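(* Assume that $R$ and $R^G$ are noetherian, let $\mathfrak{a}$ be an ideal of $R^G$, and let $M$ be an $RG$-module that is finitely generated as $R^G$-module. Assume that $M$ is Cohen-Macaulay as $R$-module and that $\sqrt{\mathfrak{a}}\supseteq\operatorname{ann}_{R^G}M^G$. Furthermore, assume that, for some $r\ge 0$, $H^q(G,M)=0$ holds for $0<q<r$ but $\mathfrak{a}x=0$ for some $0\neq x\in H^r(G,M)$. Then $$\operatorname{depth}(\mathfrak{a},M^G)=\min\{r+1,\operatorname{depth}(\mathfrak{a},M)\}.$$
   Context: $G$ is a finite group and $R$ is a commutative ring on which $G$ acts by ring automorphisms; $R^G$ is the subring of $G$-invariants. $RG$ denotes the skew group ring: the free left $R$-module with basis $G$ and multiplication $rg\cdot r'g'=r\,g(r')\,gg'$. For an $RG$-module $M$, $M^G$ is the $R^G$-module of $G$-invariants, and the group cohomology $H^*(G,M)$ is an $R^G$-module via the maps induced by the ($G$-equivariant) multiplications by elements of $R^G$ on $M$. For a commutative noetherian ring $A$, an ideal $\mathfrak{a}$ of $A$ and a finitely generated $A$-module $V$: $\operatorname{depth}(\mathfrak{a},V)=\inf\{i\mid H^i_{\mathfrak{a}}(V)\neq 0\}$, where $H^i_{\mathfrak{a}}$ is local cohomology with respect to $\mathfrak{a}$ and $\inf\emptyset=\infty$; $\operatorname{height}(\mathfrak{a},V)$ is the height of the ideal $(\mathfrak{a}+\operatorname{ann}_AV)/\operatorname{ann}_AV$ of $A/\operatorname{ann}_AV$ (the unit ideal has height $\infty$). $V$ is Cohen-Macaulay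 if $\operatorname{depth}(\mathfrak{a},V)=\operatorname{height}(\mathfrak{a},V)$ for all ideals $\mathfrak{a}$ of $A$. In the claim, the depths $\operatorname{depth}(\mathfrak{a},M^G)$ and $\operatorname{depth}(\mathfrak{a},M)$ are taken over $A=R^G$. *)

theory Defs
  imports "HOL-Algebra.Algebra" "HOL-Library.Extended_Nat"
begin

section \<open>Modules\<close>

text \<open>
  The locale \<^locale>\<open>module\<close> is restricted to commutative scalars, so left modules over a
  skew group ring need a version of their own.  As everywhere in HOL-Algebra, the fields
  \<^const>\<open>monoid.mult\<close> and \<^const>\<open>one\<close> of a module record carry no meaning.
\<close>

locale left_module = S?: ring S + M?: abelian_group M
  for S :: "('s, 'x) ring_scheme" (structure) and M :: "('s, 'm, 'z) module_scheme" (structure) +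
  assumes smult_closed:
      "\<lbrakk>a \<in> carrier S; x \<in> carrier M\<rbrakk> \<Longrightarrow> a \<odot>\<^bsub>M\<^esub> x \<in> carrier M"
    and smult_l_distr:
      "\<lbrakk>a \<in> carrier S; b \<in> carrier S; x \<in> carrier M\<rbrakk> \<Longrightarrow>
        (a \<oplus>\<^bsub>S\<^esub> b) \<odot>\<^bsub>M\<^esub> x = a \<odot>\<^bsub>M\<^esub> x \<oplus>\<^bsub>M\<^esub> b \<odot>\<^bsub>M\<^esub> x"
    and smult_r_distr:
      "\<lbrakk>a \<in> carrier S; x \<in> carrier M; y \<in> carrier M\<rbrakk> \<Longrightarrow>
        a \<odot>\<^bsub>M\<^esub> (x \<oplus>\<^bsub>M\<^esub> y) = a \<odot>\<^bsub>M\<^esub> x \<oplus>\<^bsub>M\<^esub> a \<odot>\<^bsub>M\<^esub> y"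
    and smult_assoc:
      "\<lbrakk>a \<in> carrier S; b \<in> carrier S; x \<in> carrier M\<rbrakk> \<Longrightarrow>
        (a \<otimes>\<^bsub>S\<^esub> b) \<odot>\<^bsub>M\<^esub> x = a \<odot>\<^bsub>M\<^esub> (b \<odot>\<^bsub>M\<^esub> x)"
    and smult_one:
      "x \<in> carrier M \<Longrightarrow> \<one>\<^bsub>S\<^esub> \<odot>\<^bsub>M\<^esub> x = x"

definition module_hom ::
  "('a, 'x) ring_scheme \<Rightarrow> ('a, 'b, 'y) module_scheme \<Rightarrow> ('a, 'c, 'z) module_scheme \<Rightarrow> ('b \<Rightarrow> 'c) set"
  where "module_hom A M N =
    {f \<in> hom (add_monoid M) (add_monoid N).
       \<forall>a\<in>carrier A. \<forall>x\<in>carrier M. f (a \<odot>\<^bsub>M\<^esub> x) = a \<odot>\<^bsub>N\<^esub> f x}"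

text \<open>
  The second argument is (the carrier of) a submodule.  The scalar multiple of a coset is
  \<open>a \<odot> (N + x) = N + a \<odot> x\<close>.
\<close>

definition quotient_module :: "('a, 'b, 'y) module_scheme \<Rightarrow> 'b set \<Rightarrow> ('a, 'b set) module"
  where "quotient_module M N =
    \<lparr>carrier = a_rcosets\<^bsub>M\<^esub> N, monoid.mult = undefined, one = undefined, ring.zero = N,
     add = set_add M,
     smult = (\<lambda>a Y. \<Union>y\<in>Y. N +>\<^bsub>M\<^esub> (a \<odot>\<^bsub>M\<^esub> y))\<rparr>"

definition finitely_generated_module ::
  "('a, 'x) ring_scheme \<Rightarrow> ('a, 'b, 'y) module_scheme \<Rightarrow> bool"
  where "finitely_generated_module A M \<longleftrightarrow>
    (\<exists>S. finite S \<and> S \<subseteq> carrier M \<and>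
       (\<forall>x\<in>carrier M. \<exists>c\<in>S \<rightarrow> carrier A. x = (\<Oplus>\<^bsub>M\<^esub>s\<in>S. c s \<odot>\<^bsub>M\<^esub> s)))"

definition annihilator :: "('a, 'x) ring_scheme \<Rightarrow> ('a, 'b, 'y) module_scheme \<Rightarrow> 'a set"
  where "annihilator A M = {a \<in> carrier A. \<forall>x\<in>carrier M. a \<odot>\<^bsub>M\<^esub> x = \<zero>\<^bsub>M\<^esub>}"

definition radical :: "('a, 'x) ring_scheme \<Rightarrow> 'a set \<Rightarrow> 'a set"
  where "radical A I = {a \<in> carrier A. \<exists>n::nat. a [^]\<^bsub>A\<^esub> n \<in> I}"


section \<open>Cohomology of a cochain complex of modules\<close>

text \<open>Complexes are concentrated in degrees \<open>n \<ge> 0\<close>; the incoming differential in degree 0 is zero.\<close>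

definition coboundaries :: "(nat \<Rightarrow> ('a, 'b) module) \<Rightarrow> (nat \<Rightarrow> 'b \<Rightarrow> 'b) \<Rightarrow> nat \<Rightarrow> 'b set"
  where "coboundaries C d n =
    (case n of 0 \<Rightarrow> {\<zero>\<^bsub>C 0\<^esub>} | Suc k \<Rightarrow> d k ` carrier (C k))"

definition cohomology ::
  "(nat \<Rightarrow> ('a, 'b) module) \<Rightarrow> (nat \<Rightarrow> 'b \<Rightarrow> 'b) \<Rightarrow> nat \<Rightarrow> ('a, 'b set) module"
  where "cohomology C d n =
    quotient_module ((C n)\<lparr>carrier := a_kernel (C n) (C (Suc n)) (d n)\<rparr>) (coboundaries C d n)"


section \<open>Local cohomology, depth and height\<close>

text \<open>
  The test modules \<open>N\<close> range over all \<open>A\<close>-modules on the element type \<open>'e\<close> of \<open>E\<close>.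
  As soon as \<open>'e\<close> contains a copy of \<open>A\<close> (as it does below), Baer's criterion shows that
  this is injectivity with respect to \<open>A\<close>-modules of any size.
\<close>

definition injective_module :: "('a, 'x) ring_scheme \<Rightarrow> ('a, 'e) module \<Rightarrow> bool"
  where "injective_module A E \<longleftrightarrow> module A E \<and>
    (\<forall>(N :: ('a, 'e) module) L f.
       module A N \<and> submodule L A N \<and> f \<in> module_hom A (N\<lparr>carrier := L\<rparr>) E \<longrightarrow>
       (\<exists>h\<in>module_hom A N E. \<forall>x\<in>L. h x = f x))"

definition injective_resolution ::
  "('a, 'x) ring_scheme \<Rightarrow> ('a, 'v, 'y) module_scheme \<Rightarrow> ('v \<Rightarrow> 'e) \<Rightarrow>
   (nat \<Rightarrow> ('a, 'e) module) \<Rightarrow> (nat \<Rightarrow> 'e \<Rightarrow> 'e) \<Rightarrow> bool"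
  where "injective_resolution A V \<epsilon> E d \<longleftrightarrow>
    (\<forall>n. injective_module A (E n)) \<and>
    (\<forall>n. d n \<in> module_hom A (E n) (E (Suc n))) \<and>
    \<epsilon> \<in> module_hom A V (E 0) \<and>
    inj_on \<epsilon> (carrier V) \<and>
    \<epsilon> ` carrier V = a_kernel (E 0) (E 1) (d 0) \<and>
    (\<forall>n. d n ` carrier (E n) = a_kernel (E (Suc n)) (E (Suc (Suc n))) (d (Suc n)))"

text \<open>
  The functor of \<open>\<aa>\<close>-torsion, \<open>\<Gamma>\<^sub>\<aa>(V) = {x \<in> V. \<aa>\<^sup>n x = 0 for some n}\<close>; powers of ideals
  are taken in the monoid of ideals \<^const>\<open>ideals_set\<close>.
\<close>

definition torsion_module ::
  "('a, 'x) ring_scheme \<Rightarrow> 'a set \<Rightarrow> ('a, 'v, 'y) module_scheme \<Rightarrow> ('a, 'v, 'y) module_scheme"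
  where "torsion_module A \<aa> V = V\<lparr>carrier :=
    {x \<in> carrier V. \<exists>n::nat. \<forall>a \<in> \<aa> [^]\<^bsub>ideals_set A\<^esub> n. a \<odot>\<^bsub>V\<^esub> x = \<zero>\<^bsub>V\<^esub>}\<rparr>"

text \<open>
  Local cohomology is the right derived functor of \<open>\<Gamma>\<^sub>\<aa>\<close>, computed from an arbitrarily chosen
  injective resolution (up to isomorphism the choice is irrelevant).  The element type
  \<open>('v \<times> 'a \<times> nat) set\<close> is large enough for one to exist: its cardinality \<open>\<lambda>\<close> is infinite,
  bounds that of \<open>V\<close>, and satisfies \<open>\<lambda>\<^sup>\<kappa> = \<lambda>\<close> for \<open>\<kappa> = |A|\<close>; if \<open>|W| \<le> \<lambda>\<close> and \<open>D\<close> is a divisible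
  hull of the abelian group \<open>W\<close>, then \<open>W\<close> embeds into the injective module \<open>Hom\<^sub>\<int>(A, D)\<close>, of
  cardinality at most \<open>\<lambda>\<^sup>\<kappa> = \<lambda>\<close>, and the construction can be iterated on the cokernel.
\<close>

definition chosen_injective_resolution ::
  "('a, 'x) ring_scheme \<Rightarrow> ('a, 'v, 'y) module_scheme \<Rightarrow>
   (nat \<Rightarrow> ('a, ('v \<times> 'a \<times> nat) set) module) \<times>
   (nat \<Rightarrow> ('v \<times> 'a \<times> nat) set \<Rightarrow> ('v \<times> 'a \<times> nat) set)"
  where "chosen_injective_resolution A V =
    (SOME (E, d). \<exists>\<epsilon>. injective_resolution A V \<epsilon> E d)"

definition local_cohomology ::
  "('a, 'x) ring_scheme \<Rightarrow> 'a set \<Rightarrow> ('a, 'v, 'y) module_scheme \<Rightarrow> nat \<Rightarrow>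
   ('a, ('v \<times> 'a \<times> nat) set set) module"
  where "local_cohomology A \<aa> V i =
    (case chosen_injective_resolution A V of
       (E, d) \<Rightarrow> cohomology (\<lambda>n. torsion_module A \<aa> (E n)) d i)"

definition depth ::
  "('a, 'x) ring_scheme \<Rightarrow> 'a set \<Rightarrow> ('a, 'v, 'y) module_scheme \<Rightarrow> enat"
  where "depth A \<aa> V =
    Inf {enat i | i. carrier (local_cohomology A \<aa> V i) \<noteq> {\<zero>\<^bsub>local_cohomology A \<aa> V i\<^esub>}}"

definition prime_height :: "('a, 'x) ring_scheme \<Rightarrow> 'a set \<Rightarrow> enat"
  where "prime_height B P =
    Sup {enat n | n. \<exists>p :: nat \<Rightarrow> 'a set.
      (\<forall>i\<le>n. primeideal (p i) B) \<and> (\<forall>i<n. p i \<subset> p (Suc i)) \<and> p n = P}"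

text \<open>No prime contains the unit ideal, whose height is therefore \<open>Inf {} = \<infinity>\<close>.\<close>

definition ideal_height :: "('a, 'x) ring_scheme \<Rightarrow> 'a set \<Rightarrow> enat"
  where "ideal_height B I = Inf {prime_height B P | P. primeideal P B \<and> I \<subseteq> P}"

text \<open>The height of \<open>(\<aa> + ann V) / ann V\<close> in the ring \<open>A / ann V\<close>.\<close>

definition height ::
  "('a, 'x) ring_scheme \<Rightarrow> 'a set \<Rightarrow> ('a, 'v, 'y) module_scheme \<Rightarrow> enat"
  where "height A \<aa> V =
    ideal_height (A Quot (annihilator A V))
      ((\<lambda>x. annihilator A V +>\<^bsub>A\<^esub> x) ` (\<aa> <+>\<^bsub>A\<^esub> annihilator A V))"

definition cohen_macaulay :: "('a, 'x) ring_scheme \<Rightarrow> ('a, 'v, 'y) module_scheme \<Rightarrow> bool"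
  where "cohen_macaulay A V \<longleftrightarrow> (\<forall>\<aa>. ideal \<aa> A \<longrightarrow> depth A \<aa> V = height A \<aa> V)"


section \<open>Group actions on rings and skew group rings\<close>

locale ring_action = G?: group G + R?: cring R + group_action G "carrier R" \<phi>
  for G (structure) and R (structure) and \<phi> +
  assumes ring_hom: "g \<in> carrier G \<Longrightarrow> \<phi> g \<in> ring_hom R R"

definition invariant_ring ::
  "('g, 'w) monoid_scheme \<Rightarrow> ('r, 'x) ring_scheme \<Rightarrow> ('g \<Rightarrow> 'r \<Rightarrow> 'r) \<Rightarrow> ('r, 'x) ring_scheme"
  where "invariant_ring G R \<phi> = R\<lparr>carrier := {a \<in> carrier R. \<forall>g\<in>carrier G. \<phi> g a = a}\<rparr>"

text \<open>The element \<open>a g\<close> of \<open>R G\<close>.\<close>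

definition skew_monom ::
  "('g, 'w) monoid_scheme \<Rightarrow> ('r, 'x) ring_scheme \<Rightarrow> 'r \<Rightarrow> 'g \<Rightarrow> ('g \<Rightarrow> 'r)"
  where "skew_monom G R a g = (\<lambda>x\<in>carrier G. if x = g then a else \<zero>\<^bsub>R\<^esub>)"

text \<open>
  For finite \<open>G\<close>, elements are coefficient functions on \<open>G\<close>.  The product \<open>a g \<cdot> b h = a g(b) gh\<close>
  contributes to the coefficient at \<open>x\<close> exactly when \<open>h = g\<inverse> x\<close>; see \<open>skew_monom_mult\<close> below.
\<close>

definition skew_group_ring ::
  "('g, 'w) monoid_scheme \<Rightarrow> ('r, 'x) ring_scheme \<Rightarrow> ('g \<Rightarrow> 'r \<Rightarrow> 'r) \<Rightarrow> ('g \<Rightarrow> 'r) ring"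
  where "skew_group_ring G R \<phi> =
    \<lparr>carrier = carrier G \<rightarrow>\<^sub>E carrier R,
     monoid.mult = (\<lambda>u v. \<lambda>x\<in>carrier G.
       \<Oplus>\<^bsub>R\<^esub>g\<in>carrier G. u g \<otimes>\<^bsub>R\<^esub> \<phi> g (v (inv\<^bsub>G\<^esub> g \<otimes>\<^bsub>G\<^esub> x))),
     one = skew_monom G R \<one>\<^bsub>R\<^esub> \<one>\<^bsub>G\<^esub>,
     ring.zero = (\<lambda>x\<in>carrier G. \<zero>\<^bsub>R\<^esub>),
     add = (\<lambda>u v. \<lambda>x\<in>carrier G. u x \<oplus>\<^bsub>R\<^esub> v x)\<rparr>"

text \<open>The \<open>R\<close>-module (hence \<open>R\<^sup>G\<close>-module) underlying an \<open>R G\<close>-module.\<close>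

definition underlying_module ::
  "('g, 'w) monoid_scheme \<Rightarrow> ('r, 'x) ring_scheme \<Rightarrow> ('g \<Rightarrow> 'r, 'm, 'z) module_scheme \<Rightarrow>
   ('r, 'm) module"
  where "underlying_module G R M =
    \<lparr>carrier = carrier M, monoid.mult = monoid.mult M, one = one M,
     ring.zero = ring.zero M, add = add M,
     smult = (\<lambda>a x. skew_monom G R a \<one>\<^bsub>G\<^esub> \<odot>\<^bsub>M\<^esub> x)\<rparr>"

definition module_action ::
  "('g, 'w) monoid_scheme \<Rightarrow> ('r, 'x) ring_scheme \<Rightarrow> ('g \<Rightarrow> 'r, 'm, 'z) module_scheme \<Rightarrow>
   'g \<Rightarrow> 'm \<Rightarrow> 'm"
  where "module_action G R M g x = skew_monom G R \<one>\<^bsub>R\<^esub> g \<odot>\<^bsub>M\<^esub> x"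

definition invariant_module ::
  "('g, 'w) monoid_scheme \<Rightarrow> ('r, 'x) ring_scheme \<Rightarrow> ('g \<Rightarrow> 'r, 'm, 'z) module_scheme \<Rightarrow>
   ('r, 'm) module"
  where "invariant_module G R M = (underlying_module G R M)
    \<lparr>carrier := {x \<in> carrier M. \<forall>g\<in>carrier G. module_action G R M g x = x}\<rparr>"


section \<open>Group cohomology\<close>

text \<open>
  Inhomogeneous cochains \<open>G\<^sup>n \<rightarrow> M\<close>, with \<open>G\<^sup>n\<close> the set of lists of length \<open>n\<close> over \<open>G\<close>.
\<close>

definition tuples :: "('g, 'w) monoid_scheme \<Rightarrow> nat \<Rightarrow> 'g list set"
  where "tuples G n = {gs. set gs \<subseteq> carrier G \<and> length gs = n}"

definition cochains ::
  "('g, 'w) monoid_scheme \<Rightarrow> ('r, 'x) ring_scheme \<Rightarrow> ('g \<Rightarrow> 'r, 'm, 'z) module_scheme \<Rightarrow> nat \<Rightarrow>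
   ('r, 'g list \<Rightarrow> 'm) module"
  where "cochains G R M n =
    \<lparr>carrier = tuples G n \<rightarrow>\<^sub>E carrier M, monoid.mult = undefined, one = undefined,
     ring.zero = (\<lambda>gs\<in>tuples G n. \<zero>\<^bsub>M\<^esub>),
     add = (\<lambda>f f'. \<lambda>gs\<in>tuples G n. f gs \<oplus>\<^bsub>M\<^esub> f' gs),
     smult = (\<lambda>a f. \<lambda>gs\<in>tuples G n. a \<odot>\<^bsub>underlying_module G R M\<^esub> f gs)\<rparr>"

definition alternating :: "('m, 'z) ring_scheme \<Rightarrow> nat \<Rightarrow> 'm \<Rightarrow> 'm"
  where "alternating M k x = (if even k then x else \<ominus>\<^bsub>M\<^esub> x)"

text \<open>
  \<open>(d f)(g\<^sub>1, \<dots>, g\<^sub>n\<^sub>+\<^sub>1) = g\<^sub>1 f(g\<^sub>2, \<dots>, g\<^sub>n\<^sub>+\<^sub>1)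
    + \<Sum>\<^sub>1\<^sub>\<le>\<^sub>j\<^sub>\<le>\<^sub>n (-1)\<^sup>j f(g\<^sub>1, \<dots>, g\<^sub>j g\<^sub>j\<^sub>+\<^sub>1, \<dots>, g\<^sub>n\<^sub>+\<^sub>1) + (-1)\<^sup>n\<^sup>+\<^sup>1 f(g\<^sub>1, \<dots>, g\<^sub>n)\<close>;
  list positions are counted from 0, so that \<open>i = j - 1\<close> in the sum.
\<close>

definition cochain_diff ::
  "('g, 'w) monoid_scheme \<Rightarrow> ('r, 'x) ring_scheme \<Rightarrow> ('g \<Rightarrow> 'r, 'm, 'z) module_scheme \<Rightarrow> nat \<Rightarrow>
   ('g list \<Rightarrow> 'm) \<Rightarrow> ('g list \<Rightarrow> 'm)"
  where "cochain_diff G R M n f = (\<lambda>gs\<in>tuples G (Suc n).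
      module_action G R M (hd gs) (f (tl gs))
      \<oplus>\<^bsub>M\<^esub> (\<Oplus>\<^bsub>M\<^esub>i\<in>{..<n}. alternating M (Suc i)
             (f (take i gs @ [(gs ! i) \<otimes>\<^bsub>G\<^esub> (gs ! Suc i)] @ drop (Suc (Suc i)) gs)))
      \<oplus>\<^bsub>M\<^esub> alternating M (Suc n) (f (butlast gs)))"

text \<open>\<open>H\<^sup>n(G, M)\<close>, with scalars from \<open>R\<^sup>G\<close> acting through their multiplications on \<open>M\<close>.\<close>

definition group_cohomology ::
  "('g, 'w) monoid_scheme \<Rightarrow> ('r, 'x) ring_scheme \<Rightarrow> ('g \<Rightarrow> 'r, 'm, 'z) module_scheme \<Rightarrow> nat \<Rightarrow>
   ('r, ('g list \<Rightarrow> 'm) set) module"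
  where "group_cohomology G R M n = cohomology (cochains G R M) (cochain_diff G R M) n"


section \<open>Consistency checks\<close>

lemma (in ring_action) action_closed:
  "\<lbrakk>g \<in> carrier G; a \<in> carrier R\<rbrakk> \<Longrightarrow> \<phi> g a \<in> carrier R"
  using ring_hom ring_hom_closed by metis

lemma (in ring_action) action_zero: "g \<in> carrier G \<Longrightarrow> \<phi> g \<zero>\<^bsub>R\<^esub> = \<zero>\<^bsub>R\<^esub>"
  by (rule ring_hom_zero[OF ring_hom]) (auto intro: R.ring_axioms)

lemma (in ring_action) action_one: "a \<in> carrier R \<Longrightarrow> \<phi> \<one>\<^bsub>G\<^esub> a = a"
  using id_eq_one by (metis restrict_apply')

lemma (in ring_action) skew_monom_mult:
  assumes G: "finite (carrier G)" and g: "g \<in> carrier G" and h: "h \<in> carrier G"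
    and a: "a \<in> carrier R" and b: "b \<in> carrier R"
  shows "skew_monom G R a g \<otimes>\<^bsub>skew_group_ring G R \<phi>\<^esub> skew_monom G R b h
       = skew_monom G R (a \<otimes>\<^bsub>R\<^esub> \<phi> g b) (g \<otimes>\<^bsub>G\<^esub> h)"
proof -
  have "(\<Oplus>\<^bsub>R\<^esub>k\<in>carrier G. skew_monom G R a g k \<otimes>\<^bsub>R\<^esub>
            \<phi> k (skew_monom G R b h (inv\<^bsub>G\<^esub> k \<otimes>\<^bsub>G\<^esub> x)))
      = (if x = g \<otimes>\<^bsub>G\<^esub> h then a \<otimes>\<^bsub>R\<^esub> \<phi> g b else \<zero>\<^bsub>R\<^esub>)"
    (is "?lhs = ?rhs") if x: "x \<in> carrier G" for x
  proof -
    have eq: "inv\<^bsub>G\<^esub> g \<otimes>\<^bsub>G\<^esub> x = h \<longleftrightarrow> x = g \<otimes>\<^bsub>G\<^esub> h"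
      using g h x by (metis G.inv_closed G.inv_solve_left G.m_closed)
    have "?lhs = (\<Oplus>\<^bsub>R\<^esub>k\<in>carrier G. if g = k then ?rhs else \<zero>\<^bsub>R\<^esub>)"
    proof (rule R.finsum_cong')
      fix k assume k: "k \<in> carrier G"
      then show "skew_monom G R a g k \<otimes>\<^bsub>R\<^esub> \<phi> k (skew_monom G R b h (inv\<^bsub>G\<^esub> k \<otimes>\<^bsub>G\<^esub> x))
          = (if g = k then ?rhs else \<zero>\<^bsub>R\<^esub>)"
        using a b x eq by (auto simp: skew_monom_def action_closed action_zero)
    qed (use a b g in \<open>auto simp: action_closed\<close>)
    also have "\<dots> = ?rhs"
      using R.finsum_singleton[OF g G, of "\<lambda>_. ?rhs"] a b g by (auto simp: action_closed)
    finally show ?thesis .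
  qed
  then show ?thesis
    unfolding skew_group_ring_def skew_monom_def[of G R "a \<otimes>\<^bsub>R\<^esub> \<phi> g b" "g \<otimes>\<^bsub>G\<^esub> h"]
    by (auto intro!: restrict_ext)
qed

lemma underlying_module_is_module:
  assumes act: "ring_action G R \<phi>" and G: "finite (carrier G)"
    and M: "left_module (skew_group_ring G R \<phi>) M"
  shows "module R (underlying_module G R M)"
proof -
  interpret ring_action G R \<phi> by (rule act)
  interpret M: left_module "skew_group_ring G R \<phi>" M by (rule M)
  have mem: "skew_monom G R a g \<in> carrier (skew_group_ring G R \<phi>)" if "a \<in> carrier R" for a g
    using that by (auto simp: skew_group_ring_def skew_monom_def)
  have add: "skew_monom G R (a \<oplus>\<^bsub>R\<^esub> b) \<one>\<^bsub>G\<^esub>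
      = skew_monom G R a \<one>\<^bsub>G\<^esub> \<oplus>\<^bsub>skew_group_ring G R \<phi>\<^esub> skew_monom G R b \<one>\<^bsub>G\<^esub>"
    if "a \<in> carrier R" "b \<in> carrier R" for a b
    using that by (auto simp: skew_group_ring_def skew_monom_def)
  have mult: "skew_monom G R (a \<otimes>\<^bsub>R\<^esub> b) \<one>\<^bsub>G\<^esub>
      = skew_monom G R a \<one>\<^bsub>G\<^esub> \<otimes>\<^bsub>skew_group_ring G R \<phi>\<^esub> skew_monom G R b \<one>\<^bsub>G\<^esub>"
    if "a \<in> carrier R" "b \<in> carrier R" for a b
    using skew_monom_mult[OF G G.one_closed G.one_closed that] that by (simp add: action_one)
  have one: "skew_monom G R \<one>\<^bsub>R\<^esub> \<one>\<^bsub>G\<^esub> = \<one>\<^bsub>skew_group_ring G R \<phi>\<^esub>"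
    by (simp add: skew_group_ring_def)
  have "abelian_group (underlying_module G R M)"
    by (rule abelian_groupI)
       (auto simp: underlying_module_def M.M.add.m_ac intro: M.M.l_neg bexI[OF _ M.M.a_inv_closed])
  then show ?thesis
    by (intro moduleI)
       (auto simp: R.is_cring underlying_module_def mem add mult one
         M.smult_closed M.smult_l_distr M.smult_r_distr M.smult_assoc M.smult_one)
qed

end

theory Submission
  imports Defs "HOL-Algebra.Free_Abelian_Groups"
begin

text \<open>
  Write \<open>A = R\<^sup>G\<close>. Both depths are measured by \<open>Ext\<^sub>A(A/\<aa>, -)\<close>, computed as the cohomology of
  \<open>Hom\<^sub>A(F, -)\<close> for a fixed resolution \<open>F\<close> of \<open>A/\<aa>\<close> by finitely generated free modules.

  The inhomogeneous cochains give \<open>0 \<rightarrow> M\<^sup>G \<rightarrow> C\<^sup>0 \<rightarrow> C\<^sup>1 \<rightarrow> \<dots>\<close>, whose terms are products of copies of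
  \<open>M\<close>, so that \<open>Ext\<^sup>j(A/\<aa>, C\<^sup>q)\<close> vanishes whenever \<open>Ext\<^sup>j(A/\<aa>, M)\<close> does. Since \<open>H\<^sup>q(G, M) = 0\<close> for
  \<open>0 < q < r\<close>, shifting dimensions along this sequence yields
  \<open>depth M\<^sup>G \<ge> min {r + 1, depth M}\<close>. If \<open>depth M\<^sup>G\<close> and \<open>depth M\<close> both exceeded \<open>r + 1\<close>, the same shift would
  give \<open>Hom(A/\<aa>, H\<^sup>r(G, M)) = 0\<close>, contrary to the existence of \<open>x\<close>.

  The inequality \<open>depth M\<^sup>G \<le> depth M\<close> comes from the Cohen-Macaulay property. Let \<open>P\<close> be a prime of
  \<open>R\<close> containing \<open>\<aa>R + ann\<^sub>R M\<close>, and \<open>p = P \<inter> A\<close>; the hypothesis on the radical gives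
  \<open>ann\<^sub>A M\<^sup>G \<subseteq> p\<close>. If \<open>depth M\<^sup>G \<ge> n\<close>, cutting \<open>M\<^sup>G\<close> down by nonzerodivisors produces a chain of
  primes of length \<open>n\<close> from \<open>ann\<^sub>A M\<^sup>G\<close> up to \<open>p\<close>, and it lifts along \<open>A \<subseteq> R\<close> to a chain from
  \<open>ann\<^sub>R M\<close> up to \<open>P\<close>: \<open>G\<close> acts transitively on the primes over \<open>p\<close>, and \<open>ann\<^sub>R M\<close> is stable
  under \<open>G\<close>. Hence \<open>n \<le> height(\<aa>R, M) = depth(\<aa>R, M) \<le> depth(\<aa>, M)\<close>.
\<close>

section \<open>Module homomorphisms and quotients\<close>

text \<open>\<open>depth\<close> refers to one chosen injective resolution, of which nothing is
  known beyond its being one. Everything is therefore phrased as vanishing in an initial range of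
  degrees: \<open>enat n \<le> depth A I V\<close> holds exactly if \<open>acyclic_at V j\<close>
  for all j < n (\<open>depth_ge_iff\<close>). This bridge rests on three facts: injective
  resolutions exist on the prescribed element type, Ext(A/I, V) may be computed from either
  argument, and in a complex of injectives torsion and socle become inexact in the same first
  degree.

  The inequality depth(aR, M) \<le> depth(a, M) compares Ext over two rings. Instead of mapping one
  resolution to the other, both sides are cut down by the same nonzerodivisor in a; the degree lost
  in this way is regained over A because a annihilates Ext(A/a, -). In the lifting of prime chains,
  the norm of an element, the product of its conjugates, stands in for integrality of R over A.

  Modules of cosets would change the element type at every step of these inductions, so quotients
  are built from representatives inside the type of the given module.\<close>

lemma mhomD:
  assumes "f \<in> module_hom A M N"
  shows mhom_closed: "x \<in> carrier M \<Longrightarrow> f x \<in> carrier N"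
    and mhom_add: "x \<in> carrier M \<Longrightarrow> y \<in> carrier M \<Longrightarrow> f (x \<oplus>\<^bsub>M\<^esub> y) = f x \<oplus>\<^bsub>N\<^esub> f y"
    and mhom_smult: "a \<in> carrier A \<Longrightarrow> x \<in> carrier M \<Longrightarrow> f (a \<odot>\<^bsub>M\<^esub> x) = a \<odot>\<^bsub>N\<^esub> f x"
  using assms by (auto simp: module_hom_def hom_def)

lemma mhomI:
  assumes "\<And>x. x \<in> carrier M \<Longrightarrow> f x \<in> carrier N"
    and "\<And>x y. x \<in> carrier M \<Longrightarrow> y \<in> carrier M \<Longrightarrow> f (x \<oplus>\<^bsub>M\<^esub> y) = f x \<oplus>\<^bsub>N\<^esub> f y"
    and "\<And>a x. a \<in> carrier A \<Longrightarrow> x \<in> carrier M \<Longrightarrow> f (a \<odot>\<^bsub>M\<^esub> x) = a \<odot>\<^bsub>N\<^esub> f x"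
  shows "f \<in> module_hom A M N"
  using assms by (auto simp: module_hom_def hom_def)

lemma (in module) smult_finsum_right:
  "\<lbrakk>finite I; x \<in> carrier M; c \<in> I \<rightarrow> carrier R\<rbrakk> \<Longrightarrow>
     (\<Oplus>i\<in>I. c i) \<odot>\<^bsub>M\<^esub> x = (\<Oplus>\<^bsub>M\<^esub>i\<in>I. c i \<odot>\<^bsub>M\<^esub> x)"
  by (induct set: finite) (auto simp: Pi_def smult_l_distr)

context
  fixes A (structure) and M N f
  assumes MN: "module A M" "module A N" and f: "f \<in> module_hom A M N"
begin

interpretation M: module A M by (rule MN)
interpretation N: module A N by (rule MN)

lemma mhom_zero: "f \<zero>\<^bsub>M\<^esub> = \<zero>\<^bsub>N\<^esub>"
  using mhom_smult[OF f, of "\<zero>\<^bsub>A\<^esub>" "\<zero>\<^bsub>M\<^esub>"] mhom_closed[OF f, of "\<zero>\<^bsub>M\<^esub>"] by simp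

lemma mhom_uminus:
  assumes "x \<in> carrier M" shows "f (\<ominus>\<^bsub>M\<^esub> x) = \<ominus>\<^bsub>N\<^esub> f x"
  using mhom_smult[OF f, of "\<ominus>\<one>" x] mhom_closed[OF f assms] assms
  by (simp add: M.smult_l_minus N.smult_l_minus)

lemma mhom_minus:
  assumes "x \<in> carrier M" "y \<in> carrier M" shows "f (x \<ominus>\<^bsub>M\<^esub> y) = f x \<ominus>\<^bsub>N\<^esub> f y"
  using assms by (simp add: M.M.minus_eq N.M.minus_eq mhom_add[OF f] mhom_uminus)

lemma mhom_finsum:
  assumes "finite I" "x \<in> I \<rightarrow> carrier M"
  shows "f (\<Oplus>\<^bsub>M\<^esub>i\<in>I. x i) = (\<Oplus>\<^bsub>N\<^esub>i\<in>I. f (x i))"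
  using assms
proof (induct set: finite)
  case (insert i I)
  then show ?case
    by (subst M.M.finsum_insert N.M.finsum_insert; (auto simp: Pi_def mhom_add[OF f] mhom_closed[OF f])?)+
qed (simp add: mhom_zero)

lemma submodule_kernel: "submodule {x \<in> carrier M. f x = \<zero>\<^bsub>N\<^esub>} A M"
  by (rule M.submoduleI)
     (auto simp: mhom_zero mhom_uminus mhom_add[OF f] mhom_smult[OF f])

lemma submodule_image:
  assumes L: "submodule L A M" shows "submodule (f ` L) A N"
proof (rule N.submoduleI)
  note E = M.submoduleE[OF L]
  show "f ` L \<subseteq> carrier N" using E(1) mhom_closed[OF f] by auto
  have "\<zero>\<^bsub>M\<^esub> \<in> L" using subgroup.one_closed[OF submodule.axioms(1)[OF L]] by simp
  then show "\<zero>\<^bsub>N\<^esub> \<in> f ` L" using mhom_zero by force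
  have LM: "x \<in> carrier M" if "x \<in> L" for x using that E(1) by auto
  show "\<ominus>\<^bsub>N\<^esub> a \<in> f ` L" if "a \<in> f ` L" for a
    using that E(3) by (auto simp: LM mhom_uminus[symmetric])
  show "a \<oplus>\<^bsub>N\<^esub> b \<in> f ` L" if "a \<in> f ` L" "b \<in> f ` L" for a b
    using that E(5) by (auto simp: LM mhom_add[OF f, symmetric])
  show "a \<odot>\<^bsub>N\<^esub> b \<in> f ` L" if "a \<in> carrier A" "b \<in> f ` L" for a b
    using that E(4) by (auto simp: LM mhom_smult[OF f, symmetric])
qed

end

lemma (in abelian_group) diff_rules:
  assumes "x \<in> carrier G" "y \<in> carrier G" "z \<in> carrier G"
  shows diff_add_diff: "(x \<ominus> y) \<oplus> (y \<ominus> z) = x \<ominus> z"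
    and diff_diff_right: "(x \<ominus> z) \<ominus> (y \<ominus> z) = x \<ominus> y"
    and diff_diff_left: "(x \<ominus> y) \<ominus> (x \<ominus> z) = z \<ominus> y"
proof -
  have neg: "\<ominus> (u \<ominus> v) = v \<ominus> u" if "u \<in> carrier G" "v \<in> carrier G" for u v
    using that by (simp add: minus_eq minus_add a_comm)
  have 1: "(x \<ominus> y) \<oplus> (y \<ominus> z) = x \<ominus> z" if "x \<in> carrier G" "y \<in> carrier G" "z \<in> carrier G" for x y z
    using that by (simp add: minus_eq a_assoc r_neg1)
  show "(x \<ominus> z) \<ominus> (y \<ominus> z) = x \<ominus> y"
    using assms 1[of x z y] neg[of y z] by (simp add: minus_eq[of "x \<ominus> z"])
  show "(x \<ominus> y) \<ominus> (x \<ominus> z) = z \<ominus> y"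
    using assms 1[of z x y] neg[of x z] by (simp add: minus_eq[of "x \<ominus> y"] a_comm)
  show "(x \<ominus> y) \<oplus> (y \<ominus> z) = x \<ominus> z" using 1 assms .
qed

lemma (in abelian_group) diff_simps:
  assumes "x \<in> carrier G"
  shows diff_self: "x \<ominus> x = \<zero>" and diff_zero: "x \<ominus> \<zero> = x"
  using assms minus_equality[of \<zero> \<zero>] by (simp_all add: minus_eq r_neg)

lemma (in abelian_group) diff_simps2:
  assumes "x \<in> carrier G" "y \<in> carrier G"
  shows diff_eq_zero: "x \<ominus> y = \<zero> \<longleftrightarrow> x = y"
    and add_diff: "y \<oplus> (x \<ominus> y) = x" and diff_add: "(x \<ominus> y) \<oplus> y = x"
  using assms minus_equality[of x "\<ominus> y"] minus_minus[of y]
  by (auto simp: minus_eq r_neg a_assoc l_neg a_lcomm[of y] r_neg1)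

lemma a_kernel_eq: "a_kernel M N f = {x \<in> carrier M. f x = \<zero>\<^bsub>N\<^esub>}"
  by (simp add: a_kernel_def kernel_def)

lemma (in module) submodule_zero_mem: "submodule L R M \<Longrightarrow> \<zero>\<^bsub>M\<^esub> \<in> L"
  using subgroup.one_closed[OF submodule.axioms(1)] by force

lemma (in module) submodule_minus_mem:
  "submodule L R M \<Longrightarrow> x \<in> L \<Longrightarrow> y \<in> L \<Longrightarrow> x \<ominus>\<^bsub>M\<^esub> y \<in> L"
  by (simp add: M.minus_eq submoduleE)

lemma (in module) submodule_finsum_mem:
  assumes "submodule L R M" "finite I" "x \<in> I \<rightarrow> L"
  shows "(\<Oplus>\<^bsub>M\<^esub>i\<in>I. x i) \<in> L"
  using assms(2,3)
proof (induct set: finite)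
  case (insert i I)
  then show ?case
    using submoduleE(1,5)[OF assms(1)] by (subst M.finsum_insert) (auto simp: Pi_def)
qed (simp add: submodule_zero_mem[OF assms(1)])

lemma mhom_compose:
  "f \<in> module_hom A L M \<Longrightarrow> g \<in> module_hom A M N \<Longrightarrow> (\<lambda>x. g (f x)) \<in> module_hom A L N"
  by (rule mhomI) (simp_all add: mhom_closed mhom_add mhom_smult)

text \<open>\<open>injective_module\<close> tests only modules on the element type of the injective
  module itself. Free modules, \<open>V\<close> and the coinduced module must therefore be copied
  onto a prescribed type before they can be used together.\<close>

lemma module_transport:
  fixes M :: "('a, 'b, 'z) module_scheme" and h :: "'b \<Rightarrow> 'c"
  assumes M: "module A M" and h: "inj_on h (carrier M)"
  obtains N :: "('a, 'c) module" where "module A N" "carrier N = h ` carrier M" "h \<in> module_hom A M N"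
proof -
  interpret module A M by (rule M)
  define k where "k = the_inv_into (carrier M) h"
  have k: "k (h x) = x" if "x \<in> carrier M" for x
    unfolding k_def using that h by (rule the_inv_into_f_f[rotated])
  define N :: "('a, 'c) module" where "N = \<lparr>carrier = h ` carrier M, monoid.mult = undefined, one = undefined,
    ring.zero = h \<zero>\<^bsub>M\<^esub>, add = (\<lambda>x y. h (k x \<oplus>\<^bsub>M\<^esub> k y)), smult = (\<lambda>a x. h (a \<odot>\<^bsub>M\<^esub> k x))\<rparr>"
  have "abelian_group N"
    by (rule abelian_groupI) (auto simp: N_def k M.a_ac M.r_neg intro!: bexI[of _ "\<ominus>\<^bsub>M\<^esub> _"])
  then have "module A N"
    by (intro moduleI R.is_cring)
       (auto simp: N_def k smult_l_distr smult_r_distr smult_assoc1)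
  moreover have "h \<in> module_hom A M N"
    by (rule mhomI) (auto simp: N_def k)
  moreover have "carrier N = h ` carrier M" by (simp add: N_def)
  ultimately show thesis using that by blast
qed

text \<open>The carrier consists of one representative per coset, so the quotient keeps the element
  type of \<open>M\<close>. This allows inductions that replace a module by a quotient of
  it.\<close>

lemma quotient_exists:
  fixes M :: "('a, 'b, 'z) module_scheme"
  assumes M: "module A M" and L: "submodule L A M"
  obtains N :: "('a, 'b) module" and q where "module A N" "q \<in> module_hom A M N"
    "q ` carrier M = carrier N" "\<And>x. x \<in> carrier M \<Longrightarrow> q x = \<zero>\<^bsub>N\<^esub> \<longleftrightarrow> x \<in> L"
proof -
  interpret module A M by (rule M)
  note E = submoduleE[OF L]
  have L0: "\<zero>\<^bsub>M\<^esub> \<in> L" by (rule submodule_zero_mem[OF L])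
  have LM: "x \<in> carrier M" if "x \<in> L" for x using that E(1) by auto
  \<comment> \<open>The condition on \<open>y\<close> depends only on the coset of \<open>x\<close>,
    so the choice is constant on cosets and \<open>q\<close> is idempotent.\<close>
  define q where "q x = (SOME y. y \<in> carrier M \<and> y \<ominus>\<^bsub>M\<^esub> x \<in> L)" for x
  have q: "q x \<in> carrier M \<and> q x \<ominus>\<^bsub>M\<^esub> x \<in> L" if "x \<in> carrier M" for x
    unfolding q_def by (rule someI[of _ x]) (use that L0 in \<open>simp add: M.diff_self\<close>)
  then have qc: "q x \<in> carrier M" if "x \<in> carrier M" for x using that by blast
  have eqI: "q x = q y" if x: "x \<in> carrier M" and y: "y \<in> carrier M" and xy: "x \<ominus>\<^bsub>M\<^esub> y \<in> L" for x y
  proof -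
    have "z \<ominus>\<^bsub>M\<^esub> x \<in> L \<longleftrightarrow> z \<ominus>\<^bsub>M\<^esub> y \<in> L" if z: "z \<in> carrier M" for z
    proof -
      have "z \<ominus>\<^bsub>M\<^esub> y = (z \<ominus>\<^bsub>M\<^esub> x) \<oplus>\<^bsub>M\<^esub> (x \<ominus>\<^bsub>M\<^esub> y)" "z \<ominus>\<^bsub>M\<^esub> x = (z \<ominus>\<^bsub>M\<^esub> y) \<ominus>\<^bsub>M\<^esub> (x \<ominus>\<^bsub>M\<^esub> y)"
        using x y z by (simp_all add: M.diff_add_diff M.diff_diff_right)
      then show ?thesis using E(5) xy submodule_minus_mem[OF L] by metis
    qed
    then show ?thesis unfolding q_def by (metis (no_types, lifting))
  qed
  have eqD: "x \<ominus>\<^bsub>M\<^esub> y \<in> L" if x: "x \<in> carrier M" and y: "y \<in> carrier M" and xy: "q x = q y" for x y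
  proof -
    have "x \<ominus>\<^bsub>M\<^esub> y = (q x \<ominus>\<^bsub>M\<^esub> y) \<ominus>\<^bsub>M\<^esub> (q x \<ominus>\<^bsub>M\<^esub> x)"
      using x y q[OF x] by (simp add: M.diff_diff_left)
    then show ?thesis using q[OF x] q[OF y] xy submodule_minus_mem[OF L] by metis
  qed
  have qq: "q (q x) = q x" if "x \<in> carrier M" for x
    using that q by (intro eqI) auto
  have qadd: "q (q x \<oplus>\<^bsub>M\<^esub> q y) = q (x \<oplus>\<^bsub>M\<^esub> y)" if x: "x \<in> carrier M" and y: "y \<in> carrier M" for x y
  proof (rule eqI)
    have "q x \<oplus>\<^bsub>M\<^esub> q y \<ominus>\<^bsub>M\<^esub> (x \<oplus>\<^bsub>M\<^esub> y) = (q x \<ominus>\<^bsub>M\<^esub> x) \<oplus>\<^bsub>M\<^esub> (q y \<ominus>\<^bsub>M\<^esub> y)"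
      using x y q[OF x] q[OF y] by (simp add: M.minus_eq M.minus_add M.a_ac)
    then show "q x \<oplus>\<^bsub>M\<^esub> q y \<ominus>\<^bsub>M\<^esub> (x \<oplus>\<^bsub>M\<^esub> y) \<in> L" using x y q[OF x] q[OF y] E(5) by simp
  qed (use x y q in auto)
  have qsm: "q (a \<odot>\<^bsub>M\<^esub> q x) = q (a \<odot>\<^bsub>M\<^esub> x)" if a: "a \<in> carrier A" and x: "x \<in> carrier M" for a x
  proof (rule eqI)
    have "a \<odot>\<^bsub>M\<^esub> q x \<ominus>\<^bsub>M\<^esub> a \<odot>\<^bsub>M\<^esub> x = a \<odot>\<^bsub>M\<^esub> (q x \<ominus>\<^bsub>M\<^esub> x)"
      using a x q[OF x] by (simp add: M.minus_eq smult_r_distr smult_r_minus)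
    then show "a \<odot>\<^bsub>M\<^esub> q x \<ominus>\<^bsub>M\<^esub> a \<odot>\<^bsub>M\<^esub> x \<in> L" using a q[OF x] E(4) by simp
  qed (use a x q in auto)
  define N :: "('a, 'b) module" where "N = \<lparr>carrier = q ` carrier M, monoid.mult = undefined, one = undefined,
    ring.zero = q \<zero>\<^bsub>M\<^esub>, add = (\<lambda>x y. q (x \<oplus>\<^bsub>M\<^esub> y)), smult = (\<lambda>a x. q (a \<odot>\<^bsub>M\<^esub> x))\<rparr>"
  have q1: "q (q x \<oplus>\<^bsub>M\<^esub> y) = q (x \<oplus>\<^bsub>M\<^esub> y)" "q (y \<oplus>\<^bsub>M\<^esub> q x) = q (y \<oplus>\<^bsub>M\<^esub> x)"
    if "x \<in> carrier M" "y \<in> carrier M" for x y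
    using that qadd[of "q x" y] qadd[of x y] qadd[of y "q x"] qadd[of y x] q[of x] q[of y] qq[of x]
    by simp_all
  have "abelian_group N"
  proof (rule abelian_groupI)
    show "x \<oplus>\<^bsub>N\<^esub> y \<oplus>\<^bsub>N\<^esub> z = x \<oplus>\<^bsub>N\<^esub> (y \<oplus>\<^bsub>N\<^esub> z)"
      if "x \<in> carrier N" "y \<in> carrier N" "z \<in> carrier N" for x y z
      using that by (auto simp: N_def q1 qc M.a_assoc)
    show "x \<oplus>\<^bsub>N\<^esub> y = y \<oplus>\<^bsub>N\<^esub> x" if "x \<in> carrier N" "y \<in> carrier N" for x y
      using that by (auto simp: N_def q1 qc M.a_comm)
    show "\<exists>y\<in>carrier N. y \<oplus>\<^bsub>N\<^esub> x = \<zero>\<^bsub>N\<^esub>" if x: "x \<in> carrier N" for x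
    proof -
      obtain m where m: "m \<in> carrier M" "x = q m" using x by (auto simp: N_def)
      then have "q (q (\<ominus>\<^bsub>M\<^esub> m) \<oplus>\<^bsub>M\<^esub> x) = q \<zero>\<^bsub>M\<^esub>" by (simp add: qadd M.l_neg)
      then show ?thesis using m by (auto simp: N_def)
    qed
  qed (auto simp: N_def q1 qc qq)
  moreover have "q (a \<odot>\<^bsub>M\<^esub> q x \<oplus>\<^bsub>M\<^esub> b \<odot>\<^bsub>M\<^esub> q x) = q (a \<odot>\<^bsub>M\<^esub> x \<oplus>\<^bsub>M\<^esub> b \<odot>\<^bsub>M\<^esub> x)"
    "q (a \<odot>\<^bsub>M\<^esub> (b \<odot>\<^bsub>M\<^esub> q x)) = q (a \<odot>\<^bsub>M\<^esub> (b \<odot>\<^bsub>M\<^esub> x))"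
    if "a \<in> carrier A" "b \<in> carrier A" "x \<in> carrier M" for a b x
    using that qc qadd[of "a \<odot>\<^bsub>M\<^esub> q x" "b \<odot>\<^bsub>M\<^esub> q x"] qadd[of "a \<odot>\<^bsub>M\<^esub> x" "b \<odot>\<^bsub>M\<^esub> x"]
      qsm[of a x] qsm[of b x] qsm[of a "b \<odot>\<^bsub>M\<^esub> q x"] qsm[of a "b \<odot>\<^bsub>M\<^esub> x"] by simp_all
  ultimately have "module A N"
    by (intro moduleI R.is_cring)
       (auto simp: N_def q1 qc qq qsm smult_l_distr smult_r_distr smult_assoc1)
  moreover have "q \<in> module_hom A M N"
    by (rule mhomI) (auto simp: N_def qsm q1 qc)
  moreover have "q x = \<zero>\<^bsub>N\<^esub> \<longleftrightarrow> x \<in> L" if "x \<in> carrier M" for x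
    using that eqI[of x "\<zero>\<^bsub>M\<^esub>"] eqD[of x "\<zero>\<^bsub>M\<^esub>"] by (auto simp: N_def M.diff_zero)
  moreover have "q ` carrier M = carrier N" by (simp add: N_def)
  ultimately show thesis using that by blast
qed

definition short_exact ::
  "('a, 'x) ring_scheme \<Rightarrow> ('a, 'u, 'y1) module_scheme \<Rightarrow> ('a, 'v, 'y2) module_scheme \<Rightarrow>
   ('a, 'w, 'y3) module_scheme \<Rightarrow> ('u \<Rightarrow> 'v) \<Rightarrow> ('v \<Rightarrow> 'w) \<Rightarrow> bool"
  where "short_exact A U V W f g \<longleftrightarrow>
    module A U \<and> module A V \<and> module A W \<and> f \<in> module_hom A U V \<and> g \<in> module_hom A V W \<and>
    inj_on f (carrier U) \<and> g ` carrier V = carrier W \<and>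
    (\<forall>v\<in>carrier V. g v = \<zero>\<^bsub>W\<^esub> \<longleftrightarrow> v \<in> f ` carrier U)"

lemma (in module) submodule_short_exact:
  assumes L: "submodule L R M"
  obtains N :: "('a, 'c) module" and q where "short_exact R (M\<lparr>carrier := L\<rparr>) M N (\<lambda>x. x) q"
proof -
  obtain N :: "('a, 'c) module" and q where *: "module R N" "q \<in> module_hom R M N"
    "q ` carrier M = carrier N" "\<And>x. x \<in> carrier M \<Longrightarrow> q x = \<zero>\<^bsub>N\<^esub> \<longleftrightarrow> x \<in> L"
    using quotient_exists[OF module_axioms L] by metis
  have "(\<lambda>x. x) \<in> module_hom R (M\<lparr>carrier := L\<rparr>) M"
    using submoduleE(1)[OF L] by (intro mhomI) auto
  then show thesis
    using * submodule.submodule_is_module[OF L module_axioms] module_axioms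
    by (intro that[of N q]) (auto simp: short_exact_def)
qed

section \<open>Complexes of matrices\<close>

lemma (in abelian_monoid) finsum_swap:
  assumes "finite I" "finite J" "\<And>i j. i \<in> I \<Longrightarrow> j \<in> J \<Longrightarrow> x i j \<in> carrier G"
  shows "(\<Oplus>i\<in>I. \<Oplus>j\<in>J. x i j) = (\<Oplus>j\<in>J. \<Oplus>i\<in>I. x i j)"
  using assms(1,3)
proof (induct set: finite)
  case (insert i I)
  have "(\<Oplus>j\<in>J. \<Oplus>i\<in>insert i I. x i j) = (\<Oplus>j\<in>J. x i j \<oplus> (\<Oplus>i\<in>I. x i j))"
    using insert by (intro finsum_cong') (auto simp: Pi_def)
  also have "\<dots> = (\<Oplus>j\<in>J. x i j) \<oplus> (\<Oplus>j\<in>J. \<Oplus>i\<in>I. x i j)"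
    using insert by (intro finsum_addf) (auto simp: Pi_def)
  finally show ?case using insert by (simp add: Pi_def)
qed simp

text \<open>
  \<open>D j\<close> is the matrix of \<open>A\<^bsup>m (j + 1)\<^esup> \<rightarrow> A\<^bsup>m j\<^esup>\<close> in a complex \<open>F\<close> of free modules. An element of
  \<open>Hom(F\<^sub>j, V) = V\<^bsup>m j\<^esup>\<close> is a function on \<open>nat\<close> of which only the values below \<open>m j\<close> matter.
\<close>

locale matrix_complex = cring A for A (structure) +
  fixes m :: "nat \<Rightarrow> nat" and D :: "nat \<Rightarrow> nat \<Rightarrow> nat \<Rightarrow> 'a"
  assumes D_closed [simp]: "D j k l \<in> carrier A"
    and D_comp: "\<lbrakk>k < m (Suc (Suc j)); l < m j\<rbrakk> \<Longrightarrow>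
      (\<Oplus>t\<in>{..<m (Suc j)}. D (Suc j) k t \<otimes> D j t l) = \<zero>"
begin

definition diff :: "('a, 'v, 'y) module_scheme \<Rightarrow> nat \<Rightarrow> (nat \<Rightarrow> 'v) \<Rightarrow> nat \<Rightarrow> 'v"
  where "diff V j v k = (\<Oplus>\<^bsub>V\<^esub>l\<in>{..<m j}. D j k l \<odot>\<^bsub>V\<^esub> v l)"

definition cocycle :: "('a, 'v, 'y) module_scheme \<Rightarrow> nat \<Rightarrow> (nat \<Rightarrow> 'v) \<Rightarrow> bool"
  where "cocycle V j v \<longleftrightarrow> v \<in> {..<m j} \<rightarrow> carrier V \<and> (\<forall>k<m (Suc j). diff V j v k = \<zero>\<^bsub>V\<^esub>)"

definition coboundary :: "('a, 'v, 'y) module_scheme \<Rightarrow> nat \<Rightarrow> (nat \<Rightarrow> 'v) \<Rightarrow> bool"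
  where "coboundary V j v \<longleftrightarrow> (case j of 0 \<Rightarrow> \<forall>k<m 0. v k = \<zero>\<^bsub>V\<^esub>
    | Suc i \<Rightarrow> \<exists>u\<in>{..<m i} \<rightarrow> carrier V. \<forall>k<m (Suc i). v k = diff V i u k)"

text \<open>Vanishing of the cohomology of Hom(F, V) in degree \<open>j\<close>, that is Ext^j(A/I,
  V) = 0 once F resolves A/I. Depth sees only vanishing, so the cohomology modules are never
  formed.\<close>

definition acyclic_at :: "('a, 'v, 'y) module_scheme \<Rightarrow> nat \<Rightarrow> bool"
  where "acyclic_at V j \<longleftrightarrow> (\<forall>v. cocycle V j v \<longrightarrow> coboundary V j v)"

lemma diff_cong: "(\<And>l. l < m j \<Longrightarrow> v l = w l) \<Longrightarrow> module A V \<Longrightarrow> w \<in> {..<m j} \<rightarrow> carrier V \<Longrightarrow>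
    diff V j v k = diff V j w k"
proof -
  assume *: "\<And>l. l < m j \<Longrightarrow> v l = w l" "module A V" "w \<in> {..<m j} \<rightarrow> carrier V"
  interpret V: module A V by fact
  show ?thesis unfolding diff_def by (rule V.M.finsum_cong') (use * in \<open>auto simp: Pi_def\<close>)
qed

context
  fixes V :: "('a, 'v, 'y) module_scheme"
  assumes V: "module A V"
begin

interpretation V: module A V by (rule V)

lemma diff_closed: "v \<in> {..<m j} \<rightarrow> carrier V \<Longrightarrow> diff V j v k \<in> carrier V"
  unfolding diff_def by (rule V.M.finsum_closed) auto

lemma diff_add: "\<lbrakk>v \<in> {..<m j} \<rightarrow> carrier V; w \<in> {..<m j} \<rightarrow> carrier V\<rbrakk> \<Longrightarrow>
    diff V j (\<lambda>k. v k \<oplus>\<^bsub>V\<^esub> w k) k = diff V j v k \<oplus>\<^bsub>V\<^esub> diff V j w k"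
  unfolding diff_def
  by (subst V.M.finsum_addf[symmetric]; (intro V.M.finsum_cong')?) (auto simp: V.smult_r_distr Pi_def)

lemma diff_smult: "\<lbrakk>v \<in> {..<m j} \<rightarrow> carrier V; a \<in> carrier A\<rbrakk> \<Longrightarrow>
    diff V j (\<lambda>k. a \<odot>\<^bsub>V\<^esub> v k) k = a \<odot>\<^bsub>V\<^esub> diff V j v k"
  unfolding diff_def
  by (subst V.finsum_smult_ldistr)
     (auto simp: V.smult_assoc1[symmetric] m_comm Pi_def intro!: V.M.finsum_cong')

lemma diff_uminus: "v \<in> {..<m j} \<rightarrow> carrier V \<Longrightarrow>
    diff V j (\<lambda>k. \<ominus>\<^bsub>V\<^esub> v k) k = \<ominus>\<^bsub>V\<^esub> diff V j v k"
proof -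
  assume v: "v \<in> {..<m j} \<rightarrow> carrier V"
  have "diff V j (\<lambda>k. \<ominus>\<^bsub>V\<^esub> v k) k = diff V j (\<lambda>k. (\<ominus>\<one>) \<odot>\<^bsub>V\<^esub> v k) k"
    using v by (intro diff_cong V) (auto simp: V.smult_l_minus Pi_def)
  then show ?thesis using v by (simp add: diff_smult V.smult_l_minus diff_closed)
qed

lemma diff_minus: "\<lbrakk>v \<in> {..<m j} \<rightarrow> carrier V; w \<in> {..<m j} \<rightarrow> carrier V\<rbrakk> \<Longrightarrow>
    diff V j (\<lambda>k. v k \<ominus>\<^bsub>V\<^esub> w k) k = diff V j v k \<ominus>\<^bsub>V\<^esub> diff V j w k"
  unfolding V.M.minus_eq by (subst diff_add) (auto simp: diff_uminus)

lemma diff_diff: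
  assumes v: "v \<in> {..<m j} \<rightarrow> carrier V" and k: "k < m (Suc (Suc j))"
  shows "diff V (Suc j) (diff V j v) k = \<zero>\<^bsub>V\<^esub>"
proof -
  have "diff V (Suc j) (diff V j v) k
      = (\<Oplus>\<^bsub>V\<^esub>t\<in>{..<m (Suc j)}. \<Oplus>\<^bsub>V\<^esub>l\<in>{..<m j}. (D (Suc j) k t \<otimes> D j t l) \<odot>\<^bsub>V\<^esub> v l)"
    unfolding diff_def
    by (intro V.M.finsum_cong' refl)
       (use v in \<open>auto simp: V.finsum_smult_ldistr V.smult_assoc1 Pi_def intro!: V.M.finsum_cong'\<close>)
  also have "\<dots> = (\<Oplus>\<^bsub>V\<^esub>l\<in>{..<m j}. \<Oplus>\<^bsub>V\<^esub>t\<in>{..<m (Suc j)}. (D (Suc j) k t \<otimes> D j t l) \<odot>\<^bsub>V\<^esub> v l)"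
    using v by (intro V.M.finsum_swap) (auto simp: Pi_def)
  also have "\<dots> = (\<Oplus>\<^bsub>V\<^esub>l\<in>{..<m j}. \<zero>\<^bsub>V\<^esub>)"
    using v k by (intro V.M.finsum_cong') (auto simp: Pi_def V.smult_finsum_right[symmetric] D_comp)
  finally show ?thesis by simp
qed

end

lemma diff_hom:
  assumes "module A V" "module A W" "f \<in> module_hom A V W" "v \<in> {..<m j} \<rightarrow> carrier V"
  shows "f (diff V j v k) = diff W j (\<lambda>l. f (v l)) k"
proof -
  interpret V: module A V by fact
  interpret W: module A W by fact
  show ?thesis unfolding diff_def
    by (subst mhom_finsum[OF assms(1-3)])
       (use assms(4) in \<open>auto simp: mhom_smult[OF assms(3)] mhom_closed[OF assms(3)] Pi_def intro!: W.M.finsum_cong'\<close>)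
qed

context
  fixes U :: "('a, 'u, 'y1) module_scheme" and V :: "('a, 'v, 'y2) module_scheme"
    and W :: "('a, 'w, 'y3) module_scheme" and f g
  assumes ex: "short_exact A U V W f g"
begin

interpretation U: module A U using ex by (simp add: short_exact_def)
interpretation V: module A V using ex by (simp add: short_exact_def)
interpretation W: module A W using ex by (simp add: short_exact_def)

lemma short_exact_hom: "f \<in> module_hom A U V" "g \<in> module_hom A V W"
  using ex by (simp_all add: short_exact_def)

lemma short_exact_surj: "g ` carrier V = carrier W"
  using ex by (simp add: short_exact_def)

lemma short_exact_kernel: "v \<in> carrier V \<Longrightarrow> g v = \<zero>\<^bsub>W\<^esub> \<Longrightarrow> v \<in> f ` carrier U"
  using ex unfolding short_exact_def by blast

lemma short_exact_inj: "x \<in> carrier U \<Longrightarrow> y \<in> carrier U \<Longrightarrow> f x = f y \<longleftrightarrow> x = y"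
  using ex by (auto simp: short_exact_def inj_on_def)

lemma short_exact_comp: "x \<in> carrier U \<Longrightarrow> g (f x) = \<zero>\<^bsub>W\<^esub>"
  using ex mhom_closed[OF short_exact_hom(1)] by (auto simp: short_exact_def)

lemmas closed = mhom_closed[OF short_exact_hom(1)] mhom_closed[OF short_exact_hom(2)]

lemma lift_surj:
  fixes n :: nat
  assumes "w \<in> {..<n} \<rightarrow> carrier W"
  obtains v where "v \<in> {..<n} \<rightarrow> carrier V" "\<And>k. k < n \<Longrightarrow> g (v k) = w k"
proof -
  have "\<exists>x. x \<in> carrier V \<and> g x = w k" if "k < n" for k
  proof -
    have "w k \<in> g ` carrier V" using assms that unfolding short_exact_surj by auto
    then obtain x where "w k = g x" "x \<in> carrier V" by (rule imageE)
    then show ?thesis by (intro exI[of _ x]) simp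
  qed
  then have "\<forall>k\<in>{..<n}. \<exists>x. x \<in> carrier V \<and> g x = w k" by blast
  from bchoice[OF this] obtain v where "\<forall>k\<in>{..<n}. v k \<in> carrier V \<and> g (v k) = w k" ..
  then show thesis by (intro that[of v]) blast+
qed

lemma lift_inj:
  fixes n :: nat
  assumes "v \<in> {..<n} \<rightarrow> carrier V" "\<And>k. k < n \<Longrightarrow> g (v k) = \<zero>\<^bsub>W\<^esub>"
  obtains u where "u \<in> {..<n} \<rightarrow> carrier U" "\<And>k. k < n \<Longrightarrow> f (u k) = v k"
proof -
  have "\<exists>x. x \<in> carrier U \<and> f x = v k" if "k < n" for k
  proof -
    have "v k \<in> f ` carrier U" using assms that by (intro short_exact_kernel) auto
    then obtain x where "v k = f x" "x \<in> carrier U" by (rule imageE)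
    then show ?thesis by (intro exI[of _ x]) simp
  qed
  then have "\<forall>k\<in>{..<n}. \<exists>x. x \<in> carrier U \<and> f x = v k" by blast
  from bchoice[OF this] obtain u where "\<forall>k\<in>{..<n}. u k \<in> carrier U \<and> f (u k) = v k" ..
  then show thesis by (intro that[of u]) blast+
qed

text \<open>The piece H^j(V) \<rightarrow> H^j(W) \<rightarrow> H^(j+1)(U) of the long exact
  sequence, available because Hom(F_j, -) is a finite power and so preserves the short exact
  sequence.\<close>

lemma acyclic_at_right:
  assumes V: "acyclic_at V j" and U: "acyclic_at U (Suc j)"
  shows "acyclic_at W j"
  unfolding acyclic_at_def
proof (intro allI impI)
  fix w assume w: "cocycle W j w"
  note mods = V.module_axioms W.module_axioms U.module_axioms
  obtain v where v: "v \<in> {..<m j} \<rightarrow> carrier V" "\<And>k. k < m j \<Longrightarrow> g (v k) = w k"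
    using lift_surj w unfolding cocycle_def by metis
  have dv: "diff V j v k \<in> carrier V" for k by (rule diff_closed[OF mods(1) v(1)])
  have gdv: "g (diff V j v k) = \<zero>\<^bsub>W\<^esub>" if "k < m (Suc j)" for k
  proof -
    have "g (diff V j v k) = diff W j w k"
      unfolding diff_hom[OF mods(1,2) short_exact_hom(2) v(1)]
      by (rule diff_cong) (use v w mods in \<open>auto simp: cocycle_def\<close>)
    then show ?thesis using w that by (simp add: cocycle_def)
  qed
  obtain u where u: "u \<in> {..<m (Suc j)} \<rightarrow> carrier U" "\<And>k. k < m (Suc j) \<Longrightarrow> f (u k) = diff V j v k"
    using lift_inj[of "diff V j v" "m (Suc j)"] gdv dv by auto
  have "cocycle U (Suc j) u"
    unfolding cocycle_def
  proof (intro conjI allI impI u)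
    fix k assume k: "k < m (Suc (Suc j))"
    have "f (diff U (Suc j) u k) = diff V (Suc j) (diff V j v) k"
      unfolding diff_hom[OF mods(3,1) short_exact_hom(1) u(1)]
      by (rule diff_cong) (use u dv mods in auto)
    then have "f (diff U (Suc j) u k) = f \<zero>\<^bsub>U\<^esub>"
      by (simp add: diff_diff[OF mods(1) v(1) k] mhom_zero[OF mods(3,1) short_exact_hom(1)])
    then show "diff U (Suc j) u k = \<zero>\<^bsub>U\<^esub>"
      using short_exact_inj diff_closed[OF mods(3) u(1)] by simp
  qed
  then obtain u' where u': "u' \<in> {..<m j} \<rightarrow> carrier U" "\<And>k. k < m (Suc j) \<Longrightarrow> u k = diff U j u' k"
    using U unfolding acyclic_at_def coboundary_def by force
  have fu': "(\<lambda>k. f (u' k)) \<in> {..<m j} \<rightarrow> carrier V" using u' closed by auto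
  \<comment> \<open>The differential of the lift \<open>v\<close> comes from U and has the primitive
    \<open>u'\<close> there; subtracting it makes \<open>v\<close> a cocycle and does not change its
    image under \<open>g\<close>.\<close>
  define v' where "v' = (\<lambda>k. v k \<ominus>\<^bsub>V\<^esub> f (u' k))"
  have v': "v' \<in> {..<m j} \<rightarrow> carrier V" using v fu' by (auto simp: v'_def)
  have gv': "g (v' k) = w k" if "k < m j" for k
  proof -
    have "v k \<in> carrier V" "u' k \<in> carrier U" using v u' that by auto
    then show ?thesis using v(2)[OF that] closed(2)[of "v k"]
      by (simp add: v'_def mhom_minus[OF mods(1,2) short_exact_hom(2)] closed short_exact_comp W.M.diff_zero)
  qed
  have "cocycle V j v'"
    unfolding cocycle_def
  proof (intro conjI allI impI v')
    fix k assume k: "k < m (Suc j)"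
    have "diff V j v' k = diff V j v k \<ominus>\<^bsub>V\<^esub> f (diff U j u' k)"
      unfolding v'_def diff_minus[OF mods(1) v(1) fu'] diff_hom[OF mods(3,1) short_exact_hom(1) u'(1)] ..
    then show "diff V j v' k = \<zero>\<^bsub>V\<^esub>"
      using u(2)[OF k] u'(2)[OF k] dv[of k] by (simp add: V.M.diff_self)
  qed
  then have cob: "coboundary V j v'" using V by (simp add: acyclic_at_def)
  show "coboundary W j w"
  proof (cases j)
    case 0
    then show ?thesis
      using cob gv' mhom_zero[OF mods(1,2) short_exact_hom(2)] by (force simp: coboundary_def)
  next
    case (Suc i)
    then obtain x where x: "x \<in> {..<m i} \<rightarrow> carrier V" "\<And>k. k < m j \<Longrightarrow> v' k = diff V i x k"
      using cob by (auto simp: coboundary_def)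
    have "w k = diff W i (\<lambda>l. g (x l)) k" if "k < m j" for k
      using gv'[OF that] x(2)[OF that] diff_hom[OF mods(1,2) short_exact_hom(2) x(1)] by simp
    moreover have "(\<lambda>l. g (x l)) \<in> {..<m i} \<rightarrow> carrier W" using x closed by auto
    ultimately show ?thesis unfolding Suc coboundary_def by auto
  qed
qed

text \<open>The relation between \<open>u\<close> and \<open>v\<close> says that the connecting
  homomorphism takes the class of \<open>g v\<close> to that of \<open>u\<close>.\<close>

lemma cocycle_image_right:
  assumes u: "u \<in> {..<m (Suc i)} \<rightarrow> carrier U" and v: "v \<in> {..<m i} \<rightarrow> carrier V"
    "\<And>k. k < m (Suc i) \<Longrightarrow> f (u k) = diff V i v k"
  shows "cocycle W i (\<lambda>k. g (v k))"
  unfolding cocycle_def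
proof (intro conjI allI impI)
  show "(\<lambda>k. g (v k)) \<in> {..<m i} \<rightarrow> carrier W" using v closed by auto
  fix k assume k: "k < m (Suc i)"
  have uk: "u k \<in> carrier U" using u k by auto
  show "diff W i (\<lambda>k. g (v k)) k = \<zero>\<^bsub>W\<^esub>"
    unfolding diff_hom[OF V.module_axioms W.module_axioms short_exact_hom(2) v(1), symmetric]
      v(2)[OF k, symmetric] by (rule short_exact_comp[OF uk])
qed

text \<open>The connecting homomorphism kills coboundaries. It is stated for a single pair
  \<open>u\<close>, \<open>v\<close> because it is also applied where only particular cocycles of W
  are known to be coboundaries.\<close>

lemma coboundary_left:
  assumes u1: "u \<in> {..<m (Suc i)} \<rightarrow> carrier U" and v: "v \<in> {..<m i} \<rightarrow> carrier V"
    "\<And>k. k < m (Suc i) \<Longrightarrow> f (u k) = diff V i v k"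
    and cobW: "coboundary W i (\<lambda>k. g (v k))"
  shows "coboundary U (Suc i) u"
proof -
  note mods = V.module_axioms W.module_axioms U.module_axioms
  \<comment> \<open>Take \<open>v'\<close> to be 0 in degree 0, and otherwise a coboundary that
    lifts the coboundary \<open>g v\<close>. Then \<open>v - v'\<close> comes from U and has the
    same differential as \<open>v\<close>.\<close>
  have "\<exists>v'. v' \<in> {..<m i} \<rightarrow> carrier V \<and> (\<forall>k<m i. g (v' k) = g (v k)) \<and>
      (\<forall>k<m (Suc i). diff V i v' k = \<zero>\<^bsub>V\<^esub>)"
  proof (cases i)
    case 0
    have "diff V i (\<lambda>_. \<zero>\<^bsub>V\<^esub>) k = \<zero>\<^bsub>V\<^esub>" for k
      unfolding diff_def using V.M.finsum_zero by simp
    then show ?thesis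
      using cobW 0 mhom_zero[OF mods(1,2) short_exact_hom(2)]
      by (intro exI[of _ "\<lambda>_. \<zero>\<^bsub>V\<^esub>"]) (auto simp: coboundary_def)
  next
    case (Suc h)
    obtain w where w: "w \<in> {..<m h} \<rightarrow> carrier W" "\<And>k. k < m i \<Longrightarrow> g (v k) = diff W h w k"
      using cobW unfolding Suc coboundary_def by auto
    obtain x where x: "x \<in> {..<m h} \<rightarrow> carrier V" "\<And>k. k < m h \<Longrightarrow> g (x k) = w k"
      using lift_surj[OF w(1)] by metis
    have "g (diff V h x k) = g (v k)" if "k < m i" for k
      using w(2)[OF that] diff_cong[of h "\<lambda>l. g (x l)" w W k] x w mods
        diff_hom[OF mods(1,2) short_exact_hom(2) x(1)] by simp
    then show ?thesis
      using x diff_closed[OF mods(1) x(1)] diff_diff[OF mods(1) x(1)] Suc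
      by (intro exI[of _ "diff V h x"]) auto
  qed
  then obtain v' where v': "v' \<in> {..<m i} \<rightarrow> carrier V" "\<And>k. k < m i \<Longrightarrow> g (v' k) = g (v k)"
    "\<And>k. k < m (Suc i) \<Longrightarrow> diff V i v' k = \<zero>\<^bsub>V\<^esub>" by blast
  have "g (v k \<ominus>\<^bsub>V\<^esub> v' k) = \<zero>\<^bsub>W\<^esub>" if "k < m i" for k
  proof -
    have "v k \<in> carrier V" "v' k \<in> carrier V" using v v' that by auto
    then show ?thesis
      using v'(2)[OF that] closed(2)[of "v k"]
      by (simp add: mhom_minus[OF mods(1,2) short_exact_hom(2)] W.M.diff_self)
  qed
  then obtain u' where u': "u' \<in> {..<m i} \<rightarrow> carrier U"
    "\<And>k. k < m i \<Longrightarrow> f (u' k) = v k \<ominus>\<^bsub>V\<^esub> v' k"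
    using lift_inj[of "\<lambda>k. v k \<ominus>\<^bsub>V\<^esub> v' k" "m i"] v v' by (auto simp: Pi_def)
  have "u k = diff U i u' k" if k: "k < m (Suc i)" for k
  proof -
    have "f (diff U i u' k) = diff V i (\<lambda>k. v k \<ominus>\<^bsub>V\<^esub> v' k) k"
      unfolding diff_hom[OF mods(3,1) short_exact_hom(1) u'(1)]
      by (rule diff_cong) (use u' v v' mods in auto)
    also have "\<dots> = f (u k)"
      using v(2)[OF k] v'(3)[OF k] diff_closed[OF mods(1) v(1)]
      by (simp add: diff_minus[OF mods(1) v(1) v'(1)] V.M.diff_zero)
    finally have "f (diff U i u' k) = f (u k)" .
    moreover have "u k \<in> carrier U" using u1 k by auto
    ultimately show ?thesis using short_exact_inj[OF diff_closed[OF mods(3) u'(1)]] by simp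
  qed
  then show ?thesis
    unfolding coboundary_def nat.case
    by (intro bexI[of _ u'] allI impI u'(1)) simp
qed

text \<open>The piece H^(j-1)(W) \<rightarrow> H^j(U) \<rightarrow> H^j(V) of the long exact
  sequence. In degree 0 there is no connecting map and left exactness takes its place, hence the
  guard \<open>j = Suc i\<close>.\<close>

lemma acyclic_at_left:
  assumes V: "acyclic_at V j" and W: "\<And>i. j = Suc i \<Longrightarrow> acyclic_at W i"
  shows "acyclic_at U j"
  unfolding acyclic_at_def
proof (intro allI impI)
  fix u assume u: "cocycle U j u"
  note mods = V.module_axioms W.module_axioms U.module_axioms
  have u1: "u \<in> {..<m j} \<rightarrow> carrier U" using u by (simp add: cocycle_def)
  have fu: "(\<lambda>k. f (u k)) \<in> {..<m j} \<rightarrow> carrier V" using u1 closed by auto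
  have "cocycle V j (\<lambda>k. f (u k))"
    using u fu mhom_zero[OF mods(3,1) short_exact_hom(1)]
    by (simp add: cocycle_def diff_hom[OF mods(3,1) short_exact_hom(1) u1, symmetric])
  then have cob: "coboundary V j (\<lambda>k. f (u k))" using V by (simp add: acyclic_at_def)
  show "coboundary U j u"
  proof (cases j)
    case 0
    have "u k = \<zero>\<^bsub>U\<^esub>" if "k < m 0" for k
      using cob that 0 u1 short_exact_inj[of "u k" "\<zero>\<^bsub>U\<^esub>"] mhom_zero[OF mods(3,1) short_exact_hom(1)]
      by (auto simp: coboundary_def)
    then show ?thesis by (simp add: coboundary_def 0)
  next
    case (Suc i)
    obtain v where v: "v \<in> {..<m i} \<rightarrow> carrier V" "\<And>k. k < m j \<Longrightarrow> f (u k) = diff V i v k"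
      using cob unfolding Suc coboundary_def by auto
    have "coboundary W i (\<lambda>k. g (v k))"
      using W[OF Suc] cocycle_image_right[OF u1[unfolded Suc] v[unfolded Suc]] by (simp add: acyclic_at_def)
    then show ?thesis unfolding Suc using coboundary_left[OF u1[unfolded Suc] v[unfolded Suc]] by blast
  qed
qed

end

end

section \<open>Modules over noetherian rings\<close>

locale noetherian_cring = cring A + noetherian_ring A for A (structure)

section \<open>Ideals, primes disjoint from multiplicative sets, prime avoidance\<close>

lemma (in cring) ideal_criterion:
  assumes "I \<subseteq> carrier R" "\<zero> \<in> I" "\<And>x y. x \<in> I \<Longrightarrow> y \<in> I \<Longrightarrow> x \<oplus> y \<in> I"
    "\<And>a x. a \<in> carrier R \<Longrightarrow> x \<in> I \<Longrightarrow> a \<otimes> x \<in> I"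
  shows "ideal I R"
proof (rule idealI)
  show "subgroup I (add_monoid R)"
  proof (rule add.subgroupI)
    show "\<ominus> x \<in> I" if "x \<in> I" for x
      using assms(4)[of "\<ominus> \<one>" x] that assms(1) by (auto simp: l_minus)
  qed (use assms in auto)
  show l: "x \<otimes> a \<in> I" if "a \<in> I" "x \<in> carrier R" for a x
    using assms(4) that by blast
  show "a \<otimes> x \<in> I" if "a \<in> I" "x \<in> carrier R" for a x
    using l[OF that] that assms(1) by (auto simp: m_comm)
qed (rule ring_axioms)

lemma (in module) submodule_criterion:
  assumes "L \<subseteq> carrier M" "\<zero>\<^bsub>M\<^esub> \<in> L" "\<And>x y. x \<in> L \<Longrightarrow> y \<in> L \<Longrightarrow> x \<oplus>\<^bsub>M\<^esub> y \<in> L"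
    "\<And>a x. a \<in> carrier R \<Longrightarrow> x \<in> L \<Longrightarrow> a \<odot>\<^bsub>M\<^esub> x \<in> L"
  shows "submodule L R M"
proof (rule submoduleI)
  show "\<ominus>\<^bsub>M\<^esub> x \<in> L" if "x \<in> L" for x
    using assms(4)[of "\<ominus> \<one>" x] that assms(1) by (auto simp: smult_l_minus)
qed (use assms in auto)

lemma ideal_facts:
  fixes A (structure)
  assumes "ideal I A"
  shows ideal_subset: "I \<subseteq> carrier A" and ideal_zero: "\<zero> \<in> I"
    and ideal_add: "x \<in> I \<Longrightarrow> y \<in> I \<Longrightarrow> x \<oplus> y \<in> I"
    and ideal_minus: "x \<in> I \<Longrightarrow> y \<in> I \<Longrightarrow> x \<ominus> y \<in> I"
    and ideal_mult: "a \<in> carrier A \<Longrightarrow> x \<in> I \<Longrightarrow> a \<otimes> x \<in> I"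
    and ideal_mult': "a \<in> carrier A \<Longrightarrow> x \<in> I \<Longrightarrow> x \<otimes> a \<in> I"
    and ideal_uminus: "x \<in> I \<Longrightarrow> \<ominus> x \<in> I"
proof -
  interpret ideal I A by fact
  show "I \<subseteq> carrier A" using a_subset .
  show "\<zero> \<in> I" by simp
  show "x \<in> I \<Longrightarrow> y \<in> I \<Longrightarrow> x \<oplus> y \<in> I" by simp
  show u: "x \<in> I \<Longrightarrow> \<ominus> x \<in> I" for x by simp
  show "x \<in> I \<Longrightarrow> y \<in> I \<Longrightarrow> x \<ominus> y \<in> I" by (simp add: minus_eq)
  show "a \<in> carrier A \<Longrightarrow> x \<in> I \<Longrightarrow> a \<otimes> x \<in> I" by (rule I_l_closed)
  show "a \<in> carrier A \<Longrightarrow> x \<in> I \<Longrightarrow> x \<otimes> a \<in> I" by (rule I_r_closed)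
qed

lemma (in cring) ideal_adjoin:
  assumes Q: "ideal Q R" and a: "a \<in> carrier R"
  defines "K \<equiv> {q \<oplus> a \<otimes> r | q r. q \<in> Q \<and> r \<in> carrier R}"
  shows "ideal K R" "Q \<subseteq> K" "a \<in> K"
proof -
  note Q' = ideal_facts[OF Q]
  have Qc: "q \<in> carrier R" if "q \<in> Q" for q using that Q'(1) by blast
  show "ideal K R"
  proof (rule ideal_criterion)
    show "K \<subseteq> carrier R" using a Qc by (auto simp: K_def)
    show "\<zero> \<in> K" using a Q'(2) by (auto simp: K_def intro!: exI[of _ \<zero>])
    show "x \<oplus> y \<in> K" if xy: "x \<in> K" "y \<in> K" for x y
    proof -
      obtain q r q' r' where *: "q \<in> Q" "r \<in> carrier R" "q' \<in> Q" "r' \<in> carrier R"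
        "x = q \<oplus> a \<otimes> r" "y = q' \<oplus> a \<otimes> r'" using xy unfolding K_def by blast
      then have "x \<oplus> y = (q \<oplus> q') \<oplus> a \<otimes> (r \<oplus> r')" using a Qc by (simp add: r_distr a_ac)
      then show ?thesis using * Q'(3) unfolding K_def by blast
    qed
    show "b \<otimes> x \<in> K" if b: "b \<in> carrier R" and x: "x \<in> K" for b x
    proof -
      obtain q r where *: "q \<in> Q" "r \<in> carrier R" "x = q \<oplus> a \<otimes> r" using x by (auto simp: K_def)
      then have "b \<otimes> x = (b \<otimes> q) \<oplus> a \<otimes> (b \<otimes> r)" using a b Qc by (simp add: r_distr m_ac)
      then show ?thesis using * b Q'(5) unfolding K_def by blast
    qed
  qed
  show "Q \<subseteq> K"
  proof
    fix q assume q: "q \<in> Q"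
    then have "q = q \<oplus> a \<otimes> \<zero>" using a Qc by simp
    then show "q \<in> K" using q zero_closed unfolding K_def by blast
  qed
  have "a = \<zero> \<oplus> a \<otimes> \<one>" using a by simp
  then show "a \<in> K" using Q'(2) one_closed unfolding K_def by blast
qed

text \<open>A nonempty chain of ideals of a noetherian ring contains its own union, so Zorn's lemma
  applies inside \<open>\<A>\<close>.\<close>

lemma (in noetherian_ring) maximal_ideal_exists:
  assumes "\<A> \<noteq> {}" "\<And>I. I \<in> \<A> \<Longrightarrow> ideal I R"
  obtains I where "I \<in> \<A>" "\<And>J. J \<in> \<A> \<Longrightarrow> I \<subseteq> J \<Longrightarrow> J = I"
proof -
  have "\<exists>I\<in>\<A>. \<forall>J\<in>\<A>. I \<subseteq> J \<longrightarrow> J = I"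
  proof (rule subset_Zorn_nonempty[OF assms(1)])
    fix C assume C: "C \<noteq> {}" "subset.chain \<A> C"
    then have "subset.chain {I. ideal I R} C" using assms(2) by (auto simp: subset_chain_def)
    then have "\<Union>C \<in> C" by (rule ideal_chain_is_trivial[OF C(1)])
    then show "\<Union>C \<in> \<A>" using C(2) by (auto simp: subset_chain_def)
  qed
  then show thesis using that by blast
qed

text \<open>An ideal that is maximal among those containing \<open>J\<close> and missing the
  multiplicative set \<open>S\<close> is prime. Its maximality is exported as well, because
  \<open>lying_over\<close> extracts elements of \<open>S\<close> from larger ideals.\<close>

lemma (in noetherian_cring) exists_prime_disjoint:
  assumes J: "ideal J A" and S: "\<one> \<in> S" "\<And>s t. s \<in> S \<Longrightarrow> t \<in> S \<Longrightarrow> s \<otimes> t \<in> S"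
    and JS: "J \<inter> S = {}"
  obtains Q where "primeideal Q A" "J \<subseteq> Q" "Q \<inter> S = {}" "\<And>K. ideal K A \<Longrightarrow> Q \<subset> K \<Longrightarrow> K \<inter> S \<noteq> {}"
proof -
  obtain Q where Q: "Q \<in> {K. ideal K A \<and> J \<subseteq> K \<and> K \<inter> S = {}}"
    "\<And>K. K \<in> {K. ideal K A \<and> J \<subseteq> K \<and> K \<inter> S = {}} \<Longrightarrow> Q \<subseteq> K \<Longrightarrow> K = Q"
    using maximal_ideal_exists[of "{K. ideal K A \<and> J \<subseteq> K \<and> K \<inter> S = {}}"] J JS by blast
  have Qi: "ideal Q A" "J \<subseteq> Q" "Q \<inter> S = {}" using Q(1) by auto
  note Q' = ideal_facts[OF Qi(1)]
  have mx: "K \<inter> S \<noteq> {}" if "ideal K A" "Q \<subset> K" for K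
    using Q(2)[of K] that Qi by blast
  have "primeideal Q A"
  proof (rule primeidealI[OF Qi(1) cring_axioms])
    show "carrier A \<noteq> Q" using Qi(3) S(1) by auto
    fix a b assume ab: "a \<in> carrier A" "b \<in> carrier A" "a \<otimes> b \<in> Q"
    show "a \<in> Q \<or> b \<in> Q"
    proof (rule ccontr)
      assume n: "\<not> (a \<in> Q \<or> b \<in> Q)"
      have ex: "\<exists>q r. q \<in> Q \<and> r \<in> carrier A \<and> q \<oplus> c \<otimes> r \<in> S" if "c \<in> carrier A" "c \<notin> Q" for c
      proof -
        have "Q \<subset> {q \<oplus> c \<otimes> r | q r. q \<in> Q \<and> r \<in> carrier A}"
          using ideal_adjoin(2,3)[OF Qi(1) that(1)] that(2) by blast
        from mx[OF ideal_adjoin(1)[OF Qi(1) that(1)] this] show ?thesis by blast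
      qed
      obtain q r q' r' where *: "q \<in> Q" "r \<in> carrier A" "q \<oplus> a \<otimes> r \<in> S"
          "q' \<in> Q" "r' \<in> carrier A" "q' \<oplus> b \<otimes> r' \<in> S"
        using ex[OF ab(1)] ex[OF ab(2)] n by blast
      have c: "q \<in> carrier A" "q' \<in> carrier A" using *(1,4) Q'(1) by auto
      \<comment> \<open>Every term of the expanded product has a factor \<open>q\<close>,
        \<open>q'\<close> or \<open>a \<otimes> b\<close>, so the product of two elements of
        \<open>S\<close> would lie in \<open>Q\<close>.\<close>
      have "(q \<oplus> a \<otimes> r) \<otimes> (q' \<oplus> b \<otimes> r')
          = (q' \<oplus> b \<otimes> r') \<otimes> q \<oplus> (a \<otimes> r \<otimes> q' \<oplus> (r \<otimes> r') \<otimes> (a \<otimes> b))"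
        using c *(2,5) ab by algebra
      moreover have "\<dots> \<in> Q"
        using c * ab Q'(3,5) by simp
      ultimately have "(q \<oplus> a \<otimes> r) \<otimes> (q' \<oplus> b \<otimes> r') \<in> Q" by simp
      then show False using Qi(3) S(2)[OF *(3,6)] by blast
    qed
  qed
  then show thesis using that Qi mx by blast
qed

text \<open>Multiply one witness for each member of \<open>\<P>\<close> with an element of
  \<open>I\<close> outside \<open>Q\<close>; primality of \<open>Q\<close> keeps the product outside
  \<open>Q\<close>.\<close>

lemma (in cring) prime_avoidance_aux:
  assumes I: "ideal I R" and Q: "primeideal Q R" and fin: "finite \<P>" and IQ: "\<not> I \<subseteq> Q"
    and \<P>: "\<And>P. P \<in> \<P> \<Longrightarrow> ideal P R \<and> (\<exists>x\<in>I \<inter> P. x \<notin> Q)"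
  shows "\<exists>z\<in>I. z \<notin> Q \<and> (\<forall>P\<in>\<P>. z \<in> P)"
  using fin \<P>
proof (induct set: finite)
  case empty
  then show ?case using IQ by blast
next
  case (insert P \<P>)
  then obtain z where z: "z \<in> I" "z \<notin> Q" "\<forall>P\<in>\<P>. z \<in> P" by blast
  obtain x where x: "x \<in> I" "x \<in> P" "x \<notin> Q" using insert.prems by blast
  have c: "x \<in> carrier R" "z \<in> carrier R" using x z ideal_subset[OF I] by auto
  have "x \<otimes> z \<in> I" "x \<otimes> z \<in> P" using c z x ideal_mult[OF I] ideal_mult'[of P R] insert.prems by auto
  moreover have "x \<otimes> z \<notin> Q" using primeideal.I_prime[OF Q] c x z by blast
  moreover have "x \<otimes> z \<in> P'" if "P' \<in> \<P>" for P'
    using ideal_mult[of P' R] insert.prems that c z by auto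
  ultimately show ?case by blast
qed

lemma (in cring) prime_avoidance:
  assumes I: "ideal I R" and "finite \<P>" "\<And>P. P \<in> \<P> \<Longrightarrow> primeideal P R \<and> \<not> I \<subseteq> P"
  shows "\<exists>x\<in>I. \<forall>P\<in>\<P>. x \<notin> P"
  using assms(2,3)
proof (induct rule: finite_psubset_induct)
  case (psubset \<P>)
  show ?case
  proof (cases "\<P> = {}")
    case True
    then show ?thesis using ideal_zero[OF I] by blast
  next
    case False
    then obtain Q where Q: "Q \<in> \<P>" by blast
    have "\<exists>x\<in>I. \<forall>P'\<in>\<P> - {P}. x \<notin> P'" if "P \<in> \<P>" for P
      by (rule psubset.hyps) (use that psubset.prems in auto)
    then obtain x where x: "\<And>P. P \<in> \<P> \<Longrightarrow> x P \<in> I"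
      "\<And>P P'. P \<in> \<P> \<Longrightarrow> P' \<in> \<P> \<Longrightarrow> P \<noteq> P' \<Longrightarrow> x P \<notin> P'" by (metis Diff_iff singletonD)
    show ?thesis
    proof (cases "\<exists>P\<in>\<P>. x P \<notin> P")
      case True
      then show ?thesis using x by blast
    next
      case False
      \<comment> \<open>In the remaining case each \<open>x P\<close> lies in \<open>P\<close> and
        in no other member. With \<open>z\<close> outside \<open>Q\<close> but in all the other
        members, \<open>x Q \<oplus> z\<close> avoids every member.\<close>
      have "\<exists>z\<in>I. z \<notin> Q \<and> (\<forall>P\<in>\<P> - {Q}. z \<in> P)"
      proof (rule prime_avoidance_aux[OF I])
        show "ideal P R \<and> (\<exists>x\<in>I \<inter> P. x \<notin> Q)" if "P \<in> \<P> - {Q}" for P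
          using that False x(1)[of P] x(2)[of P Q] Q psubset.prems[of P]
          by (auto simp: primeideal_def)
      qed (use psubset Q in auto)
      then obtain z where z: "z \<in> I" "z \<notin> Q" "\<forall>P\<in>\<P> - {Q}. z \<in> P" by blast
      have c: "x Q \<in> carrier R" "z \<in> carrier R" using x(1)[OF Q] z(1) ideal_subset[OF I] by auto
      have dif: "(x Q \<oplus> z) \<ominus> x Q = z" "(x Q \<oplus> z) \<ominus> z = x Q" using c by algebra+
      have "x Q \<oplus> z \<notin> P" if P: "P \<in> \<P>" for P
      proof
        assume s: "x Q \<oplus> z \<in> P"
        have Pi: "ideal P R" using psubset.prems[OF P] by (simp add: primeideal_def)
        show False
        proof (cases "P = Q")
          case True
          then have "x Q \<in> P" using False Q by auto
          then have "z \<in> P" using ideal_minus[OF Pi s] dif by metis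
          then show False using z True by blast
        next
          case neq: False
          then have "z \<in> P" using z P by blast
          then have "x Q \<in> P" using ideal_minus[OF Pi s] dif by metis
          then show False using x(2)[OF Q P] neq by blast
        qed
      qed
      then show ?thesis using ideal_add[OF I x(1)[OF Q] z(1)] by blast
    qed
  qed
qed

section \<open>Spans and finitely generated modules\<close>

definition lin_span :: "('a, 'x) ring_scheme \<Rightarrow> ('a, 'b, 'y) module_scheme \<Rightarrow> 'b set \<Rightarrow> 'b set"
  where "lin_span A V S = \<Inter>{L. submodule L A V \<and> S \<subseteq> L}"

context module
begin

lemma span_superset: "S \<subseteq> lin_span R M S"
  by (auto simp: lin_span_def)

lemma span_minimal: "submodule L R M \<Longrightarrow> S \<subseteq> L \<Longrightarrow> lin_span R M S \<subseteq> L"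
  by (auto simp: lin_span_def)

lemma span_submodule: "S \<subseteq> carrier M \<Longrightarrow> submodule (lin_span R M S) R M"
proof (rule submodule_criterion)
  assume S: "S \<subseteq> carrier M"
  then show "lin_span R M S \<subseteq> carrier M" by (intro span_minimal carrier_is_submodule)
  show "\<zero>\<^bsub>M\<^esub> \<in> lin_span R M S" using submodule_zero_mem by (auto simp: lin_span_def)
  show "\<And>x y. x \<in> lin_span R M S \<Longrightarrow> y \<in> lin_span R M S \<Longrightarrow> x \<oplus>\<^bsub>M\<^esub> y \<in> lin_span R M S"
    using submoduleE(5) by (auto simp: lin_span_def)
  show "\<And>a x. a \<in> carrier R \<Longrightarrow> x \<in> lin_span R M S \<Longrightarrow> a \<odot>\<^bsub>M\<^esub> x \<in> lin_span R M S"
    using submoduleE(4) by (auto simp: lin_span_def)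
qed

lemma span_mono: "S \<subseteq> T \<Longrightarrow> lin_span R M S \<subseteq> lin_span R M T"
  by (auto simp: lin_span_def)

lemma span_insertD:
  assumes S: "S \<subseteq> carrier M" and v: "v \<in> carrier M" and x: "x \<in> lin_span R M (insert v S)"
  obtains a u where "a \<in> carrier R" "u \<in> lin_span R M S" "x = a \<odot>\<^bsub>M\<^esub> v \<oplus>\<^bsub>M\<^esub> u"
proof -
  note E = submoduleE[OF span_submodule[OF S]] submodule_zero_mem[OF span_submodule[OF S]]
  define L where "L = {a \<odot>\<^bsub>M\<^esub> v \<oplus>\<^bsub>M\<^esub> u | a u. a \<in> carrier R \<and> u \<in> lin_span R M S}"
  have uc: "u \<in> carrier M" if "u \<in> lin_span R M S" for u using that E(1) by blast
  have "submodule L R M"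
  proof (rule submodule_criterion)
    show "L \<subseteq> carrier M" using v uc by (auto simp: L_def)
    show "\<zero>\<^bsub>M\<^esub> \<in> L" using v E(7) unfolding L_def by (auto intro!: exI[of _ \<zero>] exI[of _ "\<zero>\<^bsub>M\<^esub>"])
    show "x \<oplus>\<^bsub>M\<^esub> y \<in> L" if xy: "x \<in> L" "y \<in> L" for x y
    proof -
      obtain a u a' u' where *: "a \<in> carrier R" "u \<in> lin_span R M S" "a' \<in> carrier R"
        "u' \<in> lin_span R M S" "x = a \<odot>\<^bsub>M\<^esub> v \<oplus>\<^bsub>M\<^esub> u" "y = a' \<odot>\<^bsub>M\<^esub> v \<oplus>\<^bsub>M\<^esub> u'" using xy by (auto simp: L_def)
      then have "x \<oplus>\<^bsub>M\<^esub> y = (a \<oplus> a') \<odot>\<^bsub>M\<^esub> v \<oplus>\<^bsub>M\<^esub> (u \<oplus>\<^bsub>M\<^esub> u')"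
        using v uc by (simp add: smult_l_distr M.a_ac)
      then show ?thesis using * E(5) unfolding L_def by blast
    qed
    show "b \<odot>\<^bsub>M\<^esub> x \<in> L" if b: "b \<in> carrier R" and x: "x \<in> L" for b x
    proof -
      obtain a u where *: "a \<in> carrier R" "u \<in> lin_span R M S" "x = a \<odot>\<^bsub>M\<^esub> v \<oplus>\<^bsub>M\<^esub> u"
        using x by (auto simp: L_def)
      then have "b \<odot>\<^bsub>M\<^esub> x = (b \<otimes> a) \<odot>\<^bsub>M\<^esub> v \<oplus>\<^bsub>M\<^esub> b \<odot>\<^bsub>M\<^esub> u"
        using v b uc by (simp add: smult_r_distr smult_assoc1)
      then show ?thesis using * b E(4) unfolding L_def by blast
    qed
  qed
  moreover have "insert v S \<subseteq> L"
  proof (rule insert_subsetI)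
    show "v \<in> L" unfolding L_def using v E(7) by (auto intro!: exI[of _ \<one>] exI[of _ "\<zero>\<^bsub>M\<^esub>"])
    show "S \<subseteq> L"
    proof
      fix s assume "s \<in> S"
      then show "s \<in> L" unfolding L_def using v S span_superset[of S]
        by (auto intro!: exI[of _ \<zero>] exI[of _ s])
    qed
  qed
  ultimately have "x \<in> L" using x span_minimal by blast
  then show thesis using that by (auto simp: L_def)
qed

lemma span_finite_support:
  assumes S: "S \<subseteq> carrier M" and x: "x \<in> lin_span R M S"
  obtains F where "finite F" "F \<subseteq> S" "x \<in> lin_span R M F"
proof -
  define L where "L = {x. \<exists>F. finite F \<and> F \<subseteq> S \<and> x \<in> lin_span R M F}"
  have sub: "submodule (lin_span R M F) R M" if "F \<subseteq> S" for F using that S by (intro span_submodule) auto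
  have "submodule L R M"
  proof (rule submodule_criterion)
    show "L \<subseteq> carrier M" using submoduleE(1)[OF sub] by (auto simp: L_def)
    show "\<zero>\<^bsub>M\<^esub> \<in> L" using submodule_zero_mem[OF sub[of "{}"]] by (auto simp: L_def)
    show "x \<oplus>\<^bsub>M\<^esub> y \<in> L" if xy: "x \<in> L" "y \<in> L" for x y
    proof -
      obtain F F' where *: "finite F" "F \<subseteq> S" "x \<in> lin_span R M F" "finite F'" "F' \<subseteq> S" "y \<in> lin_span R M F'"
        using xy by (auto simp: L_def)
      then have "x \<in> lin_span R M (F \<union> F')" "y \<in> lin_span R M (F \<union> F')"
        using span_mono[of F "F \<union> F'"] span_mono[of F' "F \<union> F'"] by auto
      then show ?thesis using submoduleE(5)[OF sub[of "F \<union> F'"]] * unfolding L_def by blast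
    qed
    show "b \<odot>\<^bsub>M\<^esub> x \<in> L" if "b \<in> carrier R" "x \<in> L" for b x
      using that submoduleE(4)[OF sub] unfolding L_def by blast
  qed
  moreover have "S \<subseteq> L"
  proof
    fix s assume "s \<in> S"
    then show "s \<in> L" unfolding L_def using span_superset[of "{s}"] by (auto intro!: exI[of _ "{s}"])
  qed
  ultimately have "x \<in> L" using x span_minimal by blast
  then show thesis using that by (auto simp: L_def)
qed

text \<open>Spans are intersections of submodules, which suits arguments by minimality. Coefficients
  are recovered here because \<open>kernel_generators\<close> has to write down matrices.\<close>

lemma span_lincomb:
  fixes p :: nat
  assumes "w \<in> {..<p} \<rightarrow> carrier M" "x \<in> lin_span R M (w ` {..<p})"
  shows "\<exists>c\<in>{..<p} \<rightarrow> carrier R. x = (\<Oplus>\<^bsub>M\<^esub>k\<in>{..<p}. c k \<odot>\<^bsub>M\<^esub> w k)"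
  using assms
proof (induct p arbitrary: x)
  case 0
  have "submodule {\<zero>\<^bsub>M\<^esub>} R M" by (rule submodule_criterion) auto
  then have "x = \<zero>\<^bsub>M\<^esub>" using 0 span_minimal[of "{\<zero>\<^bsub>M\<^esub>}" "{}"] by auto
  then show ?case by auto
next
  case (Suc p)
  have w: "w \<in> {..<p} \<rightarrow> carrier M" "w p \<in> carrier M" using Suc.prems(1) by auto
  have sub: "w ` {..<p} \<subseteq> carrier M" using w by auto
  have "x \<in> lin_span R M (insert (w p) (w ` {..<p}))" using Suc.prems(2) by (simp add: lessThan_Suc)
  then obtain a u where au: "a \<in> carrier R" "u \<in> lin_span R M (w ` {..<p})" "x = a \<odot>\<^bsub>M\<^esub> w p \<oplus>\<^bsub>M\<^esub> u"
    using span_insertD[OF sub w(2)] by metis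
  obtain c where c: "c \<in> {..<p} \<rightarrow> carrier R" "u = (\<Oplus>\<^bsub>M\<^esub>k\<in>{..<p}. c k \<odot>\<^bsub>M\<^esub> w k)"
    using Suc.hyps[OF w(1) au(2)] by blast
  have "(\<Oplus>\<^bsub>M\<^esub>k\<in>{..<Suc p}. (c(p := a)) k \<odot>\<^bsub>M\<^esub> w k)
      = (c(p := a)) p \<odot>\<^bsub>M\<^esub> w p \<oplus>\<^bsub>M\<^esub> (\<Oplus>\<^bsub>M\<^esub>k\<in>{..<p}. (c(p := a)) k \<odot>\<^bsub>M\<^esub> w k)"
    unfolding lessThan_Suc using w c au by (intro M.finsum_insert) (auto simp: Pi_def)
  also have "(\<Oplus>\<^bsub>M\<^esub>k\<in>{..<p}. (c(p := a)) k \<odot>\<^bsub>M\<^esub> w k) = u"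
    unfolding c(2) using w c by (intro M.finsum_cong') (auto simp: Pi_def)
  finally have "x = (\<Oplus>\<^bsub>M\<^esub>k\<in>{..<Suc p}. (c(p := a)) k \<odot>\<^bsub>M\<^esub> w k)" using au(3) by simp
  moreover have "c(p := a) \<in> {..<Suc p} \<rightarrow> carrier R" using c au by (auto simp: Pi_def less_Suc_eq)
  ultimately show ?case by blast
qed

end

lemma (in module) smult_left_commute:
  "\<lbrakk>a \<in> carrier R; b \<in> carrier R; x \<in> carrier M\<rbrakk> \<Longrightarrow> a \<odot>\<^bsub>M\<^esub> (b \<odot>\<^bsub>M\<^esub> x) = b \<odot>\<^bsub>M\<^esub> (a \<odot>\<^bsub>M\<^esub> x)"
  by (simp add: smult_assoc1[symmetric] R.m_comm)

definition fin_gen :: "('a, 'x) ring_scheme \<Rightarrow> ('a, 'b, 'y) module_scheme \<Rightarrow> bool"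
  where "fin_gen A V \<longleftrightarrow> (\<exists>S. finite S \<and> S \<subseteq> carrier V \<and> carrier V \<subseteq> lin_span A V S)"

lemma fin_gen_of_finitely_generated_module:
  assumes "module A V" "finitely_generated_module A V" shows "fin_gen A V"
proof -
  interpret V: module A V by fact
  obtain S where S: "finite S" "S \<subseteq> carrier V"
    "\<forall>x\<in>carrier V. \<exists>c\<in>S \<rightarrow> carrier A. x = (\<Oplus>\<^bsub>V\<^esub>s\<in>S. c s \<odot>\<^bsub>V\<^esub> s)"
    using assms(2) unfolding finitely_generated_module_def by blast
  note sub = V.span_submodule[OF S(2)]
  have "x \<in> lin_span A V S" if x: "x \<in> carrier V" for x
  proof -
    obtain c where c: "c \<in> S \<rightarrow> carrier A" "x = (\<Oplus>\<^bsub>V\<^esub>s\<in>S. c s \<odot>\<^bsub>V\<^esub> s)" using S(3) x by blast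
    show ?thesis unfolding c(2)
      by (rule V.submodule_finsum_mem[OF sub S(1)])
         (use c V.span_superset[of S] V.submoduleE(4)[OF sub] in \<open>auto simp: Pi_def\<close>)
  qed
  then show ?thesis unfolding fin_gen_def using S by blast
qed

lemma fin_gen_image:
  assumes VW: "module A V" "module A W" and q: "q \<in> module_hom A V W" "q ` carrier V = carrier W"
    and "fin_gen A V"
  shows "fin_gen A W"
proof -
  interpret V: module A V by fact
  interpret W: module A W by fact
  obtain S where S: "finite S" "S \<subseteq> carrier V" "carrier V \<subseteq> lin_span A V S"
    using assms(5) unfolding fin_gen_def by blast
  have qS: "q ` S \<subseteq> carrier W" using S(2) q(2) by blast
  note sub = W.span_submodule[OF qS]
  define L where "L = {v \<in> carrier V. q v \<in> lin_span A W (q ` S)}"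
  have "submodule L A V"
  proof (rule V.submodule_criterion)
    show "\<zero>\<^bsub>V\<^esub> \<in> L" using W.submodule_zero_mem[OF sub] by (simp add: L_def mhom_zero[OF VW q(1)])
  qed (auto simp: L_def mhom_add[OF q(1)] mhom_smult[OF q(1)] W.submoduleE(4,5)[OF sub])
  moreover have "S \<subseteq> L" using S(2) W.span_superset[of "q ` S"] by (auto simp: L_def)
  ultimately have "carrier V \<subseteq> L" using S(3) V.span_minimal by blast
  then have "carrier W \<subseteq> lin_span A W (q ` S)" unfolding q(2)[symmetric] by (auto simp: L_def)
  then show ?thesis unfolding fin_gen_def using S(1) qS by blast
qed

context noetherian_cring
begin

lemma ideal_generators:
  assumes "ideal I A"
  obtains B where "finite B" "B \<subseteq> I" "\<And>J. ideal J A \<Longrightarrow> B \<subseteq> J \<Longrightarrow> I \<subseteq> J"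
proof -
  obtain B where B: "B \<subseteq> carrier A" "finite B" "I = Idl B" using finetely_gen[OF assms] by blast
  show thesis
    by (rule that[of B]) (use B genideal_self[of B] genideal_minimal in auto)
qed

text \<open>Induction on the generators: the coefficients at \<open>v\<close> of the elements of
  \<open>N\<close> form an ideal. Lifts of finitely many generators of this ideal, together with
  generators of the part of \<open>N\<close> inside the span of \<open>S\<close>, generate
  \<open>N\<close>.\<close>

lemma submodule_of_span:
  assumes V: "module A V" and "finite S" "S \<subseteq> carrier V" "submodule N A V" "N \<subseteq> lin_span A V S"
  shows "\<exists>T. finite T \<and> T \<subseteq> N \<and> N \<subseteq> lin_span A V T"
proof -
  interpret V: module A V by fact
  show ?thesis
    using assms(2-)
  proof (induct S arbitrary: N set: finite)
    case empty
    then have "N \<subseteq> lin_span A V {}" by simp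
    then show ?case by (intro exI[of _ "{}"]) simp
  next
    case (insert v S)
    have v: "v \<in> carrier V" and S: "S \<subseteq> carrier V" using insert by auto
    note N = insert.prems(2)
    note NE = V.submoduleE[OF N] V.submodule_zero_mem[OF N]
    note subS = V.span_submodule[OF S]
    note SE = V.submoduleE[OF subS] V.submodule_zero_mem[OF subS]
    have Sc: "u \<in> carrier V" if "u \<in> lin_span A V S" for u using SE(1) that by blast
    have Nc: "u \<in> carrier V" if "u \<in> N" for u using NE(1) that by blast
    have "submodule (N \<inter> lin_span A V S) A V"
      by (rule V.submodule_criterion) (use NE SE in auto)
    then obtain T where T: "finite T" "T \<subseteq> N \<inter> lin_span A V S" "N \<inter> lin_span A V S \<subseteq> lin_span A V T"
      using insert.hyps(3)[of "N \<inter> lin_span A V S"] S by blast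
    define I where "I = {a \<in> carrier A. \<exists>y\<in>N. y \<ominus>\<^bsub>V\<^esub> a \<odot>\<^bsub>V\<^esub> v \<in> lin_span A V S}"
    \<comment> \<open>Proved for an arbitrary submodule because it is applied twice: to
      \<open>N\<close>, which gives generators of \<open>I\<close>, and to the span of the
      \<open>y b\<close>, whose coefficients are then seen to exhaust \<open>I\<close>.\<close>
    have coeff: "ideal {a \<in> carrier A. \<exists>y\<in>L. y \<ominus>\<^bsub>V\<^esub> a \<odot>\<^bsub>V\<^esub> v \<in> lin_span A V S} A"
      (is "ideal ?J A") if L: "submodule L A V" for L
    proof (rule ideal_criterion)
      note LE = V.submoduleE[OF L] V.submodule_zero_mem[OF L]
      have Lc: "u \<in> carrier V" if "u \<in> L" for u using LE(1) that by blast
      show "?J \<subseteq> carrier A" by blast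
      show "\<zero> \<in> ?J" using LE(7) SE(7) v by (auto intro!: bexI[of _ "\<zero>\<^bsub>V\<^esub>"] simp: V.M.diff_self)
      show "a \<oplus> b \<in> ?J" if ab: "a \<in> ?J" "b \<in> ?J" for a b
      proof -
        obtain y z where *: "y \<in> L" "y \<ominus>\<^bsub>V\<^esub> a \<odot>\<^bsub>V\<^esub> v \<in> lin_span A V S"
          "z \<in> L" "z \<ominus>\<^bsub>V\<^esub> b \<odot>\<^bsub>V\<^esub> v \<in> lin_span A V S" using ab by blast
        have "(y \<oplus>\<^bsub>V\<^esub> z) \<ominus>\<^bsub>V\<^esub> (a \<oplus> b) \<odot>\<^bsub>V\<^esub> v
            = (y \<ominus>\<^bsub>V\<^esub> a \<odot>\<^bsub>V\<^esub> v) \<oplus>\<^bsub>V\<^esub> (z \<ominus>\<^bsub>V\<^esub> b \<odot>\<^bsub>V\<^esub> v)"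
          using ab v Lc *(1,3) by (simp add: V.smult_l_distr V.M.minus_eq V.M.minus_add V.M.a_ac)
        then show ?thesis using ab LE(5)[OF *(1,3)] SE(5)[OF *(2,4)]
          by (auto intro!: bexI[of _ "y \<oplus>\<^bsub>V\<^esub> z"])
      qed
      show "b \<otimes> a \<in> ?J" if b: "b \<in> carrier A" and a: "a \<in> ?J" for a b
      proof -
        obtain y where *: "y \<in> L" "y \<ominus>\<^bsub>V\<^esub> a \<odot>\<^bsub>V\<^esub> v \<in> lin_span A V S" using a by blast
        have "(b \<odot>\<^bsub>V\<^esub> y) \<ominus>\<^bsub>V\<^esub> (b \<otimes> a) \<odot>\<^bsub>V\<^esub> v = b \<odot>\<^bsub>V\<^esub> (y \<ominus>\<^bsub>V\<^esub> a \<odot>\<^bsub>V\<^esub> v)"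
          using a b v Lc *(1) by (simp add: V.smult_assoc1 V.M.minus_eq V.smult_r_distr V.smult_r_minus)
        then show ?thesis using a b LE(4)[OF b *(1)] SE(4)[OF b *(2)]
          by (auto intro!: bexI[of _ "b \<odot>\<^bsub>V\<^esub> y"])
      qed
    qed
    have "ideal I A" unfolding I_def by (rule coeff[OF N])
    then obtain B where B: "finite B" "B \<subseteq> I" "\<And>J. ideal J A \<Longrightarrow> B \<subseteq> J \<Longrightarrow> I \<subseteq> J"
      by (rule ideal_generators) blast
    have "\<forall>b\<in>B. \<exists>y. y \<in> N \<and> y \<ominus>\<^bsub>V\<^esub> b \<odot>\<^bsub>V\<^esub> v \<in> lin_span A V S" using B(2) unfolding I_def by blast
    from bchoice[OF this] obtain y
      where y: "\<forall>b\<in>B. y b \<in> N \<and> y b \<ominus>\<^bsub>V\<^esub> b \<odot>\<^bsub>V\<^esub> v \<in> lin_span A V S" ..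
    have yB: "y ` B \<subseteq> N" using y by blast
    have sub1: "submodule (lin_span A V (y ` B)) A V" using yB NE(1) by (intro V.span_submodule) blast
    have yN: "lin_span A V (y ` B) \<subseteq> N" by (rule V.span_minimal[OF N yB])
    have cI: "I \<subseteq> {a \<in> carrier A. \<exists>y\<in>lin_span A V (y ` B). y \<ominus>\<^bsub>V\<^esub> a \<odot>\<^bsub>V\<^esub> v \<in> lin_span A V S}"
      using B(2) I_def y V.span_superset[of "y ` B"] by (intro B(3) coeff[OF sub1]) blast
    let ?T = "y ` B \<union> T"
    have TN: "?T \<subseteq> N" using yB T(2) by blast
    have subT: "submodule (lin_span A V ?T) A V" using TN NE(1) by (intro V.span_submodule) blast
    have "x \<in> lin_span A V ?T" if x: "x \<in> N" for x
    proof -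
      have "x \<in> lin_span A V (insert v S)" using x insert.prems by blast
      then obtain a u where au: "a \<in> carrier A" "u \<in> lin_span A V S" "x = a \<odot>\<^bsub>V\<^esub> v \<oplus>\<^bsub>V\<^esub> u"
        by (rule V.span_insertD[OF S v])
      have "x \<ominus>\<^bsub>V\<^esub> a \<odot>\<^bsub>V\<^esub> v = u"
        using au v Sc by (simp add: V.M.minus_eq V.M.a_comm[of "a \<odot>\<^bsub>V\<^esub> v"] V.M.a_assoc V.M.r_neg)
      then have "a \<in> I" using au x unfolding I_def by (auto intro!: bexI[of _ x])
      then obtain z where z: "z \<in> lin_span A V (y ` B)" "z \<ominus>\<^bsub>V\<^esub> a \<odot>\<^bsub>V\<^esub> v \<in> lin_span A V S"
        using cI by blast
      have zN: "z \<in> N" using z yN by blast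
      have "x \<ominus>\<^bsub>V\<^esub> z = (x \<ominus>\<^bsub>V\<^esub> a \<odot>\<^bsub>V\<^esub> v) \<ominus>\<^bsub>V\<^esub> (z \<ominus>\<^bsub>V\<^esub> a \<odot>\<^bsub>V\<^esub> v)"
        using Nc[OF x] Nc[OF zN] v au by (simp add: V.M.diff_diff_right)
      moreover have "\<dots> \<in> lin_span A V S"
        using \<open>x \<ominus>\<^bsub>V\<^esub> a \<odot>\<^bsub>V\<^esub> v = u\<close> au(2) z(2) V.submodule_minus_mem[OF subS] by simp
      ultimately have "x \<ominus>\<^bsub>V\<^esub> z \<in> N \<inter> lin_span A V S"
        using V.submodule_minus_mem[OF N x zN] by simp
      then have "x \<ominus>\<^bsub>V\<^esub> z \<in> lin_span A V ?T" using T(3) V.span_mono[of T ?T] by blast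
      moreover have "z \<in> lin_span A V ?T" using z(1) V.span_mono[of "y ` B" ?T] by blast
      ultimately have "z \<oplus>\<^bsub>V\<^esub> (x \<ominus>\<^bsub>V\<^esub> z) \<in> lin_span A V ?T" using V.submoduleE(5)[OF subT] by blast
      then show ?thesis using Nc[OF x] Nc[OF zN] by (simp add: V.M.add_diff)
    qed
    then show ?case using B(1) T(1) TN by (intro exI[of _ ?T]) auto
  qed
qed

lemma fin_gen_submodule:
  assumes V: "module A V" and "fin_gen A V" and L: "submodule L A V"
  shows "\<exists>T. finite T \<and> T \<subseteq> L \<and> L \<subseteq> lin_span A V T" "fin_gen A (V\<lparr>carrier := L\<rparr>)"
proof -
  interpret V: module A V by fact
  obtain S where S: "finite S" "S \<subseteq> carrier V" "carrier V \<subseteq> lin_span A V S"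
    using assms(2) unfolding fin_gen_def by blast
  have "L \<subseteq> lin_span A V S" using S(3) V.submoduleE(1)[OF L] by blast
  from submodule_of_span[OF V S(1,2) L this]
  show ex: "\<exists>T. finite T \<and> T \<subseteq> L \<and> L \<subseteq> lin_span A V T" .
  then obtain T where T: "finite T" "T \<subseteq> L" "L \<subseteq> lin_span A V T" by blast
  interpret L: module A "V\<lparr>carrier := L\<rparr>" by (rule submodule.submodule_is_module[OF L V])
  have "T \<subseteq> carrier (V\<lparr>carrier := L\<rparr>)" using T by simp
  note sub = L.span_submodule[OF this]
  \<comment> \<open>A submodule of \<open>L\<close> is a submodule of \<open>V\<close>, so the span
    formed inside \<open>L\<close> contains the span formed in \<open>V\<close>.\<close>
  have "submodule (lin_span A (V\<lparr>carrier := L\<rparr>) T) A V"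
    using L.submoduleE(1,4,5)[OF sub] L.submodule_zero_mem[OF sub] V.submoduleE(1)[OF L]
    by (intro V.submodule_criterion) auto
  then have "L \<subseteq> lin_span A (V\<lparr>carrier := L\<rparr>) T"
    using T(3) V.span_minimal L.span_superset[of T] by blast
  then show "fin_gen A (V\<lparr>carrier := L\<rparr>)" unfolding fin_gen_def using T by (intro exI[of _ T]) simp
qed

text \<open>The set \<open>S\<close> is a singleton when the annihilator of one element is wanted,
  and the whole carrier for the annihilator of the module.\<close>

lemma annihilator_ideal:
  assumes "module A V" shows "ideal {b \<in> carrier A. \<forall>v\<in>S \<inter> carrier V. b \<odot>\<^bsub>V\<^esub> v = \<zero>\<^bsub>V\<^esub>} A"
proof -
  interpret V: module A V by fact
  show ?thesis by (rule ideal_criterion) (auto simp: V.smult_l_distr V.smult_assoc1)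
qed

text \<open>The maximal annihilators of nonzero elements are primes, and there are only finitely many
  of them since otherwise the elements they annihilate would span a submodule that is not
  finitely generated.\<close>

lemma nonzerodivisor_exists:
  assumes V: "module A V" and fg: "fin_gen A V" and I: "ideal I A"
    and tf: "\<And>v. v \<in> carrier V \<Longrightarrow> (\<And>b. b \<in> I \<Longrightarrow> b \<odot>\<^bsub>V\<^esub> v = \<zero>\<^bsub>V\<^esub>) \<Longrightarrow> v = \<zero>\<^bsub>V\<^esub>"
  obtains x where "x \<in> I" "\<And>v. v \<in> carrier V \<Longrightarrow> x \<odot>\<^bsub>V\<^esub> v = \<zero>\<^bsub>V\<^esub> \<Longrightarrow> v = \<zero>\<^bsub>V\<^esub>"
proof -
  interpret V: module A V by fact
  define ann where "ann v = {b \<in> carrier A. b \<odot>\<^bsub>V\<^esub> v = \<zero>\<^bsub>V\<^esub>}" for v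
  define NZ where "NZ = {v \<in> carrier V. v \<noteq> \<zero>\<^bsub>V\<^esub>}"
  have ann: "ideal (ann v) A" if "v \<in> carrier V" for v
    using annihilator_ideal[OF V, of "{v}"] that by (simp add: ann_def)
  define \<P> where "\<P> = {P \<in> ann ` NZ. \<forall>Q\<in>ann ` NZ. P \<subseteq> Q \<longrightarrow> Q = P}"
  have above: "\<exists>P\<in>\<P>. ann v \<subseteq> P" if "v \<in> NZ" for v
  proof -
    have ne: "{Q \<in> ann ` NZ. ann v \<subseteq> Q} \<noteq> {}" using that by blast
    have "ideal Q A" if "Q \<in> {Q \<in> ann ` NZ. ann v \<subseteq> Q}" for Q using that ann unfolding NZ_def by blast
    from maximal_ideal_exists[OF ne this] obtain P where P: "P \<in> {Q \<in> ann ` NZ. ann v \<subseteq> Q}"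
      "\<And>J. J \<in> {Q \<in> ann ` NZ. ann v \<subseteq> Q} \<Longrightarrow> P \<subseteq> J \<Longrightarrow> J = P" by blast
    have "P \<in> \<P>" unfolding \<P>_def using P by blast
    then show ?thesis using P(1) by blast
  qed
  have prime: "primeideal P A" if P: "P \<in> \<P>" for P
  proof -
    obtain v where v: "v \<in> carrier V" "v \<noteq> \<zero>\<^bsub>V\<^esub>" "P = ann v"
      using P unfolding \<P>_def NZ_def by blast
    show ?thesis
    proof (rule primeidealI)
      show "ideal P A" using ann v by blast
      show "carrier A \<noteq> P"
      proof
        assume "carrier A = P"
        then have "\<one> \<in> ann v" using v by auto
        then show False using v by (simp add: ann_def)
      qed
      fix b c assume bc: "b \<in> carrier A" "c \<in> carrier A" "b \<otimes> c \<in> P"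
      show "b \<in> P \<or> c \<in> P"
      proof (rule ccontr)
        assume n: "\<not> (b \<in> P \<or> c \<in> P)"
        then have cv: "c \<odot>\<^bsub>V\<^esub> v \<in> NZ" using bc v by (auto simp: NZ_def ann_def)
        have "P \<subseteq> ann (c \<odot>\<^bsub>V\<^esub> v)"
        proof
          fix a assume "a \<in> P"
          then have a: "a \<in> carrier A" "a \<odot>\<^bsub>V\<^esub> v = \<zero>\<^bsub>V\<^esub>" using v(3) by (auto simp: ann_def)
          have "a \<odot>\<^bsub>V\<^esub> (c \<odot>\<^bsub>V\<^esub> v) = c \<odot>\<^bsub>V\<^esub> (a \<odot>\<^bsub>V\<^esub> v)"
            using bc v(1) a(1) by (intro V.smult_left_commute)
          with a show "a \<in> ann (c \<odot>\<^bsub>V\<^esub> v)" using bc by (simp add: ann_def)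
        qed
        then have "ann (c \<odot>\<^bsub>V\<^esub> v) = P" using P cv unfolding \<P>_def by blast
        moreover have "b \<in> ann (c \<odot>\<^bsub>V\<^esub> v)" using bc v by (simp add: ann_def V.smult_assoc1[symmetric])
        ultimately show False using n by simp
      qed
    qed (rule cring_axioms)
  qed
  have fin: "finite \<P>"
  proof -
    have "\<forall>P\<in>\<P>. \<exists>v. v \<in> NZ \<and> P = ann v" unfolding \<P>_def by blast
    from bchoice[OF this] obtain w where w: "\<forall>P\<in>\<P>. w P \<in> NZ \<and> P = ann (w P)" ..
    have wV: "w ` \<P> \<subseteq> carrier V" using w unfolding NZ_def by blast
    obtain T where T: "finite T" "T \<subseteq> lin_span A V (w ` \<P>)" "lin_span A V (w ` \<P>) \<subseteq> lin_span A V T"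
      using fin_gen_submodule(1)[OF V fg V.span_submodule[OF wV]] by blast
    have "\<forall>t\<in>T. \<exists>F. finite F \<and> F \<subseteq> w ` \<P> \<and> t \<in> lin_span A V F"
      using T(2) V.span_finite_support[OF wV] by (metis subsetD)
    from bchoice[OF this] obtain F
      where F: "\<forall>t\<in>T. finite (F t) \<and> F t \<subseteq> w ` \<P> \<and> t \<in> lin_span A V (F t)" ..
    have "finite (\<Union>(F ` T))" "\<Union>(F ` T) \<subseteq> w ` \<P>" using F T(1) by auto
    then obtain \<Q> where \<Q>: "\<Q> \<subseteq> \<P>" "finite \<Q>" "\<Union>(F ` T) = w ` \<Q>" by (meson finite_subset_image)
    have w\<Q>: "w ` \<Q> \<subseteq> carrier V" using wV \<Q>(1) by blast
    have "T \<subseteq> lin_span A V (w ` \<Q>)"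
    proof
      fix t assume "t \<in> T"
      then show "t \<in> lin_span A V (w ` \<Q>)" using F V.span_mono[of "F t" "w ` \<Q>"] \<Q>(3) by blast
    qed
    then have all: "lin_span A V (w ` \<P>) \<subseteq> lin_span A V (w ` \<Q>)"
      using T(3) V.span_minimal[OF V.span_submodule[OF w\<Q>]] by blast
    \<comment> \<open>If \<open>Q\<close> were not in \<open>\<Q>\<close>, some \<open>z\<close>
      outside \<open>Q\<close> would lie in all members of \<open>\<Q>\<close>. It would kill their
      elements \<open>w P\<close>, hence the common span, hence \<open>w Q\<close>, whose
      annihilator is \<open>Q\<close>.\<close>
    have "Q \<in> \<Q>" if Q: "Q \<in> \<P>" for Q
    proof (rule ccontr)
      assume nQ: "Q \<notin> \<Q>"
      have "\<exists>z\<in>carrier A. z \<notin> Q \<and> (\<forall>P\<in>\<Q>. z \<in> P)"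
      proof (rule prime_avoidance_aux[OF oneideal prime[OF Q] \<Q>(2)])
        show "\<not> carrier A \<subseteq> Q"
          using primeideal.I_notcarr[OF prime[OF Q]] ideal_subset[OF primeideal.axioms(1)[OF prime[OF Q]]]
          by blast
        show "ideal P A \<and> (\<exists>x\<in>carrier A \<inter> P. x \<notin> Q)" if P: "P \<in> \<Q>" for P
        proof -
          have PP: "P \<in> \<P>" using P \<Q>(1) by blast
          then have Pi: "ideal P A" using prime by (simp add: primeideal_def)
          have "\<not> P \<subseteq> Q"
          proof
            assume PQ: "P \<subseteq> Q"
            have 1: "Q \<in> ann ` NZ" and 2: "\<forall>Q\<in>ann ` NZ. P \<subseteq> Q \<longrightarrow> Q = P"
              using Q PP unfolding \<P>_def by blast+
            have "Q = P" by (rule bspec[OF 2 1, rule_format, OF PQ])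
            then show False using nQ P by simp
          qed
          then show ?thesis using Pi ideal_subset[OF Pi] by blast
        qed
      qed
      then obtain z where z: "z \<in> carrier A" "z \<notin> Q" "\<forall>P\<in>\<Q>. z \<in> P" by blast
      have "submodule {v \<in> carrier V. z \<odot>\<^bsub>V\<^esub> v = \<zero>\<^bsub>V\<^esub>} A V"
      proof (rule V.submodule_criterion)
        fix a x assume a: "a \<in> carrier A" and "x \<in> {v \<in> carrier V. z \<odot>\<^bsub>V\<^esub> v = \<zero>\<^bsub>V\<^esub>}"
        then have x: "x \<in> carrier V" "z \<odot>\<^bsub>V\<^esub> x = \<zero>\<^bsub>V\<^esub>" by auto
        show "a \<odot>\<^bsub>V\<^esub> x \<in> {v \<in> carrier V. z \<odot>\<^bsub>V\<^esub> v = \<zero>\<^bsub>V\<^esub>}"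
          using a x V.smult_left_commute[OF z(1) a x(1)] by simp
      qed (use z(1) in \<open>auto simp: V.smult_r_distr\<close>)
      moreover have "w ` \<Q> \<subseteq> {v \<in> carrier V. z \<odot>\<^bsub>V\<^esub> v = \<zero>\<^bsub>V\<^esub>}"
      proof
        fix v assume "v \<in> w ` \<Q>"
        then obtain P where P: "P \<in> \<Q>" "v = w P" by blast
        then have "z \<in> ann (w P)" using z(3) w \<Q>(1) by blast
        then show "v \<in> {v \<in> carrier V. z \<odot>\<^bsub>V\<^esub> v = \<zero>\<^bsub>V\<^esub>}" using P w\<Q> by (auto simp: ann_def)
      qed
      ultimately have "lin_span A V (w ` \<Q>) \<subseteq> {v \<in> carrier V. z \<odot>\<^bsub>V\<^esub> v = \<zero>\<^bsub>V\<^esub>}" by (rule V.span_minimal)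
      moreover have "w Q \<in> lin_span A V (w ` \<P>)" using V.span_superset Q by blast
      ultimately have "z \<odot>\<^bsub>V\<^esub> w Q = \<zero>\<^bsub>V\<^esub>" using all by blast
      then have "z \<in> ann (w Q)" using z(1) by (simp add: ann_def)
      then show False using z(2) w Q by blast
    qed
    then show ?thesis using \<Q>(2) by (metis finite_subset subsetI)
  qed
  have nsub: "\<not> I \<subseteq> P" if P: "P \<in> \<P>" for P
  proof
    assume IP: "I \<subseteq> P"
    obtain v where v: "v \<in> carrier V" "v \<noteq> \<zero>\<^bsub>V\<^esub>" "P = ann v" using P unfolding \<P>_def NZ_def by blast
    have "b \<odot>\<^bsub>V\<^esub> v = \<zero>\<^bsub>V\<^esub>" if "b \<in> I" for b using IP that v(3) by (auto simp: ann_def)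
    then show False using tf v by blast
  qed
  have "\<exists>x\<in>I. \<forall>P\<in>\<P>. x \<notin> P"
    by (rule prime_avoidance[OF I fin]) (intro conjI prime nsub)
  then obtain x where x: "x \<in> I" "\<forall>P\<in>\<P>. x \<notin> P" by blast
  show thesis
  proof (rule that[OF x(1)], rule ccontr)
    fix v assume v: "v \<in> carrier V" "x \<odot>\<^bsub>V\<^esub> v = \<zero>\<^bsub>V\<^esub>" "v \<noteq> \<zero>\<^bsub>V\<^esub>"
    have "x \<in> ann v" using v(2) x(1) ideal_subset[OF I] unfolding ann_def by blast
    moreover have "v \<in> NZ" using v unfolding NZ_def by blast
    then obtain P where "P \<in> \<P>" "ann v \<subseteq> P" using above by blast
    ultimately show False using x(2) by blast
  qed
qed

end

section \<open>Resolutions of \<open>A/I\<close> and chains of primes\<close>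

text \<open>Elements of F_j are row vectors, and \<open>D j\<close> multiplies them from the right.
  As F_0 is A, the two conditions on \<open>D 0\<close> say that the image of F_1 is
  \<open>I\<close>; with \<open>exact\<close> and \<open>D_comp\<close>, F is a free resolution of
  A/I.\<close>

locale ideal_resolution = matrix_complex A m D for A (structure) and m D +
  fixes I
  assumes ideal_I: "ideal I A" and m_0: "m 0 = 1"
    and D_0_mem: "k < m 1 \<Longrightarrow> D 0 k 0 \<in> I"
    and D_0_generate: "\<lbrakk>ideal J A; \<And>k. k < m 1 \<Longrightarrow> D 0 k 0 \<in> J\<rbrakk> \<Longrightarrow> I \<subseteq> J"
    and exact: "\<lbrakk>c \<in> {..<m (Suc j)} \<rightarrow> carrier A;
        \<And>l. l < m j \<Longrightarrow> (\<Oplus>k\<in>{..<m (Suc j)}. c k \<otimes> D j k l) = \<zero>\<rbrakk> \<Longrightarrow>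
      \<exists>c'\<in>{..<m (Suc (Suc j))} \<rightarrow> carrier A.
        \<forall>k<m (Suc j). c k = (\<Oplus>i\<in>{..<m (Suc (Suc j))}. c' i \<otimes> D (Suc j) i k)"
begin

text \<open>A homomorphism from A/I to V is an element of V killed by \<open>I\<close>; because
  \<open>m 0 = 1\<close>, a cocycle of degree 0 has only one relevant value.\<close>

lemma cocycle_0_iff:
  assumes V: "module A V"
  shows "cocycle V 0 v \<longleftrightarrow> v 0 \<in> carrier V \<and> (\<forall>b\<in>I. b \<odot>\<^bsub>V\<^esub> v 0 = \<zero>\<^bsub>V\<^esub>)"
proof -
  interpret V: module A V by fact
  have d: "diff V 0 v k = D 0 k 0 \<odot>\<^bsub>V\<^esub> v 0" if "v 0 \<in> carrier V" for k
    using that unfolding diff_def m_0 by (simp add: V.M.finsum_insert lessThan_Suc)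
  have "(\<forall>k<m 1. D 0 k 0 \<odot>\<^bsub>V\<^esub> v 0 = \<zero>\<^bsub>V\<^esub>) \<longleftrightarrow> (\<forall>b\<in>I. b \<odot>\<^bsub>V\<^esub> v 0 = \<zero>\<^bsub>V\<^esub>)" (is "?l \<longleftrightarrow> ?r")
    if v: "v 0 \<in> carrier V"
  proof
    assume ?l
    have "ideal {b \<in> carrier A. b \<odot>\<^bsub>V\<^esub> v 0 = \<zero>\<^bsub>V\<^esub>} A"
      by (rule ideal_criterion) (use v in \<open>auto simp: V.smult_l_distr V.smult_assoc1\<close>)
    from D_0_generate[OF this] \<open>?l\<close> show ?r by auto
  qed (simp add: D_0_mem)
  moreover have "v \<in> {..<m 0} \<rightarrow> carrier V \<longleftrightarrow> v 0 \<in> carrier V" by (auto simp: m_0)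
  ultimately show ?thesis unfolding cocycle_def using d by (cases "v 0 \<in> carrier V") simp_all
qed

lemma acyclic_at_0_iff:
  assumes V: "module A V"
  shows "acyclic_at V 0 \<longleftrightarrow> (\<forall>v\<in>carrier V. (\<forall>b\<in>I. b \<odot>\<^bsub>V\<^esub> v = \<zero>\<^bsub>V\<^esub>) \<longrightarrow> v = \<zero>\<^bsub>V\<^esub>)"
proof
  assume r: "\<forall>v\<in>carrier V. (\<forall>b\<in>I. b \<odot>\<^bsub>V\<^esub> v = \<zero>\<^bsub>V\<^esub>) \<longrightarrow> v = \<zero>\<^bsub>V\<^esub>"
  show "acyclic_at V 0"
    unfolding acyclic_at_def cocycle_0_iff[OF V] coboundary_def using r by (simp add: m_0)
next
  assume l: "acyclic_at V 0"
  show "\<forall>v\<in>carrier V. (\<forall>b\<in>I. b \<odot>\<^bsub>V\<^esub> v = \<zero>\<^bsub>V\<^esub>) \<longrightarrow> v = \<zero>\<^bsub>V\<^esub>"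
  proof (intro ballI impI)
    fix v assume "v \<in> carrier V" "\<forall>b\<in>I. b \<odot>\<^bsub>V\<^esub> v = \<zero>\<^bsub>V\<^esub>"
    then have "coboundary V 0 (\<lambda>_. v)" using l by (simp add: acyclic_at_def cocycle_0_iff[OF V])
    then show "v = \<zero>\<^bsub>V\<^esub>" by (simp add: coboundary_def m_0)
  qed
qed

end

section \<open>Nonzerodivisors and chains of primes\<close>

lemma nonzerodivisor_short_exact:
  fixes V :: "('a, 'v, 'y) module_scheme"
  assumes V: "module A V" and x: "x \<in> carrier A"
    and nzd: "\<And>v. v \<in> carrier V \<Longrightarrow> x \<odot>\<^bsub>V\<^esub> v = \<zero>\<^bsub>V\<^esub> \<Longrightarrow> v = \<zero>\<^bsub>V\<^esub>"
  obtains W :: "('a, 'v) module" and q where "short_exact A V V W (\<lambda>v. x \<odot>\<^bsub>V\<^esub> v) q"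
proof -
  interpret V: module A V by fact
  have f: "(\<lambda>v. x \<odot>\<^bsub>V\<^esub> v) \<in> module_hom A V V"
    using x by (intro mhomI) (auto simp: V.smult_r_distr V.smult_left_commute)
  have sub: "submodule ((\<lambda>v. x \<odot>\<^bsub>V\<^esub> v) ` carrier V) A V"
    by (rule submodule_image[OF V V f V.carrier_is_submodule])
  obtain W :: "('a, 'v) module" and q where W: "module A W" "q \<in> module_hom A V W"
    "q ` carrier V = carrier W"
    "\<And>v. v \<in> carrier V \<Longrightarrow> q v = \<zero>\<^bsub>W\<^esub> \<longleftrightarrow> v \<in> (\<lambda>v. x \<odot>\<^bsub>V\<^esub> v) ` carrier V"
    by (rule quotient_exists[OF V sub]) blast
  have "inj_on (\<lambda>v. x \<odot>\<^bsub>V\<^esub> v) (carrier V)"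
  proof (rule inj_onI)
    fix v w assume vw: "v \<in> carrier V" "w \<in> carrier V" "x \<odot>\<^bsub>V\<^esub> v = x \<odot>\<^bsub>V\<^esub> w"
    then have "x \<odot>\<^bsub>V\<^esub> (v \<ominus>\<^bsub>V\<^esub> w) = \<zero>\<^bsub>V\<^esub>"
      using x mhom_minus[OF V V f vw(1,2)] by (simp add: V.M.diff_self)
    then show "v = w" using nzd[of "v \<ominus>\<^bsub>V\<^esub> w"] vw V.M.diff_eq_zero by simp
  qed
  then have "short_exact A V V W (\<lambda>v. x \<odot>\<^bsub>V\<^esub> v) q"
    unfolding short_exact_def using V f W by simp
  then show thesis by (rule that)
qed

definition prime_chain :: "('a, 'x) ring_scheme \<Rightarrow> nat \<Rightarrow> (nat \<Rightarrow> 'a set) \<Rightarrow> bool"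
  where "prime_chain A n p \<longleftrightarrow> (\<forall>i\<le>n. primeideal (p i) A) \<and> (\<forall>i<n. p i \<subset> p (Suc i))"

text \<open>Nakayama's lemma for the localisation of \<open>V\<close> at \<open>P\<close>, with denominators cleared.\<close>

lemma (in cring) prime_nakayama:
  assumes P: "primeideal P R" and x: "x \<in> P" and V: "module R V"
    and "finite S" "S \<subseteq> carrier V" "s \<in> carrier R" "s \<notin> P"
    and "\<And>v. v \<in> S \<Longrightarrow> \<exists>u\<in>lin_span R V S. s \<odot>\<^bsub>V\<^esub> v = x \<odot>\<^bsub>V\<^esub> u"
  shows "\<exists>t\<in>carrier R. t \<notin> P \<and> (\<forall>v\<in>S. t \<odot>\<^bsub>V\<^esub> v = \<zero>\<^bsub>V\<^esub>)"
proof -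
  interpret V: module R V by fact
  have Pi: "ideal P R" using P by (simp add: primeideal_def)
  have xc: "x \<in> carrier R" using x ideal_subset[OF Pi] by blast
  show ?thesis
    using assms(4-)
  proof (induct S arbitrary: s set: finite)
    case empty
    then show ?case by auto
  next
    case (insert v S)
    have v: "v \<in> carrier V" and S: "S \<subseteq> carrier V" using insert by auto
    note subS = V.span_submodule[OF S]
    note SE = V.submoduleE[OF subS]
    have Sc: "u \<in> carrier V" if "u \<in> lin_span R V S" for u using SE(1) that by blast
    note s = insert.prems(2,3)
    obtain u where u: "u \<in> lin_span R V (insert v S)" "s \<odot>\<^bsub>V\<^esub> v = x \<odot>\<^bsub>V\<^esub> u"
      using insert.prems(4) by blast
    obtain c w where cw: "c \<in> carrier R" "w \<in> lin_span R V S" "u = c \<odot>\<^bsub>V\<^esub> v \<oplus>\<^bsub>V\<^esub> w"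
      by (rule V.span_insertD[OF S v u(1)])
    \<comment> \<open>Collecting the multiples of \<open>v\<close> in the equation for
      \<open>s v\<close> gives \<open>t v = x w\<close> with \<open>w\<close> in the span of the
      remaining generators. As \<open>x\<close> lies in \<open>P\<close> and \<open>s\<close> does
      not, \<open>t\<close> stays outside \<open>P\<close>.\<close>
    define t where "t = s \<ominus> x \<otimes> c"
    have tc: "t \<in> carrier R" using s cw xc by (simp add: t_def)
    have tP: "t \<notin> P"
    proof
      assume "t \<in> P"
      then have "t \<oplus> x \<otimes> c \<in> P" using ideal_add[OF Pi] ideal_mult'[OF Pi cw(1) x] by blast
      moreover have "t \<oplus> x \<otimes> c = s" unfolding t_def using s cw xc by (simp add: diff_add)
      ultimately show False using s by simp
    qed
    have tv: "t \<odot>\<^bsub>V\<^esub> v = x \<odot>\<^bsub>V\<^esub> w"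
    proof -
      have "t \<odot>\<^bsub>V\<^esub> v = s \<odot>\<^bsub>V\<^esub> v \<ominus>\<^bsub>V\<^esub> (x \<otimes> c) \<odot>\<^bsub>V\<^esub> v"
        unfolding t_def using s cw xc v by (simp add: minus_eq V.M.minus_eq V.smult_l_distr V.smult_l_minus)
      also have "s \<odot>\<^bsub>V\<^esub> v = x \<odot>\<^bsub>V\<^esub> w \<oplus>\<^bsub>V\<^esub> (x \<otimes> c) \<odot>\<^bsub>V\<^esub> v"
        unfolding u(2) cw(3) using cw xc v Sc by (simp add: V.smult_r_distr V.smult_assoc1 V.M.a_comm)
      finally show ?thesis using cw xc v Sc by (simp add: V.M.minus_eq V.M.a_assoc V.M.r_neg)
    qed
    have st: "s \<otimes> t \<in> carrier R" "s \<otimes> t \<notin> P"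
      using s tc tP primeideal.I_prime[OF P s(1) tc] by auto
    \<comment> \<open>A further factor \<open>t\<close> turns each \<open>t v\<close> on the right
      into \<open>x w\<close>, which removes \<open>v\<close>. The induction hypothesis then applies
      with \<open>s \<otimes> t\<close> as the denominator.\<close>
    have "\<exists>u\<in>lin_span R V S. (s \<otimes> t) \<odot>\<^bsub>V\<^esub> y = x \<odot>\<^bsub>V\<^esub> u" if y: "y \<in> S" for y
    proof -
      have yc: "y \<in> carrier V" using y S by blast
      obtain u where u: "u \<in> lin_span R V (insert v S)" "s \<odot>\<^bsub>V\<^esub> y = x \<odot>\<^bsub>V\<^esub> u"
        using insert.prems(4) y by blast
      obtain c' w' where cw': "c' \<in> carrier R" "w' \<in> lin_span R V S" "u = c' \<odot>\<^bsub>V\<^esub> v \<oplus>\<^bsub>V\<^esub> w'"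
        by (rule V.span_insertD[OF S v u(1)])
      have uc: "u \<in> carrier V" using cw' v Sc by simp
      have "(s \<otimes> t) \<odot>\<^bsub>V\<^esub> y = t \<odot>\<^bsub>V\<^esub> (x \<odot>\<^bsub>V\<^esub> u)"
        using s tc yc u(2) by (simp add: V.smult_assoc1 V.smult_left_commute[of s t])
      also have "\<dots> = x \<odot>\<^bsub>V\<^esub> (t \<odot>\<^bsub>V\<^esub> u)" using tc xc uc by (rule V.smult_left_commute)
      also have "t \<odot>\<^bsub>V\<^esub> u = c' \<odot>\<^bsub>V\<^esub> (t \<odot>\<^bsub>V\<^esub> v) \<oplus>\<^bsub>V\<^esub> t \<odot>\<^bsub>V\<^esub> w'"
        unfolding cw'(3) using tc cw' v Sc by (simp add: V.smult_r_distr V.smult_left_commute[of t c'])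
      finally have "(s \<otimes> t) \<odot>\<^bsub>V\<^esub> y = x \<odot>\<^bsub>V\<^esub> (c' \<odot>\<^bsub>V\<^esub> (x \<odot>\<^bsub>V\<^esub> w) \<oplus>\<^bsub>V\<^esub> t \<odot>\<^bsub>V\<^esub> w')" unfolding tv .
      moreover have "c' \<odot>\<^bsub>V\<^esub> (x \<odot>\<^bsub>V\<^esub> w) \<oplus>\<^bsub>V\<^esub> t \<odot>\<^bsub>V\<^esub> w' \<in> lin_span R V S"
        using SE(4,5) cw cw' tc xc by simp
      ultimately show ?thesis by blast
    qed
    then obtain t' where t': "t' \<in> carrier R" "t' \<notin> P" "\<forall>v\<in>S. t' \<odot>\<^bsub>V\<^esub> v = \<zero>\<^bsub>V\<^esub>"
      using insert.hyps(3)[OF S st] by blast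
    have "submodule {v \<in> carrier V. t' \<odot>\<^bsub>V\<^esub> v = \<zero>\<^bsub>V\<^esub>} R V"
      by (rule submodule_kernel[OF V V, of "\<lambda>v. t' \<odot>\<^bsub>V\<^esub> v"])
         (use t' in \<open>auto intro!: mhomI simp: V.smult_r_distr V.smult_left_commute\<close>)
    then have "w \<in> {v \<in> carrier V. t' \<odot>\<^bsub>V\<^esub> v = \<zero>\<^bsub>V\<^esub>}"
      using V.span_minimal[of _ S] t'(3) S cw(2) by blast
    then have tw: "t' \<odot>\<^bsub>V\<^esub> w = \<zero>\<^bsub>V\<^esub>" by simp
    have "(t' \<otimes> t) \<odot>\<^bsub>V\<^esub> v = \<zero>\<^bsub>V\<^esub>"
      using t' tc v tv tw cw xc Sc by (simp add: V.smult_assoc1 V.smult_left_commute[of t' x])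
    moreover have "(t' \<otimes> t) \<odot>\<^bsub>V\<^esub> y = \<zero>\<^bsub>V\<^esub>" if "y \<in> S" for y
      using t' tc that S by (auto simp: V.smult_assoc1 V.smult_left_commute[of t' t])
    moreover have "t' \<otimes> t \<notin> P" using primeideal.I_prime[OF P t'(1) tc] t'(2) tP by blast
    ultimately show ?case using t' tc by (intro bexI[of _ "t' \<otimes> t"]) auto
  qed
qed

text \<open>If some s outside \<open>P\<close> killed W = V/xV, then s V \<subseteq> x V, and
  Nakayama's lemma at \<open>P\<close> would produce an element outside \<open>P\<close> that kills
  V.\<close>

lemma (in cring) annihilator_quotient_subset_prime:
  assumes ses: "short_exact R V V W (\<lambda>v. x \<odot>\<^bsub>V\<^esub> v) q" and fg: "fin_gen R V"
    and P: "primeideal P R" and x: "x \<in> P" and annV: "annihilator R V \<subseteq> P"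
  shows "annihilator R W \<subseteq> P"
proof (rule subsetI, rule ccontr)
  have V: "module R V" and W: "module R W" and q: "q \<in> module_hom R V W"
    and ker: "\<forall>v\<in>carrier V. q v = \<zero>\<^bsub>W\<^esub> \<longleftrightarrow> v \<in> (\<lambda>v. x \<odot>\<^bsub>V\<^esub> v) ` carrier V"
    using ses by (simp_all add: short_exact_def)
  interpret V: module R V by (rule V)
  fix s assume s: "s \<in> annihilator R W" "s \<notin> P"
  then have sc: "s \<in> carrier R" by (simp add: annihilator_def)
  obtain S where S: "finite S" "S \<subseteq> carrier V" "carrier V \<subseteq> lin_span R V S"
    using fg unfolding fin_gen_def by blast
  have "\<exists>u\<in>lin_span R V S. s \<odot>\<^bsub>V\<^esub> v = x \<odot>\<^bsub>V\<^esub> u" if "v \<in> S" for v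
  proof -
    have v: "v \<in> carrier V" using that S(2) by blast
    then have "q (s \<odot>\<^bsub>V\<^esub> v) = \<zero>\<^bsub>W\<^esub>"
      using s(1) sc mhom_smult[OF q sc v] mhom_closed[OF q v] by (simp add: annihilator_def)
    then have "s \<odot>\<^bsub>V\<^esub> v \<in> (\<lambda>v. x \<odot>\<^bsub>V\<^esub> v) ` carrier V" using ker sc v by simp
    then show ?thesis using S(3) by blast
  qed
  from prime_nakayama[OF P x V S(1,2) sc s(2) this]
  obtain t where t: "t \<in> carrier R" "t \<notin> P" "\<forall>v\<in>S. t \<odot>\<^bsub>V\<^esub> v = \<zero>\<^bsub>V\<^esub>" by blast
  have "submodule {v \<in> carrier V. t \<odot>\<^bsub>V\<^esub> v = \<zero>\<^bsub>V\<^esub>} R V"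
    by (rule submodule_kernel[OF V V, of "\<lambda>v. t \<odot>\<^bsub>V\<^esub> v"])
       (use t in \<open>auto intro!: mhomI simp: V.smult_r_distr V.smult_left_commute\<close>)
  then have "carrier V \<subseteq> {v \<in> carrier V. t \<odot>\<^bsub>V\<^esub> v = \<zero>\<^bsub>V\<^esub>}"
    using V.span_minimal[of _ S] t(3) S(2,3) by blast
  then have "t \<in> annihilator R V" using t(1) by (auto simp: annihilator_def)
  then show False using annV t(2) by blast
qed

text \<open>The products x^n s with s outside \<open>P\<close> form a multiplicative set that misses
  the annihilator: if x^n s kills V then so does s, since \<open>x\<close> is a nonzerodivisor. A
  prime over the annihilator that misses this set lies in \<open>P\<close> and omits
  \<open>x\<close>.\<close>

lemma (in noetherian_cring) smaller_prime_exists: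
  assumes V: "module A V" and x: "x \<in> carrier A"
    and nzd: "\<And>v. v \<in> carrier V \<Longrightarrow> x \<odot>\<^bsub>V\<^esub> v = \<zero>\<^bsub>V\<^esub> \<Longrightarrow> v = \<zero>\<^bsub>V\<^esub>"
    and P: "primeideal P A" "annihilator A V \<subseteq> P" "x \<in> P"
  obtains Q where "primeideal Q A" "annihilator A V \<subseteq> Q" "Q \<subset> P"
proof -
  interpret V: module A V by fact
  define S where "S = {x [^] (n::nat) \<otimes> s | n s. s \<in> carrier A \<and> s \<notin> P}"
  have Pi: "ideal P A" using P(1) by (simp add: primeideal_def)
  have oneP: "\<one> \<notin> P" using primeideal.I_notcarr[OF P(1)] ideal.one_imp_carrier[OF Pi] by auto
  have disj: "annihilator A V \<inter> S = {}"
  proof (rule ccontr)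
    assume "annihilator A V \<inter> S \<noteq> {}"
    then obtain n :: nat and s where ns: "x [^] n \<otimes> s \<in> annihilator A V" "s \<in> carrier A" "s \<notin> P"
      unfolding S_def by blast
    have "s \<odot>\<^bsub>V\<^esub> v = \<zero>\<^bsub>V\<^esub>" if v: "v \<in> carrier V" for v
    proof -
      have "x [^] k \<odot>\<^bsub>V\<^esub> w = \<zero>\<^bsub>V\<^esub> \<Longrightarrow> w = \<zero>\<^bsub>V\<^esub>" if "w \<in> carrier V" for w and k :: nat
        using that
      proof (induct k)
        case (Suc k)
        then have "x \<odot>\<^bsub>V\<^esub> (x [^] k \<odot>\<^bsub>V\<^esub> w) = \<zero>\<^bsub>V\<^esub>"
          using x by (simp add: V.smult_assoc1[symmetric] m_comm)
        then show ?case using nzd[of "x [^] k \<odot>\<^bsub>V\<^esub> w"] Suc x by simp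
      qed simp
      moreover have "x [^] n \<odot>\<^bsub>V\<^esub> (s \<odot>\<^bsub>V\<^esub> v) = \<zero>\<^bsub>V\<^esub>"
        using ns v x by (simp add: annihilator_def V.smult_assoc1)
      ultimately show ?thesis using ns v by blast
    qed
    then have "s \<in> annihilator A V" using ns by (simp add: annihilator_def)
    then show False using P(2) ns by blast
  qed
  have id: "ideal (annihilator A V) A"
    using annihilator_ideal[OF V, of "carrier V"] by (simp add: annihilator_def)
  have S1: "\<one> \<in> S"
  proof -
    have "\<one> = x [^] (0::nat) \<otimes> \<one>" by simp
    then show ?thesis unfolding S_def using oneP one_closed by blast
  qed
  have S2: "s \<otimes> t \<in> S" if st: "s \<in> S" "t \<in> S" for s t
  proof -
    obtain n s' k t' where *: "s = x [^] (n::nat) \<otimes> s'" "s' \<in> carrier A" "s' \<notin> P"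
      "t = x [^] (k::nat) \<otimes> t'" "t' \<in> carrier A" "t' \<notin> P" using st unfolding S_def by blast
    have "s \<otimes> t = x [^] (n + k) \<otimes> (s' \<otimes> t')"
      using * x by (simp add: nat_pow_mult[symmetric] m_ac)
    moreover have "s' \<otimes> t' \<notin> P" using primeideal.I_prime[OF P(1) *(2,5)] * by blast
    ultimately show ?thesis unfolding S_def using * by blast
  qed
  obtain Q where Q: "primeideal Q A" "annihilator A V \<subseteq> Q" "Q \<inter> S = {}"
    by (rule exists_prime_disjoint[OF id S1 S2 disj])
  have Qc: "Q \<subseteq> carrier A" using Q(1) ideal_subset by (auto simp: primeideal_def)
  have "x \<notin> Q"
  proof
    assume "x \<in> Q"
    moreover have "x = x [^] (1::nat) \<otimes> \<one>" using x by simp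
    then have "x \<in> S" unfolding S_def using oneP one_closed by blast
    ultimately show False using Q(3) by blast
  qed
  moreover have "Q \<subseteq> P"
  proof (rule subsetI, rule ccontr)
    fix y assume y: "y \<in> Q" "y \<notin> P"
    have "y = x [^] (0::nat) \<otimes> y" using y Qc by auto
    then have "y \<in> S" unfolding S_def using y Qc by blast
    then show False using y Q(3) by blast
  qed
  ultimately show thesis using Q P(3) by (intro that[of Q]) auto
qed

locale noetherian_ideal_resolution = ideal_resolution A m D I + noetherian_cring A
  for A (structure) and m D I
begin

text \<open>Each nonzerodivisor taken from \<open>I\<close> uses up one vanishing degree, and it
  yields one more prime below the chain already found for the quotient.\<close>

lemma acyclic_prime_chain:
  fixes V :: "('a, 'v) module"
  assumes "module A V" "fin_gen A V" "\<And>j. j < n \<Longrightarrow> acyclic_at V j"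
    and P: "primeideal P A" "I \<subseteq> P" and "annihilator A V \<subseteq> P"
  shows "\<exists>p. prime_chain A n p \<and> p n = P \<and> annihilator A V \<subseteq> p 0"
  using assms(1-3,6)
proof (induct n arbitrary: V)
  case 0
  then show ?case using P by (intro exI[of _ "\<lambda>_. P"]) (simp add: prime_chain_def)
next
  case (Suc n)
  note V = Suc.prems(1)
  interpret V: module A V by (rule V)
  have "\<forall>v\<in>carrier V. (\<forall>b\<in>I. b \<odot>\<^bsub>V\<^esub> v = \<zero>\<^bsub>V\<^esub>) \<longrightarrow> v = \<zero>\<^bsub>V\<^esub>"
    using Suc.prems(3)[of 0] acyclic_at_0_iff[OF V] by simp
  then obtain x where x: "x \<in> I" "\<And>v. v \<in> carrier V \<Longrightarrow> x \<odot>\<^bsub>V\<^esub> v = \<zero>\<^bsub>V\<^esub> \<Longrightarrow> v = \<zero>\<^bsub>V\<^esub>"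
    using nonzerodivisor_exists[OF V Suc.prems(2) ideal_I] by metis
  have xc: "x \<in> carrier A" and xP: "x \<in> P" using x(1) ideal_subset[OF ideal_I] P(2) by auto
  obtain W :: "('a, 'v) module" and q where ses: "short_exact A V V W (\<lambda>v. x \<odot>\<^bsub>V\<^esub> v) q"
    by (rule nonzerodivisor_short_exact[OF V xc x(2)])
  have W: "module A W" "q \<in> module_hom A V W" "q ` carrier V = carrier W"
    using ses by (simp_all add: short_exact_def)
  have "fin_gen A W" by (rule fin_gen_image[OF V W Suc.prems(2)])
  moreover have "acyclic_at W j" if "j < n" for j
    using that by (intro acyclic_at_right[OF ses] Suc.prems(3)) auto
  moreover have "annihilator A W \<subseteq> P"
    by (rule annihilator_quotient_subset_prime[OF ses Suc.prems(2) P(1) xP Suc.prems(4)])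
  ultimately obtain p where p: "prime_chain A n p" "p n = P" "annihilator A W \<subseteq> p 0"
    using Suc.hyps[OF W(1)] by blast
  have q: "q (b \<odot>\<^bsub>V\<^esub> v) = \<zero>\<^bsub>W\<^esub>" if "b = x \<or> b \<in> annihilator A V" "v \<in> carrier V" for b v
  proof (cases "b = x")
    case True
    have "\<forall>v\<in>carrier V. q v = \<zero>\<^bsub>W\<^esub> \<longleftrightarrow> v \<in> (\<lambda>v. x \<odot>\<^bsub>V\<^esub> v) ` carrier V"
      using ses by (simp add: short_exact_def)
    then show ?thesis using True that(2) xc by blast
  next
    case False
    then have "b \<odot>\<^bsub>V\<^esub> v = \<zero>\<^bsub>V\<^esub>" using that by (simp add: annihilator_def)
    then show ?thesis by (simp add: mhom_zero[OF V W(1,2)])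
  qed
  have sub: "b \<in> annihilator A W" if b: "b = x \<or> b \<in> annihilator A V" for b
  proof -
    have bc: "b \<in> carrier A" using b xc by (auto simp: annihilator_def)
    have "b \<odot>\<^bsub>W\<^esub> w = \<zero>\<^bsub>W\<^esub>" if "w \<in> carrier W" for w
    proof -
      have "w \<in> q ` carrier V" using that W(3) by simp
      then obtain v where "w = q v" "v \<in> carrier V" by (rule imageE)
      then show ?thesis using q[OF b] mhom_smult[OF W(2) bc] by simp
    qed
    then show ?thesis using bc by (simp add: annihilator_def)
  qed
  \<comment> \<open>As \<open>x\<close> kills W, it lies in \<open>p 0\<close>; as it is a
    nonzerodivisor on V, there is a smaller prime over the annihilator of V, which is prepended to
    the chain.\<close>
  have p0: "primeideal (p 0) A" "annihilator A V \<subseteq> p 0" "x \<in> p 0"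
    using p(1,3) sub by (auto simp: prime_chain_def)
  obtain Q where Q: "primeideal Q A" "annihilator A V \<subseteq> Q" "Q \<subset> p 0"
    by (rule smaller_prime_exists[OF V xc x(2) p0])
  have "prime_chain A (Suc n) (case_nat Q p)"
    using p(1) Q unfolding prime_chain_def by (auto split: nat.split simp: less_Suc_eq_0_disj)
  then show ?case using p(2) Q(2) by (intro exI[of _ "case_nat Q p"]) simp
qed

end

section \<open>Primes of the ring of invariants\<close>

lemma (in cring) finprod_mem_ideal:
  assumes "ideal Q R" "finite I" "i \<in> I" "f i \<in> Q" "f \<in> I \<rightarrow> carrier R"
  shows "finprod R f I \<in> Q"
proof -
  have "finprod R f (insert i (I - {i})) = f i \<otimes> finprod R f (I - {i})"
    using assms by (intro finprod_insert) auto
  moreover have "finprod R f (I - {i}) \<in> carrier R" using assms by (intro finprod_closed) auto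
  ultimately show ?thesis using assms ideal_mult'[OF assms(1)] by (simp add: insert_absorb)
qed

lemma (in cring) finprod_mem_prime:
  assumes Q: "primeideal Q R" and "finite I" "f \<in> I \<rightarrow> carrier R" "finprod R f I \<in> Q"
  shows "\<exists>i\<in>I. f i \<in> Q"
  using assms(2-)
proof (induct I set: finite)
  case empty
  then show ?case using primeideal.I_notcarr[OF Q] ideal.one_imp_carrier[OF primeideal.axioms(1)[OF Q]] by auto
next
  case (insert i I)
  have c: "f i \<in> carrier R" "finprod R f I \<in> carrier R" using insert by (auto intro: finprod_closed)
  have "finprod R f (insert i I) = f i \<otimes> finprod R f I"
    using insert by (intro finprod_insert) auto
  then show ?case using primeideal.I_prime[OF Q c] insert by auto
qed

lemma (in cring) primeideal_pow:
  assumes Q: "primeideal Q R" and x: "x \<in> carrier R" and "x [^] (n::nat) \<in> Q"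
  shows "x \<in> Q"
  using assms(3)
proof (induct n)
  case 0
  then show ?case using primeideal.I_notcarr[OF Q] ideal.one_imp_carrier[OF primeideal.axioms(1)[OF Q]] by auto
next
  case (Suc n)
  then show ?case using primeideal.I_prime[OF Q, of "x [^] n" x] x by auto
qed

text \<open>Modulo \<open>y\<close> every factor equals \<open>s\<close>.\<close>

lemma (in cring) finprod_add_expand:
  assumes "finite I" "u \<in> I \<rightarrow> carrier R" "s \<in> carrier R" "y \<in> carrier R"
  shows "\<exists>t\<in>carrier R. finprod R (\<lambda>i. s \<oplus> y \<otimes> u i) I = s [^] card I \<oplus> y \<otimes> t"
  using assms(1,2)
proof (induct I set: finite)
  case empty
  then show ?case using assms by (intro bexI[of _ \<zero>]) auto
next
  case (insert i I)
  then obtain t where t: "t \<in> carrier R" "finprod R (\<lambda>i. s \<oplus> y \<otimes> u i) I = s [^] card I \<oplus> y \<otimes> t" by auto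
  have ui: "u i \<in> carrier R" using insert by auto
  have pc: "s [^] card I \<in> carrier R" using assms by simp
  have "finprod R (\<lambda>i. s \<oplus> y \<otimes> u i) (insert i I) = (s \<oplus> y \<otimes> u i) \<otimes> (s [^] card I \<oplus> y \<otimes> t)"
    unfolding t(2)[symmetric] using insert assms by (intro finprod_insert) auto
  also have "\<dots> = s \<otimes> s [^] card I \<oplus> y \<otimes> (s \<otimes> t \<oplus> u i \<otimes> (s [^] card I \<oplus> y \<otimes> t))"
    using t(1) ui pc assms by algebra
  also have "s \<otimes> s [^] card I = s [^] card (insert i I)" using insert assms by (simp add: m_comm)
  finally show ?case using t(1) ui pc assms
    by (intro bexI[of _ "s \<otimes> t \<oplus> u i \<otimes> (s [^] card I \<oplus> y \<otimes> t)"]) auto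
qed

context ring_action
begin

abbreviation "inv_ring \<equiv> invariant_ring G R \<phi>"

lemma inv_ring_simps [simp]:
  "carrier inv_ring = {a \<in> carrier R. \<forall>g\<in>carrier G. \<phi> g a = a}"
  "\<zero>\<^bsub>inv_ring\<^esub> = \<zero>\<^bsub>R\<^esub>" "\<one>\<^bsub>inv_ring\<^esub> = \<one>\<^bsub>R\<^esub>" "x \<oplus>\<^bsub>inv_ring\<^esub> y = x \<oplus>\<^bsub>R\<^esub> y" "x \<otimes>\<^bsub>inv_ring\<^esub> y = x \<otimes>\<^bsub>R\<^esub> y"
  by (simp_all add: invariant_ring_def)

lemma action_mult: "g \<in> carrier G \<Longrightarrow> a \<in> carrier R \<Longrightarrow> b \<in> carrier R \<Longrightarrow> \<phi> g (a \<otimes>\<^bsub>R\<^esub> b) = \<phi> g a \<otimes>\<^bsub>R\<^esub> \<phi> g b"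
  by (rule ring_hom_mult[OF ring_hom])

lemma action_add: "g \<in> carrier G \<Longrightarrow> a \<in> carrier R \<Longrightarrow> b \<in> carrier R \<Longrightarrow> \<phi> g (a \<oplus>\<^bsub>R\<^esub> b) = \<phi> g a \<oplus>\<^bsub>R\<^esub> \<phi> g b"
  by (rule ring_hom_add[OF ring_hom])

lemma action_unit: "g \<in> carrier G \<Longrightarrow> \<phi> g \<one>\<^bsub>R\<^esub> = \<one>\<^bsub>R\<^esub>"
  by (rule ring_hom_one[OF ring_hom])

lemma action_uminus: "g \<in> carrier G \<Longrightarrow> a \<in> carrier R \<Longrightarrow> \<phi> g (\<ominus>\<^bsub>R\<^esub> a) = \<ominus>\<^bsub>R\<^esub> \<phi> g a"
  using action_add[of g "\<ominus>\<^bsub>R\<^esub> a" a] R.minus_equality[of "\<phi> g (\<ominus>\<^bsub>R\<^esub> a)" "\<phi> g a"]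
  by (simp add: R.l_neg action_zero action_closed)

lemma subcring_invariants: "subcring {a \<in> carrier R. \<forall>g\<in>carrier G. \<phi> g a = a} R"
  by (intro R.subcringI' R.subringI)
     (auto simp: action_mult action_add action_unit action_uminus)

lemma cring_inv_ring: "cring inv_ring"
  unfolding invariant_ring_def using R.subcring_iff[of "{a \<in> carrier R. \<forall>g\<in>carrier G. \<phi> g a = a}"]
    subcring_invariants by blast

lemma ring_hom_ring_action: "g \<in> carrier G \<Longrightarrow> ring_hom_ring R R (\<phi> g)"
  by (intro ring_hom_ring.intro ring_hom_ring_axioms.intro ring_hom R.ring_axioms)

lemma action_inv: "g \<in> carrier G \<Longrightarrow> a \<in> carrier R \<Longrightarrow> \<phi> (inv g) (\<phi> g a) = a"
  "g \<in> carrier G \<Longrightarrow> a \<in> carrier R \<Longrightarrow> \<phi> g (\<phi> (inv g) a) = a"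
  using composition_rule[of a "inv g" g] composition_rule[of a g "inv g"] by (simp_all add: action_one)

text \<open>The substitute for integrality of R over its invariants: \<open>norm z\<close> is
  invariant and lies in every ideal of R that contains \<open>z\<close>.\<close>

definition norm :: "'c \<Rightarrow> 'c" where "norm z = finprod R (\<lambda>g. \<phi> g z) (carrier G)"

context
  assumes fin: "finite (carrier G)"
begin

lemma norm_invariant:
  assumes z: "z \<in> carrier R" shows "norm z \<in> carrier inv_ring"
proof -
  have "\<phi> h (norm z) = norm z" if h: "h \<in> carrier G" for h
  proof -
    interpret hh: ring_hom_ring R R "\<phi> h" by (rule ring_hom_ring_action[OF h])
    have "\<phi> h (finprod R (\<lambda>g. \<phi> g z) I) = finprod R (\<lambda>g. \<phi> (h \<otimes> g) z) I" if "finite I" "I \<subseteq> carrier G" for I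
      using that
    proof (induct I set: finite)
      case empty
      then show ?case by (simp add: action_unit h)
    next
      case (insert i I)
      have "\<phi> h (finprod R (\<lambda>g. \<phi> g z) (insert i I)) = \<phi> h (\<phi> i z \<otimes>\<^bsub>R\<^esub> finprod R (\<lambda>g. \<phi> g z) I)"
        using insert z by (subst R.finprod_insert) (auto simp: action_closed)
      also have "\<dots> = \<phi> (h \<otimes> i) z \<otimes>\<^bsub>R\<^esub> finprod R (\<lambda>g. \<phi> (h \<otimes> g) z) I"
        using insert z h by (subst action_mult) (auto simp: action_closed composition_rule intro!: R.finprod_closed)
      also have "\<dots> = finprod R (\<lambda>g. \<phi> (h \<otimes> g) z) (insert i I)"
        using insert z h by (intro R.finprod_insert[symmetric]) (auto simp: action_closed)
      finally show ?case .
    qed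
    then have "\<phi> h (norm z) = finprod R (\<lambda>g. \<phi> (h \<otimes> g) z) (carrier G)" unfolding norm_def using fin by simp
    also have "\<dots> = finprod R (\<lambda>g. \<phi> g z) ((\<lambda>g. h \<otimes> g) ` carrier G)"
      using h z by (intro R.finprod_reindex[symmetric]) (auto simp: action_closed inj_on_def)
    also have "(\<lambda>g. h \<otimes> g) ` carrier G = carrier G" using h by (rule G.surj_const_mult)
    finally show ?thesis by (simp add: norm_def)
  qed
  moreover have "norm z \<in> carrier R" unfolding norm_def using z by (intro R.finprod_closed) (auto simp: action_closed)
  ultimately show ?thesis by simp
qed

lemma norm_mem_ideal: "ideal Q R \<Longrightarrow> z \<in> Q \<Longrightarrow> norm z \<in> Q"
  unfolding norm_def using fin ideal_subset[of Q R]
  by (intro R.finprod_mem_ideal[where i = "\<one>"]) (auto simp: action_one action_closed)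

lemma norm_of_invariant: "a \<in> carrier inv_ring \<Longrightarrow> norm a = a [^]\<^bsub>R\<^esub> card (carrier G)"
  unfolding norm_def by (subst R.finprod_const[symmetric]) (auto intro!: R.finprod_cong')

lemma norm_mult: "y \<in> carrier inv_ring \<Longrightarrow> t \<in> carrier R \<Longrightarrow>
    norm (y \<otimes>\<^bsub>R\<^esub> t) = y [^]\<^bsub>R\<^esub> card (carrier G) \<otimes>\<^bsub>R\<^esub> norm t"
proof -
  assume y: "y \<in> carrier inv_ring" and t: "t \<in> carrier R"
  have "norm (y \<otimes>\<^bsub>R\<^esub> t) = finprod R (\<lambda>g. \<phi> g y \<otimes>\<^bsub>R\<^esub> \<phi> g t) (carrier G)"
    unfolding norm_def using y t by (intro R.finprod_cong') (auto simp: action_mult action_closed)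
  also have "\<dots> = norm y \<otimes>\<^bsub>R\<^esub> norm t" unfolding norm_def
    using y t by (intro R.finprod_multf) (auto simp: action_closed)
  finally show ?thesis using norm_of_invariant[OF y] by simp
qed

lemma card_pos: "card (carrier G) > 0"
  using fin G.one_closed card_gt_0_iff by blast

lemma inv_ring_pow: "a [^]\<^bsub>inv_ring\<^esub> (n::nat) = a [^]\<^bsub>R\<^esub> n"
  by (simp add: nat_pow_def invariant_ring_def)

text \<open>The product of \<open>y\<close> and \<open>t\<close> is invariant, so its power with
  exponent |G| is its norm. That norm is the same power of \<open>y\<close> times the norm of
  \<open>t\<close>, so it lies in \<open>p\<close>.\<close>

lemma prime_contract_mult:
  assumes p: "primeideal p inv_ring" and y: "y \<in> p" and t: "t \<in> carrier R"
    and yt: "y \<otimes>\<^bsub>R\<^esub> t \<in> carrier inv_ring"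
  shows "y \<otimes>\<^bsub>R\<^esub> t \<in> p"
proof -
  interpret A: cring inv_ring by (rule cring_inv_ring)
  have pi: "ideal p inv_ring" using p by (simp add: primeideal_def)
  have yA: "y \<in> carrier inv_ring" using y ideal_subset[OF pi] by blast
  obtain n where n: "card (carrier G) = Suc n" using card_pos by (metis gr0_conv_Suc)
  have "(y \<otimes>\<^bsub>R\<^esub> t) [^]\<^bsub>inv_ring\<^esub> card (carrier G) = y [^]\<^bsub>inv_ring\<^esub> card (carrier G) \<otimes>\<^bsub>inv_ring\<^esub> norm t"
    using norm_mult[OF yA t] norm_of_invariant[OF yt] by (simp add: inv_ring_pow)
  also have "\<dots> = (y [^]\<^bsub>inv_ring\<^esub> n \<otimes>\<^bsub>inv_ring\<^esub> y) \<otimes>\<^bsub>inv_ring\<^esub> norm t" unfolding n by simp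
  also have "\<dots> \<in> p"
    using ideal_mult[OF pi A.nat_pow_closed[OF yA] y] ideal_mult'[OF pi norm_invariant[OF t]] by blast
  finally show ?thesis by (rule A.primeideal_pow[OF p yt])
qed

text \<open>Let \<open>Q\<close> contain \<open>J\<close> and be maximal among the ideals that miss
  the invariants outside \<open>p\<close>. If some \<open>y\<close> in \<open>p\<close> were not in
  \<open>Q\<close>, maximality would give s = q + y r with q in \<open>Q\<close> and s an invariant
  outside \<open>p\<close>. Modulo \<open>y\<close> the norm of q is a power of s; this norm is an
  invariant in \<open>Q\<close>, hence in \<open>p\<close>, which forces s into
  \<open>p\<close>.\<close>

lemma lying_over:
  assumes R: "noetherian_ring R" and J: "ideal J R" and p: "primeideal p inv_ring"
    and Jp: "J \<inter> carrier inv_ring \<subseteq> p"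
  obtains Q where "primeideal Q R" "J \<subseteq> Q" "Q \<inter> carrier inv_ring = p"
proof -
  interpret A: cring inv_ring by (rule cring_inv_ring)
  interpret RN: noetherian_cring R by (intro noetherian_cring.intro R R.cring_axioms)
  have pi: "ideal p inv_ring" using p by (simp add: primeideal_def)
  have pA: "p \<subseteq> carrier inv_ring" by (rule ideal_subset[OF pi])
  have onep: "\<one>\<^bsub>R\<^esub> \<notin> p" using primeideal.I_notcarr[OF p] ideal.one_imp_carrier[OF pi] by auto
  define S where "S = carrier inv_ring - p"
  have S1: "\<one>\<^bsub>R\<^esub> \<in> S" using A.one_closed onep unfolding S_def by simp
  have S2: "s \<otimes>\<^bsub>R\<^esub> t \<in> S" if "s \<in> S" "t \<in> S" for s t
    using that primeideal.I_prime[OF p, of s t] A.m_closed[of s t] unfolding S_def by auto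
  have JS: "J \<inter> S = {}" using Jp unfolding S_def by blast
  obtain Q where Q: "primeideal Q R" "J \<subseteq> Q" "Q \<inter> S = {}"
    and mx: "\<And>K. ideal K R \<Longrightarrow> Q \<subset> K \<Longrightarrow> K \<inter> S \<noteq> {}"
    using RN.exists_prime_disjoint[OF J S1 S2 JS] by metis
  have Qi: "ideal Q R" using Q(1) by (simp add: primeideal_def)
  have "y \<in> Q" if y: "y \<in> p" for y
  proof (rule ccontr)
    assume yQ: "y \<notin> Q"
    have yA: "y \<in> carrier inv_ring" using y pA by blast
    then have yc: "y \<in> carrier R" by simp
    have "Q \<subset> {q \<oplus>\<^bsub>R\<^esub> y \<otimes>\<^bsub>R\<^esub> r | q r. q \<in> Q \<and> r \<in> carrier R}"
      using R.ideal_adjoin(2,3)[OF Qi yc] yQ by blast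
    from mx[OF R.ideal_adjoin(1)[OF Qi yc] this] obtain q r
      where qr: "q \<in> Q" "r \<in> carrier R" "q \<oplus>\<^bsub>R\<^esub> y \<otimes>\<^bsub>R\<^esub> r \<in> S" by blast
    define s where "s = q \<oplus>\<^bsub>R\<^esub> y \<otimes>\<^bsub>R\<^esub> r"
    have qc: "q \<in> carrier R" using qr(1) ideal_subset[OF Qi] by blast
    have sA: "s \<in> carrier inv_ring" and sp: "s \<notin> p" using qr(3) unfolding s_def S_def by auto
    have sc: "s \<in> carrier R" using sA by simp
    have q: "q = s \<oplus>\<^bsub>R\<^esub> y \<otimes>\<^bsub>R\<^esub> (\<ominus>\<^bsub>R\<^esub> r)"
      unfolding s_def using qc qr(2) yc by (simp add: R.r_minus R.a_assoc R.r_neg)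
    have "norm q = finprod R (\<lambda>g. s \<oplus>\<^bsub>R\<^esub> y \<otimes>\<^bsub>R\<^esub> \<phi> g (\<ominus>\<^bsub>R\<^esub> r)) (carrier G)"
      unfolding norm_def
    proof (rule R.finprod_cong')
      fix g assume g: "g \<in> carrier G"
      show "\<phi> g q = s \<oplus>\<^bsub>R\<^esub> y \<otimes>\<^bsub>R\<^esub> \<phi> g (\<ominus>\<^bsub>R\<^esub> r)"
        using g sA yA qr(2) by (subst q) (simp add: action_add action_mult action_closed)
    qed (use sc yc qr(2) in \<open>auto simp: action_closed\<close>)
    then obtain t where t: "t \<in> carrier R" "norm q = s [^]\<^bsub>R\<^esub> card (carrier G) \<oplus>\<^bsub>R\<^esub> y \<otimes>\<^bsub>R\<^esub> t"
      using R.finprod_add_expand[OF fin _ sc yc, of "\<lambda>g. \<phi> g (\<ominus>\<^bsub>R\<^esub> r)"] qr(2) by (auto simp: action_closed)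
    have NqA: "norm q \<in> carrier inv_ring" by (rule norm_invariant[OF qc])
    have "norm q \<in> Q" by (rule norm_mem_ideal[OF Qi qr(1)])
    then have Nqp: "norm q \<in> p" using NqA Q(3) unfolding S_def by blast
    have snA: "s [^]\<^bsub>R\<^esub> card (carrier G) \<in> carrier inv_ring"
      using A.nat_pow_closed[OF sA] unfolding inv_ring_pow .
    have ytc: "y \<otimes>\<^bsub>R\<^esub> t \<in> carrier R" using yc t by simp
    \<comment> \<open>The element \<open>t\<close> is arbitrary, but its product with
      \<open>y\<close> is the difference of two invariants, the norm of \<open>q\<close> and a power
      of \<open>s\<close>.\<close>
    have "y \<otimes>\<^bsub>R\<^esub> t \<in> carrier inv_ring"
    proof -
      have "\<phi> g (y \<otimes>\<^bsub>R\<^esub> t) = y \<otimes>\<^bsub>R\<^esub> t" if g: "g \<in> carrier G" for g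
      proof -
        have snc: "s [^]\<^bsub>R\<^esub> card (carrier G) \<in> carrier R" "\<phi> g (s [^]\<^bsub>R\<^esub> card (carrier G)) = s [^]\<^bsub>R\<^esub> card (carrier G)"
          using snA g by auto
        have "\<phi> g (norm q) = norm q" using NqA g by simp
        then have "s [^]\<^bsub>R\<^esub> card (carrier G) \<oplus>\<^bsub>R\<^esub> \<phi> g (y \<otimes>\<^bsub>R\<^esub> t) = s [^]\<^bsub>R\<^esub> card (carrier G) \<oplus>\<^bsub>R\<^esub> y \<otimes>\<^bsub>R\<^esub> t"
          unfolding t(2) using action_add[OF g snc(1) ytc] snc(2) by simp
        then show ?thesis using snc(1) ytc action_closed[OF g ytc] R.add.l_cancel by blast
      qed
      then show ?thesis using ytc by simp
    qed
    then have ytp: "y \<otimes>\<^bsub>R\<^esub> t \<in> p" by (rule prime_contract_mult[OF p y t(1)])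
    then have "norm q \<ominus>\<^bsub>inv_ring\<^esub> y \<otimes>\<^bsub>R\<^esub> t \<in> p" using ideal_minus[OF pi Nqp] by blast
    moreover have "norm q \<ominus>\<^bsub>inv_ring\<^esub> y \<otimes>\<^bsub>R\<^esub> t = s [^]\<^bsub>inv_ring\<^esub> card (carrier G)"
    proof -
      have "norm q = s [^]\<^bsub>inv_ring\<^esub> card (carrier G) \<oplus>\<^bsub>inv_ring\<^esub> y \<otimes>\<^bsub>R\<^esub> t"
        using t(2) by (simp add: inv_ring_pow)
      moreover have "s [^]\<^bsub>inv_ring\<^esub> card (carrier G) \<in> carrier inv_ring" "y \<otimes>\<^bsub>R\<^esub> t \<in> carrier inv_ring"
        using A.nat_pow_closed[OF sA] ytp pA by blast+
      ultimately show ?thesis by (simp only: A.minus_eq A.a_assoc A.a_inv_closed A.r_neg A.r_zero)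
    qed
    ultimately have "s \<in> p" using A.primeideal_pow[OF p sA] by simp
    then show False using sp by blast
  qed
  moreover have "Q \<inter> carrier inv_ring \<subseteq> p" using Q(3) unfolding S_def by blast
  ultimately have "Q \<inter> carrier inv_ring = p" using pA by blast
  then show thesis by (rule that[OF Q(1,2)])
qed

text \<open>Going up: lying over is applied with the last prime already lifted in place of
  \<open>J\<close>.\<close>

lemma prime_chain_lift:
  assumes R: "noetherian_ring R" and J: "ideal J R" and p: "prime_chain inv_ring n p"
    and Jp: "J \<inter> carrier inv_ring \<subseteq> p 0"
  shows "\<exists>q. prime_chain R n q \<and> J \<subseteq> q 0 \<and> (\<forall>i\<le>n. q i \<inter> carrier inv_ring = p i)"
  using p
proof (induct n)
  case 0
  then have "primeideal (p 0) inv_ring" by (simp add: prime_chain_def)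
  from lying_over[OF R J this Jp] obtain Q where "primeideal Q R" "J \<subseteq> Q" "Q \<inter> carrier inv_ring = p 0" .
  then show ?case by (intro exI[of _ "\<lambda>_. Q"]) (simp add: prime_chain_def)
next
  case (Suc n)
  have p: "prime_chain inv_ring n p" "primeideal (p (Suc n)) inv_ring" "p n \<subset> p (Suc n)"
    using Suc.prems by (simp_all add: prime_chain_def)
  obtain q where q: "prime_chain R n q" "J \<subseteq> q 0" "\<forall>i\<le>n. q i \<inter> carrier inv_ring = p i"
    using Suc.hyps p(1) by blast
  have "ideal (q n) R" using q(1) by (simp add: prime_chain_def primeideal_def)
  moreover have qn: "q n \<inter> carrier inv_ring = p n" using q(3) by simp
  then have "q n \<inter> carrier inv_ring \<subseteq> p (Suc n)" using p(3) by blast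
  ultimately obtain Q where Q: "primeideal Q R" "q n \<subseteq> Q" "Q \<inter> carrier inv_ring = p (Suc n)"
    using lying_over[OF R _ p(2)] by metis
  have "q n \<subset> Q" using Q(2,3) qn p(3) by blast
  then have "prime_chain R (Suc n) (q(Suc n := Q))"
    using q(1) Q(1) unfolding prime_chain_def by (auto simp: le_Suc_eq less_Suc_eq)
  moreover have "\<forall>i\<le>Suc n. (q(Suc n := Q)) i \<inter> carrier inv_ring = p i"
    using q(3) Q(3) by (auto simp: le_Suc_eq)
  moreover have "J \<subseteq> (q(Suc n := Q)) 0" using q(2) by simp
  ultimately show ?case by blast
qed

text \<open>A lifted chain ends in some prime over \<open>p n\<close>, which may differ from
  \<open>P\<close>. Translating the chain by a suitable group element moves its top into
  \<open>P\<close> and keeps it above the stable ideal \<open>J\<close>.\<close>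

lemma prime_chain_lift_to:
  assumes R: "noetherian_ring R" and J: "ideal J R" and p: "prime_chain inv_ring n p"
    and Jp: "J \<inter> carrier inv_ring \<subseteq> p 0"
    and stable: "\<And>g a. g \<in> carrier G \<Longrightarrow> a \<in> J \<Longrightarrow> \<phi> g a \<in> J"
    and P: "primeideal P R" "P \<inter> carrier inv_ring = p n"
  shows "\<exists>q. prime_chain R n q \<and> J \<subseteq> q 0 \<and> q n = P"
proof -
  obtain q where q: "prime_chain R n q" "J \<subseteq> q 0" "\<forall>i\<le>n. q i \<inter> carrier inv_ring = p i"
    using prime_chain_lift[OF R J p Jp] by blast
  define pb where "pb g Q = {x \<in> carrier R. \<phi> g x \<in> Q}" for g Q
  have pb: "primeideal (pb g Q) R" if "g \<in> carrier G" "primeideal Q R" for g Q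
    unfolding pb_def by (rule ring_hom_ring.primeideal_vimage[OF ring_hom_ring_action R.cring_axioms]) (use that in auto)
  have qi: "ideal (q i) R" if "i \<le> n" for i using q(1) that by (simp add: prime_chain_def primeideal_def)
  have "\<exists>g\<in>carrier G. q n \<subseteq> pb g P"
  proof (rule ccontr)
    assume "\<not> (\<exists>g\<in>carrier G. q n \<subseteq> pb g P)"
    \<comment> \<open>Prime avoidance would give an \<open>x\<close> in \<open>q n\<close> with no
      conjugate in \<open>P\<close>. But its norm is an invariant in \<open>q n\<close>, so it lies
      in \<open>p n\<close> and in \<open>P\<close>, and one of its factors lies in
      \<open>P\<close>.\<close>
    then have "\<exists>x\<in>q n. \<forall>P'\<in>(\<lambda>g. pb g P) ` carrier G. x \<notin> P'"
      using fin pb P(1) by (intro R.prime_avoidance qi) auto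
    then obtain x where x: "x \<in> q n" "\<And>g. g \<in> carrier G \<Longrightarrow> x \<notin> pb g P" by blast
    have xc: "x \<in> carrier R" using x(1) ideal_subset[OF qi] by blast
    have "norm x \<in> q n" by (rule norm_mem_ideal[OF qi x(1)]) simp
    then have "norm x \<in> P" using norm_invariant[OF xc] q(3) P(2) by blast
    then have "\<exists>g\<in>carrier G. \<phi> g x \<in> P" unfolding norm_def
      by (intro R.finprod_mem_prime[OF P(1) fin]) (use xc in \<open>auto simp: action_closed\<close>)
    then show False using x(2) xc by (auto simp: pb_def)
  qed
  then obtain g where g: "g \<in> carrier G" "q n \<subseteq> pb g P" by blast
  note gi = G.inv_closed[OF g(1)]
  define q' where "q' i = pb (inv g) (q i)" for i
  have q'n: "q' n \<subseteq> P"
  proof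
    fix x assume "x \<in> q' n"
    then have x: "x \<in> carrier R" "\<phi> (inv g) x \<in> q n" by (auto simp: q'_def pb_def)
    then have "\<phi> (inv g) x \<in> pb g P" using g(2) by blast
    then show "x \<in> P" using action_inv(2)[OF g(1) x(1)] by (simp add: pb_def)
  qed
  have prime: "primeideal (q' i) R" if "i \<le> n" for i
    unfolding q'_def using q(1) that by (intro pb gi) (simp add: prime_chain_def)
  have strict: "q' i \<subset> q' (Suc i)" if i: "i < n" for i
  proof -
    have qq: "q i \<subset> q (Suc i)" using q(1) i by (simp add: prime_chain_def)
    then obtain y where y: "y \<in> q (Suc i)" "y \<notin> q i" by blast
    have yc: "y \<in> carrier R" using y(1) ideal_subset[OF qi[of "Suc i"]] i by auto
    have "\<phi> g y \<in> q' (Suc i)" "\<phi> g y \<notin> q' i"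
      using y yc g(1) by (simp_all add: q'_def pb_def action_inv action_closed)
    moreover have "q' i \<subseteq> q' (Suc i)" using qq by (auto simp: q'_def pb_def)
    ultimately show ?thesis by blast
  qed
  have J': "J \<subseteq> q' 0"
  proof
    fix x assume x: "x \<in> J"
    then show "x \<in> q' 0" using stable[OF gi x] q(2) ideal_subset[OF J] by (auto simp: q'_def pb_def)
  qed
  have strict': "q' i \<subset> P" if "Suc i = n" for i using strict[of i] that q'n by auto
  \<comment> \<open>Only the inclusion of the translated top in \<open>P\<close> has been
    established, so the top is replaced by \<open>P\<close> itself; strictness of the last inclusion
    is inherited.\<close>
  have "prime_chain R n (q'(n := P))"
    unfolding prime_chain_def using prime strict strict' P(1) by auto
  moreover have "J \<subseteq> (q'(n := P)) 0" using J' q'n by auto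
  moreover have "(q'(n := P)) n = P" by simp
  ultimately show ?thesis by blast
qed

end

end

section \<open>Existence of free resolutions\<close>

text \<open>Extensional functions, so that a row vector is determined by its entries. The cochains
  of \<open>matrix_complex\<close> are left unnormalised.\<close>

definition free_module :: "('a, 'x) ring_scheme \<Rightarrow> nat \<Rightarrow> ('a, nat \<Rightarrow> 'a) module"
  where "free_module A q =
    \<lparr>carrier = {..<q} \<rightarrow>\<^sub>E carrier A, monoid.mult = undefined, one = undefined,
     ring.zero = (\<lambda>l\<in>{..<q}. \<zero>\<^bsub>A\<^esub>), add = (\<lambda>x y. \<lambda>l\<in>{..<q}. x l \<oplus>\<^bsub>A\<^esub> y l),
     smult = (\<lambda>a x. \<lambda>l\<in>{..<q}. a \<otimes>\<^bsub>A\<^esub> x l)\<rparr>"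

definition free_unit :: "('a, 'x) ring_scheme \<Rightarrow> nat \<Rightarrow> nat \<Rightarrow> nat \<Rightarrow> 'a"
  where "free_unit A q k = (\<lambda>l\<in>{..<q}. if l = k then \<one>\<^bsub>A\<^esub> else \<zero>\<^bsub>A\<^esub>)"

context cring
begin

lemma free_module_simps [simp]:
  "carrier (free_module R q) = {..<q} \<rightarrow>\<^sub>E carrier R"
  "\<zero>\<^bsub>free_module R q\<^esub> = (\<lambda>l\<in>{..<q}. \<zero>)"
  "x \<oplus>\<^bsub>free_module R q\<^esub> y = (\<lambda>l\<in>{..<q}. x l \<oplus> y l)"
  "a \<odot>\<^bsub>free_module R q\<^esub> x = (\<lambda>l\<in>{..<q}. a \<otimes> x l)"
  by (simp_all add: free_module_def)

lemma free_module_is_module: "module R (free_module R q)"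
proof -
  have mem: "x l \<in> carrier R" if "x \<in> {..<q} \<rightarrow>\<^sub>E carrier R" "l < q" for x l using that by auto
  have out: "x l = undefined" if "x \<in> {..<q} \<rightarrow>\<^sub>E carrier R" "\<not> l < q" for x l
    using that by (auto intro: PiE_arb)
  have "abelian_group (free_module R q)"
  proof (rule abelian_groupI)
    fix x assume x: "x \<in> carrier (free_module R q)"
    show "\<zero>\<^bsub>free_module R q\<^esub> \<oplus>\<^bsub>free_module R q\<^esub> x = x"
      using x by (intro ext) (simp add: restrict_def mem out)
    have "(\<lambda>l\<in>{..<q}. \<ominus> x l) \<oplus>\<^bsub>free_module R q\<^esub> x = \<zero>\<^bsub>free_module R q\<^esub>"
      using x by (intro ext) (simp add: restrict_def mem l_neg)
    then show "\<exists>y\<in>carrier (free_module R q). y \<oplus>\<^bsub>free_module R q\<^esub> x = \<zero>\<^bsub>free_module R q\<^esub>"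
      using x by (intro bexI[of _ "\<lambda>l\<in>{..<q}. \<ominus> x l"]) (simp_all add: mem)
    fix y assume y: "y \<in> carrier (free_module R q)"
    show "x \<oplus>\<^bsub>free_module R q\<^esub> y \<in> carrier (free_module R q)" using x y by (simp add: mem)
    show "x \<oplus>\<^bsub>free_module R q\<^esub> y = y \<oplus>\<^bsub>free_module R q\<^esub> x"
      using x y by (intro ext) (simp add: restrict_def mem a_comm)
    fix z assume z: "z \<in> carrier (free_module R q)"
    show "x \<oplus>\<^bsub>free_module R q\<^esub> y \<oplus>\<^bsub>free_module R q\<^esub> z = x \<oplus>\<^bsub>free_module R q\<^esub> (y \<oplus>\<^bsub>free_module R q\<^esub> z)"
      using x y z by (intro ext) (simp add: restrict_def mem a_assoc)
  qed simp
  then show ?thesis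
  proof (rule moduleI[OF is_cring])
    show "a \<odot>\<^bsub>free_module R q\<^esub> x \<in> carrier (free_module R q)" if "a \<in> carrier R" "x \<in> carrier (free_module R q)" for a x
      using that by (simp add: mem)
    show "(a \<oplus> b) \<odot>\<^bsub>free_module R q\<^esub> x = a \<odot>\<^bsub>free_module R q\<^esub> x \<oplus>\<^bsub>free_module R q\<^esub> b \<odot>\<^bsub>free_module R q\<^esub> x"
      if "a \<in> carrier R" "b \<in> carrier R" "x \<in> carrier (free_module R q)" for a b x
      using that by (intro ext) (simp add: restrict_def mem l_distr)
    show "a \<odot>\<^bsub>free_module R q\<^esub> (x \<oplus>\<^bsub>free_module R q\<^esub> y) = a \<odot>\<^bsub>free_module R q\<^esub> x \<oplus>\<^bsub>free_module R q\<^esub> a \<odot>\<^bsub>free_module R q\<^esub> y"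
      if "a \<in> carrier R" "x \<in> carrier (free_module R q)" "y \<in> carrier (free_module R q)" for a x y
      using that by (intro ext) (simp add: restrict_def mem r_distr)
    show "(a \<otimes> b) \<odot>\<^bsub>free_module R q\<^esub> x = a \<odot>\<^bsub>free_module R q\<^esub> (b \<odot>\<^bsub>free_module R q\<^esub> x)"
      if "a \<in> carrier R" "b \<in> carrier R" "x \<in> carrier (free_module R q)" for a b x
      using that by (intro ext) (simp add: restrict_def mem m_assoc)
    show "\<one> \<odot>\<^bsub>free_module R q\<^esub> x = x" if "x \<in> carrier (free_module R q)" for x
      using that by (intro ext) (simp add: restrict_def mem out)
  qed
qed

lemma free_unit_closed: "free_unit R q k \<in> carrier (free_module R q)"
  by (auto simp: free_unit_def)

lemma free_module_finsum_apply:
  assumes "finite I" "f \<in> I \<rightarrow> carrier (free_module R q)" "l < q"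
  shows "(\<Oplus>\<^bsub>free_module R q\<^esub>i\<in>I. f i) l = (\<Oplus>i\<in>I. f i l)"
proof -
  interpret F: module R "free_module R q" by (rule free_module_is_module)
  show ?thesis
    using assms(1,2)
  proof (induct I set: finite)
    case empty
    then show ?case using assms(3) by simp
  next
    case (insert i I)
    have f: "f \<in> I \<rightarrow> carrier (free_module R q)" "f i \<in> carrier (free_module R q)" using insert.prems by auto
    have "(\<Oplus>\<^bsub>free_module R q\<^esub>i\<in>insert i I. f i) = f i \<oplus>\<^bsub>free_module R q\<^esub> (\<Oplus>\<^bsub>free_module R q\<^esub>i\<in>I. f i)"
      using insert.hyps f by (intro F.M.finsum_insert)
    then have "(\<Oplus>\<^bsub>free_module R q\<^esub>i\<in>insert i I. f i) l = f i l \<oplus> (\<Oplus>\<^bsub>free_module R q\<^esub>i\<in>I. f i) l"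
      using assms(3) by simp
    also have "\<dots> = f i l \<oplus> (\<Oplus>i\<in>I. f i l)" using insert.hyps(3)[OF f(1)] by simp
    also have "\<dots> = (\<Oplus>i\<in>insert i I. f i l)"
      using insert.hyps f assms(3) by (intro finsum_insert[symmetric]) auto
    finally show ?case .
  qed
qed

lemma free_module_hom_expand:
  assumes V: "module R V" and h: "h \<in> module_hom R (free_module R q) V" and x: "x \<in> carrier (free_module R q)"
  shows "h x = (\<Oplus>\<^bsub>V\<^esub>l\<in>{..<q}. x l \<odot>\<^bsub>V\<^esub> h (free_unit R q l))"
proof -
  interpret V: module R V by fact
  note F = free_module_is_module
  have xl: "x l \<in> carrier R" if "l < q" for l using x that by auto
  \<comment> \<open>The vector is built up coordinate by coordinate: induction on the number n of
    coordinates not yet replaced by 0.\<close>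
  have "h (\<lambda>l\<in>{..<q}. if l < n then x l else \<zero>) = (\<Oplus>\<^bsub>V\<^esub>l\<in>{..<n}. x l \<odot>\<^bsub>V\<^esub> h (free_unit R q l))"
    if "n \<le> q" for n
    using that
  proof (induct n)
    case 0
    have "h (\<lambda>l\<in>{..<q}. if l < 0 then x l else \<zero>) = h \<zero>\<^bsub>free_module R q\<^esub>" by (rule arg_cong[of _ _ h]) simp
    also have "\<dots> = \<zero>\<^bsub>V\<^esub>" by (rule mhom_zero[OF F V h])
    finally have e: "h (\<lambda>l\<in>{..<q}. if l < 0 then x l else \<zero>) = \<zero>\<^bsub>V\<^esub>" .
    show ?case unfolding e by simp
  next
    case (Suc n)
    let ?t = "\<lambda>n. \<lambda>l\<in>{..<q}. if l < n then x l else \<zero>"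
    have n: "n < q" using Suc.prems by simp
    have c: "?t n \<in> carrier (free_module R q)" using xl by auto
    have e: "?t (Suc n) = x n \<odot>\<^bsub>free_module R q\<^esub> free_unit R q n \<oplus>\<^bsub>free_module R q\<^esub> ?t n"
      using xl n by (auto simp: free_unit_def less_Suc_eq intro!: restrict_ext)
    have xu: "x n \<odot>\<^bsub>free_module R q\<^esub> free_unit R q n \<in> carrier (free_module R q)"
      by (rule module.smult_closed[OF F xl[OF n] free_unit_closed])
    have "h (?t (Suc n)) = x n \<odot>\<^bsub>V\<^esub> h (free_unit R q n) \<oplus>\<^bsub>V\<^esub> h (?t n)"
      unfolding e mhom_add[OF h xu c] mhom_smult[OF h xl[OF n] free_unit_closed] ..
    also have "h (?t n) = (\<Oplus>\<^bsub>V\<^esub>l\<in>{..<n}. x l \<odot>\<^bsub>V\<^esub> h (free_unit R q l))"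
      by (rule Suc.hyps) (use n in simp)
    also have "x n \<odot>\<^bsub>V\<^esub> h (free_unit R q n) \<oplus>\<^bsub>V\<^esub> (\<Oplus>\<^bsub>V\<^esub>l\<in>{..<n}. x l \<odot>\<^bsub>V\<^esub> h (free_unit R q l))
        = (\<Oplus>\<^bsub>V\<^esub>l\<in>{..<Suc n}. x l \<odot>\<^bsub>V\<^esub> h (free_unit R q l))"
      unfolding lessThan_Suc using xl n mhom_closed[OF h free_unit_closed]
      by (intro V.M.finsum_insert[symmetric]) (auto intro!: V.smult_closed)
    finally show ?case .
  qed
  from this[of q] have "h (\<lambda>l\<in>{..<q}. if l < q then x l else \<zero>) = (\<Oplus>\<^bsub>V\<^esub>l\<in>{..<q}. x l \<odot>\<^bsub>V\<^esub> h (free_unit R q l))"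
    by simp
  moreover have "x l = undefined" if "\<not> l < q" for l using x that by (simp add: PiE_arb[of x "{..<q}"])
  then have "(\<lambda>l\<in>{..<q}. if l < q then x l else \<zero>) = x"
    by (intro ext) (simp add: restrict_def)
  ultimately show ?thesis by simp
qed

lemma free_module_fin_gen: "fin_gen R (free_module R q)"
proof -
  interpret F: module R "free_module R q" by (rule free_module_is_module)
  let ?S = "free_unit R q ` {..<q}"
  have S: "?S \<subseteq> carrier (free_module R q)" using free_unit_closed by blast
  note sub = F.span_submodule[OF S]
  have id: "(\<lambda>x. x) \<in> module_hom R (free_module R q) (free_module R q)" by (rule mhomI) auto
  have "x \<in> lin_span R (free_module R q) ?S" if x: "x \<in> carrier (free_module R q)" for x
  proof -
    have mem: "(\<Oplus>\<^bsub>free_module R q\<^esub>l\<in>{..<q}. x l \<odot>\<^bsub>free_module R q\<^esub> free_unit R q l) \<in> lin_span R (free_module R q) ?S"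
    proof (rule F.submodule_finsum_mem[OF sub])
      show "(\<lambda>l. x l \<odot>\<^bsub>free_module R q\<^esub> free_unit R q l) \<in> {..<q} \<rightarrow> lin_span R (free_module R q) ?S"
      proof
        fix l assume l: "l \<in> {..<q}"
        have "x l \<in> carrier R" using x l by auto
        moreover have "free_unit R q l \<in> lin_span R (free_module R q) ?S"
          using F.span_superset[of ?S] l by blast
        ultimately show "x l \<odot>\<^bsub>free_module R q\<^esub> free_unit R q l \<in> lin_span R (free_module R q) ?S"
          by (rule F.submoduleE(4)[OF sub])
      qed
    qed simp
    show ?thesis by (subst free_module_hom_expand[OF free_module_is_module id x]) (rule mem)
  qed
  then show ?thesis unfolding fin_gen_def using S by (intro exI[of _ ?S]) auto
qed

lemma lincomb_hom:
  assumes V: "module R V" and w: "w \<in> {..<p} \<rightarrow> carrier V"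
  shows "(\<lambda>c. \<Oplus>\<^bsub>V\<^esub>k\<in>{..<p}. c k \<odot>\<^bsub>V\<^esub> w k) \<in> module_hom R (free_module R p) V"
proof -
  interpret V: module R V by fact
  have w': "w k \<in> carrier V" if "k < p" for k using w that by auto
  have cm: "c k \<in> carrier R" if "c \<in> {..<p} \<rightarrow>\<^sub>E carrier R" "k < p" for c k using that by auto
  show ?thesis
  proof (rule mhomI)
    fix x assume x: "x \<in> carrier (free_module R p)"
    then show "(\<Oplus>\<^bsub>V\<^esub>k\<in>{..<p}. x k \<odot>\<^bsub>V\<^esub> w k) \<in> carrier V"
      using w' by (intro V.M.finsum_closed) auto
    fix y assume y: "y \<in> carrier (free_module R p)"
    have "(\<Oplus>\<^bsub>V\<^esub>k\<in>{..<p}. (x \<oplus>\<^bsub>free_module R p\<^esub> y) k \<odot>\<^bsub>V\<^esub> w k)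
        = (\<Oplus>\<^bsub>V\<^esub>k\<in>{..<p}. x k \<odot>\<^bsub>V\<^esub> w k \<oplus>\<^bsub>V\<^esub> y k \<odot>\<^bsub>V\<^esub> w k)"
      using w' x y by (intro V.M.finsum_cong') (auto simp: V.smult_l_distr cm)
    also have "\<dots> = (\<Oplus>\<^bsub>V\<^esub>k\<in>{..<p}. x k \<odot>\<^bsub>V\<^esub> w k) \<oplus>\<^bsub>V\<^esub> (\<Oplus>\<^bsub>V\<^esub>k\<in>{..<p}. y k \<odot>\<^bsub>V\<^esub> w k)"
      using w' x y by (intro V.M.finsum_addf) (auto simp: cm)
    finally show "(\<Oplus>\<^bsub>V\<^esub>k\<in>{..<p}. (x \<oplus>\<^bsub>free_module R p\<^esub> y) k \<odot>\<^bsub>V\<^esub> w k)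
      = (\<Oplus>\<^bsub>V\<^esub>k\<in>{..<p}. x k \<odot>\<^bsub>V\<^esub> w k) \<oplus>\<^bsub>V\<^esub> (\<Oplus>\<^bsub>V\<^esub>k\<in>{..<p}. y k \<odot>\<^bsub>V\<^esub> w k)" .
  next
    fix a x assume a: "a \<in> carrier R" and x: "x \<in> carrier (free_module R p)"
    have "(\<Oplus>\<^bsub>V\<^esub>k\<in>{..<p}. (a \<odot>\<^bsub>free_module R p\<^esub> x) k \<odot>\<^bsub>V\<^esub> w k)
        = (\<Oplus>\<^bsub>V\<^esub>k\<in>{..<p}. a \<odot>\<^bsub>V\<^esub> (x k \<odot>\<^bsub>V\<^esub> w k))"
      using w' a x by (intro V.M.finsum_cong') (auto simp: V.smult_assoc1 cm)
    also have "\<dots> = a \<odot>\<^bsub>V\<^esub> (\<Oplus>\<^bsub>V\<^esub>k\<in>{..<p}. x k \<odot>\<^bsub>V\<^esub> w k)"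
      using w' a x by (intro V.finsum_smult_ldistr[symmetric]) (auto simp: cm)
    finally show "(\<Oplus>\<^bsub>V\<^esub>k\<in>{..<p}. (a \<odot>\<^bsub>free_module R p\<^esub> x) k \<odot>\<^bsub>V\<^esub> w k)
      = a \<odot>\<^bsub>V\<^esub> (\<Oplus>\<^bsub>V\<^esub>k\<in>{..<p}. x k \<odot>\<^bsub>V\<^esub> w k)" .
  qed
qed

lemma row_combination_apply:
  fixes p q :: nat
  assumes "\<And>k l. D k l \<in> carrier R" "c \<in> {..<p} \<rightarrow> carrier R" "l < q"
  shows "(\<Oplus>\<^bsub>free_module R q\<^esub>k\<in>{..<p}. c k \<odot>\<^bsub>free_module R q\<^esub> (\<lambda>l\<in>{..<q}. D k l)) l
    = (\<Oplus>k\<in>{..<p}. c k \<otimes> D k l)"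
proof -
  have "(\<Oplus>\<^bsub>free_module R q\<^esub>k\<in>{..<p}. c k \<odot>\<^bsub>free_module R q\<^esub> (\<lambda>l\<in>{..<q}. D k l)) l
      = (\<Oplus>k\<in>{..<p}. (c k \<odot>\<^bsub>free_module R q\<^esub> (\<lambda>l\<in>{..<q}. D k l)) l)"
    by (rule free_module_finsum_apply) (use assms in \<open>auto simp: Pi_def\<close>)
  also have "\<dots> = (\<Oplus>k\<in>{..<p}. c k \<otimes> D k l)"
    using assms by (intro finsum_cong') (auto simp: Pi_def)
  finally show ?thesis .
qed

end

section \<open>Linear systems over injective modules\<close>

lemma module_hom_factor:
  assumes P: "module A P" and Q: "module A Q" and E: "module A E"
    and f: "f \<in> module_hom A P Q" and g: "g \<in> module_hom A P E"
    and ker: "\<And>x. x \<in> carrier P \<Longrightarrow> f x = \<zero>\<^bsub>Q\<^esub> \<Longrightarrow> g x = \<zero>\<^bsub>E\<^esub>"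
  shows "\<exists>h\<in>module_hom A (Q\<lparr>carrier := f ` carrier P\<rparr>) E. \<forall>x\<in>carrier P. h (f x) = g x"
proof -
  interpret P: module A P by fact
  interpret Q: module A Q by fact
  interpret E: module A E by fact
  define h where "h y = g (SOME x. x \<in> carrier P \<and> f x = y)" for y
  have h: "h (f x) = g x" if x: "x \<in> carrier P" for x
  proof -
    define x' where "x' = (SOME x'. x' \<in> carrier P \<and> f x' = f x)"
    have x': "x' \<in> carrier P" "f x' = f x" unfolding x'_def using someI[of "\<lambda>x'. x' \<in> carrier P \<and> f x' = f x" x] x by auto
    then have "f (x' \<ominus>\<^bsub>P\<^esub> x) = \<zero>\<^bsub>Q\<^esub>" using x mhom_closed[OF f x]
      by (simp add: mhom_minus[OF P Q f] Q.M.diff_self)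
    then have "g x' \<ominus>\<^bsub>E\<^esub> g x = \<zero>\<^bsub>E\<^esub>" using ker[of "x' \<ominus>\<^bsub>P\<^esub> x"] x x' by (simp add: mhom_minus[OF P E g])
    then have "g x' = g x" using E.M.diff_eq_zero mhom_closed[OF g] x x' by blast
    then show ?thesis by (simp add: h_def x'_def)
  qed
  have "h \<in> module_hom A (Q\<lparr>carrier := f ` carrier P\<rparr>) E"
    by (rule mhomI)
       (auto simp: h mhom_closed[OF g] mhom_add[OF f, symmetric] mhom_add[OF g]
          mhom_smult[OF f, symmetric] mhom_smult[OF g])
  then show ?thesis using h by blast
qed

text \<open>By consistency, sending row k of \<open>D\<close> to \<open>w k\<close> is well defined
  on the span of the rows. Injectivity extends this map to the free module, and its values at the
  unit vectors solve the system. The extension takes place on a copy of the free module in the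
  element type of \<open>E\<close>, for which \<open>enc\<close> makes room. Injectivity is used
  below only in this form.\<close>

lemma (in cring) injective_solves_system:
  fixes p q :: nat and E :: "('a, 'e) module" and enc :: "(nat \<Rightarrow> 'a) \<Rightarrow> 'e"
  assumes E: "injective_module R E" and enc: "inj_on enc ({..<q} \<rightarrow>\<^sub>E carrier R)"
    and D: "\<And>k l. D k l \<in> carrier R" and w: "w \<in> {..<p} \<rightarrow> carrier E"
    and consistent: "\<And>c. \<lbrakk>c \<in> {..<p} \<rightarrow> carrier R; \<And>l. l < q \<Longrightarrow> (\<Oplus>k\<in>{..<p}. c k \<otimes> D k l) = \<zero>\<rbrakk> \<Longrightarrow>
      (\<Oplus>\<^bsub>E\<^esub>k\<in>{..<p}. c k \<odot>\<^bsub>E\<^esub> w k) = \<zero>\<^bsub>E\<^esub>"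
  shows "\<exists>u\<in>{..<q} \<rightarrow> carrier E. \<forall>k<p. w k = (\<Oplus>\<^bsub>E\<^esub>l\<in>{..<q}. D k l \<odot>\<^bsub>E\<^esub> u l)"
proof -
  have Em: "module R E" using E by (simp add: injective_module_def)
  interpret E: module R E by (rule Em)
  note F = free_module_is_module
  define row where "row k = (\<lambda>l\<in>{..<q}. D k l)" for k
  define comb where "comb c = (\<Oplus>\<^bsub>free_module R q\<^esub>k\<in>{..<p}. c k \<odot>\<^bsub>free_module R q\<^esub> row k)" for c
  have rowc: "row k \<in> carrier (free_module R q)" for k using D by (auto simp: row_def)
  have comb: "comb \<in> module_hom R (free_module R p) (free_module R q)"
    unfolding comb_def using rowc by (intro lincomb_hom F) auto
  obtain N :: "('a, 'e) module" where N: "module R N" "carrier N = enc ` carrier (free_module R q)"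
    "enc \<in> module_hom R (free_module R q) N"
    by (rule module_transport[OF F, of enc q]) (use enc in auto)
  define f where "f c = enc (comb c)" for c
  have f: "f \<in> module_hom R (free_module R p) N"
    unfolding f_def by (rule mhom_compose[OF comb N(3)])
  define g where "g c = (\<Oplus>\<^bsub>E\<^esub>k\<in>{..<p}. c k \<odot>\<^bsub>E\<^esub> w k)" for c
  have g: "g \<in> module_hom R (free_module R p) E"
    unfolding g_def by (rule lincomb_hom[OF Em w])
  have ker: "g c = \<zero>\<^bsub>E\<^esub>" if c: "c \<in> carrier (free_module R p)" "f c = \<zero>\<^bsub>N\<^esub>" for c
  proof -
    have "enc (comb c) = enc \<zero>\<^bsub>free_module R q\<^esub>"
      using c(2) mhom_zero[OF F N(1,3)] by (simp add: f_def)
    then have z: "comb c = \<zero>\<^bsub>free_module R q\<^esub>"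
      using inj_onD[OF enc, of "comb c" "\<zero>\<^bsub>free_module R q\<^esub>"] mhom_closed[OF comb c(1)]
        F[of q, THEN module.axioms(2), THEN abelian_group.axioms(1), THEN abelian_monoid.zero_closed] by simp
    have "(\<Oplus>k\<in>{..<p}. c k \<otimes> D k l) = \<zero>" if l: "l < q" for l
    proof -
      have "comb c l = (\<Oplus>k\<in>{..<p}. c k \<otimes> D k l)"
        unfolding comb_def row_def using c(1) D l by (intro row_combination_apply) auto
      then show ?thesis using l by (simp add: z)
    qed
    then show ?thesis unfolding g_def using c(1) by (intro consistent) auto
  qed
  obtain h where h: "h \<in> module_hom R (N\<lparr>carrier := f ` carrier (free_module R p)\<rparr>) E"
    "\<And>c. c \<in> carrier (free_module R p) \<Longrightarrow> h (f c) = g c"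
    using module_hom_factor[OF F N(1) Em f g ker] by blast
  have "submodule (f ` carrier (free_module R p)) R N"
    by (rule submodule_image[OF F N(1) f module.carrier_is_submodule[OF F]])
  then obtain h' where h': "h' \<in> module_hom R N E" "\<And>y. y \<in> f ` carrier (free_module R p) \<Longrightarrow> h' y = h y"
    using E N(1) h(1) unfolding injective_module_def by blast
  have k: "(\<lambda>x. h' (enc x)) \<in> module_hom R (free_module R q) E" by (rule mhom_compose[OF N(3) h'(1)])
  define u where "u l = h' (enc (free_unit R q l))" for l
  have "w k = (\<Oplus>\<^bsub>E\<^esub>l\<in>{..<q}. D k l \<odot>\<^bsub>E\<^esub> u l)" if kp: "k < p" for k
  proof -
    note un = free_unit_closed[of p k]
    have u1: "(\<Oplus>\<^bsub>V\<^esub>i\<in>{..<p}. free_unit R p k i \<odot>\<^bsub>V\<^esub> y i) = y k"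
      if "module R V" "y \<in> {..<p} \<rightarrow> carrier V" for V :: "('a, 'v) module" and y
    proof -
      interpret V: module R V by fact
      have yc: "y i \<in> carrier V" if "i < p" for i using \<open>y \<in> {..<p} \<rightarrow> carrier V\<close> that by auto
      have "(\<Oplus>\<^bsub>V\<^esub>i\<in>{..<p}. free_unit R p k i \<odot>\<^bsub>V\<^esub> y i) = (\<Oplus>\<^bsub>V\<^esub>i\<in>{..<p}. if k = i then y i else \<zero>\<^bsub>V\<^esub>)"
        using yc kp by (intro V.M.finsum_cong') (auto simp: free_unit_def)
      also have "\<dots> = y k" using V.M.finsum_singleton[of k "{..<p}" y] that(2) kp by simp
      finally show ?thesis .
    qed
    have "f (free_unit R p k) = enc (row k)"
      unfolding f_def comb_def using u1[OF F, of row] rowc by simp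
    moreover have "g (free_unit R p k) = w k" unfolding g_def using u1[OF Em w] .
    ultimately have "h' (enc (row k)) = w k" using h(2)[OF un] h'(2)[OF imageI[OF un]] by simp
    also have "h' (enc (row k)) = (\<Oplus>\<^bsub>E\<^esub>l\<in>{..<q}. row k l \<odot>\<^bsub>E\<^esub> u l)"
      using free_module_hom_expand[OF Em k rowc[of k]] by (simp add: u_def)
    also have "\<dots> = (\<Oplus>\<^bsub>E\<^esub>l\<in>{..<q}. D k l \<odot>\<^bsub>E\<^esub> u l)"
      using D mhom_closed[OF k free_unit_closed] by (intro E.M.finsum_cong') (auto simp: row_def u_def)
    finally show ?thesis by simp
  qed
  moreover have "u \<in> {..<q} \<rightarrow> carrier E" using mhom_closed[OF k free_unit_closed] by (auto simp: u_def)
  ultimately show ?thesis by blast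
qed

lemma finite_enumerate_set:
  assumes "finite S" obtains p :: nat and w where "S = w ` {..<p}"
  using assms finite_imp_nat_seg_image_inj_on[of S] by (metis lessThan_def)

section \<open>Construction of the free resolution\<close>

context noetherian_cring
begin

text \<open>The relations between the rows of \<open>D\<close> form a submodule of a finitely
  generated free module, so finitely many of them, the rows of \<open>D'\<close>, generate
  all.\<close>

lemma kernel_generators:
  fixes p q :: nat
  assumes D: "\<And>k l. D k l \<in> carrier A"
  shows "\<exists>(p' :: nat) D'. (\<forall>k l. D' k l \<in> carrier A) \<and>
    (\<forall>i<p'. \<forall>l<q. (\<Oplus>k\<in>{..<p}. D' i k \<otimes> D k l) = \<zero>) \<and>
    (\<forall>c\<in>{..<p} \<rightarrow> carrier A. (\<forall>l<q. (\<Oplus>k\<in>{..<p}. c k \<otimes> D k l) = \<zero>) \<longrightarrow>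
      (\<exists>c'\<in>{..<p'} \<rightarrow> carrier A. \<forall>k<p. c k = (\<Oplus>i\<in>{..<p'}. c' i \<otimes> D' i k)))"
proof -
  note F = free_module_is_module
  interpret F: module A "free_module A p" by (rule F)
  define comb where "comb c = (\<Oplus>\<^bsub>free_module A q\<^esub>k\<in>{..<p}. c k \<odot>\<^bsub>free_module A q\<^esub> (\<lambda>l\<in>{..<q}. D k l))" for c
  have comb: "comb \<in> module_hom A (free_module A p) (free_module A q)"
    unfolding comb_def using D by (intro lincomb_hom F) auto
  define K where "K = {c \<in> carrier (free_module A p). comb c = \<zero>\<^bsub>free_module A q\<^esub>}"
  have K_iff: "c \<in> K \<longleftrightarrow> c \<in> carrier (free_module A p) \<and> (\<forall>l<q. (\<Oplus>k\<in>{..<p}. c k \<otimes> D k l) = \<zero>)" for c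
  proof -
    have "comb c = \<zero>\<^bsub>free_module A q\<^esub> \<longleftrightarrow> (\<forall>l<q. (\<Oplus>k\<in>{..<p}. c k \<otimes> D k l) = \<zero>)"
      if c: "c \<in> carrier (free_module A p)"
    proof -
      have "comb c l = (\<Oplus>k\<in>{..<p}. c k \<otimes> D k l)" if "l < q" for l
        unfolding comb_def using c D that by (intro row_combination_apply) auto
      moreover have "comb c \<in> extensional {..<q}" using mhom_closed[OF comb c] by (auto simp: PiE_def)
      ultimately show ?thesis by (auto intro!: extensionalityI[of _ "{..<q}"])
    qed
    then show ?thesis unfolding K_def by blast
  qed
  have K: "submodule K A (free_module A p)" unfolding K_def by (rule submodule_kernel[OF F F comb])
  obtain T where T: "finite T" "T \<subseteq> K" "K \<subseteq> lin_span A (free_module A p) T"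
    using fin_gen_submodule(1)[OF F free_module_fin_gen K] by blast
  obtain p' :: nat and w where w: "T = w ` {..<p'}" by (rule finite_enumerate_set[OF T(1)])
  \<comment> \<open>Padded with zeros, because \<open>D_closed\<close> asks for entries in the
    carrier at all indices.\<close>
  define D' where "D' i k = (if i < p' \<and> k < p then w i k else \<zero>)" for i k
  have wK: "w i \<in> K" if "i < p'" for i using T(2) that unfolding w by auto
  have wc: "w i \<in> carrier (free_module A p)" if "i < p'" for i
    using wK[OF that] unfolding K_def by blast
  have D': "D' i k \<in> carrier A" for i k using wc[of i] by (auto simp: D'_def)
  have wD: "w i = (\<lambda>k\<in>{..<p}. D' i k)" if "i < p'" for i
  proof -
    have "w i k = undefined" if "\<not> k < p" for k
      using wc[OF \<open>i < p'\<close>] that by (simp add: PiE_arb[of "w i" "{..<p}"])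
    then show ?thesis using that by (intro ext) (simp add: restrict_def D'_def)
  qed
  have 1: "(\<Oplus>k\<in>{..<p}. D' i k \<otimes> D k l) = \<zero>" if "i < p'" "l < q" for i l
  proof -
    have "(\<Oplus>k\<in>{..<p}. D' i k \<otimes> D k l) = (\<Oplus>k\<in>{..<p}. w i k \<otimes> D k l)"
      using that D D' by (intro finsum_cong') (auto simp: wD)
    then show ?thesis using wK[OF that(1)] that(2) K_iff[of "w i"] by simp
  qed
  have 2: "\<exists>c'\<in>{..<p'} \<rightarrow> carrier A. \<forall>k<p. c k = (\<Oplus>i\<in>{..<p'}. c' i \<otimes> D' i k)"
    if c: "c \<in> {..<p} \<rightarrow> carrier A" "\<forall>l<q. (\<Oplus>k\<in>{..<p}. c k \<otimes> D k l) = \<zero>" for c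
  proof -
    let ?c = "\<lambda>k\<in>{..<p}. c k"
    have "(\<Oplus>k\<in>{..<p}. ?c k \<otimes> D k l) = (\<Oplus>k\<in>{..<p}. c k \<otimes> D k l)" for l
      using c(1) D by (intro finsum_cong') (auto simp: Pi_def)
    then have "?c \<in> K" using c by (auto simp: K_iff)
    then have "?c \<in> lin_span A (free_module A p) (w ` {..<p'})" using T(3) unfolding w by blast
    moreover have "w \<in> {..<p'} \<rightarrow> carrier (free_module A p)" using wc by blast
    ultimately obtain c' where c': "c' \<in> {..<p'} \<rightarrow> carrier A"
      "?c = (\<Oplus>\<^bsub>free_module A p\<^esub>i\<in>{..<p'}. c' i \<odot>\<^bsub>free_module A p\<^esub> w i)"
      using F.span_lincomb by blast
    have "c k = (\<Oplus>i\<in>{..<p'}. c' i \<otimes> D' i k)" if k: "k < p" for k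
    proof -
      have "?c = (\<Oplus>\<^bsub>free_module A p\<^esub>i\<in>{..<p'}. c' i \<odot>\<^bsub>free_module A p\<^esub> (\<lambda>k\<in>{..<p}. D' i k))"
        unfolding c'(2) using c'(1) D' wD
        by (intro F.M.finsum_cong') (auto simp: Pi_def)
      then have "?c k = (\<Oplus>\<^bsub>free_module A p\<^esub>i\<in>{..<p'}. c' i \<odot>\<^bsub>free_module A p\<^esub> (\<lambda>k\<in>{..<p}. D' i k)) k"
        by (rule arg_cong)
      also have "\<dots> = (\<Oplus>i\<in>{..<p'}. c' i \<otimes> D' i k)" by (rule row_combination_apply[OF D' c'(1) k])
      finally show ?thesis using k by simp
    qed
    then show ?thesis using c'(1) by blast
  qed
  show ?thesis
    by (rule exI[of _ p'], rule exI[of _ D'], intro conjI allI ballI impI) (blast intro: D' 1 2)+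
qed

lemma ideal_resolution_exists:
  assumes I: "ideal I A"
  obtains m D where "noetherian_ideal_resolution A m D I"
proof -
  obtain B where B: "finite B" "B \<subseteq> I" "\<And>J. ideal J A \<Longrightarrow> B \<subseteq> J \<Longrightarrow> I \<subseteq> J"
    by (rule ideal_generators[OF I]) blast
  obtain p :: nat and w where w: "B = w ` {..<p}" by (rule finite_enumerate_set[OF B(1)])
  \<comment> \<open>A state consists of the number of rows, the number of columns and the matrix.
    The initial matrix is the column of generators of \<open>I\<close>.\<close>
  define P where "P n s = (case s of (p', q', D') \<Rightarrow> (\<forall>k l. D' k l \<in> carrier A) \<and>
    (n = 0 \<longrightarrow> s = (p, 1, \<lambda>k l. if k < p then w k else \<zero>)))"
    for n :: nat and s :: "nat \<times> nat \<times> (nat \<Rightarrow> nat \<Rightarrow> 'a)"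
  define Q where "Q s s' = (case (s, s') of ((p, q, D), (p', q', D')) \<Rightarrow> q' = p \<and>
    (\<forall>i<p'. \<forall>l<q. (\<Oplus>k\<in>{..<p}. D' i k \<otimes> D k l) = \<zero>) \<and>
    (\<forall>c\<in>{..<p} \<rightarrow> carrier A. (\<forall>l<q. (\<Oplus>k\<in>{..<p}. c k \<otimes> D k l) = \<zero>) \<longrightarrow>
      (\<exists>c'\<in>{..<p'} \<rightarrow> carrier A. \<forall>k<p. c k = (\<Oplus>i\<in>{..<p'}. c' i \<otimes> D' i k))))"
    for s s' :: "nat \<times> nat \<times> (nat \<Rightarrow> nat \<Rightarrow> 'a)"
  have wI: "w k \<in> I" if "k < p" for k using B(2) that unfolding w by auto
  have "\<exists>f. \<forall>n. P n (f n) \<and> Q (f n) (f (Suc n))"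
  proof (rule dependent_nat_choice)
    show "\<exists>s. P 0 s" unfolding P_def using wI ideal_subset[OF I] by auto
    fix s n assume P: "P n s"
    obtain p q D where s: "s = (p, q, D)" by (cases s) auto
    have D: "D k l \<in> carrier A" for k l using P by (simp add: P_def s)
    from kernel_generators[where D = D and p = p and q = q, OF D] obtain p' :: nat and D' where
      "\<forall>k l. D' k l \<in> carrier A" "\<forall>i<p'. \<forall>l<q. (\<Oplus>k\<in>{..<p}. D' i k \<otimes> D k l) = \<zero>"
      "\<forall>c\<in>{..<p} \<rightarrow> carrier A. (\<forall>l<q. (\<Oplus>k\<in>{..<p}. c k \<otimes> D k l) = \<zero>) \<longrightarrow>
      (\<exists>c'\<in>{..<p'} \<rightarrow> carrier A. \<forall>k<p. c k = (\<Oplus>i\<in>{..<p'}. c' i \<otimes> D' i k))" by blast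
    then show "\<exists>s'. P (Suc n) s' \<and> Q s s'"
      unfolding P_def Q_def s by (intro exI[of _ "(p', p, D')"]) simp
  qed
  then obtain f where f: "\<And>n. P n (f n)" "\<And>n. Q (f n) (f (Suc n))" by blast
  define D where "D n = snd (snd (f n))" for n
  define m where "m n = fst (snd (f n))" for n
  have D: "D n k l \<in> carrier A" for n k l using f(1)[of n] by (auto simp: P_def D_def split: prod.splits)
  have f0: "f 0 = (p, 1, \<lambda>k l. if k < p then w k else \<zero>)" using f(1)[of 0] by (auto simp: P_def)
  have fst: "fst (f n) = m (Suc n)" for n using f(2)[of n] by (auto simp: Q_def m_def split: prod.splits)
  have fn: "f n = (m (Suc n), m n, D n)" for n using fst[of n] by (simp add: m_def D_def prod_eq_iff)
  have Q: "\<forall>i<m (Suc (Suc n)). \<forall>l<m n. (\<Oplus>k\<in>{..<m (Suc n)}. D (Suc n) i k \<otimes> D n k l) = \<zero>"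
    "\<forall>c\<in>{..<m (Suc n)} \<rightarrow> carrier A. (\<forall>l<m n. (\<Oplus>k\<in>{..<m (Suc n)}. c k \<otimes> D n k l) = \<zero>) \<longrightarrow>
      (\<exists>c'\<in>{..<m (Suc (Suc n))} \<rightarrow> carrier A. \<forall>k<m (Suc n). c k = (\<Oplus>i\<in>{..<m (Suc (Suc n))}. c' i \<otimes> D (Suc n) i k))" for n
    using f(2)[of n] unfolding Q_def fn by simp_all
  have m0: "m 0 = 1" "m 1 = p" "D 0 = (\<lambda>k l. if k < p then w k else \<zero>)" using f0 fn[of 0] by simp_all
  show thesis
  proof (rule that[of m D], intro noetherian_ideal_resolution.intro ideal_resolution.intro
      matrix_complex.intro matrix_complex_axioms.intro ideal_resolution_axioms.intro)
    show "cring A" "noetherian_cring A" by unfold_locales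
    show "D j k l \<in> carrier A" for j k l by (rule D)
    show "(\<Oplus>t\<in>{..<m (Suc j)}. D (Suc j) k t \<otimes> D j t l) = \<zero>" if "k < m (Suc (Suc j))" "l < m j" for j k l
      using Q(1) that by blast
    show "ideal I A" by (rule I)
    show "m 0 = 1" by (rule m0)
    show "D 0 k 0 \<in> I" if "k < m 1" for k using wI ideal_zero[OF I] by (simp add: m0)
    show "I \<subseteq> J" if "ideal J A" "\<And>k. k < m 1 \<Longrightarrow> D 0 k 0 \<in> J" for J
    proof (rule B(3)[OF that(1)])
      have "w k \<in> J" if "k < p" for k
        using \<open>\<And>k. k < m 1 \<Longrightarrow> D 0 k 0 \<in> J\<close>[of k] that unfolding m0 by simp
      then show "B \<subseteq> J" unfolding w by blast
    qed
    show "\<exists>c'\<in>{..<m (Suc (Suc j))} \<rightarrow> carrier A. \<forall>k<m (Suc j). c k = (\<Oplus>i\<in>{..<m (Suc (Suc j))}. c' i \<otimes> D (Suc j) i k)"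
      if "c \<in> {..<m (Suc j)} \<rightarrow> carrier A" "\<And>l. l < m j \<Longrightarrow> (\<Oplus>k\<in>{..<m (Suc j)}. c k \<otimes> D j k l) = \<zero>" for c j
      using Q(2)[of j] that by blast
  qed
qed

end

section \<open>Depth by local cohomology and by free resolutions\<close>

lemma (in cring) ideal_pow:
  assumes I: "ideal I R"
  shows ideal_pow_ideal: "ideal (I [^]\<^bsub>ideals_set R\<^esub> (n::nat)) R"
    and ideal_pow_0: "I [^]\<^bsub>ideals_set R\<^esub> (0::nat) = carrier R"
    and ideal_pow_1: "I [^]\<^bsub>ideals_set R\<^esub> (1::nat) = I"
    and ideal_pow_Suc_mem: "a \<in> I \<Longrightarrow> b \<in> I [^]\<^bsub>ideals_set R\<^esub> (n::nat) \<Longrightarrow> a \<otimes> b \<in> I [^]\<^bsub>ideals_set R\<^esub> Suc n"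
    and ideal_pow_Suc_subset: "I [^]\<^bsub>ideals_set R\<^esub> Suc n \<subseteq> I [^]\<^bsub>ideals_set R\<^esub> (n::nat)"
proof -
  interpret S: semiring "ideals_set R" by (rule ideals_set_is_semiring)
  have Ic: "I \<in> carrier (ideals_set R)" using I by (simp add: ideals_set_def)
  show id: "ideal (I [^]\<^bsub>ideals_set R\<^esub> (n::nat)) R" for n
    using S.nat_pow_closed[OF Ic, of n] by (simp add: ideals_set_def)
  have suc: "I [^]\<^bsub>ideals_set R\<^esub> Suc n = ideal_prod R (I [^]\<^bsub>ideals_set R\<^esub> (n::nat)) I" for n
    by (simp add: ideals_set_def)
  show "I [^]\<^bsub>ideals_set R\<^esub> (0::nat) = carrier R" by (simp add: ideals_set_def)
  show "I [^]\<^bsub>ideals_set R\<^esub> (1::nat) = I" using S.nat_pow_eone[OF Ic] by simp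
  show "a \<otimes> b \<in> I [^]\<^bsub>ideals_set R\<^esub> Suc n" if a: "a \<in> I" and b: "b \<in> I [^]\<^bsub>ideals_set R\<^esub> n"
  proof -
    have "b \<otimes> a \<in> I [^]\<^bsub>ideals_set R\<^esub> Suc n" unfolding suc using a b by (rule ideal_prod.prod[rotated])
    then show ?thesis using a b ideal_subset[OF I] ideal_subset[OF id[of n]] by (simp add: m_comm subset_iff)
  qed
  show "I [^]\<^bsub>ideals_set R\<^esub> Suc n \<subseteq> I [^]\<^bsub>ideals_set R\<^esub> n"
    unfolding suc using ideal_prod_inter[OF id I] by blast
qed

text \<open>The element f corresponds to an extension to A/L of the map (L + A l)/L \<rightarrow> E
  with l \<mapsto> y, which is well defined by \<open>ann\<close>. It solves a system with one
  unknown: b f = 0 for the generators b of \<open>L\<close>, and l f = y.\<close>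

lemma (in noetherian_cring) injective_extend_ideal:
  fixes E :: "('a, 'e) module"
  assumes E: "injective_module A E" and enc: "\<exists>enc :: (nat \<Rightarrow> 'a) \<Rightarrow> 'e. inj_on enc ({..<1} \<rightarrow>\<^sub>E carrier A)"
    and L: "ideal L A" and l: "l \<in> carrier A" and y: "y \<in> carrier E"
    and ann: "\<And>b. \<lbrakk>b \<in> carrier A; b \<otimes> l \<in> L\<rbrakk> \<Longrightarrow> b \<odot>\<^bsub>E\<^esub> y = \<zero>\<^bsub>E\<^esub>"
  shows "\<exists>f\<in>carrier E. (\<forall>b\<in>L. b \<odot>\<^bsub>E\<^esub> f = \<zero>\<^bsub>E\<^esub>) \<and> l \<odot>\<^bsub>E\<^esub> f = y"
proof -
  have Em: "module A E" using E by (simp add: injective_module_def)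
  interpret E: module A E by (rule Em)
  obtain enc :: "(nat \<Rightarrow> 'a) \<Rightarrow> 'e" where enc: "inj_on enc ({..<1} \<rightarrow>\<^sub>E carrier A)" using enc by blast
  obtain B where B: "finite B" "B \<subseteq> L" "\<And>J. ideal J A \<Longrightarrow> B \<subseteq> J \<Longrightarrow> L \<subseteq> J"
    by (rule ideal_generators[OF L]) blast
  obtain s :: nat and w where w: "B = w ` {..<s}" by (rule finite_enumerate_set[OF B(1)])
  have wL: "w k \<in> L" if "k < s" for k using B(2) that unfolding w by auto
  define D where "D k (j::nat) = (if k < s then w k else l)" for k j
  define v where "v k = (if k < s then \<zero>\<^bsub>E\<^esub> else y)" for k
  have wc: "w k \<in> carrier A" if "k < s" for k using wL[OF that] ideal_subset[OF L] by blast
  have D: "D k j \<in> carrier A" for k j using wc l by (simp add: D_def)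
  have "\<exists>u\<in>{..<1} \<rightarrow> carrier E. \<forall>k<Suc s. v k = (\<Oplus>\<^bsub>E\<^esub>j\<in>{..<1}. D k j \<odot>\<^bsub>E\<^esub> u j)"
  proof (rule injective_solves_system[OF E enc D])
    show "v \<in> {..<Suc s} \<rightarrow> carrier E" using y by (auto simp: v_def)
    fix c assume c: "c \<in> {..<Suc s} \<rightarrow> carrier A"
      and z: "\<And>j. j < 1 \<Longrightarrow> (\<Oplus>k\<in>{..<Suc s}. c k \<otimes> D k j) = \<zero>"
    have cc: "c k \<in> carrier A" if "k < Suc s" for k using c that by auto
    have "(\<Oplus>k\<in>{..<Suc s}. c k \<otimes> D k 0) = c s \<otimes> D s 0 \<oplus> (\<Oplus>k\<in>{..<s}. c k \<otimes> D k 0)"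
      unfolding lessThan_Suc using cc D by (intro finsum_insert) auto
    then have "c s \<otimes> l \<oplus> (\<Oplus>k\<in>{..<s}. c k \<otimes> D k 0) = \<zero>" using z[of 0] by (simp add: D_def)
    moreover have S: "(\<Oplus>k\<in>{..<s}. c k \<otimes> D k 0) \<in> L"
    proof -
      have "(\<Oplus>k\<in>I. c k \<otimes> D k 0) \<in> L" if "finite I" "I \<subseteq> {..<s}" for I
        using that
      proof (induct I set: finite)
        case (insert i I)
        have "c i \<otimes> D i 0 \<in> L" using insert.prems wL cc by (auto simp: D_def intro!: ideal_mult[OF L])
        then show ?case using insert D cc ideal_add[OF L] by (subst finsum_insert) (auto simp: less_Suc_eq)
      qed (simp add: ideal_zero[OF L])
      then show ?thesis by simp
    qed
    moreover have "(\<Oplus>k\<in>{..<s}. c k \<otimes> D k 0) \<in> carrier A" using S ideal_subset[OF L] by blast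
    ultimately have "c s \<otimes> l = \<ominus> (\<Oplus>k\<in>{..<s}. c k \<otimes> D k 0)"
      using cc[of s] l by (intro minus_equality[symmetric]) auto
    then have "c s \<otimes> l \<in> L" using ideal_uminus[OF L S] by simp
    then have cy: "c s \<odot>\<^bsub>E\<^esub> y = \<zero>\<^bsub>E\<^esub>" using ann cc by blast
    have "(\<Oplus>\<^bsub>E\<^esub>k\<in>{..<Suc s}. c k \<odot>\<^bsub>E\<^esub> v k) = (\<Oplus>\<^bsub>E\<^esub>k\<in>{..<Suc s}. \<zero>\<^bsub>E\<^esub>)"
      using cc cy by (intro E.M.finsum_cong') (auto simp: v_def less_Suc_eq)
    then show "(\<Oplus>\<^bsub>E\<^esub>k\<in>{..<Suc s}. c k \<odot>\<^bsub>E\<^esub> v k) = \<zero>\<^bsub>E\<^esub>" by simp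
  qed
  then obtain u where u: "u \<in> {..<1} \<rightarrow> carrier E"
    "\<And>k. k < Suc s \<Longrightarrow> v k = (\<Oplus>\<^bsub>E\<^esub>j\<in>{..<1}. D k j \<odot>\<^bsub>E\<^esub> u j)" by blast
  have u0: "u 0 \<in> carrier E" using u(1) by auto
  have vk: "v k = D k 0 \<odot>\<^bsub>E\<^esub> u 0" if "k < Suc s" for k
    using u(2)[OF that] u0 D by (simp add: lessThan_Suc)
  have "ideal {b \<in> carrier A. b \<odot>\<^bsub>E\<^esub> u 0 = \<zero>\<^bsub>E\<^esub>} A"
    using annihilator_ideal[OF Em, of "{u 0}"] u0 by simp
  moreover have "w k \<odot>\<^bsub>E\<^esub> u 0 = \<zero>\<^bsub>E\<^esub>" if "k < s" for k using vk[of k] that by (simp add: v_def D_def)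
  then have "B \<subseteq> {b \<in> carrier A. b \<odot>\<^bsub>E\<^esub> u 0 = \<zero>\<^bsub>E\<^esub>}" unfolding w using wc by auto
  ultimately have "L \<subseteq> {b \<in> carrier A. b \<odot>\<^bsub>E\<^esub> u 0 = \<zero>\<^bsub>E\<^esub>}" by (rule B(3))
  moreover have "l \<odot>\<^bsub>E\<^esub> u 0 = y" using vk[of s] by (simp add: v_def D_def)
  ultimately show ?thesis using u0 by blast
qed

text \<open>By exactness every relation between the rows of \<open>D j\<close> is a combination of
  rows of \<open>D (Suc j)\<close>. A cocycle satisfies the latter relations, so it is a consistent
  right-hand side for the system given by \<open>D j\<close>.\<close>

lemma (in noetherian_ideal_resolution) injective_acyclic:
  fixes E :: "('a, 'e) module"
  assumes E: "injective_module A E" and enc: "\<exists>enc :: (nat \<Rightarrow> 'a) \<Rightarrow> 'e. inj_on enc ({..<m j} \<rightarrow>\<^sub>E carrier A)"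
  shows "acyclic_at E (Suc j)"
  unfolding acyclic_at_def
proof (intro allI impI)
  fix v assume v: "cocycle E (Suc j) v"
  have Em: "module A E" using E by (simp add: injective_module_def)
  interpret E: module A E by (rule Em)
  obtain enc :: "(nat \<Rightarrow> 'a) \<Rightarrow> 'e" where enc: "inj_on enc ({..<m j} \<rightarrow>\<^sub>E carrier A)" using enc by blast
  have vc: "v \<in> {..<m (Suc j)} \<rightarrow> carrier E" using v by (simp add: cocycle_def)
  have "\<exists>u\<in>{..<m j} \<rightarrow> carrier E. \<forall>k<m (Suc j). v k = (\<Oplus>\<^bsub>E\<^esub>l\<in>{..<m j}. D j k l \<odot>\<^bsub>E\<^esub> u l)"
  proof (rule injective_solves_system[OF E enc D_closed vc])
    fix c assume c: "c \<in> {..<m (Suc j)} \<rightarrow> carrier A"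
      and z: "\<And>l. l < m j \<Longrightarrow> (\<Oplus>k\<in>{..<m (Suc j)}. c k \<otimes> D j k l) = \<zero>"
    obtain c' where c': "c' \<in> {..<m (Suc (Suc j))} \<rightarrow> carrier A"
      "\<forall>k<m (Suc j). c k = (\<Oplus>i\<in>{..<m (Suc (Suc j))}. c' i \<otimes> D (Suc j) i k)"
      using exact[OF c z] by blast
    have c'c: "c' i \<in> carrier A" if "i < m (Suc (Suc j))" for i using c'(1) that by auto
    have vk: "v k \<in> carrier E" if "k < m (Suc j)" for k using vc that by auto
    have "(\<Oplus>\<^bsub>E\<^esub>k\<in>{..<m (Suc j)}. c k \<odot>\<^bsub>E\<^esub> v k)
        = (\<Oplus>\<^bsub>E\<^esub>k\<in>{..<m (Suc j)}. \<Oplus>\<^bsub>E\<^esub>i\<in>{..<m (Suc (Suc j))}. c' i \<odot>\<^bsub>E\<^esub> (D (Suc j) i k \<odot>\<^bsub>E\<^esub> v k))"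
    proof (rule E.M.finsum_cong')
      fix k assume k: "k \<in> {..<m (Suc j)}"
      have "c k \<odot>\<^bsub>E\<^esub> v k = (\<Oplus>\<^bsub>E\<^esub>i\<in>{..<m (Suc (Suc j))}. (c' i \<otimes> D (Suc j) i k) \<odot>\<^bsub>E\<^esub> v k)"
        using c'(2) k vk c'c by (simp add: E.smult_finsum_right Pi_def)
      also have "\<dots> = (\<Oplus>\<^bsub>E\<^esub>i\<in>{..<m (Suc (Suc j))}. c' i \<odot>\<^bsub>E\<^esub> (D (Suc j) i k \<odot>\<^bsub>E\<^esub> v k))"
        using k vk c'c by (intro E.M.finsum_cong') (auto simp: E.smult_assoc1)
      finally show "c k \<odot>\<^bsub>E\<^esub> v k = (\<Oplus>\<^bsub>E\<^esub>i\<in>{..<m (Suc (Suc j))}. c' i \<odot>\<^bsub>E\<^esub> (D (Suc j) i k \<odot>\<^bsub>E\<^esub> v k))" .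
    qed (use vk c'c in \<open>auto intro!: E.M.finsum_closed\<close>)
    also have "\<dots> = (\<Oplus>\<^bsub>E\<^esub>i\<in>{..<m (Suc (Suc j))}. \<Oplus>\<^bsub>E\<^esub>k\<in>{..<m (Suc j)}. c' i \<odot>\<^bsub>E\<^esub> (D (Suc j) i k \<odot>\<^bsub>E\<^esub> v k))"
      using vk c'c by (intro E.M.finsum_swap) auto
    also have "\<dots> = (\<Oplus>\<^bsub>E\<^esub>i\<in>{..<m (Suc (Suc j))}. \<zero>\<^bsub>E\<^esub>)"
    proof (rule E.M.finsum_cong')
      fix i assume i: "i \<in> {..<m (Suc (Suc j))}"
      have "(\<Oplus>\<^bsub>E\<^esub>k\<in>{..<m (Suc j)}. c' i \<odot>\<^bsub>E\<^esub> (D (Suc j) i k \<odot>\<^bsub>E\<^esub> v k)) = c' i \<odot>\<^bsub>E\<^esub> diff E (Suc j) v i"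
        unfolding diff_def using i vk c'c by (intro E.finsum_smult_ldistr[symmetric]) auto
      then show "(\<Oplus>\<^bsub>E\<^esub>k\<in>{..<m (Suc j)}. c' i \<odot>\<^bsub>E\<^esub> (D (Suc j) i k \<odot>\<^bsub>E\<^esub> v k)) = \<zero>\<^bsub>E\<^esub>"
        using i v c'c by (simp add: cocycle_def)
    qed auto
    finally show "(\<Oplus>\<^bsub>E\<^esub>k\<in>{..<m (Suc j)}. c k \<odot>\<^bsub>E\<^esub> v k) = \<zero>\<^bsub>E\<^esub>" by simp
  qed
  then show "coboundary E (Suc j) v" by (simp add: coboundary_def diff_def)
qed

section \<open>Torsion and socle in a complex of injective modules\<close>

locale injective_complex = noetherian_cring A for A (structure) +
  fixes I and E :: "nat \<Rightarrow> ('a, 'e) module" and d :: "nat \<Rightarrow> 'e \<Rightarrow> 'e"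
  assumes I: "ideal I A" and inj: "injective_module A (E n)"
    and d: "d n \<in> module_hom A (E n) (E (Suc n))"
    and dd: "x \<in> carrier (E n) \<Longrightarrow> d (Suc n) (d n x) = \<zero>\<^bsub>E (Suc (Suc n))\<^esub>"
    and enc: "\<exists>enc :: (nat \<Rightarrow> 'a) \<Rightarrow> 'e. inj_on enc ({..<q} \<rightarrow>\<^sub>E carrier A)"
begin

lemma E_module: "module A (E n)"
  using inj by (simp add: injective_module_def)

abbreviation pw :: "nat \<Rightarrow> 'a set" where "pw k \<equiv> I [^]\<^bsub>ideals_set A\<^esub> k"

definition kills :: "'a set \<Rightarrow> nat \<Rightarrow> 'e \<Rightarrow> bool"
  where "kills J n x \<longleftrightarrow> (\<forall>b\<in>J. b \<odot>\<^bsub>E n\<^esub> x = \<zero>\<^bsub>E n\<^esub>)"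

text \<open>
  For an injective resolution of \<open>V\<close>, \<open>torsion_exact n\<close> says \<open>H\<^sup>n\<^sub>I(V) = 0\<close> and \<open>socle_exact n\<close> says
  \<open>Ext\<^sup>n(A/I, V) = 0\<close>; either implies \<open>weakly_exact n\<close>. The induction that takes weak exactness in degrees
  below \<open>n\<close> back to both conditions passes through \<open>Ext\<^sup>i(A/J, V) = 0\<close> for all \<open>J \<supseteq> I\<close>
  (\<open>cyclic_exact\<close>) and \<open>Ext\<^sup>i(J/(J \<inter> I\<^sup>k), V) = 0\<close> (\<open>subquotient_exact\<close>).
\<close>

definition torsion_exact :: "nat \<Rightarrow> bool"
  where "torsion_exact n \<longleftrightarrow> (\<forall>z\<in>carrier (E n). d n z = \<zero>\<^bsub>E (Suc n)\<^esub> \<longrightarrow> (\<exists>k. kills (pw k) n z) \<longrightarrow>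
    (case n of 0 \<Rightarrow> z = \<zero>\<^bsub>E 0\<^esub> | Suc i \<Rightarrow> \<exists>y\<in>carrier (E i). (\<exists>k. kills (pw k) i y) \<and> d i y = z))"

definition socle_exact :: "nat \<Rightarrow> bool"
  where "socle_exact n \<longleftrightarrow> (\<forall>z\<in>carrier (E n). d n z = \<zero>\<^bsub>E (Suc n)\<^esub> \<longrightarrow> kills I n z \<longrightarrow>
    (case n of 0 \<Rightarrow> z = \<zero>\<^bsub>E 0\<^esub> | Suc i \<Rightarrow> \<exists>y\<in>carrier (E i). kills I i y \<and> d i y = z))"

definition weakly_exact :: "nat \<Rightarrow> bool"
  where "weakly_exact n \<longleftrightarrow> (\<forall>z\<in>carrier (E n). d n z = \<zero>\<^bsub>E (Suc n)\<^esub> \<longrightarrow> kills I n z \<longrightarrow>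
    (case n of 0 \<Rightarrow> z = \<zero>\<^bsub>E 0\<^esub> | Suc i \<Rightarrow> \<exists>y\<in>carrier (E i). (\<exists>k. kills (pw k) i y) \<and> d i y = z))"

definition cyclic_exact :: "nat \<Rightarrow> bool"
  where "cyclic_exact n \<longleftrightarrow> (\<forall>J z. ideal J A \<longrightarrow> I \<subseteq> J \<longrightarrow> z \<in> carrier (E n) \<longrightarrow> d n z = \<zero>\<^bsub>E (Suc n)\<^esub> \<longrightarrow> kills J n z \<longrightarrow>
    (case n of 0 \<Rightarrow> z = \<zero>\<^bsub>E 0\<^esub> | Suc i \<Rightarrow> \<exists>y\<in>carrier (E i). kills J i y \<and> d i y = z))"

definition subquotient_exact :: "nat \<Rightarrow> bool"
  where "subquotient_exact n \<longleftrightarrow> (\<forall>J k y. ideal J A \<longrightarrow> I \<subseteq> J \<longrightarrow> y \<in> carrier (E n) \<longrightarrow> kills (pw k) n y \<longrightarrow>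
    kills J (Suc n) (d n y) \<longrightarrow>
    (case n of 0 \<Rightarrow> kills J 0 y
     | Suc i \<Rightarrow> \<exists>e\<in>carrier (E i). kills (pw k \<inter> J) i e \<and> kills J n (y \<ominus>\<^bsub>E n\<^esub> d i e)))"

lemma d_closed: "x \<in> carrier (E n) \<Longrightarrow> d n x \<in> carrier (E (Suc n))"
  by (rule mhom_closed[OF d])

lemma d_zero: "d n \<zero>\<^bsub>E n\<^esub> = \<zero>\<^bsub>E (Suc n)\<^esub>"
  by (rule mhom_zero[OF E_module E_module d])

lemma d_minus: "x \<in> carrier (E n) \<Longrightarrow> y \<in> carrier (E n) \<Longrightarrow> d n (x \<ominus>\<^bsub>E n\<^esub> y) = d n x \<ominus>\<^bsub>E (Suc n)\<^esub> d n y"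
  by (rule mhom_minus[OF E_module E_module d])

lemma kills_pw_1: "kills (pw 1) n x \<longleftrightarrow> kills I n x"
  by (simp only: ideal_pow_1[OF I])

lemma weakly_exactI1:
  assumes t: "torsion_exact n" shows "weakly_exact n"
  unfolding weakly_exact_def
proof (intro ballI impI)
  fix z assume z: "z \<in> carrier (E n)" "d n z = \<zero>\<^bsub>E (Suc n)\<^esub>" "kills I n z"
  then have "\<exists>k. kills (pw k) n z" using kills_pw_1 by blast
  with t z show "case n of 0 \<Rightarrow> z = \<zero>\<^bsub>E 0\<^esub> | Suc i \<Rightarrow> \<exists>y\<in>carrier (E i). (\<exists>k. kills (pw k) i y) \<and> d i y = z"
    unfolding torsion_exact_def by blast
qed

lemma weakly_exactI2:
  assumes s: "socle_exact n" shows "weakly_exact n"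
  unfolding weakly_exact_def
proof (intro ballI impI)
  fix z assume z: "z \<in> carrier (E n)" "d n z = \<zero>\<^bsub>E (Suc n)\<^esub>" "kills I n z"
  have *: "case n of 0 \<Rightarrow> z = \<zero>\<^bsub>E 0\<^esub> | Suc i \<Rightarrow> \<exists>y\<in>carrier (E i). kills I i y \<and> d i y = z"
    using s z unfolding socle_exact_def by blast
  show "case n of 0 \<Rightarrow> z = \<zero>\<^bsub>E 0\<^esub> | Suc i \<Rightarrow> \<exists>y\<in>carrier (E i). (\<exists>k. kills (pw k) i y) \<and> d i y = z"
  proof (cases n)
    case 0
    then show ?thesis using * by simp
  next
    case (Suc i)
    then obtain y where y: "y \<in> carrier (E i)" "kills I i y" "d i y = z" using * by auto
    have "kills (pw 1) i y" using y(2) by (simp only: kills_pw_1)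
    then have "\<exists>k. kills (pw k) i y" ..
    then show ?thesis using y Suc by auto
  qed
qed

text \<open>Weak exactness gives a primitive \<open>y\<close> of \<open>z\<close> that is killed by
  some power of \<open>I\<close>. Since \<open>J\<close> kills \<open>d i y = z\<close>, exactness
  for subquotients one degree lower corrects \<open>y\<close> by a coboundary to a primitive killed
  by \<open>J\<close>.\<close>

lemma cyclic_exact_step:
  assumes w: "weakly_exact n" and s: "\<And>i. n = Suc i \<Longrightarrow> subquotient_exact i"
  shows "cyclic_exact n"
  unfolding cyclic_exact_def
proof (intro allI impI)
  fix J z assume J: "ideal J A" "I \<subseteq> J" and z: "z \<in> carrier (E n)" "d n z = \<zero>\<^bsub>E (Suc n)\<^esub>" "kills J n z"
  have zI: "kills I n z" using z(3) J(2) unfolding kills_def by blast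
  show "case n of 0 \<Rightarrow> z = \<zero>\<^bsub>E 0\<^esub> | Suc i \<Rightarrow> \<exists>y\<in>carrier (E i). kills J i y \<and> d i y = z"
  proof (cases n)
    case 0
    then show ?thesis using w z zI unfolding weakly_exact_def by simp
  next
    case (Suc i)
    interpret Ei: module A "E i" by (rule E_module)
    interpret En: module A "E n" by (rule E_module)
    obtain y k where y: "y \<in> carrier (E i)" "kills (pw k) i y" "d i y = z"
      using w z zI unfolding weakly_exact_def Suc by auto
    have dy: "kills J (Suc i) (d i y)" using z(3) y(3) Suc by simp
    show ?thesis
    proof (cases i)
      case 0
      have "case i of 0 \<Rightarrow> kills J 0 y
        | Suc h \<Rightarrow> \<exists>e\<in>carrier (E h). kills (pw k \<inter> J) h e \<and> kills J i (y \<ominus>\<^bsub>E i\<^esub> d h e)"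
        using s[OF Suc] J y(1,2) dy unfolding subquotient_exact_def by blast
      then have "kills J 0 y" unfolding 0 by simp
      then have "kills J i y" by (simp add: 0)
      then show ?thesis unfolding Suc nat.case using y(1,3) by blast
    next
      case i: (Suc h)
      have "case i of 0 \<Rightarrow> kills J 0 y
        | Suc h \<Rightarrow> \<exists>e\<in>carrier (E h). kills (pw k \<inter> J) h e \<and> kills J i (y \<ominus>\<^bsub>E i\<^esub> d h e)"
        using s[OF Suc] J y(1,2) dy unfolding subquotient_exact_def by blast
      then obtain e where e: "e \<in> carrier (E h)" "kills J i (y \<ominus>\<^bsub>E i\<^esub> d h e)"
        unfolding i nat.case by blast
      have de: "d h e \<in> carrier (E i)" using d_closed[OF e(1)] i by simp
      have "d i (y \<ominus>\<^bsub>E i\<^esub> d h e) = z"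
      proof -
        have di: "d i \<in> module_hom A (E i) (E n)" using d[of i] Suc by simp
        have "d i (d h e) = \<zero>\<^bsub>E n\<^esub>" using dd[OF e(1)] Suc i by simp
        then show ?thesis using y(3) z(1) by (simp add: mhom_minus[OF E_module E_module di y(1) de] En.M.diff_zero)
      qed
      moreover have "y \<ominus>\<^bsub>E i\<^esub> d h e \<in> carrier (E i)" using y(1) de by simp
      ultimately show ?thesis unfolding Suc nat.case using e(2) by blast
    qed
  qed
qed

text \<open>As long as some element of a power of \<open>I\<close> keeps the product with
  \<open>l\<close> outside \<open>L\<close>, replace \<open>l\<close> by that product; the exponent
  needed to move it into \<open>L\<close> drops until it is 1.\<close>

lemma ideal_filtration_step:
  assumes "ideal L A" "ideal J A" "l \<in> J" "l \<notin> L" "\<And>b. b \<in> pw k \<Longrightarrow> b \<otimes> l \<in> L"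
  shows "\<exists>l'\<in>J. l' \<notin> L \<and> (\<forall>b\<in>I. b \<otimes> l' \<in> L)"
  using assms(3-)
proof (induct k arbitrary: l)
  case 0
  have "l \<in> carrier A" using 0(1) ideal_subset[OF assms(2)] by blast
  then show ?case using 0(3)[of \<one>] 0(2) ideal_pow_0[OF I] by simp
next
  case (Suc k)
  show ?case
  proof (cases "\<forall>b\<in>pw k. b \<otimes> l \<in> L")
    case True
    then show ?thesis using Suc by blast
  next
    case False
    then obtain b where b: "b \<in> pw k" "b \<otimes> l \<notin> L" by blast
    have c: "b \<in> carrier A" "l \<in> carrier A"
      using b(1) Suc.prems(1) ideal_subset[OF assms(2)] ideal_subset[OF ideal_pow_ideal[OF I, of k]] by auto
    have "a \<otimes> (b \<otimes> l) \<in> L" if a: "a \<in> I" for a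
    proof -
      have "a \<otimes> b \<otimes> l \<in> L" by (rule Suc.prems(3)[OF ideal_pow_Suc_mem[OF I a b(1)]])
      then show ?thesis using a c ideal_subset[OF I] by (simp add: m_assoc subset_iff)
    qed
    then show ?thesis using b(2) ideal_mult[OF assms(2) c(1) Suc.prems(1)] by blast
  qed
qed

text \<open>By injectivity a map from J/(J \<inter> I^k) to E n has the form b \<mapsto> b y with
  \<open>y\<close> killed by I^k, which explains how \<open>subquotient_exact\<close> is phrased.
  The subquotient is filtered by ideals L with cyclic factors A/K where I \<subseteq> K, and
  \<open>cyclic_exact\<close> handles each factor.\<close>

lemma subquotient_exact_step:
  assumes c: "cyclic_exact n"
  shows "subquotient_exact n"
  unfolding subquotient_exact_def
proof (intro allI impI)
  fix J k y assume J: "ideal J A" "I \<subseteq> J" and y: "y \<in> carrier (E n)" "kills (pw k) n y"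
    "kills J (Suc n) (d n y)"
  interpret En: module A "E n" by (rule E_module)
  have Jc: "b \<in> carrier A" if "b \<in> J" for b using that ideal_subset[OF J(1)] by blast
  have pc: "b \<in> carrier A" if "b \<in> pw k" for b k using that ideal_subset[OF ideal_pow_ideal[OF I]] by blast
  have Jy: "d n (b \<odot>\<^bsub>E n\<^esub> y) = \<zero>\<^bsub>E (Suc n)\<^esub>" if "b \<in> J" for b
    using y(1,3) that Jc by (simp add: mhom_smult[OF d] kills_def)
  show "case n of 0 \<Rightarrow> kills J 0 y
     | Suc i \<Rightarrow> \<exists>e\<in>carrier (E i). kills (pw k \<inter> J) i e \<and> kills J n (y \<ominus>\<^bsub>E n\<^esub> d i e)"
  proof (cases n)
    case 0
    have tf: "z = \<zero>\<^bsub>E n\<^esub>" if "z \<in> carrier (E n)" "d n z = \<zero>\<^bsub>E (Suc n)\<^esub>" "kills I n z" for z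
      using c I that unfolding cyclic_exact_def 0 by auto
    \<comment> \<open>Multiplying by the elements of the power with exponent j produces cocycles
      killed by \<open>I\<close>, which vanish by \<open>tf\<close>; so the exponent can be lowered
      step by step.\<close>
    have tor: "z = \<zero>\<^bsub>E n\<^esub>" if "z \<in> carrier (E n)" "d n z = \<zero>\<^bsub>E (Suc n)\<^esub>" "kills (pw j) n z" for z j
      using that
    proof (induct j)
      case 0
      then show ?case using ideal_pow_0[OF I] En.smult_one[of z] by (auto simp: kills_def)
    next
      case (Suc j)
      have "b \<odot>\<^bsub>E n\<^esub> z = \<zero>\<^bsub>E n\<^esub>" if b: "b \<in> pw j" for b
      proof (rule tf)
        show "b \<odot>\<^bsub>E n\<^esub> z \<in> carrier (E n)" using Suc.prems pc[OF b] by simp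
        show "d n (b \<odot>\<^bsub>E n\<^esub> z) = \<zero>\<^bsub>E (Suc n)\<^esub>"
          using Suc.prems pc[OF b] module.smult_r_null[OF E_module] by (simp add: mhom_smult[OF d])
        show "kills I n (b \<odot>\<^bsub>E n\<^esub> z)"
          unfolding kills_def
        proof
          fix a assume a: "a \<in> I"
          then have "a \<odot>\<^bsub>E n\<^esub> (b \<odot>\<^bsub>E n\<^esub> z) = (a \<otimes> b) \<odot>\<^bsub>E n\<^esub> z"
            using Suc.prems pc[OF b] ideal_subset[OF I] by (simp add: En.smult_assoc1 subset_iff)
          then show "a \<odot>\<^bsub>E n\<^esub> (b \<odot>\<^bsub>E n\<^esub> z) = \<zero>\<^bsub>E n\<^esub>"
            using Suc.prems(3) ideal_pow_Suc_mem[OF I a b] by (simp add: kills_def)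
        qed
      qed
      then show ?case using Suc by (simp add: kills_def)
    qed
    have "b \<odot>\<^bsub>E n\<^esub> y = \<zero>\<^bsub>E n\<^esub>" if b: "b \<in> J" for b
    proof (rule tor[of _ k])
      show "b \<odot>\<^bsub>E n\<^esub> y \<in> carrier (E n)" using y Jc[OF b] by simp
      show "d n (b \<odot>\<^bsub>E n\<^esub> y) = \<zero>\<^bsub>E (Suc n)\<^esub>" by (rule Jy[OF b])
      show "kills (pw k) n (b \<odot>\<^bsub>E n\<^esub> y)"
        unfolding kills_def
      proof
        fix a assume a: "a \<in> pw k"
        have "a \<odot>\<^bsub>E n\<^esub> (b \<odot>\<^bsub>E n\<^esub> y) = b \<odot>\<^bsub>E n\<^esub> (a \<odot>\<^bsub>E n\<^esub> y)"
          using pc[OF a] Jc[OF b] y(1) by (rule En.smult_left_commute)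
        then show "a \<odot>\<^bsub>E n\<^esub> (b \<odot>\<^bsub>E n\<^esub> y) = \<zero>\<^bsub>E n\<^esub>" using y(2) a Jc[OF b] by (simp add: kills_def)
      qed
    qed
    then show ?thesis using 0 by (simp add: kills_def)
  next
    case (Suc i)
    interpret Ei: module A "E i" by (rule E_module)
    have dh: "d i \<in> module_hom A (E i) (E n)" using d[of i] Suc by simp
    note di = mhom_closed[OF dh]
    have d0: "d i \<zero>\<^bsub>E i\<^esub> = \<zero>\<^bsub>E n\<^esub>" using d_zero[of i] Suc by simp
    have ddi: "d n (d i x) = \<zero>\<^bsub>E (Suc n)\<^esub>" if "x \<in> carrier (E i)" for x using dd[OF that] Suc by simp
    \<comment> \<open>The ideals up to which \<open>y\<close> has been corrected. The smallest one
      needs no correction, and a maximal one will turn out to be \<open>J\<close>.\<close>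
    define \<Phi> where "\<Phi> = {L. ideal L A \<and> pw k \<inter> J \<subseteq> L \<and> L \<subseteq> J \<and>
      (\<exists>e\<in>carrier (E i). kills (pw k \<inter> J) i e \<and> kills L n (y \<ominus>\<^bsub>E n\<^esub> d i e))}"
    have "pw k \<inter> J \<in> \<Phi>"
    proof -
      have "y \<ominus>\<^bsub>E n\<^esub> d i \<zero>\<^bsub>E i\<^esub> = y" using y(1) by (simp add: d0 En.M.diff_zero)
      then have "kills (pw k \<inter> J) n (y \<ominus>\<^bsub>E n\<^esub> d i \<zero>\<^bsub>E i\<^esub>)" using y(2) by (simp add: kills_def)
      moreover have "kills (pw k \<inter> J) i \<zero>\<^bsub>E i\<^esub>" using Jc by (simp add: kills_def)
      moreover have "ideal (pw k \<inter> J) A" by (rule i_intersect[OF ideal_pow_ideal[OF I] J(1)])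
      ultimately show ?thesis unfolding \<Phi>_def by blast
    qed
    then have ne: "\<Phi> \<noteq> {}" by blast
    have "ideal L A" if "L \<in> \<Phi>" for L using that unfolding \<Phi>_def by blast
    from maximal_ideal_exists[OF ne this] obtain L
      where L: "L \<in> \<Phi>" and mx: "\<And>L'. L' \<in> \<Phi> \<Longrightarrow> L \<subseteq> L' \<Longrightarrow> L' = L" by blast
    have Li: "ideal L A" "pw k \<inter> J \<subseteq> L" "L \<subseteq> J" using L unfolding \<Phi>_def by blast+
    obtain e where e: "e \<in> carrier (E i)" "kills (pw k \<inter> J) i e" "kills L n (y \<ominus>\<^bsub>E n\<^esub> d i e)"
      using L unfolding \<Phi>_def by blast
    have "J \<subseteq> L"
    proof (rule ccontr)
      assume "\<not> J \<subseteq> L"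
      then obtain l0 where l0: "l0 \<in> J" "l0 \<notin> L" by blast
      have "b \<otimes> l0 \<in> L" if b: "b \<in> pw k" for b
        using ideal_mult[OF J(1) pc[OF b] l0(1)] ideal_mult'[OF ideal_pow_ideal[OF I] Jc[OF l0(1)] b] Li(2) by blast
      from ideal_filtration_step[OF Li(1) J(1) l0 this] obtain l
        where l: "l \<in> J" "l \<notin> L" "\<forall>b\<in>I. b \<otimes> l \<in> L" by blast
      have lc: "l \<in> carrier A" by (rule Jc[OF l(1)])
      \<comment> \<open>The cyclic module A/K is isomorphic to (L + A l)/L, the next factor of the
        filtration.\<close>
      define K where "K = {b \<in> carrier A. b \<otimes> l \<in> L}"
      have K: "ideal K A"
        unfolding K_def using lc ideal_facts[OF Li(1)]
        by (intro ideal_criterion) (auto simp: l_distr m_assoc)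
      have IK: "I \<subseteq> K" using l(3) ideal_subset[OF I] unfolding K_def by blast
      define x where "x = y \<ominus>\<^bsub>E n\<^esub> d i e"
      have xc: "x \<in> carrier (E n)" using y(1) di[OF e(1)] by (simp add: x_def)
      have dx: "d n x = d n y"
        using y(1) di[OF e(1)] ddi[OF e(1)] d_closed[OF y(1)] module.axioms(2)[OF E_module[of "Suc n"]]
        unfolding x_def by (simp add: d_minus abelian_group.diff_zero)
      define z where "z = l \<odot>\<^bsub>E n\<^esub> x"
      have zc: "z \<in> carrier (E n)" using xc lc by (simp add: z_def)
      have dz: "d n z = \<zero>\<^bsub>E (Suc n)\<^esub>"
        using y(3) l(1) lc xc dx by (simp add: z_def mhom_smult[OF d] kills_def)
      have Kz: "kills K n z"
        unfolding kills_def
      proof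
        fix b assume b: "b \<in> K"
        then have "b \<odot>\<^bsub>E n\<^esub> z = (b \<otimes> l) \<odot>\<^bsub>E n\<^esub> x" using xc lc by (simp add: z_def K_def En.smult_assoc1)
        then show "b \<odot>\<^bsub>E n\<^esub> z = \<zero>\<^bsub>E n\<^esub>" using b e(3) by (simp add: kills_def K_def x_def)
      qed
      obtain y' where y': "y' \<in> carrier (E i)" "kills K i y'" "d i y' = z"
        using c K IK zc dz Kz unfolding cyclic_exact_def Suc by auto
      \<comment> \<open>Since \<open>f\<close> is killed by \<open>L\<close>, adding it to
        \<open>e\<close> preserves what holds on \<open>L\<close>; since \<open>l\<close> sends it
        to \<open>y'\<close>, it also makes \<open>l\<close> kill the corrected
        \<open>y\<close>.\<close>
      have "\<exists>f\<in>carrier (E i). (\<forall>b\<in>L. b \<odot>\<^bsub>E i\<^esub> f = \<zero>\<^bsub>E i\<^esub>) \<and> l \<odot>\<^bsub>E i\<^esub> f = y'"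
        by (rule injective_extend_ideal[OF inj enc Li(1) lc y'(1)])
           (use y'(2) in \<open>simp add: kills_def K_def\<close>)
      then obtain f where f: "f \<in> carrier (E i)" "\<And>b. b \<in> L \<Longrightarrow> b \<odot>\<^bsub>E i\<^esub> f = \<zero>\<^bsub>E i\<^esub>" "l \<odot>\<^bsub>E i\<^esub> f = y'" by blast
      define L' where "L' = {q \<oplus> l \<otimes> r | q r. q \<in> L \<and> r \<in> carrier A}"
      have Lc: "b \<in> carrier A" if "b \<in> L" for b using that Li(3) Jc by blast
      define x' where "x' = y \<ominus>\<^bsub>E n\<^esub> d i (e \<oplus>\<^bsub>E i\<^esub> f)"
      have x': "x' = x \<ominus>\<^bsub>E n\<^esub> d i f"
        using y(1) di[OF e(1)] di[OF f(1)] e(1) f(1)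
        by (simp add: x'_def x_def mhom_add[OF dh] En.M.minus_eq En.M.minus_add En.M.a_ac)
      have x'c: "x' \<in> carrier (E n)" using xc di[OF f(1)] by (simp add: x')
      have sm: "b \<odot>\<^bsub>E n\<^esub> x' = b \<odot>\<^bsub>E n\<^esub> x \<ominus>\<^bsub>E n\<^esub> d i (b \<odot>\<^bsub>E i\<^esub> f)" if "b \<in> carrier A" for b
        using that xc di[OF f(1)] f(1) mhom_smult[OF dh that f(1)]
        by (simp add: x' En.M.minus_eq En.smult_r_distr En.smult_r_minus)
      have q0: "q \<odot>\<^bsub>E n\<^esub> x' = \<zero>\<^bsub>E n\<^esub>" if "q \<in> L" for q
        using sm[OF Lc[OF that]] f(2)[OF that] e(3) that d0
        by (simp add: kills_def x_def En.M.diff_zero)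
      have l0': "l \<odot>\<^bsub>E n\<^esub> x' = \<zero>\<^bsub>E n\<^esub>"
        using sm[OF lc] f(3) y'(3) zc by (simp add: z_def En.M.diff_self)
      have "kills L' n x'"
        unfolding kills_def
      proof
        fix b assume "b \<in> L'"
        then obtain q r where qr: "b = q \<oplus> l \<otimes> r" "q \<in> L" "r \<in> carrier A" unfolding L'_def by blast
        have "b \<odot>\<^bsub>E n\<^esub> x' = q \<odot>\<^bsub>E n\<^esub> x' \<oplus>\<^bsub>E n\<^esub> r \<odot>\<^bsub>E n\<^esub> (l \<odot>\<^bsub>E n\<^esub> x')"
          using qr lc Lc x'c by (simp add: En.smult_l_distr En.smult_assoc1[symmetric] m_comm)
        then show "b \<odot>\<^bsub>E n\<^esub> x' = \<zero>\<^bsub>E n\<^esub>" using q0[OF qr(2)] l0' qr(3) by simp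
      qed
      moreover have "kills (pw k \<inter> J) i (e \<oplus>\<^bsub>E i\<^esub> f)"
        unfolding kills_def
      proof
        fix b assume b: "b \<in> pw k \<inter> J"
        then have "b \<in> L" using Li(2) by blast
        then show "b \<odot>\<^bsub>E i\<^esub> (e \<oplus>\<^bsub>E i\<^esub> f) = \<zero>\<^bsub>E i\<^esub>"
          using b e f(1,2) Lc by (simp add: Ei.smult_r_distr kills_def)
      qed
      moreover have "e \<oplus>\<^bsub>E i\<^esub> f \<in> carrier (E i)" using e(1) f(1) by simp
      moreover have "ideal L' A" "L \<subseteq> L'" "l \<in> L'" unfolding L'_def by (rule ideal_adjoin[OF Li(1) lc])+
      moreover have "L' \<subseteq> J"
      proof
        fix b assume "b \<in> L'"
        then obtain q r where qr: "b = q \<oplus> l \<otimes> r" "q \<in> L" "r \<in> carrier A" unfolding L'_def by blast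
        then show "b \<in> J" using Li(3) ideal_add[OF J(1)] ideal_mult'[OF J(1) qr(3) l(1)] by blast
      qed
      ultimately have "L' \<in> \<Phi>" using Li(2) unfolding \<Phi>_def x'_def by blast
      from mx[OF this \<open>L \<subseteq> L'\<close>] show False using \<open>l \<in> L'\<close> l(2) by simp
    qed
    then have "L = J" using Li(3) by blast
    then show ?thesis using e Suc by auto
  qed
qed

lemma exactness_induct:
  assumes "\<And>i. i < N \<Longrightarrow> weakly_exact i" and "n < N"
  shows "cyclic_exact n \<and> subquotient_exact n"
  using assms(2)
proof (induct n)
  case 0
  then show ?case using cyclic_exact_step[of 0] subquotient_exact_step assms(1) by auto
next
  case (Suc n)
  then show ?case using cyclic_exact_step[of "Suc n"] subquotient_exact_step assms(1) by auto
qed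

text \<open>Both sides range over all degrees below N because exactness is built up from degree 0.
  Socle exactness is \<open>cyclic_exact\<close> for J = I. Torsion exactness is
  \<open>subquotient_exact\<close> for J = A: all of A kills the differential of a cocycle z, so 1
  kills z - d e for a suitable torsion element e.\<close>

lemma torsion_exact_iff_socle_exact:
  "(\<forall>n<N. torsion_exact n) \<longleftrightarrow> (\<forall>n<N. socle_exact n)"
proof (intro iffI allI impI)
  fix n assume "\<forall>n<N. torsion_exact n" and n: "n < N"
  then have "cyclic_exact n" using exactness_induct weakly_exactI1 by blast
  then show "socle_exact n" unfolding cyclic_exact_def socle_exact_def using I by blast
next
  fix n assume "\<forall>n<N. socle_exact n" and n: "n < N"
  then have sq: "subquotient_exact n" using exactness_induct weakly_exactI2 by blast
  interpret En: module A "E n" by (rule E_module)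
  show "torsion_exact n"
    unfolding torsion_exact_def
  proof (intro ballI impI)
    fix z assume z: "z \<in> carrier (E n)" "d n z = \<zero>\<^bsub>E (Suc n)\<^esub>" and "\<exists>k. kills (pw k) n z"
    then obtain k where k: "kills (pw k) n z" by blast
    have kd: "kills (carrier A) (Suc n) (d n z)"
      using z(2) module.smult_r_null[OF E_module] by (simp add: kills_def)
    have Ic: "I \<subseteq> carrier A" by (rule ideal_subset[OF I])
    have sq': "case n of 0 \<Rightarrow> kills (carrier A) 0 z
      | Suc i \<Rightarrow> \<exists>e\<in>carrier (E i). kills (pw k \<inter> carrier A) i e \<and> kills (carrier A) n (z \<ominus>\<^bsub>E n\<^esub> d i e)"
      using sq oneideal Ic z(1) k kd unfolding subquotient_exact_def by blast
    show "case n of 0 \<Rightarrow> z = \<zero>\<^bsub>E 0\<^esub> | Suc i \<Rightarrow> \<exists>y\<in>carrier (E i). (\<exists>k. kills (pw k) i y) \<and> d i y = z"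
    proof (cases n)
      case 0
      then have "kills (carrier A) n z" using sq' by simp
      then have "\<one> \<odot>\<^bsub>E n\<^esub> z = \<zero>\<^bsub>E n\<^esub>" unfolding kills_def using one_closed by blast
      then have "z = \<zero>\<^bsub>E n\<^esub>" using En.smult_one[OF z(1)] by simp
      then show ?thesis using 0 by simp
    next
      case (Suc i)
      then obtain e where e: "e \<in> carrier (E i)" "kills (pw k \<inter> carrier A) i e"
        "kills (carrier A) n (z \<ominus>\<^bsub>E n\<^esub> d i e)"
        using sq' by auto
      have de: "d i e \<in> carrier (E n)" using d_closed[OF e(1)] Suc by simp
      have "\<one> \<odot>\<^bsub>E n\<^esub> (z \<ominus>\<^bsub>E n\<^esub> d i e) = \<zero>\<^bsub>E n\<^esub>" using e(3) unfolding kills_def using one_closed by blast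
      then have "d i e = z" using z(1) de En.M.diff_eq_zero[of z "d i e"] by simp
      moreover have "pw k \<inter> carrier A = pw k" using ideal_subset[OF ideal_pow_ideal[OF I]] by blast
      then have "\<exists>k. kills (pw k) i e" using e(2) by metis
      ultimately show ?thesis unfolding Suc nat.case using e(1) by blast
    qed
  qed
qed

end

section \<open>Ext by free resolutions against Ext by injective resolutions\<close>

context noetherian_ideal_resolution
begin

context
  fixes U :: "('a, 'u, 'y1) module_scheme" and V :: "('a, 'v, 'y2) module_scheme"
    and W :: "('a, 'w, 'y3) module_scheme" and f g
  assumes ses: "short_exact A U V W f g"
begin

interpretation U: module A U using ses by (simp add: short_exact_def)
interpretation V: module A V using ses by (simp add: short_exact_def)
interpretation W: module A W using ses by (simp add: short_exact_def)

lemma acyclic_at_shift: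
  assumes "acyclic_at V (Suc j)" "acyclic_at V (Suc (Suc j))"
  shows "acyclic_at U (Suc (Suc j)) \<longleftrightarrow> acyclic_at W (Suc j)"
  using acyclic_at_right[OF ses assms(1)] acyclic_at_left[OF ses assms(2)] by blast

text \<open>Degree 0 of the middle term need not vanish, so this shift yields a lifting property: if
  Ext^1(A/I, V) = 0, then Ext^1(A/I, U) is the cokernel of Hom(A/I, V) \<rightarrow> Hom(A/I,
  W).\<close>

lemma acyclic_at_shift_1:
  assumes V1: "acyclic_at V (Suc 0)"
  shows "acyclic_at U (Suc 0) \<longleftrightarrow>
    (\<forall>w\<in>carrier W. (\<forall>b\<in>I. b \<odot>\<^bsub>W\<^esub> w = \<zero>\<^bsub>W\<^esub>) \<longrightarrow>
      (\<exists>e\<in>carrier V. (\<forall>b\<in>I. b \<odot>\<^bsub>V\<^esub> e = \<zero>\<^bsub>V\<^esub>) \<and> g e = w))"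
proof -
  note mods = V.module_axioms W.module_axioms U.module_axioms
  note hom = short_exact_hom[OF ses]
  note cl = mhom_closed[OF hom(1)] mhom_closed[OF hom(2)]
  show ?thesis
  proof (intro iffI ballI impI)
    fix w assume U1: "acyclic_at U (Suc 0)" and w: "w \<in> carrier W" "\<forall>b\<in>I. b \<odot>\<^bsub>W\<^esub> w = \<zero>\<^bsub>W\<^esub>"
    have "w \<in> g ` carrier V" using w(1) unfolding short_exact_surj[OF ses] .
    then obtain e where e: "w = g e" "e \<in> carrier V" by (rule imageE)
    have ev: "(\<lambda>_. e) \<in> {..<m 0} \<rightarrow> carrier V" using e(2) by auto
    have cw: "cocycle W 0 (\<lambda>_. w)" using w by (simp add: cocycle_0_iff[OF mods(2)])
    define v where "v = diff V 0 (\<lambda>_. e)"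
    have vc: "v \<in> {..<m (Suc 0)} \<rightarrow> carrier V" unfolding v_def using diff_closed[OF mods(1) ev] by auto
    have gv: "g (v k) = \<zero>\<^bsub>W\<^esub>" if "k < m (Suc 0)" for k
      using cw that unfolding v_def diff_hom[OF mods(1,2) hom(2) ev] by (simp add: cocycle_def e(1))
    obtain u where u: "u \<in> {..<m (Suc 0)} \<rightarrow> carrier U" "\<And>k. k < m (Suc 0) \<Longrightarrow> f (u k) = v k"
      using lift_inj[OF ses vc gv] by blast
    have "cocycle U (Suc 0) u"
      unfolding cocycle_def
    proof (intro conjI allI impI u)
      fix k assume k: "k < m (Suc (Suc 0))"
      have "f (diff U (Suc 0) u k) = diff V (Suc 0) v k"
        unfolding diff_hom[OF mods(3,1) hom(1) u(1)]
        by (rule diff_cong) (use u vc mods in auto)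
      also have "\<dots> = f \<zero>\<^bsub>U\<^esub>"
        unfolding v_def diff_diff[OF mods(1) ev k] mhom_zero[OF mods(3,1) hom(1)] ..
      finally show "diff U (Suc 0) u k = \<zero>\<^bsub>U\<^esub>"
        using short_exact_inj[OF ses] diff_closed[OF mods(3) u(1)] by simp
    qed
    then obtain u' where u': "u' \<in> {..<m 0} \<rightarrow> carrier U" "\<And>k. k < m (Suc 0) \<Longrightarrow> u k = diff U 0 u' k"
      using U1 unfolding acyclic_at_def coboundary_def by force
    have fu': "(\<lambda>k. f (u' k)) \<in> {..<m 0} \<rightarrow> carrier V" using u'(1) cl by auto
    have u0: "u' 0 \<in> carrier U" using u'(1) m_0 by auto
    have "cocycle V 0 (\<lambda>k. e \<ominus>\<^bsub>V\<^esub> f (u' k))"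
      unfolding cocycle_def
    proof (intro conjI allI impI)
      show "(\<lambda>k. e \<ominus>\<^bsub>V\<^esub> f (u' k)) \<in> {..<m 0} \<rightarrow> carrier V" using ev fu' by auto
      fix k assume k: "k < m (Suc 0)"
      have "diff V 0 (\<lambda>k. e \<ominus>\<^bsub>V\<^esub> f (u' k)) k = v k \<ominus>\<^bsub>V\<^esub> f (diff U 0 u' k)"
        unfolding v_def diff_minus[OF mods(1) ev fu'] diff_hom[OF mods(3,1) hom(1) u'(1)] ..
      also have "\<dots> = \<zero>\<^bsub>V\<^esub>"
        using u(2)[OF k] u'(2)[OF k] diff_closed[OF mods(1) ev] by (simp add: v_def V.M.diff_self)
      finally show "diff V 0 (\<lambda>k. e \<ominus>\<^bsub>V\<^esub> f (u' k)) k = \<zero>\<^bsub>V\<^esub>" .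
    qed
    then have "e \<ominus>\<^bsub>V\<^esub> f (u' 0) \<in> carrier V" "\<forall>b\<in>I. b \<odot>\<^bsub>V\<^esub> (e \<ominus>\<^bsub>V\<^esub> f (u' 0)) = \<zero>\<^bsub>V\<^esub>"
      by (simp_all add: cocycle_0_iff[OF mods(1)])
    moreover have "g (e \<ominus>\<^bsub>V\<^esub> f (u' 0)) = w"
      unfolding mhom_minus[OF mods(1,2) hom(2) e(2) cl(1)[OF u0]] short_exact_comp[OF ses u0]
      using w(1) e(1) by (simp add: W.M.diff_zero)
    ultimately show "\<exists>e\<in>carrier V. (\<forall>b\<in>I. b \<odot>\<^bsub>V\<^esub> e = \<zero>\<^bsub>V\<^esub>) \<and> g e = w" by blast
  next
    assume lift: "\<forall>w\<in>carrier W. (\<forall>b\<in>I. b \<odot>\<^bsub>W\<^esub> w = \<zero>\<^bsub>W\<^esub>) \<longrightarrow>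
      (\<exists>e\<in>carrier V. (\<forall>b\<in>I. b \<odot>\<^bsub>V\<^esub> e = \<zero>\<^bsub>V\<^esub>) \<and> g e = w)"
    show "acyclic_at U (Suc 0)"
      unfolding acyclic_at_def
    proof (intro allI impI)
      fix u assume u: "cocycle U (Suc 0) u"
      have u1: "u \<in> {..<m (Suc 0)} \<rightarrow> carrier U" using u by (simp add: cocycle_def)
      have fu: "(\<lambda>k. f (u k)) \<in> {..<m (Suc 0)} \<rightarrow> carrier V" using u1 cl by auto
      have "cocycle V (Suc 0) (\<lambda>k. f (u k))"
        using u fu mhom_zero[OF mods(3,1) hom(1)]
        by (simp add: cocycle_def diff_hom[OF mods(3,1) hom(1) u1, symmetric])
      then obtain v where v: "v \<in> {..<m 0} \<rightarrow> carrier V" "\<And>k. k < m (Suc 0) \<Longrightarrow> f (u k) = diff V 0 v k"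
        using V1 unfolding acyclic_at_def coboundary_def by force
      have v0: "v 0 \<in> carrier V" using v(1) m_0 by auto
      have "cocycle W 0 (\<lambda>k. g (v k))"
        unfolding cocycle_def
      proof (intro conjI allI impI)
        show "(\<lambda>k. g (v k)) \<in> {..<m 0} \<rightarrow> carrier W" using v(1) cl by auto
        fix k assume k: "k < m (Suc 0)"
        have uk: "u k \<in> carrier U" using u1 k by auto
        show "diff W 0 (\<lambda>k. g (v k)) k = \<zero>\<^bsub>W\<^esub>"
          unfolding diff_hom[OF mods(1,2) hom(2) v(1), symmetric] v(2)[OF k, symmetric] short_exact_comp[OF ses uk] ..
      qed
      then have "\<exists>e\<in>carrier V. (\<forall>b\<in>I. b \<odot>\<^bsub>V\<^esub> e = \<zero>\<^bsub>V\<^esub>) \<and> g e = g (v 0)"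
        using lift unfolding cocycle_0_iff[OF mods(2)] by blast
      then obtain e where e: "e \<in> carrier V" "\<forall>b\<in>I. b \<odot>\<^bsub>V\<^esub> e = \<zero>\<^bsub>V\<^esub>" "g e = g (v 0)" by blast
      have ce: "cocycle V 0 (\<lambda>_. e)" using e by (simp add: cocycle_0_iff[OF mods(1)])
      then have ev: "(\<lambda>_. e) \<in> {..<m 0} \<rightarrow> carrier V" by (simp add: cocycle_def)
      have "g (v 0 \<ominus>\<^bsub>V\<^esub> e) = \<zero>\<^bsub>W\<^esub>"
        unfolding mhom_minus[OF mods(1,2) hom(2) v0 e(1)] e(3) using cl(2)[OF v0] by (rule W.M.diff_self)
      then have "v 0 \<ominus>\<^bsub>V\<^esub> e \<in> f ` carrier U" using v0 e(1) by (intro short_exact_kernel[OF ses]) simp_all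
      then obtain x where x: "v 0 \<ominus>\<^bsub>V\<^esub> e = f x" "x \<in> carrier U" by (rule imageE)
      have xv: "(\<lambda>_. x) \<in> {..<m 0} \<rightarrow> carrier U" using x(2) by auto
      have "u k = diff U 0 (\<lambda>_. x) k" if k: "k < m (Suc 0)" for k
      proof -
        have uk: "u k \<in> carrier U" using u1 k by auto
        have "f (diff U 0 (\<lambda>_. x) k) = diff V 0 (\<lambda>k. v k \<ominus>\<^bsub>V\<^esub> e) k"
          unfolding diff_hom[OF mods(3,1) hom(1) xv]
          by (rule diff_cong) (use x v0 e(1) mods in \<open>auto simp: m_0\<close>)
        also have "\<dots> = f (u k)"
          using v(2)[OF k] ce k diff_closed[OF mods(1) v(1)]
          by (simp add: diff_minus[OF mods(1) v(1) ev] cocycle_def V.M.diff_zero)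
        finally show ?thesis using short_exact_inj[OF ses diff_closed[OF mods(3) xv] uk] by simp
      qed
      then show "coboundary U (Suc 0) u" unfolding coboundary_def nat.case using xv by blast
    qed
  qed
qed

end

context
  fixes V :: "('a, 'v, 'y) module_scheme" and E :: "nat \<Rightarrow> ('a, 'e) module" and \<epsilon> d
  assumes V: "module A V" and res: "injective_resolution A V \<epsilon> E d"
    and enc: "\<And>q. \<exists>enc :: (nat \<Rightarrow> 'a) \<Rightarrow> 'e. inj_on enc ({..<q} \<rightarrow>\<^sub>E carrier A)"
begin

lemma resolution_facts:
  shows "injective_module A (E n)" "d n \<in> module_hom A (E n) (E (Suc n))"
    "\<epsilon> \<in> module_hom A V (E 0)" "inj_on \<epsilon> (carrier V)"
    "\<epsilon> ` carrier V = {x \<in> carrier (E 0). d 0 x = \<zero>\<^bsub>E 1\<^esub>}"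
    "d n ` carrier (E n) = {x \<in> carrier (E (Suc n)). d (Suc n) x = \<zero>\<^bsub>E (Suc (Suc n))\<^esub>}"
  using res by (simp_all only: injective_resolution_def a_kernel_eq)

lemma resolution_injective_complex: "injective_complex A I E d"
proof (intro injective_complex.intro injective_complex_axioms.intro)
  show "noetherian_cring A" by (rule noetherian_cring_axioms)
  show "d (Suc n) (d n x) = \<zero>\<^bsub>E (Suc (Suc n))\<^esub>" if "x \<in> carrier (E n)" for n x
    using imageI[OF that, of "d n"] unfolding resolution_facts(6) by simp
qed (fact ideal_I resolution_facts enc)+

interpretation C: injective_complex A I E d by (rule resolution_injective_complex)

text \<open>The cosyzygies of V in the resolution, with \<open>Z 0\<close> a copy of V
  itself.\<close>

definition Z :: "nat \<Rightarrow> ('a, 'e) module"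
  where "Z n = (E n)\<lparr>carrier := {x \<in> carrier (E n). d n x = \<zero>\<^bsub>E (Suc n)\<^esub>}\<rparr>"

lemma Z_module: "module A (Z n)"
  unfolding Z_def
  by (rule submodule.submodule_is_module[OF submodule_kernel[OF C.E_module C.E_module C.d] C.E_module])

lemma Z_short_exact: "short_exact A (Z n) (E n) (Z (Suc n)) (\<lambda>x. x) (d n)"
proof -
  have "d n \<in> module_hom A (E n) (Z (Suc n))"
    by (rule mhomI) (simp_all add: Z_def C.d_closed C.dd mhom_add[OF C.d] mhom_smult[OF C.d])
  moreover have "(\<lambda>x. x) \<in> module_hom A (Z n) (E n)" by (rule mhomI) (simp_all add: Z_def)
  moreover have "d n ` carrier (E n) = carrier (Z (Suc n))" unfolding resolution_facts(6) by (simp add: Z_def)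
  moreover have "\<forall>v\<in>carrier (E n). d n v = \<zero>\<^bsub>Z (Suc n)\<^esub> \<longleftrightarrow> v \<in> (\<lambda>x. x) ` carrier (Z n)"
    by (simp add: Z_def)
  ultimately show ?thesis unfolding short_exact_def using Z_module C.E_module by simp
qed

lemma augmentation_short_exact: "short_exact A V (E 0) (Z (Suc 0)) \<epsilon> (d 0)"
proof -
  have "\<forall>v\<in>carrier (E 0). d 0 v = \<zero>\<^bsub>Z (Suc 0)\<^esub> \<longleftrightarrow> v \<in> \<epsilon> ` carrier V"
    unfolding resolution_facts(5) by (simp add: Z_def)
  then show ?thesis using Z_short_exact[of 0] V resolution_facts(3,4) unfolding short_exact_def by blast
qed

lemma E_acyclic: "acyclic_at (E n) (Suc j)"
  by (rule injective_acyclic[OF C.inj enc])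

lemma socle_exact_Suc_iff:
  "C.socle_exact (Suc n) \<longleftrightarrow> (\<forall>w\<in>carrier (Z (Suc n)). (\<forall>b\<in>I. b \<odot>\<^bsub>Z (Suc n)\<^esub> w = \<zero>\<^bsub>Z (Suc n)\<^esub>) \<longrightarrow>
      (\<exists>e\<in>carrier (E n). (\<forall>b\<in>I. b \<odot>\<^bsub>E n\<^esub> e = \<zero>\<^bsub>E n\<^esub>) \<and> d n e = w))"
  unfolding C.socle_exact_def C.kills_def Z_def by (simp add: Ball_def imp_conjL)

lemma acyclic_Z_iff: "acyclic_at (Z n) (Suc j) \<longleftrightarrow> C.socle_exact (Suc (n + j))"
proof (induct j arbitrary: n)
  case 0
  show ?case using acyclic_at_shift_1[OF Z_short_exact E_acyclic] socle_exact_Suc_iff by simp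
next
  case (Suc j)
  show ?case using acyclic_at_shift[OF Z_short_exact E_acyclic E_acyclic] Suc[of "Suc n"] by simp
qed

text \<open>Balancing of Ext without a double complex: dimension shifting along the cosyzygies, on
  which the injective terms have no effect in positive degrees, ends in the lifting property of
  \<open>acyclic_at_shift_1\<close>. That property is socle exactness.\<close>

lemma acyclic_iff_socle_exact: "acyclic_at V n \<longleftrightarrow> C.socle_exact n"
proof (cases n)
  case 0
  note \<epsilon> = resolution_facts(3)
  have kills: "(\<forall>b\<in>I. b \<odot>\<^bsub>E 0\<^esub> \<epsilon> v = \<zero>\<^bsub>E 0\<^esub>) \<longleftrightarrow> (\<forall>b\<in>I. b \<odot>\<^bsub>V\<^esub> v = \<zero>\<^bsub>V\<^esub>)" if v: "v \<in> carrier V" for v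
  proof -
    have "b \<odot>\<^bsub>E 0\<^esub> \<epsilon> v = \<zero>\<^bsub>E 0\<^esub> \<longleftrightarrow> b \<odot>\<^bsub>V\<^esub> v = \<zero>\<^bsub>V\<^esub>" if b: "b \<in> I" for b
    proof -
      have bc: "b \<in> carrier A" using b ideal_subset[OF ideal_I] by blast
      have "b \<odot>\<^bsub>E 0\<^esub> \<epsilon> v = \<epsilon> (b \<odot>\<^bsub>V\<^esub> v)" using mhom_smult[OF \<epsilon> bc v] by simp
      moreover have "b \<odot>\<^bsub>V\<^esub> v \<in> carrier V" "\<zero>\<^bsub>V\<^esub> \<in> carrier V"
        using module.smult_closed[OF V bc v] module.smult_r_null[OF V bc]
          module.smult_closed[OF V bc, of "\<zero>\<^bsub>V\<^esub>"] abelian_monoid.zero_closed[OF abelian_group.axioms(1)[OF module.axioms(2)[OF V]]]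
        by auto
      ultimately show ?thesis
        using inj_on_eq_iff[OF resolution_facts(4), of "b \<odot>\<^bsub>V\<^esub> v" "\<zero>\<^bsub>V\<^esub>"]
        by (simp add: mhom_zero[OF V C.E_module \<epsilon>])
    qed
    then show ?thesis by blast
  qed
  have V0: "\<zero>\<^bsub>V\<^esub> \<in> carrier V"
    by (rule abelian_monoid.zero_closed[OF abelian_group.axioms(1)[OF module.axioms(2)[OF V]]])
  have zero: "\<epsilon> v = \<zero>\<^bsub>E 0\<^esub> \<longleftrightarrow> v = \<zero>\<^bsub>V\<^esub>" if "v \<in> carrier V" for v
    using inj_on_eq_iff[OF resolution_facts(4) that V0] unfolding mhom_zero[OF V C.E_module \<epsilon>] .
  have "C.socle_exact 0 \<longleftrightarrow> (\<forall>z\<in>\<epsilon> ` carrier V. (\<forall>b\<in>I. b \<odot>\<^bsub>E 0\<^esub> z = \<zero>\<^bsub>E 0\<^esub>) \<longrightarrow> z = \<zero>\<^bsub>E 0\<^esub>)"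
    unfolding resolution_facts(5) C.socle_exact_def C.kills_def by (simp add: Ball_def imp_conjL)
  also have "\<dots> \<longleftrightarrow> acyclic_at V 0" unfolding acyclic_at_0_iff[OF V] using kills zero by simp
  finally show ?thesis using 0 by simp
next
  case (Suc i)
  show ?thesis
  proof (cases i)
    case 0
    then show ?thesis
      using acyclic_at_shift_1[OF augmentation_short_exact E_acyclic] socle_exact_Suc_iff[of 0] Suc by simp
  next
    case (Suc h)
    then show ?thesis
      using acyclic_at_shift[OF augmentation_short_exact E_acyclic E_acyclic] acyclic_Z_iff[of "Suc 0" h]
        \<open>n = Suc i\<close> by simp
  qed
qed

end

end

section \<open>Vanishing of local cohomology and depth\<close>

lemma (in module) cosets_trivial_iff:
  assumes B: "submodule B R M" and K: "K \<subseteq> carrier M" "K \<noteq> {}"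
  shows "a_rcosets\<^bsub>M\<lparr>carrier := K\<rparr>\<^esub> B = {B} \<longleftrightarrow> K \<subseteq> B"
proof -
  note E = submoduleE[OF B]
  have coset: "B +>\<^bsub>M\<lparr>carrier := K\<rparr>\<^esub> x = (\<lambda>b. b \<oplus>\<^bsub>M\<^esub> x) ` B" for x by (auto simp: a_r_coset_def')
  have mem: "x \<in> B +>\<^bsub>M\<lparr>carrier := K\<rparr>\<^esub> x" if "x \<in> K" for x
  proof -
    have "\<zero>\<^bsub>M\<^esub> \<oplus>\<^bsub>M\<^esub> x = x" using that K(1) by auto
    then show ?thesis unfolding coset using submodule_zero_mem[OF B] by force
  qed
  have triv: "B +>\<^bsub>M\<lparr>carrier := K\<rparr>\<^esub> x = B" if x: "x \<in> B" for x
  proof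
    show "B +>\<^bsub>M\<lparr>carrier := K\<rparr>\<^esub> x \<subseteq> B" unfolding coset using E(5) x by blast
    show "B \<subseteq> B +>\<^bsub>M\<lparr>carrier := K\<rparr>\<^esub> x"
    proof
      fix b assume b: "b \<in> B"
      have "b = (b \<ominus>\<^bsub>M\<^esub> x) \<oplus>\<^bsub>M\<^esub> x" using E(1) b x by (simp add: M.diff_add subset_iff)
      then show "b \<in> B +>\<^bsub>M\<lparr>carrier := K\<rparr>\<^esub> x" unfolding coset using submodule_minus_mem[OF B b x] by blast
    qed
  qed
  have cs: "a_rcosets\<^bsub>M\<lparr>carrier := K\<rparr>\<^esub> B = (\<lambda>x. B +>\<^bsub>M\<lparr>carrier := K\<rparr>\<^esub> x) ` K"
    by (auto simp: A_RCOSETS_def')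
  show ?thesis
  proof
    assume l: "a_rcosets\<^bsub>M\<lparr>carrier := K\<rparr>\<^esub> B = {B}"
    show "K \<subseteq> B"
    proof
      fix x assume x: "x \<in> K"
      then have "B +>\<^bsub>M\<lparr>carrier := K\<rparr>\<^esub> x \<in> {B}" using l cs by blast
      then show "x \<in> B" using mem[OF x] by blast
    qed
  next
    assume "K \<subseteq> B"
    then have "(\<lambda>x. B +>\<^bsub>M\<lparr>carrier := K\<rparr>\<^esub> x) ` K = (\<lambda>_. B) ` K" using triv by (intro image_cong) auto
    then show "a_rcosets\<^bsub>M\<lparr>carrier := K\<rparr>\<^esub> B = {B}" unfolding cs using K(2) by auto
  qed
qed

lemma cohomology_trivial_iff:
  assumes M: "module A (C n)" and d: "d n \<in> module_hom A (C n) (C (Suc n))" "module A (C (Suc n))"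
    and B: "submodule (coboundaries C d n) A (C n)"
  shows "carrier (cohomology C d n) = {\<zero>\<^bsub>cohomology C d n\<^esub>} \<longleftrightarrow>
    {x \<in> carrier (C n). d n x = \<zero>\<^bsub>C (Suc n)\<^esub>} \<subseteq> coboundaries C d n"
proof -
  interpret M: module A "C n" by (rule M)
  have "\<zero>\<^bsub>C n\<^esub> \<in> {x \<in> carrier (C n). d n x = \<zero>\<^bsub>C (Suc n)\<^esub>}" by (simp add: mhom_zero[OF M d(2,1)])
  then have "{x \<in> carrier (C n). d n x = \<zero>\<^bsub>C (Suc n)\<^esub>} \<noteq> {}" by blast
  from M.cosets_trivial_iff[OF B _ this] show ?thesis
    by (simp add: cohomology_def quotient_module_def a_kernel_eq)
qed

context injective_complex
begin

lemma torsion_submodule: "submodule {x \<in> carrier (E n). \<exists>k. kills (pw k) n x} A (E n)"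
proof -
  interpret En: module A "E n" by (rule E_module)
  have pc: "b \<in> carrier A" if "b \<in> pw k" for b k using that ideal_subset[OF ideal_pow_ideal[OF I]] by blast
  have anti: "pw j \<subseteq> pw k" if "k \<le> j" for j k
    using that by (rule lift_Suc_antimono_le[rotated]) (rule ideal_pow_Suc_subset[OF I])
  show ?thesis
  proof (rule En.submodule_criterion)
    have "kills (pw 0) n \<zero>\<^bsub>E n\<^esub>" using pc[of _ 0] by (simp add: kills_def)
    then show "\<zero>\<^bsub>E n\<^esub> \<in> {x \<in> carrier (E n). \<exists>k. kills (pw k) n x}" by blast
  next
    fix x y assume "x \<in> {x \<in> carrier (E n). \<exists>k. kills (pw k) n x}" "y \<in> {x \<in> carrier (E n). \<exists>k. kills (pw k) n x}"
    then obtain j k where *: "x \<in> carrier (E n)" "kills (pw j) n x" "y \<in> carrier (E n)" "kills (pw k) n y" by blast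
    have "b \<odot>\<^bsub>E n\<^esub> (x \<oplus>\<^bsub>E n\<^esub> y) = \<zero>\<^bsub>E n\<^esub>" if b: "b \<in> pw (max j k)" for b
    proof -
      have "b \<in> pw j" "b \<in> pw k" using b anti[of j "max j k"] anti[of k "max j k"] by auto
      then show ?thesis using * pc[OF b] by (simp add: kills_def En.smult_r_distr)
    qed
    then have "kills (pw (max j k)) n (x \<oplus>\<^bsub>E n\<^esub> y)" by (simp add: kills_def)
    then show "x \<oplus>\<^bsub>E n\<^esub> y \<in> {x \<in> carrier (E n). \<exists>k. kills (pw k) n x}" using * by blast
  next
    fix a x assume a: "a \<in> carrier A" and "x \<in> {x \<in> carrier (E n). \<exists>k. kills (pw k) n x}"
    then obtain k where *: "x \<in> carrier (E n)" "kills (pw k) n x" by blast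
    have "b \<odot>\<^bsub>E n\<^esub> (a \<odot>\<^bsub>E n\<^esub> x) = \<zero>\<^bsub>E n\<^esub>" if b: "b \<in> pw k" for b
    proof -
      have "b \<odot>\<^bsub>E n\<^esub> (a \<odot>\<^bsub>E n\<^esub> x) = a \<odot>\<^bsub>E n\<^esub> (b \<odot>\<^bsub>E n\<^esub> x)" by (rule En.smult_left_commute[OF pc[OF b] a *(1)])
      then show ?thesis using *(2) b a by (simp add: kills_def)
    qed
    then have "kills (pw k) n (a \<odot>\<^bsub>E n\<^esub> x)" by (simp add: kills_def)
    then show "a \<odot>\<^bsub>E n\<^esub> x \<in> {x \<in> carrier (E n). \<exists>k. kills (pw k) n x}" using a * by blast
  qed blast
qed

lemma torsion_module_eq:
  "torsion_module A I (E n) = (E n)\<lparr>carrier := {x \<in> carrier (E n). \<exists>k. kills (pw k) n x}\<rparr>"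
  by (simp add: torsion_module_def kills_def)

lemma torsion_cohomology_trivial_iff:
  "carrier (cohomology (\<lambda>n. torsion_module A I (E n)) d n) = {\<zero>\<^bsub>cohomology (\<lambda>n. torsion_module A I (E n)) d n\<^esub>}
    \<longleftrightarrow> torsion_exact n"
proof -
  let ?T = "\<lambda>n. torsion_module A I (E n)"
  have T: "module A (?T n)" for n
    unfolding torsion_module_eq by (rule submodule.submodule_is_module[OF torsion_submodule E_module])
  have dT: "d n \<in> module_hom A (?T n) (?T (Suc n))" for n
  proof (rule mhomI)
    fix x assume "x \<in> carrier (?T n)"
    then obtain k where x: "x \<in> carrier (E n)" "kills (pw k) n x" by (auto simp: torsion_module_eq)
    have "kills (pw k) (Suc n) (d n x)"
      unfolding kills_def
    proof
      fix b assume b: "b \<in> pw k"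
      have bc: "b \<in> carrier A" using b ideal_subset[OF ideal_pow_ideal[OF I]] by blast
      show "b \<odot>\<^bsub>E (Suc n)\<^esub> d n x = \<zero>\<^bsub>E (Suc n)\<^esub>"
        using x(2) b mhom_smult[OF d bc x(1)] d_zero by (simp add: kills_def)
    qed
    then show "d n x \<in> carrier (?T (Suc n))" using d_closed[OF x(1)] by (auto simp: torsion_module_eq)
  qed (auto simp: torsion_module_eq mhom_add[OF d] mhom_smult[OF d])
  have B: "submodule (coboundaries ?T d n) A (?T n)"
  proof (cases n)
    case 0
    interpret T0: module A "?T 0" by (rule T)
    have "submodule {\<zero>\<^bsub>?T 0\<^esub>} A (?T 0)" by (rule T0.submodule_criterion) auto
    then show ?thesis by (simp add: coboundaries_def 0)
  next
    case (Suc k)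
    then show ?thesis
      using submodule_image[OF T T dT module.carrier_is_submodule[OF T], of k] by (simp add: coboundaries_def)
  qed
  have "{x \<in> carrier (?T n). d n x = \<zero>\<^bsub>?T (Suc n)\<^esub>} \<subseteq> coboundaries ?T d n \<longleftrightarrow> torsion_exact n"
  proof (cases n)
    case 0
    then show ?thesis
      unfolding torsion_exact_def coboundaries_def 0 torsion_module_eq by auto
  next
    case (Suc i)
    have "d i ` carrier (?T i) = {z. \<exists>y\<in>carrier (E i). (\<exists>k. kills (pw k) i y) \<and> d i y = z}"
      unfolding torsion_module_eq by auto
    then show ?thesis
      unfolding torsion_exact_def coboundaries_def Suc nat.case by (auto simp: torsion_module_eq)
  qed
  then show ?thesis using cohomology_trivial_iff[of A ?T n d, OF T dT T B] by simp
qed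

end

text \<open>A sequence is encoded by its graph, with a dummy entry from \<open>'v\<close>. This
  makes room for all finitely generated free modules in the element type used by
  \<open>local_cohomology\<close>.\<close>

lemma tuple_encoding: "\<exists>enc :: (nat \<Rightarrow> 'a) \<Rightarrow> ('v \<times> 'a \<times> nat) set. inj_on enc S"
proof -
  have "inj (\<lambda>c :: nat \<Rightarrow> 'a. {(undefined :: 'v, c k, k) | k. True})"
  proof (rule injI, rule ext)
    fix c c' :: "nat \<Rightarrow> 'a" and k
    assume "{(undefined :: 'v, c k, k) | k. True} = {(undefined, c' k, k) | k. True}"
    then have "(undefined :: 'v, c k, k) \<in> {(undefined, c' k, k) | k. True}" by blast
    then show "c k = c' k" by blast
  qed
  then show ?thesis using inj_on_subset by blast
qed

lemma enat_le_Inf_iff: "enat n \<le> Inf {enat i | i. \<not> P i} \<longleftrightarrow> (\<forall>i<n. P i)"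
proof -
  have "enat n \<le> Inf {enat i | i. \<not> P i} \<longleftrightarrow> (\<forall>i. \<not> P i \<longrightarrow> n \<le> i)" by (auto simp: le_Inf_iff)
  then show ?thesis using not_less by blast
qed

text \<open>The interface between \<open>depth\<close> and the rest of the proof. By
  \<open>ex\<close> the chosen pair is an injective resolution, and the comparisons above hold for
  every injective resolution.\<close>

lemma (in noetherian_ideal_resolution) depth_ge_iff:
  fixes V :: "('a, 'v, 'y) module_scheme"
  assumes V: "module A V"
    and ex: "\<exists>E d \<epsilon>. injective_resolution A V \<epsilon> (E :: nat \<Rightarrow> ('a, ('v \<times> 'a \<times> nat) set) module) d"
  shows "enat n \<le> depth A I V \<longleftrightarrow> (\<forall>j<n. acyclic_at V j)"
proof -
  obtain E d where Ed: "chosen_injective_resolution A V = (E, d)" by (cases "chosen_injective_resolution A V") auto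
  have "\<exists>\<epsilon>. injective_resolution A V \<epsilon> E d"
  proof -
    have "\<exists>x. case x of (E, d) \<Rightarrow> \<exists>\<epsilon>. injective_resolution A V \<epsilon> (E :: nat \<Rightarrow> ('a, ('v \<times> 'a \<times> nat) set) module) d"
      using ex by auto
    from someI_ex[OF this] show ?thesis
      unfolding Ed[unfolded chosen_injective_resolution_def] prod.case .
  qed
  then obtain \<epsilon> where res: "injective_resolution A V \<epsilon> E d" by blast
  interpret C: injective_complex A I E d by (rule resolution_injective_complex[OF V res tuple_encoding])
  have lc: "carrier (local_cohomology A I V i) = {\<zero>\<^bsub>local_cohomology A I V i\<^esub>} \<longleftrightarrow> C.torsion_exact i" for i
    unfolding local_cohomology_def Ed prod.case by (rule C.torsion_cohomology_trivial_iff)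
  have "enat n \<le> depth A I V \<longleftrightarrow> (\<forall>i<n. C.torsion_exact i)"
    unfolding depth_def lc[symmetric] by (rule enat_le_Inf_iff)
  also have "\<dots> \<longleftrightarrow> (\<forall>i<n. C.socle_exact i)" by (rule C.torsion_exact_iff_socle_exact)
  also have "\<dots> \<longleftrightarrow> (\<forall>j<n. acyclic_at V j)" using acyclic_iff_socle_exact[OF V res tuple_encoding] by simp
  finally show ?thesis .
qed

section \<open>Existence of injective resolutions\<close>

definition divisible :: "('d, 'y) monoid_scheme \<Rightarrow> bool"
  where "divisible D \<longleftrightarrow> (\<forall>x\<in>carrier D. \<forall>n>0. \<exists>y\<in>carrier D. y [^]\<^bsub>D\<^esub> (n::nat) = x)"

text \<open>A homomorphism on a subgroup of \<open>N\<close> is represented by its graph, to which Zorn's lemma applies.\<close>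

locale hom_graph = N?: comm_group N + D: comm_group D for N (structure) and D :: "('d, 'y) monoid_scheme"
begin

definition graph :: "('a \<times> 'd) set \<Rightarrow> bool"
  where "graph \<Gamma> \<longleftrightarrow> \<Gamma> \<subseteq> carrier N \<times> carrier D \<and> (\<forall>x y y'. (x, y) \<in> \<Gamma> \<longrightarrow> (x, y') \<in> \<Gamma> \<longrightarrow> y = y') \<and>
    (\<one>, \<one>\<^bsub>D\<^esub>) \<in> \<Gamma> \<and>
    (\<forall>x y x' y'. (x, y) \<in> \<Gamma> \<longrightarrow> (x', y') \<in> \<Gamma> \<longrightarrow> (x \<otimes> x', y \<otimes>\<^bsub>D\<^esub> y') \<in> \<Gamma>) \<and>
    (\<forall>x y. (x, y) \<in> \<Gamma> \<longrightarrow> (inv x, inv\<^bsub>D\<^esub> y) \<in> \<Gamma>)"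

lemma graphD:
  assumes "graph \<Gamma>"
  shows graph_subset: "(x, y) \<in> \<Gamma> \<Longrightarrow> x \<in> carrier N \<and> y \<in> carrier D"
    and graph_unique: "(x, y) \<in> \<Gamma> \<Longrightarrow> (x, y') \<in> \<Gamma> \<Longrightarrow> y = y'"
    and graph_one: "(\<one>, \<one>\<^bsub>D\<^esub>) \<in> \<Gamma>"
    and graph_mult: "(x, y) \<in> \<Gamma> \<Longrightarrow> (x', y') \<in> \<Gamma> \<Longrightarrow> (x \<otimes> x', y \<otimes>\<^bsub>D\<^esub> y') \<in> \<Gamma>"
    and graph_inv: "(x, y) \<in> \<Gamma> \<Longrightarrow> (inv x, inv\<^bsub>D\<^esub> y) \<in> \<Gamma>"
  using assms unfolding graph_def by blast+

lemma graph_pow: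
  assumes "graph \<Gamma>" "(x, y) \<in> \<Gamma>"
  shows "(x [^] (n::int), y [^]\<^bsub>D\<^esub> n) \<in> \<Gamma>"
proof -
  have nat: "(x [^] (k::nat), y [^]\<^bsub>D\<^esub> k) \<in> \<Gamma>" for k
    by (induct k) (simp_all add: graph_one[OF assms(1)] graph_mult[OF assms(1) _ assms(2)])
  show ?thesis unfolding int_pow_def2
    by (cases "n < 0") (simp_all only: if_True if_False nat graph_inv[OF assms(1) nat])
qed

lemma graph_Union:
  assumes "C \<noteq> {}" "\<And>\<Gamma>. \<Gamma> \<in> C \<Longrightarrow> graph \<Gamma>" "\<And>\<Gamma> \<Delta>. \<Gamma> \<in> C \<Longrightarrow> \<Delta> \<in> C \<Longrightarrow> \<Gamma> \<subseteq> \<Delta> \<or> \<Delta> \<subseteq> \<Gamma>"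
  shows "graph (\<Union>C)"
proof -
  have both: "\<exists>\<Gamma>\<in>C. p \<in> \<Gamma> \<and> q \<in> \<Gamma>" if pq: "p \<in> \<Union>C" "q \<in> \<Union>C" for p q
  proof -
    obtain \<Gamma> \<Delta> where "\<Gamma> \<in> C" "\<Delta> \<in> C" "p \<in> \<Gamma>" "q \<in> \<Delta>" using pq by blast
    then show ?thesis using assms(3)[of \<Gamma> \<Delta>] by blast
  qed
  show ?thesis
    unfolding graph_def
  proof (intro conjI allI impI)
    show "\<Union>C \<subseteq> carrier N \<times> carrier D" using graph_subset[OF assms(2)] by auto
    show "(\<one>, \<one>\<^bsub>D\<^esub>) \<in> \<Union>C" using assms(1) graph_one[OF assms(2)] by blast
    show "y = y'" if xy: "(x, y) \<in> \<Union>C" "(x, y') \<in> \<Union>C" for x y y'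
      using both[OF xy] graph_unique[OF assms(2)] by blast
    show "(x \<otimes> x', y \<otimes>\<^bsub>D\<^esub> y') \<in> \<Union>C" if xy: "(x, y) \<in> \<Union>C" "(x', y') \<in> \<Union>C" for x y x' y'
      using both[OF xy] graph_mult[OF assms(2)] by blast
    show "(inv x, inv\<^bsub>D\<^esub> y) \<in> \<Union>C" if "(x, y) \<in> \<Union>C" for x y
      using that graph_inv[OF assms(2)] by blast
  qed
qed

text \<open>The value to be given to \<open>x\<close>. If a positive power of \<open>x\<close> lies
  in the domain, let k be the least such exponent and take a k-th root of the value at x^k;
  otherwise only j = 0 imposes a condition, and 1 is chosen.\<close>

lemma graph_value:
  assumes div: "divisible D" and \<Gamma>: "graph \<Gamma>" and x: "x \<in> carrier N"
  shows "\<exists>y\<in>carrier D. \<forall>j::int. x [^] j \<in> Domain \<Gamma> \<longrightarrow> (x [^] j, y [^]\<^bsub>D\<^esub> j) \<in> \<Gamma>"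
proof (cases "\<exists>n>0. x [^] (n::nat) \<in> Domain \<Gamma>")
  case False
  have z: "j = 0" if j: "x [^] (j::int) \<in> Domain \<Gamma>" for j
  proof (rule ccontr)
    assume j0: "j \<noteq> 0"
    have inv: "inv z \<in> Domain \<Gamma>" if "z \<in> Domain \<Gamma>" for z using that graph_inv[OF \<Gamma>] by blast
    show False
    proof (cases j rule: int_cases2)
      case (nonneg n)
      then have "x [^] n \<in> Domain \<Gamma>" using j by (simp only: int_pow_int)
      moreover have "n > 0" using nonneg j0 by simp
      ultimately show False using False by blast
    next
      case (nonpos n)
      then have "inv (x [^] n) \<in> Domain \<Gamma>" using j by (simp only: int_pow_neg_int[OF x])
      from inv[OF this] have "x [^] n \<in> Domain \<Gamma>" by (simp only: inv_inv[OF nat_pow_closed[OF x]])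
      moreover have "n > 0" using nonpos j0 by simp
      ultimately show False using False by blast
    qed
  qed
  have "(x [^] j, \<one>\<^bsub>D\<^esub> [^]\<^bsub>D\<^esub> j) \<in> \<Gamma>" if "x [^] (j::int) \<in> Domain \<Gamma>" for j
    using z[OF that] graph_one[OF \<Gamma>] by simp
  then show ?thesis using D.one_closed by blast
next
  case True
  define k where "k = (LEAST n. n > 0 \<and> x [^] (n::nat) \<in> Domain \<Gamma>)"
  have k: "k > 0" "x [^] k \<in> Domain \<Gamma>" using LeastI_ex[OF True] unfolding k_def by auto
  have least: "k \<le> n" if "n > 0" "x [^] n \<in> Domain \<Gamma>" for n unfolding k_def using that by (intro Least_le) simp
  obtain w where w: "(x [^] k, w) \<in> \<Gamma>" using k(2) by blast
  then have "w \<in> carrier D" using graph_subset[OF \<Gamma>] by blast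
  then obtain y where y: "y \<in> carrier D" "y [^]\<^bsub>D\<^esub> k = w" using div k(1) unfolding divisible_def by blast
  have "(x [^] j, y [^]\<^bsub>D\<^esub> j) \<in> \<Gamma>" if j: "x [^] (j::int) \<in> Domain \<Gamma>" for j
  proof -
    \<comment> \<open>Division with remainder shows that every admissible exponent is a multiple of
      \<open>k\<close>: the remainder is admissible and smaller than \<open>k\<close>.\<close>
    define q where "q = j div int k"
    define r where "r = j mod int k"
    have jqr: "j = int k * q + r" by (simp add: q_def r_def)
    have r: "0 \<le> r" "r < int k" using k(1) by (simp_all add: r_def)
    have kq: "((x [^] k) [^] q, w [^]\<^bsub>D\<^esub> q) \<in> \<Gamma>" by (rule graph_pow[OF \<Gamma> w])
    have xk: "(x [^] k) [^] q = x [^] (int k * q)" using x by (simp add: int_pow_pow int_pow_int[symmetric])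
    have yk: "w [^]\<^bsub>D\<^esub> q = y [^]\<^bsub>D\<^esub> (int k * q)" 
    proof -
      have "w = y [^]\<^bsub>D\<^esub> int k" using y(2) by (simp only: int_pow_int)
      then show ?thesis by (simp only: D.int_pow_pow[OF y(1)])
    qed
    obtain v where v: "(x [^] j, v) \<in> \<Gamma>" using j by blast
    have "(inv (x [^] (int k * q)) \<otimes> x [^] j) \<in> Domain \<Gamma>"
      using graph_mult[OF \<Gamma> graph_inv[OF \<Gamma> kq] v] unfolding xk by blast
    moreover have "inv (x [^] (int k * q)) \<otimes> x [^] j = x [^] r"
      unfolding jqr int_pow_mult[OF x] using x by (simp add: m_assoc[symmetric])
    ultimately have "x [^] int (nat r) \<in> Domain \<Gamma>" using r(1) by simp
    then have "x [^] (nat r) \<in> Domain \<Gamma>" by (simp only: int_pow_int)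
    then have "nat r = 0" using least[of "nat r"] r by (cases "nat r = 0") auto
    then have "j = int k * q" using jqr r(1) by simp
    then show ?thesis using kq xk yk by simp
  qed
  then show ?thesis using y(1) by blast
qed

lemma graph_extend:
  assumes div: "divisible D" and \<Gamma>: "graph \<Gamma>" and x: "x \<in> carrier N"
  shows "\<exists>\<Delta>. graph \<Delta> \<and> \<Gamma> \<subseteq> \<Delta> \<and> x \<in> Domain \<Delta>"
proof -
  obtain y where y: "y \<in> carrier D" "\<And>j::int. x [^] j \<in> Domain \<Gamma> \<Longrightarrow> (x [^] j, y [^]\<^bsub>D\<^esub> j) \<in> \<Gamma>"
    using graph_value[OF assms] by blast
  define \<Delta> where "\<Delta> = {(x [^] n \<otimes> a, y [^]\<^bsub>D\<^esub> n \<otimes>\<^bsub>D\<^esub> b) | (n::int) a b. (a, b) \<in> \<Gamma>}"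
  have mem: "(x [^] n \<otimes> a, y [^]\<^bsub>D\<^esub> n \<otimes>\<^bsub>D\<^esub> b) \<in> \<Delta>" if "(a, b) \<in> \<Gamma>" for n :: int and a b
    using that unfolding \<Delta>_def by blast
  have elim: "\<exists>(n::int) a b. p = x [^] n \<otimes> a \<and> q = y [^]\<^bsub>D\<^esub> n \<otimes>\<^bsub>D\<^esub> b \<and> (a, b) \<in> \<Gamma> \<and> a \<in> carrier N \<and> b \<in> carrier D"
    if "(p, q) \<in> \<Delta>" for p q
    using that graph_subset[OF \<Gamma>] unfolding \<Delta>_def by blast
  have "graph \<Delta>"
    unfolding graph_def
  proof (intro conjI allI impI)
    show "\<Delta> \<subseteq> carrier N \<times> carrier D"
    proof (rule subrelI)
      fix p q assume "(p, q) \<in> \<Delta>"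
      then obtain n a b where "p = x [^] (n::int) \<otimes> a" "q = y [^]\<^bsub>D\<^esub> n \<otimes>\<^bsub>D\<^esub> b" "a \<in> carrier N" "b \<in> carrier D"
        using elim by blast
      then show "(p, q) \<in> carrier N \<times> carrier D" using x y(1) by simp
    qed
    have "(x [^] (0::int) \<otimes> \<one>, y [^]\<^bsub>D\<^esub> (0::int) \<otimes>\<^bsub>D\<^esub> \<one>\<^bsub>D\<^esub>) \<in> \<Delta>" by (rule mem[OF graph_one[OF \<Gamma>]])
    then show "(\<one>, \<one>\<^bsub>D\<^esub>) \<in> \<Delta>" by simp
    \<comment> \<open>Two representations of \<open>p\<close> differ by the power of
      \<open>x\<close> with exponent n - n', which then lies in the domain of
      \<open>\<Gamma>\<close>; there \<open>y\<close> was chosen to agree with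
      \<open>\<Gamma>\<close>.\<close>
    show "q = q'" if pq: "(p, q) \<in> \<Delta>" "(p, q') \<in> \<Delta>" for p q q'
    proof -
      obtain n a b where *: "p = x [^] (n::int) \<otimes> a" "q = y [^]\<^bsub>D\<^esub> n \<otimes>\<^bsub>D\<^esub> b" "(a, b) \<in> \<Gamma>" "a \<in> carrier N" "b \<in> carrier D"
        using elim[OF pq(1)] by blast
      obtain n' a' b' where #: "p = x [^] (n'::int) \<otimes> a'" "q' = y [^]\<^bsub>D\<^esub> n' \<otimes>\<^bsub>D\<^esub> b'" "(a', b') \<in> \<Gamma>" "a' \<in> carrier N" "b' \<in> carrier D"
        using elim[OF pq(2)] by blast
      have e: "x [^] n \<otimes> a = x [^] n' \<otimes> a'" using *(1) #(1) by simp
      have "x [^] (n - n') = x [^] n \<otimes> inv (x [^] n')" using x by (simp add: int_pow_diff)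
      also have "x [^] n = x [^] n' \<otimes> a' \<otimes> inv a" using e *(4) #(4) x by (metis int_pow_closed inv_solve_right m_closed)
      also have "x [^] n' \<otimes> a' \<otimes> inv a \<otimes> inv (x [^] n') = a' \<otimes> inv a"
        using *(4) #(4) x by (simp add: m_ac)
      finally have xe: "x [^] (n - n') = a' \<otimes> inv a" .
      have g: "(a' \<otimes> inv a, b' \<otimes>\<^bsub>D\<^esub> inv\<^bsub>D\<^esub> b) \<in> \<Gamma>" by (rule graph_mult[OF \<Gamma> #(3) graph_inv[OF \<Gamma> *(3)]])
      then have "x [^] (n - n') \<in> Domain \<Gamma>" unfolding xe by blast
      from y(2)[OF this] have "(a' \<otimes> inv a, y [^]\<^bsub>D\<^esub> (n - n')) \<in> \<Gamma>" unfolding xe .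
      from graph_unique[OF \<Gamma> this g] have ye: "y [^]\<^bsub>D\<^esub> (n - n') = b' \<otimes>\<^bsub>D\<^esub> inv\<^bsub>D\<^esub> b" .
      have "y [^]\<^bsub>D\<^esub> n = y [^]\<^bsub>D\<^esub> (n - n') \<otimes>\<^bsub>D\<^esub> y [^]\<^bsub>D\<^esub> n'" using D.int_pow_mult[OF y(1), of "n - n'" n'] by simp
      then have "q = b' \<otimes>\<^bsub>D\<^esub> inv\<^bsub>D\<^esub> b \<otimes>\<^bsub>D\<^esub> y [^]\<^bsub>D\<^esub> n' \<otimes>\<^bsub>D\<^esub> b" using *(2) ye by simp
      also have "\<dots> = b' \<otimes>\<^bsub>D\<^esub> (inv\<^bsub>D\<^esub> b \<otimes>\<^bsub>D\<^esub> (b \<otimes>\<^bsub>D\<^esub> y [^]\<^bsub>D\<^esub> n'))"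
        using #(5) *(5) y(1) by (simp add: D.m_assoc D.m_comm[of "y [^]\<^bsub>D\<^esub> n'" b])
      also have "inv\<^bsub>D\<^esub> b \<otimes>\<^bsub>D\<^esub> (b \<otimes>\<^bsub>D\<^esub> y [^]\<^bsub>D\<^esub> n') = y [^]\<^bsub>D\<^esub> n'"
        using *(5) y(1) by (simp add: D.m_assoc[symmetric])
      also have "b' \<otimes>\<^bsub>D\<^esub> y [^]\<^bsub>D\<^esub> n' = q'" using #(2,5) y(1) by (simp add: D.m_comm)
      finally show ?thesis .
    qed
    show "(p \<otimes> p', q \<otimes>\<^bsub>D\<^esub> q') \<in> \<Delta>" if pq: "(p, q) \<in> \<Delta>" "(p', q') \<in> \<Delta>" for p q p' q'
    proof -
      obtain n a b where *: "p = x [^] (n::int) \<otimes> a" "q = y [^]\<^bsub>D\<^esub> n \<otimes>\<^bsub>D\<^esub> b" "(a, b) \<in> \<Gamma>" "a \<in> carrier N" "b \<in> carrier D"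
        using elim[OF pq(1)] by blast
      obtain n' a' b' where #: "p' = x [^] (n'::int) \<otimes> a'" "q' = y [^]\<^bsub>D\<^esub> n' \<otimes>\<^bsub>D\<^esub> b'" "(a', b') \<in> \<Gamma>" "a' \<in> carrier N" "b' \<in> carrier D"
        using elim[OF pq(2)] by blast
      have "p \<otimes> p' = x [^] (n + n') \<otimes> (a \<otimes> a')" "q \<otimes>\<^bsub>D\<^esub> q' = y [^]\<^bsub>D\<^esub> (n + n') \<otimes>\<^bsub>D\<^esub> (b \<otimes>\<^bsub>D\<^esub> b')"
        using * # x y(1) by (simp_all add: int_pow_mult D.int_pow_mult m_ac D.m_ac)
      then show ?thesis using mem[OF graph_mult[OF \<Gamma> *(3) #(3)], of "n + n'"] by simp
    qed
    show "(inv p, inv\<^bsub>D\<^esub> q) \<in> \<Delta>" if pq: "(p, q) \<in> \<Delta>" for p q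
    proof -
      obtain n a b where *: "p = x [^] (n::int) \<otimes> a" "q = y [^]\<^bsub>D\<^esub> n \<otimes>\<^bsub>D\<^esub> b" "(a, b) \<in> \<Gamma>" "a \<in> carrier N" "b \<in> carrier D"
        using elim[OF pq] by blast
      have "inv p = x [^] (- n) \<otimes> inv a" "inv\<^bsub>D\<^esub> q = y [^]\<^bsub>D\<^esub> (- n) \<otimes>\<^bsub>D\<^esub> inv\<^bsub>D\<^esub> b"
        using * x y(1) by (simp_all add: int_pow_neg D.int_pow_neg inv_mult D.inv_mult)
      then show ?thesis using mem[OF graph_inv[OF \<Gamma> *(3)], of "- n"] by simp
    qed
  qed
  moreover have "\<Gamma> \<subseteq> \<Delta>"
  proof
    fix p assume p: "p \<in> \<Gamma>"
    obtain a b where ab: "p = (a, b)" by (cases p)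
    then have "a \<in> carrier N" "b \<in> carrier D" using p graph_subset[OF \<Gamma>] by blast+
    then show "p \<in> \<Delta>" using mem[of a b 0] p ab by simp
  qed
  moreover have "(x [^] (1::int) \<otimes> \<one>, y [^]\<^bsub>D\<^esub> (1::int) \<otimes>\<^bsub>D\<^esub> \<one>\<^bsub>D\<^esub>) \<in> \<Delta>" by (rule mem[OF graph_one[OF \<Gamma>]])
  then have "x \<in> Domain \<Delta>" using x y(1) by auto
  ultimately show ?thesis by blast
qed

text \<open>A graph that is maximal above the graph of \<open>f\<close> has full domain, by
  \<open>graph_extend\<close>.\<close>

lemma divisible_extend:
  assumes div: "divisible D" and L: "subgroup L N" and f: "f \<in> hom (N\<lparr>carrier := L\<rparr>) D"
  shows "\<exists>h\<in>hom N D. \<forall>x\<in>L. h x = f x"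
proof -
  define \<Gamma>0 where "\<Gamma>0 = (\<lambda>x. (x, f x)) ` L"
  interpret L: subgroup L N by (rule L)
  have LG: "group (N\<lparr>carrier := L\<rparr>)" by (rule L.subgroup_is_group) (rule is_group)
  interpret f: group_hom "N\<lparr>carrier := L\<rparr>" D f
    by (intro group_hom.intro group_hom_axioms.intro LG f D.is_group)
  have fx: "f x \<in> carrier D" if "x \<in> L" for x using f.hom_closed that by simp
  have finv: "f (inv x) = inv\<^bsub>D\<^esub> f x" if "x \<in> L" for x
    using f.hom_inv[of x] that L by (simp add: m_inv_consistent)
  have "graph \<Gamma>0"
    unfolding graph_def \<Gamma>0_def
  proof (intro conjI allI impI)
    show "(\<one>, \<one>\<^bsub>D\<^esub>) \<in> (\<lambda>x. (x, f x)) ` L" using f.hom_one by force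
    show "(x \<otimes> x', y \<otimes>\<^bsub>D\<^esub> y') \<in> (\<lambda>x. (x, f x)) ` L" if "(x, y) \<in> (\<lambda>x. (x, f x)) ` L" "(x', y') \<in> (\<lambda>x. (x, f x)) ` L" for x y x' y'
      using that f.hom_mult by force
    show "(inv x, inv\<^bsub>D\<^esub> y) \<in> (\<lambda>x. (x, f x)) ` L" if "(x, y) \<in> (\<lambda>x. (x, f x)) ` L" for x y
      using that finv by force
  qed (use fx in auto)
  then have ne: "{\<Gamma>. graph \<Gamma> \<and> \<Gamma>0 \<subseteq> \<Gamma>} \<noteq> {}" by blast
  have "\<exists>\<Gamma>\<in>{\<Gamma>. graph \<Gamma> \<and> \<Gamma>0 \<subseteq> \<Gamma>}. \<forall>\<Delta>\<in>{\<Gamma>. graph \<Gamma> \<and> \<Gamma>0 \<subseteq> \<Gamma>}. \<Gamma> \<subseteq> \<Delta> \<longrightarrow> \<Delta> = \<Gamma>"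
  proof (rule subset_Zorn_nonempty[OF ne])
    fix C assume C: "C \<noteq> {}" "subset.chain {\<Gamma>. graph \<Gamma> \<and> \<Gamma>0 \<subseteq> \<Gamma>} C"
    then have C': "\<Gamma> \<in> C \<Longrightarrow> graph \<Gamma>" "\<Gamma> \<in> C \<Longrightarrow> \<Gamma>0 \<subseteq> \<Gamma>"
      "\<Gamma> \<in> C \<Longrightarrow> \<Delta> \<in> C \<Longrightarrow> \<Gamma> \<subseteq> \<Delta> \<or> \<Delta> \<subseteq> \<Gamma>" for \<Gamma> \<Delta>
      by (auto simp: subset_chain_def)
    have "graph (\<Union>C)" by (rule graph_Union[OF C(1) C'(1,3)])
    moreover have "\<Gamma>0 \<subseteq> \<Union>C" using C(1) C'(2) by (simp add: less_eq_Sup)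
    ultimately show "\<Union>C \<in> {\<Gamma>. graph \<Gamma> \<and> \<Gamma>0 \<subseteq> \<Gamma>}" by simp
  qed
  then obtain \<Gamma> where 1: "\<Gamma> \<in> {\<Gamma>. graph \<Gamma> \<and> \<Gamma>0 \<subseteq> \<Gamma>}"
    and 2: "\<forall>\<Delta>\<in>{\<Gamma>. graph \<Gamma> \<and> \<Gamma>0 \<subseteq> \<Gamma>}. \<Gamma> \<subseteq> \<Delta> \<longrightarrow> \<Delta> = \<Gamma>" by (rule bexE)
  have \<Gamma>: "graph \<Gamma>" "\<Gamma>0 \<subseteq> \<Gamma>" using 1 by simp_all
  have dom: "\<exists>y. (x, y) \<in> \<Gamma>" if x: "x \<in> carrier N" for x
  proof -
    obtain \<Delta> where \<Delta>: "graph \<Delta>" "\<Gamma> \<subseteq> \<Delta>" "x \<in> Domain \<Delta>" using graph_extend[OF div \<Gamma>(1) x] by blast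
    then have "\<Delta> = \<Gamma>" using 2 \<Gamma>(2) by simp
    then show ?thesis using \<Delta>(3) by blast
  qed
  define h where "h x = (THE y. (x, y) \<in> \<Gamma>)" for x
  have h: "h x = y" if "(x, y) \<in> \<Gamma>" for x y
    unfolding h_def using that graph_unique[OF \<Gamma>(1)] by blast
  have hx: "(x, h x) \<in> \<Gamma>" if "x \<in> carrier N" for x using dom[OF that] h by blast
  have "h \<in> hom N D"
  proof (rule homI)
    show "h x \<in> carrier D" if "x \<in> carrier N" for x using hx[OF that] graph_subset[OF \<Gamma>(1)] by blast
    show "h (x \<otimes> y) = h x \<otimes>\<^bsub>D\<^esub> h y" if "x \<in> carrier N" "y \<in> carrier N" for x y
      by (rule h) (rule graph_mult[OF \<Gamma>(1) hx[OF that(1)] hx[OF that(2)]])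
  qed
  moreover have "h x = f x" if "x \<in> L" for x using \<Gamma>(2) that unfolding \<Gamma>0_def by (intro h) blast
  ultimately show ?thesis by blast
qed

end

section \<open>Divisible groups and coinduced modules\<close>

text \<open>An abelian group \<open>W\<close>, written as a quotient of the free abelian group on its elements,
  embeds into the corresponding quotient of the rational vector space on its elements.\<close>

lemma divisible_embedding:
  fixes W :: "('b, 'z) monoid_scheme"
  assumes W: "comm_group W"
  obtains D :: "('b \<Rightarrow>\<^sub>0 rat) set monoid" and j where "comm_group D" "divisible D" "j \<in> hom W D"
    "inj_on j (carrier W)" "\<And>S. S \<in> carrier D \<Longrightarrow> S \<noteq> {}"
    "\<And>S T. S \<in> carrier D \<Longrightarrow> T \<in> carrier D \<Longrightarrow> S \<inter> T \<noteq> {} \<Longrightarrow> S = T"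
proof -
  interpret W: comm_group W by (rule W)
  let ?F = "free_Abelian_group (carrier W)"
  interpret F: comm_group ?F by (rule abelian_free_Abelian_group)
  obtain h where h: "h \<in> hom ?F W" "\<And>x. x \<in> carrier W \<Longrightarrow> h (frag_of x) = x"
    using W.free_Abelian_group_universal[of "\<lambda>x. x" "carrier W"] by auto
  interpret h: group_hom ?F W h by (intro group_hom.intro group_hom_axioms.intro F.is_group W.is_group h(1))
  define U :: "('b \<Rightarrow>\<^sub>0 rat) monoid" where "U = \<lparr>carrier = UNIV, monoid.mult = (+), one = 0\<rparr>"
  have U: "comm_group U"
    by (rule comm_groupI) (auto simp: U_def add.assoc add.commute intro: exI[of _ "- _"])
  interpret U: comm_group U by (rule U)
  have Uinv: "inv\<^bsub>U\<^esub> p = - p" for p by (rule U.inv_equality) (simp_all add: U_def)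
  \<comment> \<open>The relations of W, that is the kernel of \<open>h\<close>, viewed inside the
    rational vector space.\<close>
  define K where "K = {p :: 'b \<Rightarrow>\<^sub>0 rat. \<exists>c. Poly_Mapping.keys c \<subseteq> carrier W \<and> h c = \<one>\<^bsub>W\<^esub> \<and>
    (\<forall>k. poly_mapping.lookup p k = of_int (poly_mapping.lookup c k))}"
  have K: "subgroup K U"
  proof (rule U.subgroupI)
    show "K \<subseteq> carrier U" by (simp add: U_def)
    have "h 0 = \<one>\<^bsub>W\<^esub>" using h.hom_one by simp
    then have "0 \<in> K" unfolding K_def by (auto intro!: exI[of _ 0])
    then show "K \<noteq> {}" by blast
    show "inv\<^bsub>U\<^esub> p \<in> K" if p: "p \<in> K" for p
    proof -
      obtain c where c: "Poly_Mapping.keys c \<subseteq> carrier W" "h c = \<one>\<^bsub>W\<^esub>" "\<forall>k. poly_mapping.lookup p k = of_int (poly_mapping.lookup c k)"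
        using p unfolding K_def by blast
      have "h (- c) = \<one>\<^bsub>W\<^esub>" using h.hom_inv[of c] c by simp
      then show ?thesis unfolding K_def Uinv using c by (auto intro!: exI[of _ "- c"])
    qed
    show "p \<otimes>\<^bsub>U\<^esub> q \<in> K" if pq: "p \<in> K" "q \<in> K" for p q
    proof -
      obtain c where c: "Poly_Mapping.keys c \<subseteq> carrier W" "h c = \<one>\<^bsub>W\<^esub>" "\<forall>k. poly_mapping.lookup p k = of_int (poly_mapping.lookup c k)"
        using pq(1) unfolding K_def by blast
      obtain c' where c': "Poly_Mapping.keys c' \<subseteq> carrier W" "h c' = \<one>\<^bsub>W\<^esub>" "\<forall>k. poly_mapping.lookup q k = of_int (poly_mapping.lookup c' k)"
        using pq(2) unfolding K_def by blast
      have "h (c + c') = \<one>\<^bsub>W\<^esub>" using h.hom_mult[of c c'] c c' by simp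
      moreover have "Poly_Mapping.keys (c + c') \<subseteq> carrier W" using c c' Poly_Mapping.keys_add[of c c'] by blast
      moreover have "poly_mapping.lookup (p + q) k = of_int (poly_mapping.lookup (c + c') k)" for k using c c' by (simp add: lookup_add)
      ultimately show ?thesis unfolding K_def by (auto simp: U_def)
    qed
  qed
  have Kn: "K \<lhd> U" using K by (simp add: U.normal_iff_subgroup)
  interpret K: normal K U by (rule Kn)
  define D where "D = U Mod K"
  have D: "comm_group D" unfolding D_def by (rule U.abelian_FactGroup[OF K])
  define \<pi> where "\<pi> p = K #>\<^bsub>U\<^esub> p" for p
  have \<pi>: "\<pi> \<in> hom U D" unfolding \<pi>_def D_def by (rule K.r_coset_hom_Mod)
  have Dc: "carrier D = range \<pi>" by (auto simp: D_def FactGroup_def RCOSETS_def \<pi>_def U_def)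
  have \<pi>_eq: "\<pi> p = \<pi> q \<longleftrightarrow> p - q \<in> K" for p q
  proof -
    have "\<pi> p = \<pi> q \<longleftrightarrow> p \<in> K #>\<^bsub>U\<^esub> q"
      unfolding \<pi>_def using U.repr_independence[of p K q] U.rcos_self[of p K] K by (auto simp: U_def)
    also have "\<dots> \<longleftrightarrow> p - q \<in> K" unfolding r_coset_def U_def by (auto simp: algebra_simps) (metis add.commute diff_add_cancel)
    finally show ?thesis .
  qed
  interpret \<pi>: group_hom U D \<pi> by (intro group_hom.intro group_hom_axioms.intro U.is_group comm_group.axioms(2)[OF D] \<pi>)
  have "divisible D"
    unfolding divisible_def
  proof (intro ballI allI impI)
    fix S and n :: nat assume "S \<in> carrier D" and n: "0 < n"
    then obtain p where p: "S = \<pi> p" using Dc by auto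
    define q where "q = Poly_Mapping.map (\<lambda>r. r / of_nat n) p"
    have "poly_mapping.lookup (q [^]\<^bsub>U\<^esub> k) x = of_nat k * poly_mapping.lookup q x" for k x
      by (induct k) (simp_all add: U_def lookup_add algebra_simps)
    moreover have "poly_mapping.lookup q x = poly_mapping.lookup p x / of_nat n" for x
      by (simp add: q_def map.rep_eq when_def)
    ultimately have "q [^]\<^bsub>U\<^esub> n = p" using n by (intro poly_mapping_eqI) simp
    then have "\<pi> q [^]\<^bsub>D\<^esub> n = S" using \<pi>.hom_nat_pow[of q n] p by (simp add: U_def)
    then show "\<exists>T\<in>carrier D. T [^]\<^bsub>D\<^esub> n = S" using Dc by blast
  qed
  define j where "j w = \<pi> (Poly_Mapping.single w 1)" for w
  have keys: "Poly_Mapping.keys (frag_of w) \<subseteq> carrier W" if "w \<in> carrier W" for w using that by simp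
  have hm: "h (c - c') = h c \<otimes>\<^bsub>W\<^esub> inv\<^bsub>W\<^esub> h c'" "Poly_Mapping.keys (c - c') \<subseteq> carrier W"
    if "Poly_Mapping.keys c \<subseteq> carrier W" "Poly_Mapping.keys c' \<subseteq> carrier W" for c c'
  proof -
    show "Poly_Mapping.keys (c - c') \<subseteq> carrier W" using that Poly_Mapping.keys_diff[of c c'] by blast
    have "h (c + (- c')) = h c \<otimes>\<^bsub>W\<^esub> h (- c')" using h.hom_mult[of c "- c'"] that by simp
    then show "h (c - c') = h c \<otimes>\<^bsub>W\<^esub> inv\<^bsub>W\<^esub> h c'" using h.hom_inv[of c'] that by simp
  qed
  have "j \<in> hom W D"
  proof (rule homI)
    show "j w \<in> carrier D" for w unfolding j_def Dc by blast
    fix v w assume vw: "v \<in> carrier W" "w \<in> carrier W"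
    let ?c = "frag_of (v \<otimes>\<^bsub>W\<^esub> w) - (frag_of v + frag_of w)"
    let ?p = "Poly_Mapping.single (v \<otimes>\<^bsub>W\<^esub> w) (1::rat) - (Poly_Mapping.single v 1 + Poly_Mapping.single w 1)"
    have k2: "Poly_Mapping.keys (frag_of v + frag_of w) \<subseteq> carrier W"
      using keys[OF vw(1)] keys[OF vw(2)] Poly_Mapping.keys_add[of "frag_of v" "frag_of w"] by blast
    have vwc: "v \<otimes>\<^bsub>W\<^esub> w \<in> carrier W" using vw by simp
    have "h (frag_of v + frag_of w) = v \<otimes>\<^bsub>W\<^esub> w"
      using h.hom_mult[of "frag_of v" "frag_of w"] vw h(2) by simp
    then have "h ?c = \<one>\<^bsub>W\<^esub>" using hm(1)[OF keys[OF vwc] k2] h(2)[OF vwc] vwc by simp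
    moreover have "Poly_Mapping.keys ?c \<subseteq> carrier W" by (rule hm(2)[OF keys[OF vwc] k2])
    moreover have "poly_mapping.lookup ?p k = of_int (poly_mapping.lookup ?c k)" for k
      by (simp add: lookup_minus lookup_add lookup_single when_def)
    ultimately have "?p \<in> K" unfolding K_def by blast
    then have "j (v \<otimes>\<^bsub>W\<^esub> w) = \<pi> (Poly_Mapping.single v 1 \<otimes>\<^bsub>U\<^esub> Poly_Mapping.single w 1)"
      unfolding j_def \<pi>_eq by (simp add: U_def)
    then show "j (v \<otimes>\<^bsub>W\<^esub> w) = j v \<otimes>\<^bsub>D\<^esub> j w" using \<pi>.hom_mult by (simp add: j_def U_def)
  qed
  moreover have "inj_on j (carrier W)"
  proof (rule inj_onI)
    fix v w assume vw: "v \<in> carrier W" "w \<in> carrier W" "j v = j w"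
    then have "Poly_Mapping.single v (1::rat) - Poly_Mapping.single w 1 \<in> K" by (simp add: j_def \<pi>_eq)
    then obtain c where c: "h c = \<one>\<^bsub>W\<^esub>"
      "\<forall>k. poly_mapping.lookup (Poly_Mapping.single v (1::rat) - Poly_Mapping.single w 1) k = of_int (poly_mapping.lookup c k)"
      unfolding K_def by blast
    have "poly_mapping.lookup c k = poly_mapping.lookup (frag_of v - frag_of w) k" for k
    proof -
      have "(of_int (poly_mapping.lookup c k) :: rat) = of_int (poly_mapping.lookup (frag_of v - frag_of w) k)"
        using c(2)[rule_format, of k, symmetric] by (simp add: lookup_minus lookup_single when_def)
      then show ?thesis by (simp only: of_int_eq_iff)
    qed
    then have "c = frag_of v - frag_of w" by (rule poly_mapping_eqI)
    then have "v \<otimes>\<^bsub>W\<^esub> inv\<^bsub>W\<^esub> w = \<one>\<^bsub>W\<^esub>" using c(1) hm(1)[OF keys[OF vw(1)] keys[OF vw(2)]] h(2) vw by simp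
    then show "v = w" using vw by (metis W.inv_equality W.inv_inv W.inv_closed)
  qed
  \<comment> \<open>The elements of \<open>D\<close> are cosets, nonempty and pairwise disjoint.
    This is exported so that a coset can later be encoded by one of its members.\<close>
  moreover have "S \<noteq> {}" if "S \<in> carrier D" for S
    using that U.rcos_self[of _ K] K unfolding Dc \<pi>_def by (auto simp: U_def)
  moreover have "S = T" if XY: "S \<in> carrier D" "T \<in> carrier D" "S \<inter> T \<noteq> {}" for S T
  proof -
    obtain p where p: "S = K #>\<^bsub>U\<^esub> p" using XY(1) unfolding Dc \<pi>_def by blast
    obtain q where q: "T = K #>\<^bsub>U\<^esub> q" using XY(2) unfolding Dc \<pi>_def by blast
    obtain z where z: "z \<in> S" "z \<in> T" using XY(3) by blast
    then have "S = K #>\<^bsub>U\<^esub> z" "T = K #>\<^bsub>U\<^esub> z"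
      using U.repr_independence[of z K p] U.repr_independence[of z K q] K p q by (auto simp: U_def)
    then show ?thesis by simp
  qed
  ultimately show thesis using D \<open>divisible D\<close> by (intro that[of D j])
qed

text \<open>The module of additive maps from A to the abelian group \<open>D\<close>, which is
  written multiplicatively; it is injective when \<open>D\<close> is divisible.\<close>

definition coinduced_module :: "('a, 'x) ring_scheme \<Rightarrow> ('d, 'y) monoid_scheme \<Rightarrow> ('a, 'a \<Rightarrow> 'd) module"
  where "coinduced_module A D =
    \<lparr>carrier = {\<phi> \<in> hom (add_monoid A) D. \<phi> \<in> extensional (carrier A)}, monoid.mult = undefined, one = undefined,
     ring.zero = (\<lambda>a\<in>carrier A. \<one>\<^bsub>D\<^esub>), add = (\<lambda>\<phi> \<psi>. \<lambda>a\<in>carrier A. \<phi> a \<otimes>\<^bsub>D\<^esub> \<psi> a),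
     smult = (\<lambda>b \<phi>. \<lambda>a\<in>carrier A. \<phi> (a \<otimes>\<^bsub>A\<^esub> b))\<rparr>"

locale coinduced = A?: cring A + D: comm_group D for A (structure) and D :: "('d, 'y) monoid_scheme"
begin

abbreviation "H \<equiv> coinduced_module A D"

lemma H_carrier: "\<phi> \<in> carrier H \<longleftrightarrow> (\<forall>a\<in>carrier A. \<phi> a \<in> carrier D) \<and>
    (\<forall>a\<in>carrier A. \<forall>b\<in>carrier A. \<phi> (a \<oplus> b) = \<phi> a \<otimes>\<^bsub>D\<^esub> \<phi> b) \<and> (\<forall>a. a \<notin> carrier A \<longrightarrow> \<phi> a = undefined)"
  by (auto simp: coinduced_module_def hom_def extensional_def)

lemma H_D:
  assumes "\<phi> \<in> carrier H"
  shows "a \<in> carrier A \<Longrightarrow> \<phi> a \<in> carrier D"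
    "a \<in> carrier A \<Longrightarrow> b \<in> carrier A \<Longrightarrow> \<phi> (a \<oplus> b) = \<phi> a \<otimes>\<^bsub>D\<^esub> \<phi> b"
    "a \<notin> carrier A \<Longrightarrow> \<phi> a = undefined"
  using assms unfolding H_carrier by blast+

lemma H_ops:
  "\<zero>\<^bsub>H\<^esub> = (\<lambda>a\<in>carrier A. \<one>\<^bsub>D\<^esub>)" "\<phi> \<oplus>\<^bsub>H\<^esub> \<psi> = (\<lambda>a\<in>carrier A. \<phi> a \<otimes>\<^bsub>D\<^esub> \<psi> a)"
  "b \<odot>\<^bsub>H\<^esub> \<phi> = (\<lambda>a\<in>carrier A. \<phi> (a \<otimes> b))"
  by (simp_all add: coinduced_module_def)

lemma H_eqI: "\<phi> \<in> carrier H \<Longrightarrow> \<psi> \<in> carrier H \<Longrightarrow> (\<And>a. a \<in> carrier A \<Longrightarrow> \<phi> a = \<psi> a) \<Longrightarrow> \<phi> = \<psi>"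
  using H_D(3) by (metis ext)

lemma H_zero_closed: "\<zero>\<^bsub>H\<^esub> \<in> carrier H"
  unfolding H_carrier H_ops by simp

lemma H_add_closed: "\<phi> \<in> carrier H \<Longrightarrow> \<psi> \<in> carrier H \<Longrightarrow> \<phi> \<oplus>\<^bsub>H\<^esub> \<psi> \<in> carrier H"
  unfolding H_ops by (subst H_carrier) (simp add: H_D D.m_ac)

lemma H_smult_closed: "b \<in> carrier A \<Longrightarrow> \<phi> \<in> carrier H \<Longrightarrow> b \<odot>\<^bsub>H\<^esub> \<phi> \<in> carrier H"
  unfolding H_ops by (subst H_carrier) (simp add: H_D l_distr)

lemma H_module: "module A H"
proof (rule moduleI[OF is_cring])
  show "abelian_group H"
  proof (rule abelian_groupI)
    fix \<phi> assume \<phi>: "\<phi> \<in> carrier H"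
    show "\<zero>\<^bsub>H\<^esub> \<oplus>\<^bsub>H\<^esub> \<phi> = \<phi>"
      by (rule H_eqI[OF H_add_closed[OF H_zero_closed \<phi>] \<phi>]) (simp add: H_ops H_D[OF \<phi>])
    define \<psi> where "\<psi> = (\<lambda>a\<in>carrier A. inv\<^bsub>D\<^esub> \<phi> a)"
    have \<psi>: "\<psi> \<in> carrier H" unfolding H_carrier \<psi>_def by (simp add: H_D[OF \<phi>] D.inv_mult)
    have "\<psi> \<oplus>\<^bsub>H\<^esub> \<phi> = \<zero>\<^bsub>H\<^esub>"
      by (rule H_eqI[OF H_add_closed[OF \<psi> \<phi>] H_zero_closed]) (simp add: H_ops \<psi>_def H_D[OF \<phi>])
    then show "\<exists>\<psi>\<in>carrier H. \<psi> \<oplus>\<^bsub>H\<^esub> \<phi> = \<zero>\<^bsub>H\<^esub>" using \<psi> by blast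
    fix \<psi> assume \<psi>: "\<psi> \<in> carrier H"
    show "\<phi> \<oplus>\<^bsub>H\<^esub> \<psi> \<in> carrier H" by (rule H_add_closed[OF \<phi> \<psi>])
    show "\<phi> \<oplus>\<^bsub>H\<^esub> \<psi> = \<psi> \<oplus>\<^bsub>H\<^esub> \<phi>"
      by (rule H_eqI[OF H_add_closed[OF \<phi> \<psi>] H_add_closed[OF \<psi> \<phi>]]) (simp add: H_ops H_D[OF \<phi>] H_D[OF \<psi>] D.m_comm)
    fix \<chi> assume \<chi>: "\<chi> \<in> carrier H"
    show "\<phi> \<oplus>\<^bsub>H\<^esub> \<psi> \<oplus>\<^bsub>H\<^esub> \<chi> = \<phi> \<oplus>\<^bsub>H\<^esub> (\<psi> \<oplus>\<^bsub>H\<^esub> \<chi>)"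
      by (rule H_eqI[OF H_add_closed[OF H_add_closed[OF \<phi> \<psi>] \<chi>] H_add_closed[OF \<phi> H_add_closed[OF \<psi> \<chi>]]])
         (simp add: H_ops H_D[OF \<phi>] H_D[OF \<psi>] H_D[OF \<chi>] D.m_assoc)
  qed (rule H_zero_closed)
  show "b \<odot>\<^bsub>H\<^esub> \<phi> \<in> carrier H" if "b \<in> carrier A" "\<phi> \<in> carrier H" for b \<phi> using that by (rule H_smult_closed)
  show "(b \<oplus> c) \<odot>\<^bsub>H\<^esub> \<phi> = b \<odot>\<^bsub>H\<^esub> \<phi> \<oplus>\<^bsub>H\<^esub> c \<odot>\<^bsub>H\<^esub> \<phi>" if "b \<in> carrier A" "c \<in> carrier A" "\<phi> \<in> carrier H" for b c \<phi>
    by (rule H_eqI) (use that in \<open>simp_all add: H_smult_closed H_add_closed\<close>, simp add: H_ops H_D[OF that(3)] r_distr)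
  show "b \<odot>\<^bsub>H\<^esub> (\<phi> \<oplus>\<^bsub>H\<^esub> \<psi>) = b \<odot>\<^bsub>H\<^esub> \<phi> \<oplus>\<^bsub>H\<^esub> b \<odot>\<^bsub>H\<^esub> \<psi>" if "b \<in> carrier A" "\<phi> \<in> carrier H" "\<psi> \<in> carrier H" for b \<phi> \<psi>
    by (rule H_eqI) (use that in \<open>simp_all add: H_smult_closed H_add_closed\<close>, simp add: H_ops)
  show "(b \<otimes> c) \<odot>\<^bsub>H\<^esub> \<phi> = b \<odot>\<^bsub>H\<^esub> (c \<odot>\<^bsub>H\<^esub> \<phi>)" if "b \<in> carrier A" "c \<in> carrier A" "\<phi> \<in> carrier H" for b c \<phi>
    by (rule H_eqI) (use that in \<open>simp_all add: H_smult_closed\<close>, simp add: H_ops m_assoc)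
  show "\<one> \<odot>\<^bsub>H\<^esub> \<phi> = \<phi>" if "\<phi> \<in> carrier H" for \<phi>
    by (rule H_eqI) (use that in \<open>simp_all add: H_smult_closed\<close>, simp add: H_ops)
qed

text \<open>An additive map \<open>N \<rightarrow> D\<close> is the same as a linear map from \<open>N\<close> into \<open>Hom(A, D)\<close>, via evaluation at 1.\<close>

lemma H_extend:
  assumes div: "divisible D" and N: "module A N" and L: "submodule L A N"
    and f: "f \<in> module_hom A (N\<lparr>carrier := L\<rparr>) H"
  shows "\<exists>h\<in>module_hom A N H. \<forall>x\<in>L. h x = f x"
proof -
  interpret N: module A N by (rule N)
  interpret hom_graph "add_monoid N" D
    by (intro hom_graph.intro N.M.a_comm_group D.comm_group_axioms)
  note LE = N.submoduleE[OF L]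
  have fL: "f x \<in> carrier H" if "x \<in> L" for x using mhom_closed[OF f] that by simp
  define \<phi> where "\<phi> x = f x \<one>" for x
  have "\<phi> \<in> hom (add_monoid N\<lparr>carrier := L\<rparr>) D"
  proof (rule homI)
    show "\<phi> x \<in> carrier D" if "x \<in> carrier (add_monoid N\<lparr>carrier := L\<rparr>)" for x
      using H_D(1)[OF fL[of x] one_closed] that by (simp add: \<phi>_def)
    show "\<phi> (x \<otimes>\<^bsub>add_monoid N\<lparr>carrier := L\<rparr>\<^esub> y) = \<phi> x \<otimes>\<^bsub>D\<^esub> \<phi> y"
      if "x \<in> carrier (add_monoid N\<lparr>carrier := L\<rparr>)" "y \<in> carrier (add_monoid N\<lparr>carrier := L\<rparr>)" for x y
      using that mhom_add[OF f, of x y] by (simp add: \<phi>_def H_ops)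
  qed
  then obtain \<psi> where \<psi>: "\<psi> \<in> hom (add_monoid N) D" "\<forall>x\<in>L. \<psi> x = \<phi> x"
    using divisible_extend[OF div submodule.axioms(1)[OF L]] by blast
  have \<psi>c: "\<psi> x \<in> carrier D" if "x \<in> carrier N" for x using hom_in_carrier[OF \<psi>(1)] that by simp
  have \<psi>a: "\<psi> (x \<oplus>\<^bsub>N\<^esub> y) = \<psi> x \<otimes>\<^bsub>D\<^esub> \<psi> y" if "x \<in> carrier N" "y \<in> carrier N" for x y
    using hom_mult[OF \<psi>(1)] that by simp
  define h where "h x = (\<lambda>a\<in>carrier A. \<psi> (a \<odot>\<^bsub>N\<^esub> x))" for x
  have hc: "h x \<in> carrier H" if "x \<in> carrier N" for x
    unfolding H_carrier h_def using that by (simp add: \<psi>c \<psi>a N.smult_l_distr)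
  have "h \<in> module_hom A N H"
  proof (rule mhomI)
    show "h (x \<oplus>\<^bsub>N\<^esub> y) = h x \<oplus>\<^bsub>H\<^esub> h y" if "x \<in> carrier N" "y \<in> carrier N" for x y
      by (rule H_eqI) (use that in \<open>simp_all add: hc H_add_closed\<close>, simp add: H_ops h_def \<psi>a N.smult_r_distr)
    show "h (b \<odot>\<^bsub>N\<^esub> x) = b \<odot>\<^bsub>H\<^esub> h x" if "b \<in> carrier A" "x \<in> carrier N" for b x
      by (rule H_eqI) (use that in \<open>simp_all add: hc H_smult_closed\<close>, simp add: H_ops h_def N.smult_assoc1)
  qed (rule hc)
  moreover have "h x = f x" if x: "x \<in> L" for x
  proof (rule H_eqI)
    show "h x \<in> carrier H" using x LE(1) hc by blast
    show "f x \<in> carrier H" by (rule fL[OF x])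
    fix a assume a: "a \<in> carrier A"
    have "h x a = f (a \<odot>\<^bsub>N\<^esub> x) \<one>" using a \<psi>(2) LE(4)[OF a x] by (simp add: h_def \<phi>_def)
    also have "\<dots> = f x a" using mhom_smult[OF f a, of x] x a by (simp add: H_ops)
    finally show "h x a = f x a" .
  qed
  ultimately show ?thesis by blast
qed

end

text \<open>Injectivity of the copy \<open>E\<close> is tested on modules of its own element type,
  so \<open>ext\<close> asks for the extension property of \<open>H\<close> on that type and not on
  the type of \<open>H\<close>.\<close>

lemma injective_module_transport:
  fixes H :: "('a, 'h) module" and E :: "('a, 'e) module"
  assumes H: "module A H" and E: "module A E" and \<iota>: "\<iota> \<in> module_hom A H E" "inj_on \<iota> (carrier H)"
    "carrier E = \<iota> ` carrier H"
    and ext: "\<And>(N :: ('a, 'e) module) L f. \<lbrakk>module A N; submodule L A N; f \<in> module_hom A (N\<lparr>carrier := L\<rparr>) H\<rbrakk> \<Longrightarrow>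
      \<exists>h\<in>module_hom A N H. \<forall>x\<in>L. h x = f x"
  shows "injective_module A E"
  unfolding injective_module_def
proof (intro conjI allI impI E)
  fix N :: "('a, 'e) module" and L f
  assume *: "module A N \<and> submodule L A N \<and> f \<in> module_hom A (N\<lparr>carrier := L\<rparr>) E"
  define k where "k = the_inv_into (carrier H) \<iota>"
  have k: "k (\<iota> x) = x" if "x \<in> carrier H" for x unfolding k_def by (rule the_inv_into_f_f[OF \<iota>(2) that])
  have kE: "k y \<in> carrier H" "\<iota> (k y) = y" if "y \<in> carrier E" for y
  proof -
    have "y \<in> \<iota> ` carrier H" using that \<iota>(3) by simp
    then obtain x where "y = \<iota> x" "x \<in> carrier H" by (rule imageE)
    then show "k y \<in> carrier H" "\<iota> (k y) = y" using k by simp_all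
  qed
  interpret H: module A H by (rule H)
  have kh: "k \<in> module_hom A E H"
  proof (rule mhomI)
    show "k (x \<oplus>\<^bsub>E\<^esub> y) = k x \<oplus>\<^bsub>H\<^esub> k y" if "x \<in> carrier E" "y \<in> carrier E" for x y
      using k[of "k x \<oplus>\<^bsub>H\<^esub> k y"] mhom_add[OF \<iota>(1) kE(1)[OF that(1)] kE(1)[OF that(2)]] kE that by simp
    show "k (a \<odot>\<^bsub>E\<^esub> x) = a \<odot>\<^bsub>H\<^esub> k x" if "a \<in> carrier A" "x \<in> carrier E" for a x
      using k[of "a \<odot>\<^bsub>H\<^esub> k x"] mhom_smult[OF \<iota>(1) that(1) kE(1)[OF that(2)]] kE that by simp
  qed (rule kE(1))
  have N: "module A N" and L: "submodule L A N" and f: "f \<in> module_hom A (N\<lparr>carrier := L\<rparr>) E"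
    using * by simp_all
  obtain h where h: "h \<in> module_hom A N H" "\<forall>x\<in>L. h x = k (f x)"
    using ext[OF N L mhom_compose[OF f kh]] by (rule bexE)
  have "\<iota> (h x) = f x" if "x \<in> L" for x
    using h(2) that kE(2)[OF mhom_closed[OF f]] by simp
  then show "\<exists>h\<in>module_hom A N E. \<forall>x\<in>L. h x = f x"
    by (intro bexI[OF _ mhom_compose[OF h(1) \<iota>(1)]] ballI)
qed

section \<open>Encodings into the element type of the resolution\<close>

lemma pair_encoding: "\<exists>t :: ('a \<times> nat) \<times> ('a \<times> nat) \<Rightarrow> 'a \<times> nat. inj t"
proof -
  have "infinite (UNIV :: ('a \<times> nat) set)" using finite_prod[where ?'a = 'a and ?'b = nat] by simp
  from card_of_Times_same_infinite[OF this] have "|(UNIV :: ('a \<times> nat) set) \<times> (UNIV :: ('a \<times> nat) set)| =o |UNIV :: ('a \<times> nat) set|" .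
  then obtain t :: "('a \<times> nat) \<times> ('a \<times> nat) \<Rightarrow> 'a \<times> nat" where "bij_betw t (UNIV \<times> UNIV) UNIV"
    unfolding card_of_ordIso[symmetric] by blast
  then show ?thesis by (auto simp: bij_betw_def)
qed

text \<open>A family of subsets indexed by \<open>'a\<close> is a single subset of a product with
  one more factor \<open>'a\<close>; the infinite type \<open>'a \<times> nat\<close> absorbs that
  factor.\<close>

lemma function_encoding:
  "\<exists>t :: ('a \<Rightarrow> ('v \<times> 'a \<times> nat) set) \<Rightarrow> ('v \<times> 'a \<times> nat) set. inj t"
proof -
  obtain t :: "('a \<times> nat) \<times> ('a \<times> nat) \<Rightarrow> 'a \<times> nat" where t: "inj t" using pair_encoding by blast
  define s where "s f = {(v, t ((a, 0), an)) | v a an. (v, an) \<in> f a}" for f :: "'a \<Rightarrow> ('v \<times> 'a \<times> nat) set"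
  have mem: "(v, t ((a, 0), an)) \<in> s f \<longleftrightarrow> (v, an) \<in> f a" for v a an f
    unfolding s_def using inj_eq[OF t] by (cases an) auto
  have "inj s"
  proof (rule injI)
    fix f g :: "'a \<Rightarrow> ('v \<times> 'a \<times> nat) set" assume e: "s f = s g"
    have "x \<in> f a \<longleftrightarrow> x \<in> g a" for a x
      using mem[of "fst x" a "snd x" f] mem[of "fst x" a "snd x" g] unfolding e by simp
    then show "f = g" by blast
  qed
  then show ?thesis by blast
qed

text \<open>Over an infinite domain, finitely supported functions with values in a countable set are
  no more numerous than the points of the domain.\<close>

lemma finite_support_encoding: "\<exists>t :: (('v \<times> 'a \<times> nat) set \<Rightarrow>\<^sub>0 rat) \<Rightarrow> ('v \<times> 'a \<times> nat) set. inj t"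
proof -
  let ?U = "UNIV :: ('v \<times> 'a \<times> nat) set set"
  have "infinite (UNIV :: ('v \<times> 'a \<times> nat) set)" by (simp add: finite_prod)
  then have inf: "infinite ?U" using Finite_Set.finite_set by blast
  have "(UNIV :: (('v \<times> 'a \<times> nat) set \<Rightarrow>\<^sub>0 rat) set) \<lesssim>
      {f :: ('v \<times> 'a \<times> nat) set \<Rightarrow> rat. f ` ?U \<subseteq> UNIV \<and> {x. f x \<noteq> 0} \<subseteq> ?U \<and> finite {x. f x \<noteq> 0}}"
    unfolding lepoll_def
    by (rule exI[of _ poly_mapping.lookup]) (auto simp: poly_mapping_eqI inj_onI)
  also have "\<dots> \<lesssim> Fpow (?U \<times> (UNIV :: rat set))" by (rule lepoll_restricted_funspace)
  also have "\<dots> \<approx> ?U \<times> (UNIV :: rat set)"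
  proof (rule eqpoll_Fpow, rule notI)
    assume "finite (?U \<times> (UNIV :: rat set))"
    then have "finite ?U" by (rule finite_cartesian_productD1) simp
    then show False using inf by simp
  qed
  also have "\<dots> \<lesssim> ?U"
  proof -
    have "|UNIV :: rat set| \<le>o |?U|"
      using inf infinite_iff_card_of_countable[of "UNIV :: rat set" ?U] infinite_UNIV_char_0 by auto
    then have "|?U \<times> (UNIV :: rat set)| \<le>o |?U|"
      using inf by (intro card_of_Times_ordLeq_infinite) auto
    then show ?thesis unfolding lepoll_def card_of_ordLeq .
  qed
  finally show ?thesis by (auto simp: lepoll_def)
qed

lemma (in cring) injective_embedding:
  fixes W :: "('a, ('v \<times> 'a \<times> nat) set) module"
  assumes W: "module R W"
  obtains E :: "('a, ('v \<times> 'a \<times> nat) set) module" and i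
  where "injective_module R E" "i \<in> module_hom R W E" "inj_on i (carrier W)"
proof -
  interpret W: module R W by (rule W)
  obtain D :: "(('v \<times> 'a \<times> nat) set \<Rightarrow>\<^sub>0 rat) set monoid" and j where D: "comm_group D" "divisible D"
    "j \<in> hom (add_monoid W) D" "inj_on j (carrier (add_monoid W))"
    and ne: "\<And>S. S \<in> carrier D \<Longrightarrow> S \<noteq> {}"
    and disj: "\<And>S T. S \<in> carrier D \<Longrightarrow> T \<in> carrier D \<Longrightarrow> S \<inter> T \<noteq> {} \<Longrightarrow> S = T"
    by (rule divisible_embedding[OF W.M.a_comm_group]) blast
  interpret coinduced R D by (intro coinduced.intro is_cring D(1))
  obtain t :: "('a \<Rightarrow> ('v \<times> 'a \<times> nat) set) \<Rightarrow> ('v \<times> 'a \<times> nat) set" where t: "inj t" using function_encoding by blast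
  obtain s :: "(('v \<times> 'a \<times> nat) set \<Rightarrow>\<^sub>0 rat) \<Rightarrow> ('v \<times> 'a \<times> nat) set" where s: "inj s" using finite_support_encoding by blast
  \<comment> \<open>A coset is replaced by an encoded member of it; as distinct cosets are disjoint,
    nothing is lost.\<close>
  define r where "r S = s (SOME p. p \<in> S)" for S
  have r: "S = T" if S: "S \<in> carrier D" and T: "T \<in> carrier D" and e: "r S = r T" for S T
  proof -
    have "(SOME p. p \<in> S) \<in> S" "(SOME p. p \<in> T) \<in> T" using ne[OF S] ne[OF T] by (simp_all add: some_in_eq)
    moreover have "(SOME p. p \<in> S) = (SOME p. p \<in> T)" using e inj_eq[OF s] by (simp add: r_def)
    ultimately show ?thesis by (intro disj S T) auto
  qed
  define \<iota> where "\<iota> \<phi> = t (\<lambda>a. r (\<phi> a))" for \<phi>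
  have \<iota>: "inj_on \<iota> (carrier H)"
  proof (rule inj_onI)
    fix \<phi> \<psi> assume *: "\<phi> \<in> carrier H" "\<psi> \<in> carrier H" "\<iota> \<phi> = \<iota> \<psi>"
    have "(\<lambda>a. r (\<phi> a)) = (\<lambda>a. r (\<psi> a))" using *(3) inj_eq[OF t] by (simp add: \<iota>_def)
    then have e: "r (\<phi> a) = r (\<psi> a)" for a by (rule fun_cong)
    show "\<phi> = \<psi>" by (rule H_eqI[OF *(1,2)]) (rule r[OF H_D(1)[OF *(1)] H_D(1)[OF *(2)] e])
  qed
  obtain E :: "('a, ('v \<times> 'a \<times> nat) set) module" where E: "module R E" "carrier E = \<iota> ` carrier H" "\<iota> \<in> module_hom R H E"
    by (rule module_transport[OF H_module \<iota>])
  have injE: "injective_module R E"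
    by (rule injective_module_transport[OF H_module E(1,3) \<iota> E(2) H_extend[OF D(2)]])
  have jc: "j w \<in> carrier D" if "w \<in> carrier W" for w using hom_in_carrier[OF D(3)] that by simp
  have ja: "j (v \<oplus>\<^bsub>W\<^esub> w) = j v \<otimes>\<^bsub>D\<^esub> j w" if "v \<in> carrier W" "w \<in> carrier W" for v w
    using hom_mult[OF D(3)] that by simp
  \<comment> \<open>The linear map into the coinduced module that belongs to the additive map
    \<open>j\<close>; evaluation at 1 returns \<open>j\<close>, so injectivity is inherited.\<close>
  define k where "k w = (\<lambda>a\<in>carrier R. j (a \<odot>\<^bsub>W\<^esub> w))" for w
  have kc: "k w \<in> carrier H" if "w \<in> carrier W" for w
    unfolding H_carrier k_def using that by (simp add: jc ja W.smult_l_distr)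
  have k: "k \<in> module_hom R W H"
  proof (rule mhomI)
    show "k (x \<oplus>\<^bsub>W\<^esub> y) = k x \<oplus>\<^bsub>H\<^esub> k y" if "x \<in> carrier W" "y \<in> carrier W" for x y
      by (rule H_eqI) (use that in \<open>simp_all add: kc H_add_closed\<close>, simp add: H_ops k_def ja W.smult_r_distr)
    show "k (b \<odot>\<^bsub>W\<^esub> x) = b \<odot>\<^bsub>H\<^esub> k x" if "b \<in> carrier R" "x \<in> carrier W" for b x
      by (rule H_eqI) (use that in \<open>simp_all add: kc H_smult_closed\<close>, simp add: H_ops k_def W.smult_assoc1)
  qed (rule kc)
  have "inj_on (\<lambda>w. \<iota> (k w)) (carrier W)"
  proof (rule inj_onI)
    fix v w assume *: "v \<in> carrier W" "w \<in> carrier W" "\<iota> (k v) = \<iota> (k w)"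
    then have "k v = k w" using inj_onD[OF \<iota>] kc by blast
    then have "k v \<one> = k w \<one>" by simp
    then have "j v = j w" using * by (simp add: k_def)
    then show "v = w" using inj_onD[OF D(4)] * by simp
  qed
  then show thesis by (rule that[OF injE mhom_compose[OF k E(3)]])
qed

lemma (in cring) injective_cosyzygy:
  fixes W :: "('a, ('v \<times> 'a \<times> nat) set) module"
  assumes W: "module R W"
  shows "\<exists>(E :: ('a, ('v \<times> 'a \<times> nat) set) module) (W' :: ('a, ('v \<times> 'a \<times> nat) set) module) i q.
    injective_module R E \<and> short_exact R W E W' i q"
proof -
  obtain E :: "('a, ('v \<times> 'a \<times> nat) set) module" and i
    where E: "injective_module R E" "i \<in> module_hom R W E" "inj_on i (carrier W)" by (rule injective_embedding[OF W])
  have Em: "module R E" using E(1) by (simp add: injective_module_def)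
  have "submodule (i ` carrier W) R E" by (rule submodule_image[OF W Em E(2) module.carrier_is_submodule[OF W]])
  then obtain W' :: "('a, ('v \<times> 'a \<times> nat) set) module" and q where W': "module R W'" "q \<in> module_hom R E W'"
    "q ` carrier E = carrier W'" "\<And>x. x \<in> carrier E \<Longrightarrow> q x = \<zero>\<^bsub>W'\<^esub> \<longleftrightarrow> x \<in> i ` carrier W"
    by (rule quotient_exists[OF Em]) blast
  have "short_exact R W E W' i q" unfolding short_exact_def using W Em E W' by simp
  then show ?thesis using E(1) by blast
qed

lemma (in cring) injective_resolution_exists:
  fixes V :: "('a, 'v, 'y) module_scheme"
  assumes V: "module R V"
  shows "\<exists>E d \<epsilon>. injective_resolution R V \<epsilon> (E :: nat \<Rightarrow> ('a, ('v \<times> 'a \<times> nat) set) module) d"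
proof -
  \<comment> \<open>The element types of \<open>V\<close> and of the resolution differ, so
    \<open>V\<close> enters through singletons.\<close>
  have "inj_on (\<lambda>v. {(v, undefined :: 'a, 0 :: nat)}) (carrier V)" by (rule inj_onI) simp
  from module_transport[OF V this]
  obtain V' :: "('a, ('v \<times> 'a \<times> nat) set) module" where V': "module R V'"
    "carrier V' = (\<lambda>v. {(v, undefined, 0)}) ` carrier V" "(\<lambda>v. {(v, undefined, 0)}) \<in> module_hom R V V'" by blast
  define \<epsilon>0 where "\<epsilon>0 v = {(v, undefined :: 'a, 0 :: nat)}" for v :: 'v
  have \<epsilon>0: "\<epsilon>0 \<in> module_hom R V V'" "carrier V' = \<epsilon>0 ` carrier V" "inj \<epsilon>0"
    using V'(2,3) unfolding \<epsilon>0_def by (simp_all add: inj_def)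
  \<comment> \<open>A state is one short exact sequence W \<rightarrow> E \<rightarrow> W' with E
    injective, and \<open>Q\<close> makes the next one start at W'. Splicing them gives the
    resolution.\<close>
  define P where "P n s = (case s of (W, E, W', i, q) \<Rightarrow> injective_module R E \<and> short_exact R W E W' i q \<and> (n = 0 \<longrightarrow> W = V'))"
    for n :: nat and s :: "('a, ('v \<times> 'a \<times> nat) set) module \<times> ('a, ('v \<times> 'a \<times> nat) set) module \<times>
      ('a, ('v \<times> 'a \<times> nat) set) module \<times> (('v \<times> 'a \<times> nat) set \<Rightarrow> ('v \<times> 'a \<times> nat) set) \<times>
      (('v \<times> 'a \<times> nat) set \<Rightarrow> ('v \<times> 'a \<times> nat) set)"
  define Q where "Q s s' \<longleftrightarrow> fst s' = fst (snd (snd s))"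
    for s s' :: "('a, ('v \<times> 'a \<times> nat) set) module \<times> ('a, ('v \<times> 'a \<times> nat) set) module \<times>
      ('a, ('v \<times> 'a \<times> nat) set) module \<times> (('v \<times> 'a \<times> nat) set \<Rightarrow> ('v \<times> 'a \<times> nat) set) \<times>
      (('v \<times> 'a \<times> nat) set \<Rightarrow> ('v \<times> 'a \<times> nat) set)"
  have step: "\<exists>s. P n s \<and> fst s = W" if W: "module R W" "n = 0 \<longrightarrow> W = V'" for n W
  proof -
    obtain E W' :: "('a, ('v \<times> 'a \<times> nat) set) module" and i q
      where "injective_module R E" "short_exact R W E W' i q" using injective_cosyzygy[OF W(1)] by blast
    then show ?thesis using W(2) unfolding P_def by (intro exI[of _ "(W, E, W', i, q)"]) simp
  qed
  have "\<exists>f. \<forall>n. P n (f n) \<and> Q (f n) (f (Suc n))"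
  proof (rule dependent_nat_choice)
    show "\<exists>s. P 0 s" using step[of V' 0] V'(1) by blast
    fix s n assume "P n s"
    then have "module R (fst (snd (snd s)))" by (auto simp: P_def short_exact_def split: prod.splits)
    then show "\<exists>s'. P (Suc n) s' \<and> Q s s'" using step[of "fst (snd (snd s))" "Suc n"] by (simp add: Q_def)
  qed
  then obtain f where f: "\<And>n. P n (f n)" "\<And>n. Q (f n) (f (Suc n))" by blast
  define W where "W n = fst (f n)" for n
  define E where "E n = fst (snd (f n))" for n
  define i where "i n = fst (snd (snd (snd (f n))))" for n
  define q where "q n = snd (snd (snd (snd (f n))))" for n
  have ses: "short_exact R (W n) (E n) (W (Suc n)) (i n) (q n)" and inj: "injective_module R (E n)" for n
    using f(1)[of n] f(2)[of n] unfolding P_def Q_def W_def E_def i_def q_def by (simp_all split: prod.splits)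
  have W0: "W 0 = V'" using f(1)[of 0] unfolding P_def W_def by (simp split: prod.splits)
  have ses': "module R (E n)" "module R (W n)" "i n \<in> module_hom R (W n) (E n)" "q n \<in> module_hom R (E n) (W (Suc n))"
    "inj_on (i n) (carrier (W n))" "q n ` carrier (E n) = carrier (W (Suc n))"
    "\<forall>v\<in>carrier (E n). q n v = \<zero>\<^bsub>W (Suc n)\<^esub> \<longleftrightarrow> v \<in> i n ` carrier (W n)" for n
    using ses[of n] unfolding short_exact_def by blast+
  define d where "d n x = i (Suc n) (q n x)" for n x
  define \<epsilon> where "\<epsilon> v = i 0 (\<epsilon>0 v)" for v
  have d: "d n \<in> module_hom R (E n) (E (Suc n))" for n
    unfolding d_def by (rule mhom_compose[OF ses'(4) ses'(3)])
  have iW: "i n ` carrier (W n) \<subseteq> carrier (E n)" for n using mhom_closed[OF ses'(3)] by blast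
  have ker: "{x \<in> carrier (E n). d n x = \<zero>\<^bsub>E (Suc n)\<^esub>} = i n ` carrier (W n)" for n
  proof -
    have "d n x = \<zero>\<^bsub>E (Suc n)\<^esub> \<longleftrightarrow> x \<in> i n ` carrier (W n)" if x: "x \<in> carrier (E n)" for x
    proof -
      have "\<zero>\<^bsub>W (Suc n)\<^esub> \<in> carrier (W (Suc n))"
        by (rule abelian_monoid.zero_closed[OF abelian_group.axioms(1)[OF module.axioms(2)[OF ses'(2)]]])
      from inj_on_eq_iff[OF ses'(5) mhom_closed[OF ses'(4) x] this]
      have "d n x = \<zero>\<^bsub>E (Suc n)\<^esub> \<longleftrightarrow> q n x = \<zero>\<^bsub>W (Suc n)\<^esub>"
        unfolding d_def mhom_zero[OF ses'(2,1,3)] .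
      then show ?thesis using ses'(7) x by blast
    qed
    then show ?thesis using iW by blast
  qed
  have "injective_resolution R V \<epsilon> E d"
    unfolding injective_resolution_def a_kernel_eq
  proof (intro conjI allI)
    have "\<epsilon>0 \<in> module_hom R V (W 0)" using \<epsilon>0(1) W0 by simp
    then show "\<epsilon> \<in> module_hom R V (E 0)" unfolding \<epsilon>_def by (rule mhom_compose[OF _ ses'(3)])
    have "inj_on (i 0) (\<epsilon>0 ` carrier V)" using ses'(5)[of 0] unfolding W0 \<epsilon>0(2) .
    then show "inj_on \<epsilon> (carrier V)"
      unfolding \<epsilon>_def using comp_inj_on[of \<epsilon>0 "carrier V" "i 0"] inj_on_subset[OF \<epsilon>0(3)] by (simp add: comp_def)
    have "\<epsilon> ` carrier V = i 0 ` carrier (W 0)" unfolding W0 \<epsilon>0(2) \<epsilon>_def by (simp add: image_image)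
    then show "\<epsilon> ` carrier V = {x \<in> carrier (E 0). d 0 x = \<zero>\<^bsub>E 1\<^esub>}" using ker[of 0] by simp
    show "d n ` carrier (E n) = {x \<in> carrier (E (Suc n)). d (Suc n) x = \<zero>\<^bsub>E (Suc (Suc n))\<^esub>}" for n
    proof -
      have "d n ` carrier (E n) = i (Suc n) ` (q n ` carrier (E n))" unfolding d_def by (simp add: image_image)
      then show ?thesis unfolding ker ses'(6) .
    qed
  qed (rule inj d)+
  then show ?thesis by blast
qed

section \<open>Change of rings for depth and height\<close>

context matrix_complex
begin

lemma coboundary_cong: "(\<And>k. k < m j \<Longrightarrow> v k = w k) \<Longrightarrow> coboundary V j v \<longleftrightarrow> coboundary V j w"
  by (cases j) (simp_all add: coboundary_def)

lemma cocycle_hom: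
  assumes "module A U" "module A V" "f \<in> module_hom A U V" "cocycle U j u"
  shows "cocycle V j (\<lambda>k. f (u k))"
proof -
  have u: "u \<in> {..<m j} \<rightarrow> carrier U" using assms(4) by (simp add: cocycle_def)
  then have "(\<lambda>k. f (u k)) \<in> {..<m j} \<rightarrow> carrier V" using mhom_closed[OF assms(3)] by auto
  then show ?thesis
    using assms(4) mhom_zero[OF assms(1-3)] by (simp add: cocycle_def diff_hom[OF assms(1-3) u, symmetric])
qed

text \<open>As \<open>V\<close> is acyclic in degree i + 1, the connecting map from H^i(W) onto
  H^(i+1)(U) is surjective; it is linear, so an element that kills the source kills the
  target.\<close>

lemma smult_coboundary_step:
  fixes U :: "('a, 'u, 'y1) module_scheme" and V :: "('a, 'v, 'y2) module_scheme"
    and W :: "('a, 'w, 'y3) module_scheme"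
  assumes ses: "short_exact A U V W f g" and V: "acyclic_at V (Suc i)" and x: "x \<in> carrier A"
    and W: "\<And>w. cocycle W i w \<Longrightarrow> coboundary W i (\<lambda>k. x \<odot>\<^bsub>W\<^esub> w k)" and u: "cocycle U (Suc i) u"
  shows "coboundary U (Suc i) (\<lambda>k. x \<odot>\<^bsub>U\<^esub> u k)"
proof -
  have Um: "module A U" and Vm: "module A V" and Wm: "module A W" using ses by (simp_all add: short_exact_def)
  interpret Um: module A U by (rule Um)
  interpret Vm: module A V by (rule Vm)
  note hom = short_exact_hom[OF ses]
  have u1: "u \<in> {..<m (Suc i)} \<rightarrow> carrier U" using u by (simp add: cocycle_def)
  have "coboundary V (Suc i) (\<lambda>k. f (u k))"
    using V cocycle_hom[OF Um Vm hom(1) u] by (simp add: acyclic_at_def)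
  then obtain v where v: "v \<in> {..<m i} \<rightarrow> carrier V" "\<And>k. k < m (Suc i) \<Longrightarrow> f (u k) = diff V i v k"
    unfolding coboundary_def nat.case by blast
  have "cocycle W i (\<lambda>k. g (v k))" using cocycle_image_right[OF ses u1 v] by blast
  then have "coboundary W i (\<lambda>k. x \<odot>\<^bsub>W\<^esub> g (v k))" by (rule W)
  moreover have "x \<odot>\<^bsub>W\<^esub> g (v k) = g (x \<odot>\<^bsub>V\<^esub> v k)" if k: "k < m i" for k
  proof -
    have "v k \<in> carrier V" using v(1) k by auto
    then show ?thesis using mhom_smult[OF hom(2) x] by simp
  qed
  ultimately have cobW: "coboundary W i (\<lambda>k. g (x \<odot>\<^bsub>V\<^esub> v k))"
    using coboundary_cong[of i "\<lambda>k. x \<odot>\<^bsub>W\<^esub> g (v k)" "\<lambda>k. g (x \<odot>\<^bsub>V\<^esub> v k)" W] by blast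
  show ?thesis
  proof (rule coboundary_left[OF ses _ _ _ cobW])
    show "(\<lambda>k. x \<odot>\<^bsub>U\<^esub> u k) \<in> {..<m (Suc i)} \<rightarrow> carrier U" using u1 x by auto
    show "(\<lambda>k. x \<odot>\<^bsub>V\<^esub> v k) \<in> {..<m i} \<rightarrow> carrier V" using v(1) x by auto
    fix k assume k: "k < m (Suc i)"
    have "u k \<in> carrier U" using u1 k by auto
    then show "f (x \<odot>\<^bsub>U\<^esub> u k) = diff V i (\<lambda>k. x \<odot>\<^bsub>V\<^esub> v k) k"
      using mhom_smult[OF hom(1) x] v(2)[OF k] by (simp add: diff_smult[OF Vm v(1) x])
  qed
qed

end

context noetherian_ideal_resolution
begin

lemma cocycle_0_smult_coboundary:
  assumes "module A V" "x \<in> I" "cocycle V 0 v"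
  shows "coboundary V 0 (\<lambda>k. x \<odot>\<^bsub>V\<^esub> v k)"
  using assms(2,3) cocycle_0_iff[OF assms(1)] by (simp add: coboundary_def m_0)

text \<open>The ideal \<open>I\<close> annihilates \<open>Ext(A/I, V)\<close>.\<close>

lemma cocycle_smult_coboundary:
  fixes V :: "('a, 'v, 'y) module_scheme"
  assumes V: "module A V" and x: "x \<in> I" and v: "cocycle V j v"
  shows "coboundary V j (\<lambda>k. x \<odot>\<^bsub>V\<^esub> v k)"
proof -
  have xc: "x \<in> carrier A" using x ideal_subset[OF ideal_I] by blast
  obtain E :: "nat \<Rightarrow> ('a, ('v \<times> 'a \<times> nat) set) module" and d \<epsilon> where res: "injective_resolution A V \<epsilon> E d"
    using injective_resolution_exists[OF V] by blast
  note ctx = V res tuple_encoding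
  \<comment> \<open>Dimension shifting along the cosyzygies down to degree 0, where the single value
    of a cocycle is killed by \<open>I\<close>.\<close>
  have Zk: "cocycle (Z E d n) i w \<Longrightarrow> coboundary (Z E d n) i (\<lambda>k. x \<odot>\<^bsub>Z E d n\<^esub> w k)" for n i w
  proof (induct i arbitrary: n w)
    case 0
    show ?case by (rule cocycle_0_smult_coboundary[OF Z_module[OF ctx] x 0])
  next
    case (Suc i)
    show ?case
      by (rule smult_coboundary_step[OF Z_short_exact[OF ctx] E_acyclic[OF ctx] xc Suc.hyps Suc.prems])
  qed
  show ?thesis
  proof (cases j)
    case 0
    then show ?thesis using cocycle_0_smult_coboundary[OF V x] v by simp
  next
    case (Suc i)
    then show ?thesis
      using smult_coboundary_step[OF augmentation_short_exact[OF ctx] E_acyclic[OF ctx] xc Zk] v by simp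
  qed
qed

end

lemma module_hom_subring: "f \<in> module_hom R M N \<Longrightarrow> S \<subseteq> carrier R \<Longrightarrow> f \<in> module_hom (R\<lparr>carrier := S\<rparr>) M N"
  by (auto simp: module_hom_def)

lemma module_subring:
  assumes V: "module R V" and S: "S \<subseteq> carrier R" "cring (R\<lparr>carrier := S\<rparr>)"
  shows "module (R\<lparr>carrier := S\<rparr>) V"
proof -
  interpret V: module R V by (rule V)
  have "a \<in> carrier R" if "a \<in> S" for a using S(1) that by blast
  then show ?thesis
    by (intro moduleI S(2) V.M.abelian_group_axioms) (simp_all add: V.smult_l_distr V.smult_r_distr V.smult_assoc1)
qed

text \<open>Induction on the number of degrees, along a nonzerodivisor x in \<open>I\<close>. Over
  R, the quotient W = V/xV is acyclic in one degree fewer, and by induction it is so over the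
  subring. There the missing degree of V is regained because x kills Ext: if x v is the differential
  of u, then the connecting map takes the class of q u, which vanishes, to that of v.\<close>

lemma acyclic_subring:
  fixes R :: "('r, 'x) ring_scheme" and V :: "('r, 'v) module"
  assumes R: "noetherian_ideal_resolution R m' D' (genideal R I)"
    and A: "noetherian_ideal_resolution (R\<lparr>carrier := S\<rparr>) m D I" and S: "S \<subseteq> carrier R"
    and "module R V" "fin_gen (R\<lparr>carrier := S\<rparr>) V" "\<And>j. j < n \<Longrightarrow> matrix_complex.acyclic_at m' D' V j"
    and "j < n"
  shows "matrix_complex.acyclic_at m D V j"
  using assms(4-7)
proof (induct n arbitrary: V j)
  case (Suc n)
  let ?A = "R\<lparr>carrier := S\<rparr>"
  interpret R: noetherian_ideal_resolution R m' D' "genideal R I" by (rule R)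
  interpret A: noetherian_ideal_resolution ?A m D I by (rule A)
  note V = Suc.prems(1)
  note sub = module_subring[OF _ S A.cring_axioms]
  interpret V: module R V by (rule V)
  have VA: "module ?A V" by (rule sub[OF V])
  have IS: "I \<subseteq> S" using ideal_subset[OF A.ideal_I] by simp
  have IR: "I \<subseteq> carrier R" using IS S by blast
  have tf: "v = \<zero>\<^bsub>V\<^esub>" if v: "v \<in> carrier V" "\<And>b. b \<in> I \<Longrightarrow> b \<odot>\<^bsub>V\<^esub> v = \<zero>\<^bsub>V\<^esub>" for v
  proof -
    have "ideal {b \<in> carrier R. b \<odot>\<^bsub>V\<^esub> v = \<zero>\<^bsub>V\<^esub>} R" using R.annihilator_ideal[OF V, of "{v}"] v(1) by simp
    moreover have "I \<subseteq> {b \<in> carrier R. b \<odot>\<^bsub>V\<^esub> v = \<zero>\<^bsub>V\<^esub>}" using IR v(2) by blast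
    ultimately have "genideal R I \<subseteq> {b \<in> carrier R. b \<odot>\<^bsub>V\<^esub> v = \<zero>\<^bsub>V\<^esub>}" by (rule R.genideal_minimal)
    then have "\<forall>b\<in>genideal R I. b \<odot>\<^bsub>V\<^esub> v = \<zero>\<^bsub>V\<^esub>" by blast
    then show ?thesis using Suc.prems(3)[of 0] R.acyclic_at_0_iff[OF V] v(1) by simp
  qed
  \<comment> \<open>\<open>V\<close> is finitely generated over the noetherian subring, so the
    nonzerodivisor can be taken in \<open>I\<close> itself and serves over both rings.\<close>
  obtain x where x: "x \<in> I" "\<And>v. v \<in> carrier V \<Longrightarrow> x \<odot>\<^bsub>V\<^esub> v = \<zero>\<^bsub>V\<^esub> \<Longrightarrow> v = \<zero>\<^bsub>V\<^esub>"
    using A.nonzerodivisor_exists[OF VA Suc.prems(2) A.ideal_I] tf by metis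
  have xR: "x \<in> carrier R" using x(1) IR by blast
  obtain W :: "('r, 'v) module" and q where ses: "short_exact R V V W (\<lambda>v. x \<odot>\<^bsub>V\<^esub> v) q"
    by (rule nonzerodivisor_short_exact[OF V xR x(2)])
  have W: "module R W" "q \<in> module_hom R V W" "q ` carrier V = carrier W"
    using ses by (simp_all add: short_exact_def)
  have sesA: "short_exact ?A V V W (\<lambda>v. x \<odot>\<^bsub>V\<^esub> v) q"
    using ses sub module_hom_subring[OF _ S] unfolding short_exact_def by blast
  have Wfg: "fin_gen ?A W"
    by (rule fin_gen_image[OF VA sub[OF W(1)] module_hom_subring[OF W(2) S] W(3) Suc.prems(2)])
  have "R.acyclic_at W j" if "j < n" for j
    using that by (intro R.acyclic_at_right[OF ses] Suc.prems(3)) auto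
  then have IH: "A.acyclic_at W j" if "j < n" for j using Suc.hyps[OF W(1) Wfg] that by blast
  show ?case
  proof (cases j)
    case 0
    then show ?thesis using A.acyclic_at_0_iff[OF VA] tf by blast
  next
    case (Suc i)
    show ?thesis
      unfolding A.acyclic_at_def Suc
    proof (intro allI impI)
      fix v assume v: "A.cocycle V (Suc i) v"
      have v1: "v \<in> {..<m (Suc i)} \<rightarrow> carrier V" using v by (simp add: A.cocycle_def)
      have "A.coboundary V (Suc i) (\<lambda>k. x \<odot>\<^bsub>V\<^esub> v k)" by (rule A.cocycle_smult_coboundary[OF VA x(1) v])
      then obtain u where u: "u \<in> {..<m i} \<rightarrow> carrier V" "\<And>k. k < m (Suc i) \<Longrightarrow> x \<odot>\<^bsub>V\<^esub> v k = A.diff V i u k"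
        unfolding A.coboundary_def nat.case by blast
      have "A.cocycle W i (\<lambda>k. q (u k))" using A.cocycle_image_right[OF sesA v1 u] by blast
      then have "A.coboundary W i (\<lambda>k. q (u k))"
        using IH[of i] Suc.prems(4) Suc by (simp add: A.acyclic_at_def)
      then show "A.coboundary V (Suc i) v" using A.coboundary_left[OF sesA v1 u] by blast
    qed
  qed
qed simp

text \<open>Depths are compared through their finite lower bounds, which treats finite and infinite
  depth alike and fits \<open>depth_ge_iff\<close>.\<close>

lemma enat_le_of_nat_le: "(\<And>n. enat n \<le> x \<Longrightarrow> enat n \<le> y) \<Longrightarrow> x \<le> y"
proof (rule ccontr)
  assume *: "\<And>n. enat n \<le> x \<Longrightarrow> enat n \<le> y" and "\<not> x \<le> y"
  then obtain k where k: "y = enat k" "y < x" by (cases y) auto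
  then have "enat (Suc k) \<le> x" by (metis Suc_ile_eq)
  then show False using *[of "Suc k"] k(1) by simp
qed

lemma depth_subring:
  fixes R :: "('r, 'x) ring_scheme" and V :: "('r, 'v) module"
  assumes R: "noetherian_cring R" and A: "noetherian_cring (R\<lparr>carrier := S\<rparr>)" and S: "S \<subseteq> carrier R"
    and I: "ideal I (R\<lparr>carrier := S\<rparr>)" and V: "module R V" and fg: "fin_gen (R\<lparr>carrier := S\<rparr>) V"
  shows "depth R (genideal R I) V \<le> depth (R\<lparr>carrier := S\<rparr>) I V"
proof (rule enat_le_of_nat_le)
  fix n assume n: "enat n \<le> depth R (genideal R I) V"
  let ?A = "R\<lparr>carrier := S\<rparr>"
  interpret R: noetherian_cring R by (rule R)
  interpret A: noetherian_cring ?A by (rule A)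
  have IR: "I \<subseteq> carrier R" using ideal_subset[OF I] S by auto
  obtain m' D' where r: "noetherian_ideal_resolution R m' D' (genideal R I)"
    by (rule R.ideal_resolution_exists[OF R.genideal_ideal[OF IR]])
  obtain m D where a: "noetherian_ideal_resolution ?A m D I" by (rule A.ideal_resolution_exists[OF I])
  have VA: "module ?A V" by (rule module_subring[OF V S A.cring_axioms])
  have "\<forall>j<n. matrix_complex.acyclic_at m' D' V j"
    using n noetherian_ideal_resolution.depth_ge_iff[OF r V R.injective_resolution_exists[OF V]] by blast
  then have "\<forall>j<n. matrix_complex.acyclic_at m D V j" using acyclic_subring[OF r a S V fg] by blast
  then show "enat n \<le> depth ?A I V"
    using noetherian_ideal_resolution.depth_ge_iff[OF a VA A.injective_resolution_exists[OF VA]] by blast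
qed

section \<open>Heights in quotient rings\<close>

lemma carrier_FactRing: "carrier (R Quot I) = a_rcosets\<^bsub>R\<^esub> I"
  by (simp add: FactRing_def)

text \<open>A prime of R/I over the image of J + I pulls back to a prime P of R over I and J, and
  the chain ending at P is pushed forward. All its members contain I, so membership depends only on
  the coset; this preserves primality and strictness.\<close>

lemma (in cring) ideal_height_quotient_ge:
  assumes I: "ideal I R" and J: "ideal J R"
    and chain: "\<And>P. \<lbrakk>primeideal P R; J \<subseteq> P; I \<subseteq> P\<rbrakk> \<Longrightarrow> \<exists>q. prime_chain R n q \<and> I \<subseteq> q 0 \<and> q n = P"
  shows "enat n \<le> ideal_height (R Quot I) ((\<lambda>x. I +> x) ` (J <+> I))"
  unfolding ideal_height_def
proof (rule Inf_greatest, clarify)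
  fix \<PP> assume PP: "primeideal \<PP> (R Quot I)" "(\<lambda>x. I +> x) ` (J <+> I) \<subseteq> \<PP>"
  interpret I: ideal I R by (rule I)
  interpret Q: cring "R Quot I" by (rule I.quotient_is_cring[OF is_cring])
  interpret h: ring_hom_ring R "R Quot I" "(+>) I" by (rule I.rcos_ring_hom_ring)
  have Ic: "I \<subseteq> carrier R" and Jc: "J \<subseteq> carrier R" by (rule ideal_subset[OF I], rule ideal_subset[OF J])
  define P where "P = {r \<in> carrier R. I +> r \<in> \<PP>}"
  have P: "primeideal P R" unfolding P_def by (rule h.primeideal_vimage[OF is_cring PP(1)])
  have sum: "a \<oplus> b \<in> J <+> I" if "a \<in> J" "b \<in> I" for a b using that by (auto simp: set_add_def')
  have "J \<subseteq> P"
  proof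
    fix a assume a: "a \<in> J"
    have ac: "a \<in> carrier R" using a Jc by blast
    have "a \<in> J <+> I" using sum[OF a ideal_zero[OF I]] ac by simp
    then have "I +> a \<in> \<PP>" using PP(2) by blast
    then show "a \<in> P" unfolding P_def using ac by blast
  qed
  moreover have "I \<subseteq> P"
  proof
    fix a assume a: "a \<in> I"
    have ac: "a \<in> carrier R" using a Ic by blast
    have "a \<in> J <+> I" using sum[OF ideal_zero[OF J] a] ac by simp
    then have "I +> a \<in> \<PP>" using PP(2) by blast
    then show "a \<in> P" unfolding P_def using ac by blast
  qed
  ultimately obtain q where q: "prime_chain R n q" "I \<subseteq> q 0" "q n = P" using chain[OF P] by blast
  have qp: "primeideal (q i) R" if "i \<le> n" for i using q(1) that by (simp add: prime_chain_def)
  have qi: "ideal (q i) R" if "i \<le> n" for i using qp[OF that] by (simp add: primeideal_def)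
  have mono: "q 0 \<subseteq> q i" if "i \<le> n" for i
    using that
  proof (induct i)
    case (Suc i)
    then have "q i \<subset> q (Suc i)" using q(1) by (simp add: prime_chain_def)
    then show ?case using Suc by auto
  qed simp
  have coset: "I +> x = I +> y \<longleftrightarrow> x \<ominus> y \<in> I" if "x \<in> carrier R" "y \<in> carrier R" for x y
    using quotient_eq_iff_same_a_r_cos[OF I that] by blast
  define p where "p i = (+>) I ` q i" for i
  have p_iff: "I +> x \<in> p i \<longleftrightarrow> x \<in> q i" if x: "x \<in> carrier R" and i: "i \<le> n" for x i
  proof
    assume "I +> x \<in> p i"
    then obtain y where y: "y \<in> q i" "I +> x = I +> y" unfolding p_def by blast
    have yc: "y \<in> carrier R" using y(1) ideal_subset[OF qi[OF i]] by blast
    have "x \<ominus> y \<in> q i" using y(2) coset[OF x yc] q(2) mono[OF i] by blast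
    then have "(x \<ominus> y) \<oplus> y \<in> q i" using ideal_add[OF qi[OF i]] y(1) by blast
    then show "x \<in> q i" using x yc by (simp add: diff_add)
  qed (simp add: p_def)
  have Qc: "\<exists>x\<in>carrier R. K = I +> x" if "K \<in> carrier (R Quot I)" for K
  proof -
    have "K \<in> a_rcosets I" using that unfolding carrier_FactRing .
    then obtain x where "K = I +> x" "x \<in> carrier R" unfolding A_RCOSETS_def' by blast
    then show ?thesis by (intro bexI[of _ x])
  qed
  have pc: "p i \<subseteq> carrier (R Quot I)" if "i \<le> n" for i
  proof
    fix K assume "K \<in> p i"
    then obtain y where y: "K = I +> y" "y \<in> q i" unfolding p_def by (rule imageE)
    have "y \<in> carrier R" using y(2) ideal_subset[OF qi[OF that]] by blast
    then show "K \<in> carrier (R Quot I)" unfolding y(1) by (rule h.hom_closed)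
  qed
  have prime: "primeideal (p i) (R Quot I)" if i: "i \<le> n" for i
  proof (rule primeidealI)
    note E = ideal_facts[OF qi[OF i]]
    show "ideal (p i) (R Quot I)"
    proof (rule Q.ideal_criterion[OF pc[OF i]])
      have "I +> \<zero> \<in> p i" using E(2) p_iff[OF zero_closed i] by blast
      then show "\<zero>\<^bsub>R Quot I\<^esub> \<in> p i" by simp
      show "K \<oplus>\<^bsub>R Quot I\<^esub> L \<in> p i" if KL: "K \<in> p i" "L \<in> p i" for K L
      proof -
        obtain x where x: "x \<in> carrier R" "K = I +> x" using Qc KL(1) pc[OF i] by blast
        obtain y where y: "y \<in> carrier R" "L = I +> y" using Qc KL(2) pc[OF i] by blast
        have "x \<oplus> y \<in> q i" using E(3) p_iff[OF x(1) i] p_iff[OF y(1) i] KL x y by simp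
        then have "I +> (x \<oplus> y) \<in> p i" by (rule p_iff[OF a_closed[OF x(1) y(1)] i, THEN iffD2])
        then show ?thesis unfolding x(2) y(2) h.hom_add[OF x(1) y(1)] .
      qed
      show "K \<otimes>\<^bsub>R Quot I\<^esub> L \<in> p i" if KL: "K \<in> carrier (R Quot I)" "L \<in> p i" for K L
      proof -
        obtain x where x: "x \<in> carrier R" "K = I +> x" using Qc KL(1) by blast
        obtain y where y: "y \<in> carrier R" "L = I +> y" using Qc KL(2) pc[OF i] by blast
        have "x \<otimes> y \<in> q i" using E(5)[OF x(1)] p_iff[OF y(1) i] KL y by simp
        then have "I +> (x \<otimes> y) \<in> p i" by (rule p_iff[OF m_closed[OF x(1) y(1)] i, THEN iffD2])
        then show ?thesis unfolding x(2) y(2) h.hom_mult[OF x(1) y(1)] .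
      qed
    qed
    show "cring (R Quot I)" by (rule Q.is_cring)
    show "carrier (R Quot I) \<noteq> p i"
    proof
      assume "carrier (R Quot I) = p i"
      then have "I +> \<one> \<in> p i" using h.hom_closed[OF one_closed] by simp
      then have "\<one> \<in> q i" using p_iff[OF one_closed i] by blast
      then show False using primeideal.I_notcarr[OF qp[OF i]] ideal.one_imp_carrier[OF qi[OF i]] by blast
    qed
    fix K L assume KL: "K \<in> carrier (R Quot I)" "L \<in> carrier (R Quot I)" "K \<otimes>\<^bsub>R Quot I\<^esub> L \<in> p i"
    obtain x where x: "x \<in> carrier R" "K = I +> x" using Qc KL(1) by blast
    obtain y where y: "y \<in> carrier R" "L = I +> y" using Qc KL(2) by blast
    have "I +> (x \<otimes> y) \<in> p i" using KL(3) unfolding x(2) y(2) h.hom_mult[OF x(1) y(1)] .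
    then have "x \<otimes> y \<in> q i" by (rule p_iff[OF m_closed[OF x(1) y(1)] i, THEN iffD1])
    then have "x \<in> q i \<or> y \<in> q i" by (rule primeideal.I_prime[OF qp[OF i] x(1) y(1)])
    then show "K \<in> p i \<or> L \<in> p i" using p_iff[OF x(1) i] p_iff[OF y(1) i] x y by blast
  qed
  have strict: "p i \<subset> p (Suc i)" if i: "i < n" for i
  proof -
    have ss: "q i \<subset> q (Suc i)" using q(1) i by (simp add: prime_chain_def)
    then obtain y where y: "y \<in> q (Suc i)" "y \<notin> q i" by blast
    have yc: "y \<in> carrier R" using y(1) ideal_subset[OF qi[of "Suc i"]] i by auto
    have "I +> y \<in> p (Suc i)" "I +> y \<notin> p i" using p_iff[OF yc, of "Suc i"] p_iff[OF yc, of i] y i by auto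
    moreover have "p i \<subseteq> p (Suc i)" unfolding p_def using ss by blast
    ultimately show ?thesis by blast
  qed
  have "p n = \<PP>"
  proof
    show "p n \<subseteq> \<PP>" unfolding p_def q(3) P_def by blast
    show "\<PP> \<subseteq> p n"
    proof
      fix K assume K: "K \<in> \<PP>"
      have "K \<in> carrier (R Quot I)" using K ideal_subset[OF primeideal.axioms(1)[OF PP(1)]] by blast
      then obtain x where x: "x \<in> carrier R" "K = I +> x" using Qc by blast
      then have "x \<in> q n" using K unfolding q(3) P_def by blast
      then show "K \<in> p n" unfolding p_def x(2) by blast
    qed
  qed
  then show "enat n \<le> prime_height (R Quot I) \<PP>"
    unfolding prime_height_def using prime strict by (intro Sup_upper) blast
qed

section \<open>Group cochains\<close>

text \<open>Stated for additive maps because a group element acts on M only semilinearly over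
  R.\<close>

lemma (in abelian_group) finsum_additive:
  assumes h: "h \<in> carrier G \<rightarrow> carrier H" "\<And>x y. x \<in> carrier G \<Longrightarrow> y \<in> carrier G \<Longrightarrow> h (x \<oplus> y) = h x \<oplus>\<^bsub>H\<^esub> h y"
    and H: "abelian_group H"
  shows additive_zero: "h \<zero> = \<zero>\<^bsub>H\<^esub>"
    and additive_uminus: "x \<in> carrier G \<Longrightarrow> h (\<ominus> x) = \<ominus>\<^bsub>H\<^esub> h x"
    and additive_finsum: "finite I \<Longrightarrow> f \<in> I \<rightarrow> carrier G \<Longrightarrow> h (\<Oplus>i\<in>I. f i) = (\<Oplus>\<^bsub>H\<^esub>i\<in>I. h (f i))"
proof -
  interpret H: abelian_group H by (rule H)
  have hc: "h x \<in> carrier H" if "x \<in> carrier G" for x using h(1) that by blast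
  have "h \<zero> \<oplus>\<^bsub>H\<^esub> h \<zero> = h \<zero>" using h(2)[of \<zero> \<zero>] by simp
  then show z: "h \<zero> = \<zero>\<^bsub>H\<^esub>" using H.add.r_cancel_one'[of "h \<zero>" "h \<zero>"] hc by simp
  show "h (\<ominus> x) = \<ominus>\<^bsub>H\<^esub> h x" if x: "x \<in> carrier G"
    using h(2)[of "\<ominus> x" x] x hc z by (intro H.minus_equality[symmetric]) (simp_all add: l_neg)
  show "h (\<Oplus>i\<in>I. f i) = (\<Oplus>\<^bsub>H\<^esub>i\<in>I. h (f i))" if "finite I" "f \<in> I \<rightarrow> carrier G"
    using that
  proof (induct set: finite)
    case (insert i I)
    have "h (finsum G f (insert i I)) = h (f i) \<oplus>\<^bsub>H\<^esub> h (finsum G f I)"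
      using insert by (simp add: Pi_def h(2))
    also have "\<dots> = (\<Oplus>\<^bsub>H\<^esub>i\<in>insert i I. h (f i))"
      using insert hc by (subst H.finsum_insert) (auto simp: Pi_def)
    finally show ?case .
  qed (simp add: z)
qed

context abelian_group
begin

lemma alternating_closed [simp]: "x \<in> carrier G \<Longrightarrow> alternating G k x \<in> carrier G"
  by (simp add: alternating_def)

lemma alternating_alternating: "x \<in> carrier G \<Longrightarrow> alternating G i (alternating G j x) = alternating G (i + j) x"
  by (simp add: alternating_def)

lemma alternating_add:
  "x \<in> carrier G \<Longrightarrow> y \<in> carrier G \<Longrightarrow> alternating G k (x \<oplus> y) = alternating G k x \<oplus> alternating G k y"
  by (simp add: alternating_def minus_add a_comm)

lemma alternating_additive:
  assumes "h \<in> carrier G \<rightarrow> carrier G" "\<And>x y. x \<in> carrier G \<Longrightarrow> y \<in> carrier G \<Longrightarrow> h (x \<oplus> y) = h x \<oplus> h y"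
    and "x \<in> carrier G"
  shows "h (alternating G k x) = alternating G k (h x)"
  using additive_uminus[OF assms(1,2) abelian_group_axioms assms(3)] by (simp add: alternating_def)

lemma alternating_cancel: "x \<in> carrier G \<Longrightarrow> alternating G k x \<oplus> alternating G (Suc k) x = \<zero>"
  by (simp add: alternating_def l_neg r_neg)

text \<open>The cancellation behind \<open>d \<circ> d = 0\<close> for a cosimplicial group.\<close>

lemma alternating_double_sum:
  assumes "\<And>i j. x i j \<in> carrier G" "\<And>i j. i < j \<Longrightarrow> j \<le> N \<Longrightarrow> x j i = x i (j - 1)"
  shows "(\<Oplus>i\<in>{..N}. \<Oplus>j\<in>{..<N}. alternating G (i + j) (x i j)) = \<zero>"
  using assms(2)
proof (induct N)
  case (Suc N)
  have c: "alternating G k (x i j) \<in> carrier G" for k i j using assms(1) by simp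
  have "(\<Oplus>i\<in>{..N}. \<Oplus>j\<in>{..<Suc N}. alternating G (i + j) (x i j))
      = (\<Oplus>i\<in>{..N}. alternating G (i + N) (x i N) \<oplus> (\<Oplus>j\<in>{..<N}. alternating G (i + j) (x i j)))"
    using c by (intro finsum_cong') (auto simp: lessThan_Suc)
  also have "\<dots> = (\<Oplus>i\<in>{..N}. alternating G (i + N) (x i N)) \<oplus>
      (\<Oplus>i\<in>{..N}. \<Oplus>j\<in>{..<N}. alternating G (i + j) (x i j))"
    using c by (intro finsum_addf) auto
  also have "\<dots> = (\<Oplus>i\<in>{..N}. alternating G (i + N) (x i N))" using Suc c by simp
  finally have 1: "(\<Oplus>i\<in>{..N}. \<Oplus>j\<in>{..<Suc N}. alternating G (i + j) (x i j))
      = (\<Oplus>i\<in>{..N}. alternating G (i + N) (x i N))" .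
  \<comment> \<open>The hypothesis identifies the new last row of the array with its new last
    column, entry by entry, and the signs differ by one step.\<close>
  have 2: "(\<Oplus>j\<in>{..<Suc N}. alternating G (Suc N + j) (x (Suc N) j))
      = (\<Oplus>j\<in>{..N}. alternating G (Suc (j + N)) (x j N))"
    using c Suc.prems[of _ "Suc N"] by (intro finsum_cong') (auto simp: add.commute)
  have "(\<Oplus>i\<in>{..Suc N}. \<Oplus>j\<in>{..<Suc N}. alternating G (i + j) (x i j))
      = (\<Oplus>j\<in>{..<Suc N}. alternating G (Suc N + j) (x (Suc N) j)) \<oplus>
        (\<Oplus>i\<in>{..N}. \<Oplus>j\<in>{..<Suc N}. alternating G (i + j) (x i j))"
    using c unfolding atMost_Suc by (subst finsum_insert) auto
  also have "\<dots> = (\<Oplus>j\<in>{..N}. alternating G (Suc (j + N)) (x j N) \<oplus> alternating G (j + N) (x j N))"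
    unfolding 1 2 using c by (intro finsum_addf[symmetric]) auto
  also have "\<dots> = (\<Oplus>j\<in>{..N}. \<zero>)"
    using c alternating_cancel assms(1) by (intro finsum_cong') (auto simp: a_comm)
  finally show ?case by simp
qed simp

end

section \<open>The complex of inhomogeneous cochains\<close>

definition merge_at :: "('g, 'w) monoid_scheme \<Rightarrow> nat \<Rightarrow> 'g list \<Rightarrow> 'g list"
  where "merge_at G i gs = take i gs @ [(gs ! i) \<otimes>\<^bsub>G\<^esub> (gs ! Suc i)] @ drop (Suc (Suc i)) gs"

lemma merge_at_simps [simp]:
  "merge_at G 0 (a # b # l) = (a \<otimes>\<^bsub>G\<^esub> b) # l"
  "merge_at G (Suc i) (a # l) = a # merge_at G i l"
  by (simp_all add: merge_at_def)

lemma length_ge_2E: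
  assumes "Suc 0 < length gs" obtains a b l where "gs = a # b # l"
  using assms by (cases gs; cases "tl gs") auto

lemma merge_at_butlast: "Suc (Suc i) < length gs \<Longrightarrow> merge_at G i (butlast gs) = butlast (merge_at G i gs)"
proof (induct i arbitrary: gs)
  case 0
  have "Suc 0 < length gs" using 0 by simp
  then obtain a b l where gs: "gs = a # b # l" by (rule length_ge_2E)
  then have "l \<noteq> []" using 0 by auto
  then show ?case using gs by simp
next
  case (Suc i)
  then obtain a l where gs: "gs = a # l" by (cases gs) auto
  then have "l \<noteq> []" "merge_at G i l \<noteq> []" using Suc.prems by (auto simp: merge_at_def)
  then show ?case using gs Suc by simp
qed

lemma butlast_merge_at_last: "length gs = Suc (Suc i) \<Longrightarrow> butlast (merge_at G i gs) = butlast (butlast gs)"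
  by (simp add: merge_at_def butlast_append butlast_conv_take take_take min_def)

context group
begin

text \<open>A simplicial identity; disjoint positions commute trivially, and i = k is
  associativity.\<close>

lemma merge_at_merge_at:
  "i \<le> k \<Longrightarrow> Suc (Suc k) < length gs \<Longrightarrow> set gs \<subseteq> carrier G \<Longrightarrow>
    merge_at G i (merge_at G (Suc k) gs) = merge_at G k (merge_at G i gs)"
proof (induct i arbitrary: k gs)
  case 0
  have "Suc 0 < length gs" using 0 by simp
  then obtain a b l where gs: "gs = a # b # l" by (rule length_ge_2E)
  show ?case
  proof (cases k)
    case k: 0
    then obtain c l' where "l = c # l'" using 0 gs by (cases l) auto
    then show ?thesis using gs k 0 by (simp add: m_assoc)
  qed (simp add: gs)
next
  case (Suc i)
  then obtain a l k' where "gs = a # l" "k = Suc k'" by (cases gs; cases k) auto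
  then show ?case using Suc by simp
qed

lemma tuples_merge_at:
  assumes "gs \<in> tuples G (Suc n)" "i < n" shows "merge_at G i gs \<in> tuples G n"
  using assms
proof (induct i arbitrary: gs n)
  case 0
  then have "Suc 0 < length gs" by (auto simp: tuples_def)
  then obtain a b l where gs: "gs = a # b # l" by (rule length_ge_2E)
  then show ?case using 0 by (auto simp: tuples_def)
next
  case (Suc i)
  then obtain a l n' where gs: "gs = a # l" "n = Suc n'" by (cases gs; cases n) (auto simp: tuples_def)
  then have "merge_at G i l \<in> tuples G n'" using Suc by (intro Suc.hyps) (auto simp: tuples_def)
  then show ?case using Suc.prems gs by (auto simp: tuples_def)
qed

lemma tuples_tl: "gs \<in> tuples G (Suc n) \<Longrightarrow> tl gs \<in> tuples G n"
  and tuples_butlast: "gs \<in> tuples G (Suc n) \<Longrightarrow> butlast gs \<in> tuples G n"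
  and tuples_hd: "gs \<in> tuples G (Suc n) \<Longrightarrow> hd gs \<in> carrier G"
  by (cases gs; auto simp: tuples_def dest: in_set_butlastD)+

end

locale skew_module = ring_action G R \<phi> + M?: left_module "skew_group_ring G R \<phi>" M
  for G :: "('g, 'w) monoid_scheme" and R :: "('r, 'x) ring_scheme" and \<phi>
    and M :: "('g \<Rightarrow> 'r, 'm, 'z) module_scheme" +
  assumes finite_group: "finite (carrier G)"
begin

abbreviation "act \<equiv> module_action G R M"
abbreviation "U \<equiv> underlying_module G R M"
abbreviation "C \<equiv> cochains G R M"
abbreviation "d \<equiv> cochain_diff G R M"

lemma skew_monom_closed: "a \<in> carrier R \<Longrightarrow> skew_monom G R a g \<in> carrier (skew_group_ring G R \<phi>)"
  by (auto simp: skew_group_ring_def skew_monom_def)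

lemma act_closed [simp]: "x \<in> carrier M \<Longrightarrow> act g x \<in> carrier M"
  by (simp add: module_action_def skew_monom_closed M.smult_closed)

lemma act_add: "x \<in> carrier M \<Longrightarrow> y \<in> carrier M \<Longrightarrow> act g (x \<oplus>\<^bsub>M\<^esub> y) = act g x \<oplus>\<^bsub>M\<^esub> act g y"
  by (simp add: module_action_def skew_monom_closed M.smult_r_distr)

lemma act_act:
  assumes "g \<in> carrier G" "h \<in> carrier G" "x \<in> carrier M"
  shows "act g (act h x) = act (g \<otimes>\<^bsub>G\<^esub> h) x"
  using M.smult_assoc[of "skew_monom G R \<one>\<^bsub>R\<^esub> g" "skew_monom G R \<one>\<^bsub>R\<^esub> h" x] assms
  by (simp add: module_action_def skew_monom_closed skew_monom_mult[OF finite_group] action_unit)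

lemma U_simps [simp]: "carrier U = carrier M" "\<zero>\<^bsub>U\<^esub> = \<zero>\<^bsub>M\<^esub>" "x \<oplus>\<^bsub>U\<^esub> y = x \<oplus>\<^bsub>M\<^esub> y"
  by (simp_all add: underlying_module_def)

lemma U_module: "module R U"
  by (rule underlying_module_is_module[OF ring_action_axioms finite_group M.left_module_axioms])

interpretation U: module R U by (rule U_module)

lemma act_smult:
  assumes g: "g \<in> carrier G" and a: "a \<in> carrier R" and x: "x \<in> carrier M"
  shows "act g (a \<odot>\<^bsub>U\<^esub> x) = \<phi> g a \<odot>\<^bsub>U\<^esub> act g x"
proof -
  have "skew_monom G R \<one>\<^bsub>R\<^esub> g \<otimes>\<^bsub>skew_group_ring G R \<phi>\<^esub> skew_monom G R a \<one>\<^bsub>G\<^esub> = skew_monom G R (\<phi> g a) g"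
    "skew_monom G R (\<phi> g a) \<one>\<^bsub>G\<^esub> \<otimes>\<^bsub>skew_group_ring G R \<phi>\<^esub> skew_monom G R \<one>\<^bsub>R\<^esub> g = skew_monom G R (\<phi> g a) g"
    using g a by (simp_all add: skew_monom_mult[OF finite_group] action_unit action_closed)
  then show ?thesis
    using M.smult_assoc[of "skew_monom G R \<one>\<^bsub>R\<^esub> g" "skew_monom G R a \<one>\<^bsub>G\<^esub>" x]
      M.smult_assoc[of "skew_monom G R (\<phi> g a) \<one>\<^bsub>G\<^esub>" "skew_monom G R \<one>\<^bsub>R\<^esub> g" x] g a x
    by (simp add: module_action_def underlying_module_def skew_monom_closed action_closed)
qed

text \<open>Because (g a) x = g (a (g^-1 x)).\<close>

lemma annihilator_stable:
  assumes g: "g \<in> carrier G" and a: "a \<in> annihilator R U"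
  shows "\<phi> g a \<in> annihilator R U"
proof -
  have ac: "a \<in> carrier R" and a0: "\<And>x. x \<in> carrier M \<Longrightarrow> a \<odot>\<^bsub>U\<^esub> x = \<zero>\<^bsub>M\<^esub>"
    using a by (simp_all add: annihilator_def)
  have act0: "act h \<zero>\<^bsub>M\<^esub> = \<zero>\<^bsub>M\<^esub>" for h
    by (rule M.additive_zero[where H = M]) (auto simp: act_add intro: M.M.abelian_group_axioms)
  have "\<phi> g a \<odot>\<^bsub>U\<^esub> x = \<zero>\<^bsub>M\<^esub>" if x: "x \<in> carrier M" for x
  proof -
    have "act \<one>\<^bsub>G\<^esub> x = x"
      using M.smult_one[OF x] by (simp add: module_action_def skew_group_ring_def)
    then have "x = act g (act (inv\<^bsub>G\<^esub> g) x)" using act_act[of g "inv\<^bsub>G\<^esub> g" x] g x by simp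
    then have "\<phi> g a \<odot>\<^bsub>U\<^esub> x = act g (a \<odot>\<^bsub>U\<^esub> act (inv\<^bsub>G\<^esub> g) x)"
      using act_smult[OF g ac, of "act (inv\<^bsub>G\<^esub> g) x"] x by simp
    then show ?thesis using a0 x act0 by simp
  qed
  then show ?thesis using ac g by (simp add: annihilator_def action_closed)
qed

lemma U_module_invariants: "module inv_ring U"
  unfolding invariant_ring_def
  by (rule module_subring[OF U_module]) (use cring_inv_ring in \<open>auto simp: invariant_ring_def\<close>)

interpretation UA: module inv_ring U by (rule U_module_invariants)

lemma C_simps [simp]:
  "carrier (C n) = tuples G n \<rightarrow>\<^sub>E carrier M" "\<zero>\<^bsub>C n\<^esub> = (\<lambda>gs\<in>tuples G n. \<zero>\<^bsub>M\<^esub>)"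
  "f \<oplus>\<^bsub>C n\<^esub> f' = (\<lambda>gs\<in>tuples G n. f gs \<oplus>\<^bsub>M\<^esub> f' gs)"
  "a \<odot>\<^bsub>C n\<^esub> f = (\<lambda>gs\<in>tuples G n. a \<odot>\<^bsub>U\<^esub> f gs)"
  by (simp_all add: cochains_def)

lemma C_module: "module inv_ring (C n)"
proof -
  have c: "f gs \<in> carrier M" if "f \<in> carrier (C n)" "gs \<in> tuples G n" for f gs
    using that by auto
  have U: "a \<odot>\<^bsub>U\<^esub> x \<in> carrier M" if "a \<in> carrier inv_ring" "x \<in> carrier M" for a x
    using U.smult_closed[of a x] that by simp
  have "abelian_group (C n)"
  proof (rule abelian_groupI)
    show "\<exists>y\<in>carrier (C n). y \<oplus>\<^bsub>C n\<^esub> x = \<zero>\<^bsub>C n\<^esub>" if x: "x \<in> carrier (C n)" for x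
      by (rule bexI[of _ "\<lambda>gs\<in>tuples G n. \<ominus>\<^bsub>M\<^esub> x gs"])
         (use c[OF x] in \<open>auto simp: M.M.l_neg intro!: restrict_ext\<close>)
    show "\<zero>\<^bsub>C n\<^esub> \<oplus>\<^bsub>C n\<^esub> x = x" if x: "x \<in> carrier (C n)" for x
      using x c[OF x] by (auto simp: fun_eq_iff restrict_def PiE_arb[of x])
  qed (auto simp: M.M.a_ac c intro!: restrict_ext)
  then show ?thesis
  proof (intro moduleI cring_inv_ring)
    show "\<one>\<^bsub>inv_ring\<^esub> \<odot>\<^bsub>C n\<^esub> x = x" if x: "x \<in> carrier (C n)" for x
      using x c[OF x] U.smult_one by (auto simp: fun_eq_iff restrict_def PiE_arb[of x])
    show "a \<odot>\<^bsub>C n\<^esub> x \<in> carrier (C n)" if "a \<in> carrier inv_ring" "x \<in> carrier (C n)" for a x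
      using U[OF that(1)] c[OF that(2)] by auto
    show "(a \<oplus>\<^bsub>inv_ring\<^esub> b) \<odot>\<^bsub>C n\<^esub> x = a \<odot>\<^bsub>C n\<^esub> x \<oplus>\<^bsub>C n\<^esub> b \<odot>\<^bsub>C n\<^esub> x"
      if "a \<in> carrier inv_ring" "b \<in> carrier inv_ring" "x \<in> carrier (C n)" for a b x
      using U.smult_l_distr[of a b] that c[OF that(3)] by (auto intro!: restrict_ext)
    show "a \<odot>\<^bsub>C n\<^esub> (x \<oplus>\<^bsub>C n\<^esub> y) = a \<odot>\<^bsub>C n\<^esub> x \<oplus>\<^bsub>C n\<^esub> a \<odot>\<^bsub>C n\<^esub> y"
      if "a \<in> carrier inv_ring" "x \<in> carrier (C n)" "y \<in> carrier (C n)" for a x y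
      using U.smult_r_distr[of a] that c[OF that(2)] c[OF that(3)] by (auto intro!: restrict_ext)
    show "(a \<otimes>\<^bsub>inv_ring\<^esub> b) \<odot>\<^bsub>C n\<^esub> x = a \<odot>\<^bsub>C n\<^esub> (b \<odot>\<^bsub>C n\<^esub> x)"
      if "a \<in> carrier inv_ring" "b \<in> carrier inv_ring" "x \<in> carrier (C n)" for a b x
      using U.smult_assoc1[of a b] that c[OF that(3)] by (auto intro!: restrict_ext)
  qed
qed

text \<open>The i-th coface operator for 0 \<le> i \<le> n + 1, whose alternating sum is
  \<open>cochain_diff\<close>. The shift \<open>i - 1\<close> arises because list positions are
  counted from 0.\<close>

definition face :: "nat \<Rightarrow> nat \<Rightarrow> ('g list \<Rightarrow> 'm) \<Rightarrow> 'g list \<Rightarrow> 'm"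
  where "face n i f gs = (if i = 0 then act (hd gs) (f (tl gs))
    else if i \<le> n then f (merge_at G (i - 1) gs) else f (butlast gs))"

lemma face_cong:
  assumes gs: "gs \<in> tuples G (Suc n)" and "\<And>hs. hs \<in> tuples G n \<Longrightarrow> f hs = f' hs"
  shows "face n i f gs = face n i f' gs"
  using assms tuples_tl[OF gs] tuples_butlast[OF gs] tuples_merge_at[OF gs, of "i - 1"]
  by (auto simp: face_def)

lemma face_closed:
  assumes gs: "gs \<in> tuples G (Suc n)" and f: "\<And>hs. hs \<in> tuples G n \<Longrightarrow> f hs \<in> carrier M"
  shows "face n i f gs \<in> carrier M"
  using assms tuples_tl[OF gs] tuples_butlast[OF gs] tuples_merge_at[OF gs, of "i - 1"]
  by (auto simp: face_def)

lemma face_equivariant: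
  assumes h: "\<And>g x. g \<in> carrier G \<Longrightarrow> x \<in> carrier M \<Longrightarrow> act g (h x) = h (act g x)"
    and gs: "gs \<in> tuples G (Suc n)" and f: "\<And>hs. hs \<in> tuples G n \<Longrightarrow> f hs \<in> carrier M"
  shows "face n i (\<lambda>hs. h (f hs)) gs = h (face n i f gs)"
  using f[OF tuples_tl[OF gs]] tuples_hd[OF gs] h by (auto simp: face_def)

lemma face_add:
  assumes gs: "gs \<in> tuples G (Suc n)" and f: "\<And>hs. hs \<in> tuples G n \<Longrightarrow> f hs \<in> carrier M"
    "\<And>hs. hs \<in> tuples G n \<Longrightarrow> f' hs \<in> carrier M"
  shows "face n i (\<lambda>hs. f hs \<oplus>\<^bsub>M\<^esub> f' hs) gs = face n i f gs \<oplus>\<^bsub>M\<^esub> face n i f' gs"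
  using tuples_tl[OF gs] f by (auto simp: face_def act_add)

lemma act_hom: "act g \<in> carrier M \<rightarrow> carrier M" by auto

lemma face_alternating_sum:
  assumes gs: "gs \<in> tuples G (Suc n)"
    and f: "\<And>j hs. hs \<in> tuples G n \<Longrightarrow> f j hs \<in> carrier M"
  shows "face n i (\<lambda>hs. \<Oplus>\<^bsub>M\<^esub>j\<in>{..k::nat}. alternating M j (f j hs)) gs
    = (\<Oplus>\<^bsub>M\<^esub>j\<in>{..k}. alternating M j (face n i (f j) gs))"
proof (cases "i = 0")
  case True
  have ft: "f j (tl gs) \<in> carrier M" for j using f tuples_tl[OF gs] by blast
  have "act (hd gs) (\<Oplus>\<^bsub>M\<^esub>j\<in>{..k}. alternating M j (f j (tl gs)))
      = (\<Oplus>\<^bsub>M\<^esub>j\<in>{..k}. act (hd gs) (alternating M j (f j (tl gs))))"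
    using ft by (intro M.M.additive_finsum[OF act_hom act_add M.M.abelian_group_axioms]) auto
  also have "\<dots> = (\<Oplus>\<^bsub>M\<^esub>j\<in>{..k}. alternating M j (act (hd gs) (f j (tl gs))))"
    using ft M.M.alternating_additive[OF act_hom act_add ft] by (intro M.M.finsum_cong') auto
  finally show ?thesis using True by (simp add: face_def)
qed (simp add: face_def)

lemma cochain_diff_face:
  assumes gs: "gs \<in> tuples G (Suc n)" and f: "\<And>hs. hs \<in> tuples G n \<Longrightarrow> f hs \<in> carrier M"
  shows "d n f gs = (\<Oplus>\<^bsub>M\<^esub>i\<in>{..Suc n}. alternating M i (face n i f gs))"
proof -
  have c: "alternating M k (face n i f gs) \<in> carrier M" for i k using face_closed[OF gs f] by simp
  have "(\<Oplus>\<^bsub>M\<^esub>i\<in>{..Suc n}. alternating M i (face n i f gs))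
      = alternating M (Suc n) (face n (Suc n) f gs) \<oplus>\<^bsub>M\<^esub> (\<Oplus>\<^bsub>M\<^esub>i\<in>{..n}. alternating M i (face n i f gs))"
    using c unfolding atMost_Suc by (subst M.M.finsum_insert) auto
  also have "{..n} = insert 0 (Suc ` {..<n})" by (simp add: lessThan_Suc_atMost[symmetric] lessThan_Suc_eq_insert_0)
  also have "(\<Oplus>\<^bsub>M\<^esub>i\<in>insert 0 (Suc ` {..<n}). alternating M i (face n i f gs))
      = alternating M 0 (face n 0 f gs) \<oplus>\<^bsub>M\<^esub> (\<Oplus>\<^bsub>M\<^esub>i\<in>Suc ` {..<n}. alternating M i (face n i f gs))"
    using c by (subst M.M.finsum_insert) auto
  also have "(\<Oplus>\<^bsub>M\<^esub>i\<in>Suc ` {..<n}. alternating M i (face n i f gs))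
      = (\<Oplus>\<^bsub>M\<^esub>i\<in>{..<n}. alternating M (Suc i) (face n (Suc i) f gs))"
    using c by (subst M.M.finsum_reindex) auto
  also have "\<dots> = (\<Oplus>\<^bsub>M\<^esub>i\<in>{..<n}. alternating M (Suc i) (f (merge_at G i gs)))"
    using tuples_merge_at[OF gs] f by (intro M.M.finsum_cong') (auto simp: face_def)
  finally have eq: "(\<Oplus>\<^bsub>M\<^esub>i\<in>{..Suc n}. alternating M i (face n i f gs))
      = alternating M (Suc n) (f (butlast gs)) \<oplus>\<^bsub>M\<^esub> (act (hd gs) (f (tl gs)) \<oplus>\<^bsub>M\<^esub>
        (\<Oplus>\<^bsub>M\<^esub>i\<in>{..<n}. alternating M (Suc i) (f (merge_at G i gs))))"
    by (simp add: face_def alternating_def[of M 0])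
  have "(\<Oplus>\<^bsub>M\<^esub>i\<in>{..<n}. alternating M (Suc i) (f (merge_at G i gs))) \<in> carrier M"
    using tuples_merge_at[OF gs] f by (intro M.M.finsum_closed) auto
  then show ?thesis
    unfolding eq cochain_diff_def merge_at_def[symmetric]
    using gs f[OF tuples_tl[OF gs]] f[OF tuples_butlast[OF gs]] by (simp add: M.M.a_comm)
qed

lemma cochain_diff_closed: "f \<in> carrier (C n) \<Longrightarrow> d n f \<in> carrier (C (Suc n))"
proof -
  assume f: "f \<in> carrier (C n)"
  have fc: "f hs \<in> carrier M" if "hs \<in> tuples G n" for hs using f that by auto
  have "d n f gs \<in> carrier M" if gs: "gs \<in> tuples G (Suc n)" for gs
  proof -
    have "face n i f gs \<in> carrier M" for i by (rule face_closed[OF gs fc])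
    then have "(\<Oplus>\<^bsub>M\<^esub>i\<in>{..Suc n}. alternating M i (face n i f gs)) \<in> carrier M" by (intro M.M.finsum_closed) auto
    then show ?thesis using cochain_diff_face[OF gs fc] by simp
  qed
  then show ?thesis by (auto simp: cochain_diff_def)
qed

lemma cochain_diff_ext:
  assumes "f \<in> carrier (C (Suc n))" "\<And>gs. gs \<in> tuples G (Suc n) \<Longrightarrow> d n f' gs = f gs"
  shows "d n f' = f"
proof
  fix gs
  show "d n f' gs = f gs"
  proof (cases "gs \<in> tuples G (Suc n)")
    case False
    then have "f gs = undefined" using assms(1) PiE_arb[of f "tuples G (Suc n)" "\<lambda>_. carrier M" gs] by simp
    then show ?thesis using False by (simp add: cochain_diff_def)
  qed (rule assms(2))
qed

lemma cochain_diff_hom: "d n \<in> module_hom inv_ring (C n) (C (Suc n))"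
proof (rule mhomI)
  interpret Cn: module inv_ring "C n" by (rule C_module)
  interpret C': module inv_ring "C (Suc n)" by (rule C_module)
  note cl = cochain_diff_closed
  show "d n f \<in> carrier (C (Suc n))" if "f \<in> carrier (C n)" for f by (rule cl[OF that])
  show "d n (f \<oplus>\<^bsub>C n\<^esub> f') = d n f \<oplus>\<^bsub>C (Suc n)\<^esub> d n f'"
    if f: "f \<in> carrier (C n)" and f': "f' \<in> carrier (C n)" for f f'
  proof (rule cochain_diff_ext[OF C'.M.a_closed[OF cl[OF f] cl[OF f']]])
    fix gs assume gs: "gs \<in> tuples G (Suc n)"
    have c: "f hs \<in> carrier M" "f' hs \<in> carrier M" "(f \<oplus>\<^bsub>C n\<^esub> f') hs \<in> carrier M"
      if "hs \<in> tuples G n" for hs using f f' that by auto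
    have fc: "face n i f gs \<in> carrier M" "face n i f' gs \<in> carrier M" for i
      using face_closed[where f = f, OF gs c(1)] face_closed[where f = f', OF gs c(2)] by blast+
    have eq: "face n i (f \<oplus>\<^bsub>C n\<^esub> f') gs = face n i f gs \<oplus>\<^bsub>M\<^esub> face n i f' gs" for i
    proof -
      have "face n i (f \<oplus>\<^bsub>C n\<^esub> f') gs = face n i (\<lambda>hs. f hs \<oplus>\<^bsub>M\<^esub> f' hs) gs"
        by (rule face_cong[OF gs]) simp
      then show ?thesis using face_add[OF gs c(1) c(2)] by simp
    qed
    have "d n (f \<oplus>\<^bsub>C n\<^esub> f') gs = (\<Oplus>\<^bsub>M\<^esub>i\<in>{..Suc n}. alternating M i (face n i (f \<oplus>\<^bsub>C n\<^esub> f') gs))"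
      by (rule cochain_diff_face[OF gs]) (rule c)
    also have "\<dots>
        = (\<Oplus>\<^bsub>M\<^esub>i\<in>{..Suc n}. alternating M i (face n i f gs) \<oplus>\<^bsub>M\<^esub> alternating M i (face n i f' gs))"
      unfolding eq using fc
      by (intro M.M.finsum_cong') (auto simp: M.M.alternating_add)
    also have "\<dots> = (\<Oplus>\<^bsub>M\<^esub>i\<in>{..Suc n}. alternating M i (face n i f gs)) \<oplus>\<^bsub>M\<^esub>
        (\<Oplus>\<^bsub>M\<^esub>i\<in>{..Suc n}. alternating M i (face n i f' gs))"
      using fc by (intro M.M.finsum_addf) auto
    also have "\<dots> = d n f gs \<oplus>\<^bsub>M\<^esub> d n f' gs"
      by (intro arg_cong2[where f = "add M"] cochain_diff_face[symmetric] gs) (rule c; assumption)+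
    finally show "d n (f \<oplus>\<^bsub>C n\<^esub> f') gs = (d n f \<oplus>\<^bsub>C (Suc n)\<^esub> d n f') gs" using gs by simp
  qed
  show "d n (a \<odot>\<^bsub>C n\<^esub> f) = a \<odot>\<^bsub>C (Suc n)\<^esub> d n f" if a: "a \<in> carrier inv_ring" and f: "f \<in> carrier (C n)" for a f
  proof (rule cochain_diff_ext[OF C'.smult_closed[OF a cl[OF f]]])
    fix gs assume gs: "gs \<in> tuples G (Suc n)"
    have aR: "a \<in> carrier R" using a by simp
    have h: "(\<lambda>x. a \<odot>\<^bsub>U\<^esub> x) \<in> carrier M \<rightarrow> carrier M"
      "\<And>x y. x \<in> carrier M \<Longrightarrow> y \<in> carrier M \<Longrightarrow> a \<odot>\<^bsub>U\<^esub> (x \<oplus>\<^bsub>M\<^esub> y) = a \<odot>\<^bsub>U\<^esub> x \<oplus>\<^bsub>M\<^esub> a \<odot>\<^bsub>U\<^esub> y"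
      using U.smult_closed[OF aR] U.smult_r_distr[OF aR] by auto
    have c: "f hs \<in> carrier M" "(a \<odot>\<^bsub>C n\<^esub> f) hs \<in> carrier M" if "hs \<in> tuples G n" for hs
      using f that h(1) by auto
    have fc: "face n i f gs \<in> carrier M" for i by (rule face_closed[OF gs c(1)])
    have eq: "face n i (a \<odot>\<^bsub>C n\<^esub> f) gs = a \<odot>\<^bsub>U\<^esub> face n i f gs" for i
    proof -
      have "face n i (a \<odot>\<^bsub>C n\<^esub> f) gs = face n i (\<lambda>hs. a \<odot>\<^bsub>U\<^esub> f hs) gs"
        by (rule face_cong[OF gs]) simp
      also have "\<dots> = a \<odot>\<^bsub>U\<^esub> face n i f gs"
        by (rule face_equivariant[OF _ gs c(1)]) (use a act_smult aR in auto)
      finally show ?thesis .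
    qed
    have "d n (a \<odot>\<^bsub>C n\<^esub> f) gs = (\<Oplus>\<^bsub>M\<^esub>i\<in>{..Suc n}. alternating M i (face n i (a \<odot>\<^bsub>C n\<^esub> f) gs))"
      by (rule cochain_diff_face[OF gs]) (rule c)
    also have "\<dots> = (\<Oplus>\<^bsub>M\<^esub>i\<in>{..Suc n}. a \<odot>\<^bsub>U\<^esub> alternating M i (face n i f gs))"
      unfolding eq using fc funcset_mem[OF h(1) fc] M.M.alternating_additive[OF h fc]
      by (intro M.M.finsum_cong') auto
    also have "\<dots> = a \<odot>\<^bsub>U\<^esub> (\<Oplus>\<^bsub>M\<^esub>i\<in>{..Suc n}. alternating M i (face n i f gs))"
      using fc by (intro M.M.additive_finsum[OF h M.M.abelian_group_axioms, symmetric]) auto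
    also have "(\<Oplus>\<^bsub>M\<^esub>i\<in>{..Suc n}. alternating M i (face n i f gs)) = d n f gs"
      by (rule cochain_diff_face[symmetric, OF gs]) (rule c)
    also have "a \<odot>\<^bsub>U\<^esub> d n f gs = (a \<odot>\<^bsub>C (Suc n)\<^esub> d n f) gs" using gs by simp
    finally show "d n (a \<odot>\<^bsub>C n\<^esub> f) gs = (a \<odot>\<^bsub>C (Suc n)\<^esub> d n f) gs" .
  qed
qed

text \<open>The cosimplicial identities. With j = k + 1, the case i = k = 0 is the action axiom, two
  inner faces give \<open>merge_at_merge_at\<close>, and for the last face merging is commuted with
  \<open>butlast\<close>.\<close>

lemma face_face:
  assumes gs: "gs \<in> tuples G (Suc (Suc n))" and f: "\<And>hs. hs \<in> tuples G n \<Longrightarrow> f hs \<in> carrier M"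
    and ij: "i < j" "j \<le> Suc (Suc n)"
  shows "face (Suc n) j (face n i f) gs = face (Suc n) i (face n (j - 1) f) gs"
proof -
  have len: "length gs = Suc (Suc n)" and set: "set gs \<subseteq> carrier G" using gs by (auto simp: tuples_def)
  obtain a b l where ab: "gs = a # b # l" by (rule length_ge_2E[of gs]) (simp add: len)
  obtain k where k: "j = Suc k" using ij(1) by (cases j) auto
  show ?thesis
  proof (cases i)
    case i: 0
    show ?thesis
    proof (cases k)
      case 0
      have "f l \<in> carrier M" by (rule f) (use gs ab in \<open>auto simp: tuples_def\<close>)
      then show ?thesis using ab set by (simp add: face_def i k 0 act_act)
    next
      case (Suc k')
      show ?thesis
      proof (cases "k \<le> n")
        case True
        then show ?thesis using ab by (simp add: face_def i k Suc)
      next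
        case False
        then show ?thesis using ab by (simp add: face_def i k Suc)
      qed
    qed
  next
    case i: (Suc i')
    have i'k: "i' < k" using ij(1) i k by simp
    show ?thesis
    proof (cases "k \<le> n")
      case True
      obtain k' where k': "k = Suc k'" using i'k by (cases k) auto
      have "merge_at G i' (merge_at G (Suc k') gs) = merge_at G k' (merge_at G i' gs)"
        using merge_at_merge_at[of i' k' gs] i'k True len set k' by simp
      then show ?thesis using True i'k by (simp add: face_def i k k')
    next
      case False
      then have kn: "k = Suc n" using ij(2) k by simp
      show ?thesis
      proof (cases "i' < n")
        case True
        then show ?thesis using merge_at_butlast[of i' gs G] len by (simp add: face_def i k kn)
      next
        case False
        then have "i' = n" using i'k kn by simp
        then show ?thesis using butlast_merge_at_last[of gs n G] len by (simp add: face_def i k kn)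
      qed
    qed
  qed
qed

lemma cochain_diff_diff:
  assumes f: "f \<in> carrier (C n)"
  shows "d (Suc n) (d n f) = \<zero>\<^bsub>C (Suc (Suc n))\<^esub>"
proof (rule cochain_diff_ext)
  show "\<zero>\<^bsub>C (Suc (Suc n))\<^esub> \<in> carrier (C (Suc (Suc n)))" by auto
  fix gs assume gs: "gs \<in> tuples G (Suc (Suc n))"
  have fc: "f hs \<in> carrier M" if "hs \<in> tuples G n" for hs using f that by auto
  have ffc: "face n j f hs \<in> carrier M" if "hs \<in> tuples G (Suc n)" for j hs by (rule face_closed[OF that fc])
  have dc: "d n f hs \<in> carrier M" if "hs \<in> tuples G (Suc n)" for hs
    using cochain_diff_closed[OF f] that by auto
  have fffc: "face (Suc n) i (face n j f) gs \<in> carrier M" for i j by (rule face_closed[OF gs ffc])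
  have "face (Suc n) i (d n f) gs
      = (\<Oplus>\<^bsub>M\<^esub>j\<in>{..Suc n}. alternating M j (face (Suc n) i (face n j f) gs))" for i
  proof -
    have "face (Suc n) i (d n f) gs
        = face (Suc n) i (\<lambda>hs. \<Oplus>\<^bsub>M\<^esub>j\<in>{..Suc n}. alternating M j (face n j f hs)) gs"
      by (rule face_cong[OF gs]) (rule cochain_diff_face[OF _ fc])
    then show ?thesis using face_alternating_sum[OF gs ffc] by simp
  qed
  then have "d (Suc n) (d n f) gs = (\<Oplus>\<^bsub>M\<^esub>i\<in>{..Suc (Suc n)}. alternating M i
      (\<Oplus>\<^bsub>M\<^esub>j\<in>{..Suc n}. alternating M j (face (Suc n) i (face n j f) gs)))"
    using cochain_diff_face[OF gs dc] by simp
  also have "\<dots> = (\<Oplus>\<^bsub>M\<^esub>i\<in>{..Suc (Suc n)}. \<Oplus>\<^bsub>M\<^esub>j\<in>{..<Suc (Suc n)}.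
      alternating M (i + j) (face (Suc n) i (face n j f) gs))"
  proof (intro M.M.finsum_cong' refl)
    fix i
    have "alternating M i (\<Oplus>\<^bsub>M\<^esub>j\<in>{..Suc n}. alternating M j (face (Suc n) i (face n j f) gs))
        = (\<Oplus>\<^bsub>M\<^esub>j\<in>{..Suc n}. alternating M i (alternating M j (face (Suc n) i (face n j f) gs)))"
      using fffc by (intro M.M.additive_finsum[OF _ M.M.alternating_add M.M.abelian_group_axioms]) auto
    then show "alternating M i (\<Oplus>\<^bsub>M\<^esub>j\<in>{..Suc n}. alternating M j (face (Suc n) i (face n j f) gs))
        = (\<Oplus>\<^bsub>M\<^esub>j\<in>{..<Suc (Suc n)}. alternating M (i + j) (face (Suc n) i (face n j f) gs))"
      using fffc by (simp add: M.M.alternating_alternating lessThan_Suc_atMost)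
  qed (use fffc in \<open>auto intro!: M.M.finsum_closed\<close>)
  also have "\<dots> = \<zero>\<^bsub>M\<^esub>"
    using fffc face_face[OF gs fc] by (intro M.M.alternating_double_sum) auto
  finally show "d (Suc n) (d n f) gs = \<zero>\<^bsub>C (Suc (Suc n))\<^esub> gs" using gs by simp
qed

end

section \<open>Exact sequences, cosets and dimension shifting\<close>

lemma (in module) submodule_of_submodule:
  assumes K: "submodule K R M" and L: "submodule L R M" "L \<subseteq> K"
  shows "submodule L R (M\<lparr>carrier := K\<rparr>)"
proof -
  interpret K: module R "M\<lparr>carrier := K\<rparr>" by (rule submodule.submodule_is_module[OF K module_axioms])
  show ?thesis
    by (rule K.submodule_criterion) (use L submoduleE[OF L(1)] submodule_zero_mem[OF L(1)] in auto)
qed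

lemma kernel_image_short_exact:
  assumes "module A M" "module A N" "f \<in> module_hom A M N"
  shows "short_exact A (M\<lparr>carrier := {x \<in> carrier M. f x = \<zero>\<^bsub>N\<^esub>}\<rparr>) M (N\<lparr>carrier := f ` carrier M\<rparr>) (\<lambda>x. x) f"
proof -
  interpret M: module A M by fact
  note sub = submodule.submodule_is_module[OF submodule_kernel[OF assms] assms(1)]
    submodule.submodule_is_module[OF submodule_image[OF assms M.carrier_is_submodule] assms(2)]
  have "(\<lambda>x. x) \<in> module_hom A (M\<lparr>carrier := {x \<in> carrier M. f x = \<zero>\<^bsub>N\<^esub>}\<rparr>) M"
    by (rule mhomI) simp_all
  moreover have "f \<in> module_hom A M (N\<lparr>carrier := f ` carrier M\<rparr>)"
    by (rule mhomI) (simp_all add: mhom_add[OF assms(3)] mhom_smult[OF assms(3)])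
  ultimately show ?thesis
    using sub assms(1) by (simp add: short_exact_def inj_on_def)
qed

lemma quotient_module_witness:
  assumes M: "module A M" and B: "submodule B A M" and K: "K \<subseteq> carrier M"
    and x: "x \<in> carrier (quotient_module (M\<lparr>carrier := K\<rparr>) B)" "x \<noteq> B"
      "\<And>a. a \<in> I \<Longrightarrow> a \<odot>\<^bsub>quotient_module (M\<lparr>carrier := K\<rparr>) B\<^esub> x = B" and I: "I \<subseteq> carrier A"
  shows "\<exists>z\<in>K. z \<notin> B \<and> (\<forall>a\<in>I. a \<odot>\<^bsub>M\<^esub> z \<in> B)"
proof -
  interpret M: module A M by (rule M)
  note E = M.submoduleE[OF B]
  have coset: "B +>\<^bsub>M\<lparr>carrier := K\<rparr>\<^esub> y = (\<lambda>b. b \<oplus>\<^bsub>M\<^esub> y) ` B" for y by (auto simp: a_r_coset_def')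
  have mem: "y \<in> B +>\<^bsub>M\<lparr>carrier := K\<rparr>\<^esub> y" if "y \<in> carrier M" for y
    unfolding coset by (rule image_eqI[of _ _ "\<zero>\<^bsub>M\<^esub>"]) (use that M.submodule_zero_mem[OF B] in simp_all)
  have "x \<in> a_rcosets\<^bsub>M\<lparr>carrier := K\<rparr>\<^esub> B" using x(1) by (simp add: quotient_module_def)
  then obtain z where z: "z \<in> K" "x = B +>\<^bsub>M\<lparr>carrier := K\<rparr>\<^esub> z"
    unfolding A_RCOSETS_def' by auto
  have zc: "z \<in> carrier M" using z(1) K by blast
  have "z \<notin> B"
  proof
    assume zB: "z \<in> B"
    have "B \<subseteq> (\<lambda>b. b \<oplus>\<^bsub>M\<^esub> z) ` B"
    proof
      fix b assume b: "b \<in> B"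
      then have "b \<ominus>\<^bsub>M\<^esub> z \<in> B" using M.submodule_minus_mem[OF B] zB by blast
      moreover have "b \<in> carrier M" using b E(1) by blast
      then have "b = (b \<ominus>\<^bsub>M\<^esub> z) \<oplus>\<^bsub>M\<^esub> z" using zc by (simp add: M.M.diff_add)
      ultimately show "b \<in> (\<lambda>b. b \<oplus>\<^bsub>M\<^esub> z) ` B" by (rule rev_image_eqI)
    qed
    moreover have "(\<lambda>b. b \<oplus>\<^bsub>M\<^esub> z) ` B \<subseteq> B" using E(5) zB by blast
    ultimately show False using x(2) unfolding z(2) coset by blast
  qed
  moreover have "a \<odot>\<^bsub>M\<^esub> z \<in> B" if a: "a \<in> I" for a
  proof -
    \<comment> \<open>The scalar multiple of the coset \<open>x\<close> is a union of cosets, one of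
      which contains the multiple of \<open>z\<close>; the whole union equals
      \<open>B\<close>.\<close>
    have "(\<Union>y\<in>x. B +>\<^bsub>M\<lparr>carrier := K\<rparr>\<^esub> (a \<odot>\<^bsub>M\<^esub> y)) = B"
      using x(3)[OF a] by (simp add: quotient_module_def)
    moreover have "z \<in> x" unfolding z(2) by (rule mem[OF zc])
    moreover have "a \<odot>\<^bsub>M\<^esub> z \<in> B +>\<^bsub>M\<lparr>carrier := K\<rparr>\<^esub> (a \<odot>\<^bsub>M\<^esub> z)"
      by (rule mem) (use a I zc in blast)
    ultimately show ?thesis by blast
  qed
  ultimately show ?thesis using z(1) by blast
qed

context matrix_complex
begin

text \<open>Each sequence reduces degree j of \<open>B q\<close> to degree j - 1 of
  \<open>B (Suc q)\<close>. The bound q + j \<le> s keeps the reduction within the given sequences,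
  and at q = s only degree 0 is left, which is \<open>last\<close>.\<close>

lemma acyclic_at_cosyzygy_left:
  assumes ses: "\<And>q. q < s \<Longrightarrow> short_exact A (B q) (C q) (B (Suc q)) (f q) (g q)"
    and C: "\<And>q j. \<lbrakk>q < s; j < n\<rbrakk> \<Longrightarrow> acyclic_at (C q) j" and last: "0 < n \<Longrightarrow> acyclic_at (B s) 0"
  shows "\<lbrakk>q + j \<le> s; j < n\<rbrakk> \<Longrightarrow> acyclic_at (B q) j"
proof (induct j arbitrary: q)
  case 0
  show ?case
  proof (cases "q < s")
    case True
    show ?thesis by (rule acyclic_at_left[OF ses[OF True] C[OF True 0(2)]]) simp
  next
    case False
    then show ?thesis using 0 last by simp
  qed
next
  case (Suc j)
  have q: "q < s" using Suc.prems by simp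
  show ?case
    by (rule acyclic_at_left[OF ses[OF q] C[OF q Suc.prems(2)]]) (use Suc in auto)
qed

text \<open>Each step passes from degree j + 1 of \<open>B q\<close> to degree j of
  \<open>B (Suc q)\<close>, which leaves the bound on q + j unchanged.\<close>

lemma acyclic_at_cosyzygy_right:
  assumes ses: "\<And>q. q < s \<Longrightarrow> short_exact A (B q) (C q) (B (Suc q)) (f q) (g q)"
    and C: "\<And>q j. \<lbrakk>q < s; j < s + n\<rbrakk> \<Longrightarrow> acyclic_at (C q) j" and B: "\<And>j. j \<le> s + n \<Longrightarrow> acyclic_at (B 0) j"
  shows "\<lbrakk>q \<le> s; q + j \<le> s + n\<rbrakk> \<Longrightarrow> acyclic_at (B q) j"
proof (induct q arbitrary: j)
  case (Suc q)
  show ?case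
    by (rule acyclic_at_right[OF ses C Suc.hyps]) (use Suc.prems in auto)
qed (use B in simp)

end

lemma (in ideal_resolution) acyclic_at_0_submodule:
  assumes M: "module A M" and L: "submodule L A M" and "acyclic_at M 0"
  shows "acyclic_at (M\<lparr>carrier := L\<rparr>) 0"
proof -
  have L': "L \<subseteq> carrier M" by (rule module.submoduleE(1)[OF M L])
  show ?thesis
    using assms(3) L' unfolding acyclic_at_0_iff[OF M] acyclic_at_0_iff[OF submodule.submodule_is_module[OF L M]]
    by auto
qed

section \<open>The invariants as the beginning of the cochain complex\<close>

context skew_module
begin

interpretation U: module R U by (rule U_module)
interpretation UA: module inv_ring U by (rule U_module_invariants)

abbreviation "MG \<equiv> invariant_module G R M"

lemma tuples_0 [simp]: "tuples G 0 = {[]}"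
  by (auto simp: tuples_def)

lemma evaluation_hom: "gs \<in> tuples G n \<Longrightarrow> (\<lambda>f. f gs) \<in> module_hom inv_ring (C n) U"
  by (rule mhomI) auto

text \<open>Evaluation at a tuple is linear over the invariants, so primitives can be chosen
  separately for each tuple.\<close>

lemma cochains_acyclic:
  assumes "matrix_complex inv_ring m D" and ac: "matrix_complex.acyclic_at m D U j"
  shows "matrix_complex.acyclic_at m D (C n) j"
proof -
  interpret F: matrix_complex inv_ring m D by (rule assms(1))
  show ?thesis
    unfolding F.acyclic_at_def
  proof (intro allI impI)
    fix v assume v: "F.cocycle (C n) j v"
    have vc: "v k \<in> carrier (C n)" if "k < m j" for k
      using v that unfolding F.cocycle_def by blast
    have cob: "F.coboundary U j (\<lambda>k. v k gs)" if gs: "gs \<in> tuples G n" for gs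
      using ac F.cocycle_hom[OF C_module U_module_invariants evaluation_hom[OF gs] v]
      by (simp add: F.acyclic_at_def)
    have ext: "f = f'" if "f \<in> carrier (C n)" "f' \<in> carrier (C n)" "\<And>gs. gs \<in> tuples G n \<Longrightarrow> f gs = f' gs" for f f'
      by (rule PiE_ext[of f "tuples G n" "\<lambda>_. carrier M"]) (use that in auto)
    show "F.coboundary (C n) j v"
    proof (cases j)
      case 0
      have "v k = \<zero>\<^bsub>C n\<^esub>" if k: "k < m 0" for k
        by (rule ext) (use cob vc k 0 in \<open>auto simp: F.coboundary_def\<close>)
      then show ?thesis by (simp add: F.coboundary_def 0)
    next
      case (Suc i)
      have "\<forall>gs\<in>tuples G n. \<exists>u. u \<in> {..<m i} \<rightarrow> carrier M \<and> (\<forall>k<m (Suc i). v k gs = F.diff U i u k)"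
        using cob unfolding Suc F.coboundary_def nat.case U_simps by blast
      from bchoice[OF this] obtain u where
        u: "\<And>gs. gs \<in> tuples G n \<Longrightarrow> u gs \<in> {..<m i} \<rightarrow> carrier M"
          "\<And>gs k. gs \<in> tuples G n \<Longrightarrow> k < m (Suc i) \<Longrightarrow> v k gs = F.diff U i (u gs) k" by blast
      define w where "w l = (\<lambda>gs\<in>tuples G n. u gs l)" for l
      have w: "w \<in> {..<m i} \<rightarrow> carrier (C n)"
        using funcset_mem[OF u(1)] by (auto simp: w_def)
      have "v k = F.diff (C n) i w k" if k: "k < m (Suc i)" for k
      proof (rule ext)
        show "v k \<in> carrier (C n)" using vc k Suc by simp
        show "F.diff (C n) i w k \<in> carrier (C n)" by (rule F.diff_closed[OF C_module w])
        fix gs assume gs: "gs \<in> tuples G n"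
        have "F.diff (C n) i w k gs = F.diff U i (\<lambda>l. w l gs) k"
          by (rule F.diff_hom[OF C_module U_module_invariants evaluation_hom[OF gs] w])
        also have "(\<lambda>l. w l gs) = u gs" using gs by (simp add: w_def)
        finally show "v k gs = F.diff (C n) i w k gs" using u(2)[OF gs k] by simp
      qed
      then show ?thesis unfolding Suc F.coboundary_def nat.case using w by blast
    qed
  qed
qed

lemma cochain_diff_0_iff:
  assumes f: "f \<in> carrier (C 0)"
  shows "d 0 f = \<zero>\<^bsub>C (Suc 0)\<^esub> \<longleftrightarrow> (\<forall>g\<in>carrier G. act g (f []) = f [])"
proof -
  have fc: "f [] \<in> carrier M" using f by auto
  have eq: "d 0 f [g] = act g (f []) \<ominus>\<^bsub>M\<^esub> f []" if "g \<in> carrier G" for g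
    using that fc by (simp add: cochain_diff_def tuples_def alternating_def M.M.minus_eq)
  show ?thesis
  proof
    assume *: "d 0 f = \<zero>\<^bsub>C (Suc 0)\<^esub>"
    have "act g (f []) \<ominus>\<^bsub>M\<^esub> f [] = \<zero>\<^bsub>M\<^esub>" if g: "g \<in> carrier G" for g
      using fun_cong[OF *, of "[g]"] eq[OF g] g by (simp add: tuples_def)
    then show "\<forall>g\<in>carrier G. act g (f []) = f []" using M.M.diff_eq_zero fc by simp
  next
    assume *: "\<forall>g\<in>carrier G. act g (f []) = f []"
    show "d 0 f = \<zero>\<^bsub>C (Suc 0)\<^esub>"
    proof (rule cochain_diff_ext)
      show "\<zero>\<^bsub>C (Suc 0)\<^esub> \<in> carrier (C (Suc 0))" by auto
      fix gs assume gs: "gs \<in> tuples G (Suc 0)"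
      then obtain g where "gs = [g]" "g \<in> carrier G" by (auto simp: tuples_def length_Suc_conv)
      then show "d 0 f gs = \<zero>\<^bsub>C (Suc 0)\<^esub> gs" using eq * fc gs by (simp add: M.M.diff_self)
    qed
  qed
qed

lemma constant_hom: "(\<lambda>x. \<lambda>gs\<in>tuples G 0. x) \<in> module_hom inv_ring U (C 0)"
  by (rule mhomI) (auto intro!: restrict_ext)

lemma MG_simps [simp]:
  "carrier MG = {x \<in> carrier M. \<forall>g\<in>carrier G. act g x = x}" "\<zero>\<^bsub>MG\<^esub> = \<zero>\<^bsub>M\<^esub>"
  "x \<oplus>\<^bsub>MG\<^esub> y = x \<oplus>\<^bsub>M\<^esub> y" "a \<odot>\<^bsub>MG\<^esub> x = a \<odot>\<^bsub>U\<^esub> x"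
  by (simp_all add: invariant_module_def underlying_module_def)

lemma invariants_submodule: "submodule {x \<in> carrier M. \<forall>g\<in>carrier G. act g x = x} inv_ring U"
proof -
  have "{x \<in> carrier U. d 0 (\<lambda>gs\<in>tuples G 0. x) = \<zero>\<^bsub>C (Suc 0)\<^esub>} = {x \<in> carrier M. \<forall>g\<in>carrier G. act g x = x}"
    using cochain_diff_0_iff[of "\<lambda>gs\<in>tuples G 0. _"] by auto
  then show ?thesis
    using submodule_kernel[OF U_module_invariants C_module mhom_compose[OF constant_hom cochain_diff_hom]] by simp
qed

lemma MG_module: "module inv_ring MG"
  unfolding invariant_module_def by (rule submodule.submodule_is_module[OF invariants_submodule U_module_invariants])

text \<open>The coboundaries of degree n + 1: the index refers to the source of the
  differential.\<close>

abbreviation "B n \<equiv> (C (Suc n))\<lparr>carrier := d n ` carrier (C n)\<rparr>"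

lemma MG_short_exact: "short_exact inv_ring MG (C 0) (B 0) (\<lambda>x. \<lambda>gs\<in>tuples G 0. x) (d 0)"
proof -
  have ses: "short_exact inv_ring ((C 0)\<lparr>carrier := {f \<in> carrier (C 0). d 0 f = \<zero>\<^bsub>C (Suc 0)\<^esub>}\<rparr>) (C 0) (B 0) (\<lambda>x. x) (d 0)"
    by (rule kernel_image_short_exact[OF C_module C_module cochain_diff_hom])
  have "(\<lambda>x. \<lambda>gs\<in>tuples G 0. x) \<in> module_hom inv_ring MG (C 0)"
    using constant_hom unfolding module_hom_def hom_def by auto
  moreover have "inj_on (\<lambda>x. \<lambda>gs\<in>tuples G 0. x) (carrier MG)"
    by (rule inj_onI) (metis restrict_apply' singletonI tuples_0)
  moreover have "d 0 f = \<zero>\<^bsub>B 0\<^esub> \<longleftrightarrow> f \<in> (\<lambda>x. \<lambda>gs\<in>tuples G 0. x) ` carrier MG" if f: "f \<in> carrier (C 0)" for f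
  proof
    assume "d 0 f = \<zero>\<^bsub>B 0\<^esub>"
    then have "\<forall>g\<in>carrier G. act g (f []) = f []" using cochain_diff_0_iff[OF f] by simp
    moreover have "f [] \<in> carrier M" using f by auto
    moreover have "f = (\<lambda>gs\<in>tuples G 0. f [])"
      by (rule PiE_ext[of f "tuples G 0" "\<lambda>_. carrier M"]) (use f in auto)
    ultimately show "f \<in> (\<lambda>x. \<lambda>gs\<in>tuples G 0. x) ` carrier MG" by (intro image_eqI[of _ _ "f []"]) simp_all
  next
    assume "f \<in> (\<lambda>x. \<lambda>gs\<in>tuples G 0. x) ` carrier MG"
    then obtain x where x: "f = (\<lambda>gs\<in>tuples G 0. x)" "x \<in> carrier MG" by (rule imageE)
    then have "\<forall>g\<in>carrier G. act g (f []) = f []" by simp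
    then show "d 0 f = \<zero>\<^bsub>B 0\<^esub>" using cochain_diff_0_iff[OF f] by simp
  qed
  ultimately show ?thesis using ses MG_module unfolding short_exact_def by blast
qed

lemma coboundaries_submodule: "submodule (coboundaries C d n) inv_ring (C n)"
proof (cases n)
  case 0
  interpret C0: module inv_ring "C 0" by (rule C_module)
  show ?thesis unfolding 0 coboundaries_def nat.case
    by (rule C0.submodule_criterion) (auto simp del: C_simps tuples_0)
next
  case (Suc k)
  show ?thesis unfolding Suc coboundaries_def nat.case
    by (rule submodule_image[OF C_module C_module cochain_diff_hom module.carrier_is_submodule[OF C_module]])
qed

lemma group_cohomology_trivialD:
  assumes "carrier (group_cohomology G R M n) = {\<zero>\<^bsub>group_cohomology G R M n\<^esub>}"
    "f \<in> carrier (C n)" "d n f = \<zero>\<^bsub>C (Suc n)\<^esub>"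
  shows "f \<in> coboundaries C d n"
  using cohomology_trivial_iff[of inv_ring C n d, OF C_module cochain_diff_hom C_module coboundaries_submodule] assms
  unfolding group_cohomology_def by blast

lemma group_cohomology_witness:
  assumes "x \<in> carrier (group_cohomology G R M n)" "x \<noteq> \<zero>\<^bsub>group_cohomology G R M n\<^esub>"
    "\<And>a. a \<in> I \<Longrightarrow> a \<odot>\<^bsub>group_cohomology G R M n\<^esub> x = \<zero>\<^bsub>group_cohomology G R M n\<^esub>"
    and "I \<subseteq> carrier inv_ring"
  shows "\<exists>z\<in>carrier (C n). d n z = \<zero>\<^bsub>C (Suc n)\<^esub> \<and> z \<notin> coboundaries C d n \<and>
    (\<forall>a\<in>I. a \<odot>\<^bsub>C n\<^esub> z \<in> coboundaries C d n)"
proof -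
  have zero: "\<zero>\<^bsub>quotient_module (C n\<lparr>carrier := K\<rparr>) (coboundaries C d n)\<^esub> = coboundaries C d n" for K
    by (simp add: quotient_module_def)
  show ?thesis
    using quotient_module_witness[OF C_module coboundaries_submodule, of "a_kernel (C n) (C (Suc n)) (d n)" n x I] assms
    unfolding group_cohomology_def cohomology_def zero a_kernel_eq by blast
qed

end

section \<open>Depth of the invariants\<close>

context skew_module
begin

interpretation U: module R U by (rule U_module)
interpretation UA: module inv_ring U by (rule U_module_invariants)

text \<open>
  If \<open>H\<^sup>q(G, M)\<close> vanishes for \<open>0 < q < r\<close>, then \<open>0 \<rightarrow> M\<^sup>G \<rightarrow> C\<^sup>0 \<rightarrow> \<dots> \<rightarrow> C\<^sup>r\<close> is exact up to
  \<open>C\<^sup>r\<^sup>-\<^sup>1\<close>, and depth is shifted along it.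
\<close>

context
  fixes m D I and r :: nat
  assumes res: "noetherian_ideal_resolution inv_ring m D I"
    and vanish: "\<And>q. \<lbrakk>0 < q; q < r\<rbrakk> \<Longrightarrow> carrier (group_cohomology G R M q) = {\<zero>\<^bsub>group_cohomology G R M q\<^esub>}"
begin

interpretation F: noetherian_ideal_resolution inv_ring m D I by (rule res)

lemma C_acyclic: "F.acyclic_at U j \<Longrightarrow> F.acyclic_at (C n) j"
  by (rule cochains_acyclic[OF F.matrix_complex_axioms])

lemma B_submodule: "submodule (d q ` carrier (C q)) inv_ring (C (Suc q))"
  using coboundaries_submodule[of "Suc q"] unfolding coboundaries_def nat.case .

text \<open>Vanishing of group cohomology in degree q + 1, which lies strictly between 0 and
  \<open>r\<close>, identifies the kernel of \<open>d (Suc q)\<close> with the image of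
  \<open>d q\<close>.\<close>

lemma B_short_exact:
  assumes q: "Suc q < r"
  shows "short_exact inv_ring (B q) (C (Suc q)) (B (Suc q)) (\<lambda>x. x) (d (Suc q))"
proof -
  have "{f \<in> carrier (C (Suc q)). d (Suc q) f = \<zero>\<^bsub>C (Suc (Suc q))\<^esub>} = d q ` carrier (C q)"
  proof
    show "d q ` carrier (C q) \<subseteq> {f \<in> carrier (C (Suc q)). d (Suc q) f = \<zero>\<^bsub>C (Suc (Suc q))\<^esub>}"
      using cochain_diff_closed cochain_diff_diff by blast
    show "{f \<in> carrier (C (Suc q)). d (Suc q) f = \<zero>\<^bsub>C (Suc (Suc q))\<^esub>} \<subseteq> d q ` carrier (C q)"
    proof
      fix f assume "f \<in> {f \<in> carrier (C (Suc q)). d (Suc q) f = \<zero>\<^bsub>C (Suc (Suc q))\<^esub>}"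
      then have "f \<in> coboundaries C d (Suc q)" using group_cohomology_trivialD[OF vanish[OF _ q]] by blast
      then show "f \<in> d q ` carrier (C q)" unfolding coboundaries_def nat.case .
    qed
  qed
  then show ?thesis using kernel_image_short_exact[OF C_module C_module cochain_diff_hom, of "Suc q"] by (simp only:)
qed

lemma invariants_acyclic:
  assumes "\<And>j. j < n \<Longrightarrow> F.acyclic_at U j" "n \<le> Suc r" "j < n"
  shows "F.acyclic_at MG j"
proof (rule F.acyclic_at_left[OF MG_short_exact C_acyclic[OF assms(1)[OF assms(3)]]])
  fix i assume i: "j = Suc i"
  show "F.acyclic_at (B 0) i"
  \<comment> \<open>The sequences exist for q + 1 < r, hence s = r - 1. As i + 1 = j < n \<le> r +
    1, degree i of \<open>B 0\<close> is within reach. The last term \<open>B (r - 1)\<close> has no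
    elements killed by I because it is a submodule of C^r.\<close>
  proof (rule F.acyclic_at_cosyzygy_left[where B = "\<lambda>q. B q" and C = "\<lambda>q. C (Suc q)" and s = "r - 1" and n = n and q = 0])
    show "short_exact inv_ring (B q) (C (Suc q)) (B (Suc q)) (\<lambda>x. x) (d (Suc q))" if "q < r - 1" for q
      using that by (intro B_short_exact) simp
    show "F.acyclic_at (C (Suc q)) j" if "j < n" for q j by (rule C_acyclic[OF assms(1)[OF that]])
    show "F.acyclic_at (B (r - 1)) 0" if "0 < n"
      by (rule F.acyclic_at_0_submodule[OF C_module B_submodule C_acyclic[OF assms(1)[OF that]]])
  qed (use assms i in auto)
qed

text \<open>This expresses Hom(A/I, H^r(G, M)) = 0. For r = s + 1, shifting from the invariants
  gives Ext^1(A/I, B s) = 0. The cocycles of degree r have no nonzero element killed by I, being a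
  submodule of C^r, and so neither has their quotient by \<open>B s\<close>. For r = 0 the
  coboundaries are zero and C^0 itself has no such element.\<close>

lemma invariants_not_acyclic:
  assumes U: "\<And>j. j \<le> r \<Longrightarrow> F.acyclic_at U j" and MG: "\<And>j. j \<le> Suc r \<Longrightarrow> F.acyclic_at MG j"
    and z: "z \<in> carrier (C r)" "d r z = \<zero>\<^bsub>C (Suc r)\<^esub>" "\<And>a. a \<in> I \<Longrightarrow> a \<odot>\<^bsub>C r\<^esub> z \<in> coboundaries C d r"
  shows "z \<in> coboundaries C d r"
proof (cases r)
  case 0
  have "F.acyclic_at (C 0) 0" by (rule C_acyclic) (use U in simp)
  moreover have "\<forall>a\<in>I. a \<odot>\<^bsub>C 0\<^esub> z = \<zero>\<^bsub>C 0\<^esub>" using z(3) unfolding 0 coboundaries_def nat.case by blast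
  ultimately have "z = \<zero>\<^bsub>C 0\<^esub>" using z(1) unfolding F.acyclic_at_0_iff[OF C_module] 0 by blast
  then show ?thesis unfolding 0 coboundaries_def nat.case by blast
next
  case (Suc s)
  have B0: "F.acyclic_at (B 0) j" if "j \<le> r" for j
    by (rule F.acyclic_at_right[OF MG_short_exact C_acyclic[OF U[OF that]]]) (use MG that in simp)
  have Bs: "F.acyclic_at (B s) (Suc 0)"
  \<comment> \<open>With n = 1, degree 1 of \<open>B s\<close> is reached from degree s + 1 = r of
    \<open>B 0\<close>, which in turn came from degree r + 1 of the invariants.\<close>
  proof (rule F.acyclic_at_cosyzygy_right[where B = "\<lambda>q. B q" and C = "\<lambda>q. C (Suc q)" and s = s and n = "Suc 0"])
    show "short_exact inv_ring (B q) (C (Suc q)) (B (Suc q)) (\<lambda>x. x) (d (Suc q))" if "q < s" for q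
      using that Suc by (intro B_short_exact) simp
    show "F.acyclic_at (C (Suc q)) j" if "j < s + Suc 0" for q j
      by (rule C_acyclic[OF U]) (use that Suc in simp)
    show "F.acyclic_at (B 0) j" if "j \<le> s + Suc 0" for j using B0 that Suc by simp
  qed simp_all
  define K where "K = {f \<in> carrier (C r). d r f = \<zero>\<^bsub>C (Suc r)\<^esub>}"
  have K: "submodule K inv_ring (C r)"
    unfolding K_def by (rule submodule_kernel[OF C_module C_module cochain_diff_hom])
  define L where "L = d s ` carrier (C s)"
  have L: "submodule L inv_ring (C r)" unfolding L_def Suc by (rule B_submodule)
  have LK: "L \<subseteq> K"
    unfolding L_def K_def Suc using cochain_diff_closed cochain_diff_diff by blast
  interpret Cr: module inv_ring "C r" by (rule C_module)
  interpret K: module inv_ring "(C r)\<lparr>carrier := K\<rparr>" by (rule submodule.submodule_is_module[OF K C_module])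
  \<comment> \<open>\<open>W\<close> is a copy of H^r(G, M) on the type of cochains.\<close>
  obtain W :: "('r, 'g list \<Rightarrow> 'm) module" and q where
    "short_exact inv_ring ((C r)\<lparr>carrier := K\<rparr>\<lparr>carrier := L\<rparr>) ((C r)\<lparr>carrier := K\<rparr>) W (\<lambda>x. x) q"
    by (rule K.submodule_short_exact[OF Cr.submodule_of_submodule[OF K L LK]])
  then have ses: "short_exact inv_ring (B s) ((C r)\<lparr>carrier := K\<rparr>) W (\<lambda>x. x) q"
    by (simp add: L_def Suc)
  have W: "module inv_ring W" and q: "q \<in> module_hom inv_ring ((C r)\<lparr>carrier := K\<rparr>) W"
    using ses by (simp_all add: short_exact_def)
  have ker: "q f = \<zero>\<^bsub>W\<^esub> \<longleftrightarrow> f \<in> L" if "f \<in> K" for f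
    using ses that by (simp add: short_exact_def L_def)
  have "F.acyclic_at ((C r)\<lparr>carrier := K\<rparr>) 0"
    by (rule F.acyclic_at_0_submodule[OF C_module K C_acyclic[OF U]]) simp
  from F.acyclic_at_right[OF ses this Bs] have W0: "F.acyclic_at W 0" .
  have zK: "z \<in> K" using z by (simp add: K_def del: C_simps)
  have cob: "coboundaries C d r = L" unfolding Suc coboundaries_def nat.case L_def ..
  have "a \<odot>\<^bsub>W\<^esub> q z = \<zero>\<^bsub>W\<^esub>" if a: "a \<in> I" for a
  proof -
    have "a \<in> carrier inv_ring" using a ideal_subset[OF F.ideal_I] by blast
    then have "a \<odot>\<^bsub>W\<^esub> q z = q (a \<odot>\<^bsub>C r\<^esub> z)" using mhom_smult[OF q, of a z] zK by simp
    moreover have "a \<odot>\<^bsub>C r\<^esub> z \<in> L" using z(3)[OF a] unfolding cob .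
    ultimately show ?thesis using ker LK by auto
  qed
  moreover have "q z \<in> carrier W" using mhom_closed[OF q, of z] zK by simp
  ultimately have "q z = \<zero>\<^bsub>W\<^esub>" using W0 unfolding F.acyclic_at_0_iff[OF W] by blast
  then show ?thesis using ker[OF zK] unfolding cob by blast
qed

end

lemma depth_invariants_le:
  assumes R: "noetherian_ring R" and A: "noetherian_ring inv_ring" and I: "ideal I inv_ring"
    and fg: "fin_gen inv_ring U" and cm: "cohen_macaulay R U"
    and rad: "annihilator inv_ring MG \<subseteq> radical inv_ring I"
  shows "depth inv_ring I MG \<le> depth inv_ring I U"
proof -
  have nR: "noetherian_cring R" and nA: "noetherian_cring inv_ring"
    using R A R.is_cring cring_inv_ring by (simp_all add: noetherian_cring_def)
  interpret R': noetherian_cring R by (rule nR)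
  interpret A: noetherian_cring inv_ring by (rule nA)
  have IA: "I \<subseteq> carrier inv_ring" by (rule ideal_subset[OF I])
  have IR: "I \<subseteq> carrier R" using IA by auto
  have J: "ideal (genideal R I) R" by (rule R.genideal_ideal[OF IR])
  have ann: "ideal (annihilator R U) R"
    using R'.annihilator_ideal[OF U_module, of "carrier U"] by (simp add: annihilator_def)
  have fgMG: "fin_gen inv_ring MG"
    unfolding invariant_module_def by (rule A.fin_gen_submodule(2)[OF U_module_invariants fg invariants_submodule])
  have "depth inv_ring I MG \<le> height R (genideal R I) U"
  proof (rule enat_le_of_nat_le)
    fix n assume n: "enat n \<le> depth inv_ring I MG"
    obtain m D where res: "noetherian_ideal_resolution inv_ring m D I" by (rule A.ideal_resolution_exists[OF I])
    interpret F: noetherian_ideal_resolution inv_ring m D I by (rule res)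
    have ac: "F.acyclic_at MG j" if "j < n" for j
      using n F.depth_ge_iff[OF MG_module cring.injective_resolution_exists[OF cring_inv_ring MG_module]] that by blast
    show "enat n \<le> height R (genideal R I) U"
      unfolding height_def
    \<comment> \<open>The height is an infimum over primes, so a chain is needed that ends at each
      prime \<open>P\<close> over the extended ideal and the annihilator. This is why the lifted
      chain has a prescribed top.\<close>
    proof (rule R.ideal_height_quotient_ge[OF ann J])
      fix P assume P: "primeideal P R" "genideal R I \<subseteq> P" "annihilator R U \<subseteq> P"
      define p where "p = P \<inter> carrier inv_ring"
      have "ring_hom_ring inv_ring R (\<lambda>x. x)"
        by (intro ring_hom_ringI cring.axioms(1)[OF cring_inv_ring] R.ring_axioms) auto
      then have "primeideal {a \<in> carrier inv_ring. a \<in> P} inv_ring"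
        by (rule ring_hom_ring.primeideal_vimage[OF _ cring_inv_ring P(1)])
      moreover have "{a \<in> carrier inv_ring. a \<in> P} = p" unfolding p_def by blast
      ultimately have p: "primeideal p inv_ring" by simp
      have Ip: "I \<subseteq> p" using R.genideal_self[OF IR] P(2) IA unfolding p_def by blast
      have annp: "annihilator inv_ring MG \<subseteq> p"
      proof
        fix a assume "a \<in> annihilator inv_ring MG"
        then obtain n :: nat where "a \<in> carrier inv_ring" "a [^]\<^bsub>inv_ring\<^esub> n \<in> I"
          using rad unfolding radical_def by blast
        then show "a \<in> p" using cring.primeideal_pow[OF cring_inv_ring p, of a n] Ip by blast
      qed
      obtain c where c: "prime_chain inv_ring n c" "c n = p" "annihilator inv_ring MG \<subseteq> c 0"
        using F.acyclic_prime_chain[OF MG_module fgMG ac p Ip annp] by blast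
      have "annihilator R U \<inter> carrier inv_ring \<subseteq> annihilator inv_ring MG"
        by (auto simp: annihilator_def)
      then have c0: "annihilator R U \<inter> carrier inv_ring \<subseteq> c 0" using c(3) by blast
      have cn: "P \<inter> carrier inv_ring = c n" using c(2) p_def by simp
      show "\<exists>q. prime_chain R n q \<and> annihilator R U \<subseteq> q 0 \<and> q n = P"
        by (rule prime_chain_lift_to[OF finite_group R ann c(1) c0 _ P(1) cn]) (rule annihilator_stable)
    qed
  qed
  also have "\<dots> = depth R (genideal R I) U" using cm J by (simp add: cohen_macaulay_def)
  also have "\<dots> \<le> depth inv_ring I U"
    using depth_subring[OF nR, of "{a \<in> carrier R. \<forall>g\<in>carrier G. \<phi> g a = a}" I U] nA I U_module fg
    unfolding invariant_ring_def by blast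
  finally show ?thesis .
qed

end

theorem proposition4p3:
  fixes G :: "('g, 'w) monoid_scheme"
    and R :: "('r, 'x) ring_scheme"
    and \<phi> :: "'g \<Rightarrow> 'r \<Rightarrow> 'r"
    and M :: "('g \<Rightarrow> 'r, 'm, 'z) module_scheme"
    and \<aa> :: "'r set"
    and r :: nat
  assumes "finite (carrier G)"
    and "ring_action G R \<phi>"
    and "noetherian_ring R"
    and "noetherian_ring (invariant_ring G R \<phi>)"
    and "ideal \<aa> (invariant_ring G R \<phi>)"
    and "left_module (skew_group_ring G R \<phi>) M"
    and "finitely_generated_module (invariant_ring G R \<phi>) (underlying_module G R M)"
    and "cohen_macaulay R (underlying_module G R M)"
    and "annihilator (invariant_ring G R \<phi>) (invariant_module G R M)
           \<subseteq> radical (invariant_ring G R \<phi>) \<aa>"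
    and "\<forall>q. 0 < q \<and> q < r \<longrightarrow>
           carrier (group_cohomology G R M q) = {\<zero>\<^bsub>group_cohomology G R M q\<^esub>}"
    and "\<exists>x\<in>carrier (group_cohomology G R M r).
           x \<noteq> \<zero>\<^bsub>group_cohomology G R M r\<^esub> \<and>
           (\<forall>a\<in>\<aa>. a \<odot>\<^bsub>group_cohomology G R M r\<^esub> x = \<zero>\<^bsub>group_cohomology G R M r\<^esub>)"
  shows "depth (invariant_ring G R \<phi>) \<aa> (invariant_module G R M)
       = min (enat (r + 1)) (depth (invariant_ring G R \<phi>) \<aa> (underlying_module G R M))"
proof -
  interpret skew_module G R \<phi> M
    using assms(1,2,6) by (intro skew_module.intro skew_module_axioms.intro)
  interpret A: noetherian_cring inv_ring
    using assms(4) cring_inv_ring by (simp add: noetherian_cring_def)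
  obtain m D where res: "noetherian_ideal_resolution inv_ring m D \<aa>" by (rule A.ideal_resolution_exists[OF assms(5)])
  interpret F: noetherian_ideal_resolution inv_ring m D \<aa> by (rule res)
  have vanish: "carrier (group_cohomology G R M q) = {\<zero>\<^bsub>group_cohomology G R M q\<^esub>}" if "0 < q" "q < r" for q
    using assms(10) that by blast
  have dU: "enat n \<le> depth inv_ring \<aa> U \<longleftrightarrow> (\<forall>j<n. F.acyclic_at U j)" for n
    by (rule F.depth_ge_iff[OF U_module_invariants cring.injective_resolution_exists[OF cring_inv_ring U_module_invariants]])
  have dMG: "enat n \<le> depth inv_ring \<aa> MG \<longleftrightarrow> (\<forall>j<n. F.acyclic_at MG j)" for n
    by (rule F.depth_ge_iff[OF MG_module cring.injective_resolution_exists[OF cring_inv_ring MG_module]])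
  obtain z where z: "z \<in> carrier (C r)" "d r z = \<zero>\<^bsub>C (Suc r)\<^esub>" "z \<notin> coboundaries C d r"
    "\<forall>a\<in>\<aa>. a \<odot>\<^bsub>C r\<^esub> z \<in> coboundaries C d r"
    using assms(11) group_cohomology_witness[OF _ _ _ ideal_subset[OF assms(5)]] by blast
  have le: "depth inv_ring \<aa> MG \<le> depth inv_ring \<aa> U"
    by (rule depth_invariants_le[OF assms(3-5) fin_gen_of_finitely_generated_module[OF U_module_invariants assms(7)] assms(8,9)])
  have "depth inv_ring \<aa> MG \<le> enat (r + 1)"
  proof (rule ccontr)
    assume "\<not> depth inv_ring \<aa> MG \<le> enat (r + 1)"
    \<comment> \<open>A depth of at least r + 2 means vanishing in the degrees up to r + 1, and
      \<open>le\<close> carries this bound over to M, as \<open>invariants_not_acyclic\<close>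
      requires.\<close>
    then have MG: "enat (r + 2) \<le> depth inv_ring \<aa> MG"
      using Suc_ile_eq[of "r + 1" "depth inv_ring \<aa> MG"] by simp
    then have "enat (r + 2) \<le> depth inv_ring \<aa> U" using le by (rule order_trans)
    then have "z \<in> coboundaries C d r"
      using MG z(4) unfolding dU dMG
      by (intro invariants_not_acyclic[OF res vanish _ _ z(1,2)]) auto
    then show False using z(3) by contradiction
  qed
  moreover have "min (enat (r + 1)) (depth inv_ring \<aa> U) \<le> depth inv_ring \<aa> MG"
  proof (rule enat_le_of_nat_le)
    fix n assume "enat n \<le> min (enat (r + 1)) (depth inv_ring \<aa> U)"
    then have "n \<le> Suc r" "\<forall>j<n. F.acyclic_at U j" using dU by simp_all
    then show "enat n \<le> depth inv_ring \<aa> MG"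
      unfolding dMG using invariants_acyclic[OF res vanish] by blast
  qed
  ultimately show ?thesis using le by (intro antisym) simp_all
qed

end
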